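(* The distributionally robust 2-stage Steiner tree problem admits a $(160+O(\varepsilon))$-approximation algorithm in the setting where every subset of $V$ is a scenario ($\mathcal{A}=2^V$), when the ball of distributions is defined by the Wasserstein metric with respect to either the discrete scenario metric or the asymmetric scenario metric $\kappa^{asym}_\infty$ (defined with respect to the metric $c$ on $V$).
   Context: DR 2-stage Steiner tree: a complete graph $G=(V,E)$ with metric edge costs $c_e$, a root $s\in V$, inflation factor $\lambda\ge1$. A scenario $A\subseteq V$ is a set of terminals to be connected to $s$. Edges may be bought in stage I at cost $c_e$ or in stage II at cost $\lambda c_e$; the stage-I edges $F$ and the edges $F^A$ bought in scenario $A$ must together connect all nodes of $A$ to $s$. Given a radius $r$ and a central distribution $p^*$ over scenarios (accessible only via independent samples), the goal is to minimize $\sum_{e\in F}c_e+\max_{q:\mathcal{L}_W(p^*,q)\le r}\mathbb{E}_{A\sim q}[\sum_{e\in F^A}\lambda c_e]$, where $\mathcal{L}_W$ is the Wasserstein (transportation) distance: the minimum of $\sum_{A,A'}\gamma_{A,A'}\kappa_{sc}(A,A')$ over nonnegative $\gamma$ with marginals $p^*$ and $q$. Discrete metric: $\kappa_{sc}(A,A')=1$ if $A\ne A'$, else $0$; $\kappa^{asym}_\infty(A,A')=\max_{j'\in A'}\min_{j\in A}c_{j'j}$. An $\alpha$-approximation algorithm here means: for every $\varepsilon>0$, an algorithm running in time polynomial in the input size and $\lambda/\varepsilon$ that with high probability returns stage-I edges and (implicitly) stage-II edges for every scenario whose objective value is at most $\alpha$ times the optimum. *)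

theory Defs
  imports "HOL-Probability.Probability" "HOL-Library.Log_Nat"
begin

section \<open>Distributionally robust two-stage Steiner tree\<close>

text \<open>
  The vertex set is \<open>{..<num_verts I}\<close>. An edge of the complete graph is the ordered pair
  \<open>(u, v)\<close> of its endpoints with \<open>u < v\<close>. All numbers of an instance are
  rational, since an instance is the input of an algorithm; the central distribution is not part
  of the instance.
\<close>

record steiner =
  num_verts :: nat
  dist_cost :: "nat \<Rightarrow> nat \<Rightarrow> rat"
  root_vert :: nat
  inflation :: rat
  radius :: rat

definition verts :: "steiner \<Rightarrow> nat set" where
  "verts I = {..<num_verts I}"

definition edges :: "steiner \<Rightarrow> (nat \<times> nat) set" where
  "edges I = {(u, v). u \<in> verts I \<and> v \<in> verts I \<and> u < v}"

definition valid_instance :: "steiner \<Rightarrow> bool" where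
  "valid_instance I \<longleftrightarrow>
     root_vert I \<in> verts I \<and> 1 \<le> inflation I \<and> 0 \<le> radius I \<and>
     (\<forall>u\<in>verts I. dist_cost I u u = 0) \<and>
     (\<forall>u\<in>verts I. \<forall>v\<in>verts I. 0 \<le> dist_cost I u v \<and> dist_cost I u v = dist_cost I v u) \<and>
     (\<forall>u\<in>verts I. \<forall>v\<in>verts I. \<forall>w\<in>verts I.
        dist_cost I u w \<le> dist_cost I u v + dist_cost I v w)"

definition edge_set_cost :: "steiner \<Rightarrow> (nat \<times> nat) set \<Rightarrow> real" where
  "edge_set_cost I F = (\<Sum>(u, v)\<in>F. real_of_rat (dist_cost I u v))"

definition connects_to_root :: "steiner \<Rightarrow> (nat \<times> nat) set \<Rightarrow> nat set \<Rightarrow> bool" where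
  "connects_to_root I F A \<longleftrightarrow> (\<forall>v\<in>A. (v, root_vert I) \<in> (F \<union> F\<inverse>)\<^sup>*)"

definition feasible :: "steiner \<Rightarrow> (nat \<times> nat) set \<Rightarrow> (nat set \<Rightarrow> (nat \<times> nat) set) \<Rightarrow> bool" where
  "feasible I F FA \<longleftrightarrow>
     F \<subseteq> edges I \<and>
     (\<forall>A\<in>Pow (verts I). FA A \<subseteq> edges I \<and> connects_to_root I (F \<union> FA A) A)"

type_synonym scenario_metric = "steiner \<Rightarrow> nat set \<Rightarrow> nat set \<Rightarrow> ennreal"

definition discrete_metric :: scenario_metric where
  "discrete_metric I A A' = (if A = A' then 0 else 1)"

text \<open>
  In \<^typ>\<open>ennreal\<close> the supremum over the empty set is \<open>0\<close> and the infimum over the empty set is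
  \<open>\<infinity>\<close>: nothing has to be paid to reach the empty scenario, and a nonempty
  scenario is infinitely far from the empty one.
\<close>

definition asym_metric :: scenario_metric where
  "asym_metric I A A' = (SUP j'\<in>A'. INF j\<in>A. ennreal (real_of_rat (dist_cost I j' j)))"

definition wasserstein :: "('a \<Rightarrow> 'a \<Rightarrow> ennreal) \<Rightarrow> 'a pmf \<Rightarrow> 'a pmf \<Rightarrow> ennreal" where
  "wasserstein \<kappa> p q =
     (INF \<gamma>\<in>{\<gamma>. map_pmf fst \<gamma> = p \<and> map_pmf snd \<gamma> = q}.
        \<integral>\<^sup>+ (A, A'). \<kappa> A A' \<partial>measure_pmf \<gamma>)"

definition distribution_ball :: "scenario_metric \<Rightarrow> steiner \<Rightarrow> nat set pmf \<Rightarrow> nat set pmf set" where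
  "distribution_ball \<kappa> I p =
     {q. set_pmf q \<subseteq> Pow (verts I) \<and> wasserstein (\<kappa> I) p q \<le> ennreal (real_of_rat (radius I))}"

definition objective ::
  "scenario_metric \<Rightarrow> steiner \<Rightarrow> nat set pmf \<Rightarrow> (nat \<times> nat) set \<Rightarrow>
     (nat set \<Rightarrow> (nat \<times> nat) set) \<Rightarrow> real" where
  "objective \<kappa> I p F FA =
     edge_set_cost I F +
     (SUP q\<in>distribution_ball \<kappa> I p.
        measure_pmf.expectation q (\<lambda>A. real_of_rat (inflation I) * edge_set_cost I (FA A)))"

definition optimum :: "scenario_metric \<Rightarrow> steiner \<Rightarrow> nat set pmf \<Rightarrow> real" where
  "optimum \<kappa> I p = (INF (F, FA)\<in>{(F, FA). feasible I F FA}. objective \<kappa> I p F FA)"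


section \<open>Randomized programs with a sampling oracle\<close>

text \<open>
  While-programs over integer arrays, with logarithmic cost: evaluating an expression costs the
  total bit length of the values of all its subexpressions, array indices included. A program has
  access to fair coin flips and to independent samples (integer lists) of an unknown distribution.
\<close>

datatype aexp =
    Const int
  | Get nat aexp
  | Add aexp aexp
  | Sub aexp aexp
  | Mul aexp aexp
  | Div aexp aexp

datatype com =
    Assign nat aexp aexp  \<comment> \<open>array, index, value\<close>
  | Seq com com
  | Cond aexp com com
  | While aexp com
  | Flip nat
  | Sample nat

type_synonym state = "nat \<Rightarrow> nat \<Rightarrow> int"

definition bit_size :: "int \<Rightarrow> nat" where
  "bit_size z = 1 + floorlog 2 (nat \<bar>z\<bar>)"

definition list_size :: "int list \<Rightarrow> nat" where
  "list_size xs = 1 + (\<Sum>x\<leftarrow>xs. bit_size x)"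

fun aval :: "aexp \<Rightarrow> state \<Rightarrow> int" where
  "aval (Const z) s = z"
| "aval (Get x a) s = s x (nat (aval a s))"
| "aval (Add a b) s = aval a s + aval b s"
| "aval (Sub a b) s = aval a s - aval b s"
| "aval (Mul a b) s = aval a s * aval b s"
| "aval (Div a b) s = aval a s div aval b s"

fun acost :: "aexp \<Rightarrow> state \<Rightarrow> nat" where
  "acost (Const z) s = bit_size z"
| "acost (Get x a) s = acost a s + bit_size (aval (Get x a) s)"
| "acost (Add a b) s = acost a s + acost b s + bit_size (aval (Add a b) s)"
| "acost (Sub a b) s = acost a s + acost b s + bit_size (aval (Sub a b) s)"
| "acost (Mul a b) s = acost a s + acost b s + bit_size (aval (Mul a b) s)"
| "acost (Div a b) s = acost a s + acost b s + bit_size (aval (Div a b) s)"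

text \<open>A list is stored in an array with its length in cell \<open>0\<close>, followed by its elements.\<close>

definition array_of :: "int list \<Rightarrow> nat \<Rightarrow> int" where
  "array_of xs i =
     (if i = 0 then int (length xs) else if i \<le> length xs then xs ! (i - 1) else 0)"

definition list_of :: "(nat \<Rightarrow> int) \<Rightarrow> int list" where
  "list_of f = map (\<lambda>i. f (Suc i)) [0..<nat (f 0)]"

text \<open>A configuration: the commands still to be executed, the state, and the time spent so far.\<close>

type_synonym config = "com list \<times> state \<times> nat"

fun step :: "int list pmf \<Rightarrow> config \<Rightarrow> config pmf" where
  "step D ([], s, t) = return_pmf ([], s, t)"
| "step D (Assign x a b # cs, s, t) =
     return_pmf (cs, s(x := (s x)(nat (aval a s) := aval b s)), t + 1 + acost a s + acost b s)"
| "step D (Seq c1 c2 # cs, s, t) = return_pmf (c1 # c2 # cs, s, t + 1)"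
| "step D (Cond a c1 c2 # cs, s, t) =
     return_pmf ((if aval a s > 0 then c1 else c2) # cs, s, t + 1 + acost a s)"
| "step D (While a c # cs, s, t) =
     return_pmf (if aval a s > 0 then c # While a c # cs else cs, s, t + 1 + acost a s)"
| "step D (Flip x # cs, s, t) =
     map_pmf (\<lambda>b. (cs, s(x := (s x)(0 := of_bool b)), t + 1)) (bernoulli_pmf (1 / 2))"
| "step D (Sample x # cs, s, t) =
     map_pmf (\<lambda>xs. (cs, s(x := array_of xs), t + 1 + list_size xs)) D"

fun deterministic :: "com \<Rightarrow> bool" where
  "deterministic (Assign x a b) \<longleftrightarrow> True"
| "deterministic (Seq c1 c2) \<longleftrightarrow> deterministic c1 \<and> deterministic c2"
| "deterministic (Cond a c1 c2) \<longleftrightarrow> deterministic c1 \<and> deterministic c2"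
| "deterministic (While a c) \<longleftrightarrow> deterministic c"
| "deterministic (Flip x) \<longleftrightarrow> False"
| "deterministic (Sample x) \<longleftrightarrow> False"

text \<open>The input lists are stored in the arrays \<open>0, 1, \<dots>\<close>; all other cells are \<open>0\<close>.\<close>

definition initial_state :: "int list list \<Rightarrow> state" where
  "initial_state xss x = (if x < length xss then array_of (xss ! x) else (\<lambda>_. 0))"

text \<open>The distribution of the configuration after \<open>n\<close> steps.\<close>

primrec run :: "int list pmf \<Rightarrow> com \<Rightarrow> int list list \<Rightarrow> nat \<Rightarrow> config pmf" where
  "run D P xss 0 = return_pmf ([P], initial_state xss, 0)"
| "run D P xss (Suc n) = bind_pmf (run D P xss n) (step D)"

text \<open>The output consists of the two lists stored in the arrays \<open>0\<close> and \<open>1\<close>.\<close>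

definition output_of :: "config \<Rightarrow> int list \<times> int list" where
  "output_of = (\<lambda>(cs, s, t). (list_of (s 0), list_of (s 1)))"

text \<open>
  Every execution ends within time \<open>T\<close>, the time to write the output included. Every step takes
  at least one unit of time, so that \<open>T\<close> steps suffice.
\<close>

definition runs_in_time :: "int list pmf \<Rightarrow> com \<Rightarrow> int list list \<Rightarrow> nat \<Rightarrow> bool" where
  "runs_in_time D P xss T \<longleftrightarrow>
     (\<forall>(cs, s, t)\<in>set_pmf (run D P xss T).
        cs = [] \<and> t + list_size (list_of (s 0)) + list_size (list_of (s 1)) \<le> T)"

definition output_pmf ::
  "int list pmf \<Rightarrow> com \<Rightarrow> int list list \<Rightarrow> nat \<Rightarrow> (int list \<times> int list) pmf" where
  "output_pmf D P xss T = map_pmf output_of (run D P xss T)"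


section \<open>Approximation algorithms\<close>

definition encode_rat :: "rat \<Rightarrow> int list" where
  "encode_rat q = [fst (quotient_of q), snd (quotient_of q)]"

definition encode_input :: "steiner \<Rightarrow> rat \<Rightarrow> int list" where
  "encode_input I \<epsilon> =
     [int (num_verts I), int (root_vert I)] @
     encode_rat (inflation I) @ encode_rat (radius I) @ encode_rat \<epsilon> @
     concat (map (\<lambda>u. concat (map (\<lambda>v. encode_rat (dist_cost I u v)) [0..<num_verts I]))
               [0..<num_verts I])"

definition encode_scenario :: "steiner \<Rightarrow> nat set \<Rightarrow> int list" where
  "encode_scenario I A = map (\<lambda>v. of_bool (v \<in> A)) [0..<num_verts I]"

fun decode_edges :: "int list \<Rightarrow> (nat \<times> nat) set" where
  "decode_edges (u # v # xs) = insert (nat u, nat v) (decode_edges xs)"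
| "decode_edges xs = {}"

definition input_size :: "steiner \<Rightarrow> rat \<Rightarrow> nat" where
  "input_size I \<epsilon> = list_size (encode_input I \<epsilon>)"

text \<open>
  The time bound \<open>K (N + \<lceil>\<lambda>/\<epsilon>\<rceil>)\<^sup>d\<close>, where \<open>N\<close> is the input size. Since \<open>N \<ge> 1\<close>, the bounds of
  this form majorize all polynomials in \<open>N\<close> and \<open>\<lambda>/\<epsilon>\<close>.
\<close>

definition time_bound :: "nat \<Rightarrow> nat \<Rightarrow> steiner \<Rightarrow> rat \<Rightarrow> nat" where
  "time_bound K d I \<epsilon> = K * (input_size I \<epsilon> + nat \<lceil>inflation I / \<epsilon>\<rceil>) ^ d"

text \<open>
  An algorithm consists of two programs. The program \<open>P\<close>, which can sample from the central
  distribution, outputs the stage-I edges (as list \<open>fs\<close>) and auxiliary data \<open>ws\<close>. The program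
  \<open>Q\<close> makes the implicit stage-II edges explicit: it computes them deterministically from the
  input, the output of \<open>P\<close> and the scenario, without further samples.
\<close>

definition stage2_input :: "steiner \<Rightarrow> rat \<Rightarrow> int list \<times> int list \<Rightarrow> nat set \<Rightarrow> int list list" where
  "stage2_input I \<epsilon> = (\<lambda>(fs, ws) A. [encode_input I \<epsilon>, fs, ws, encode_scenario I A])"

definition good_output ::
  "scenario_metric \<Rightarrow> real \<Rightarrow> com \<Rightarrow> nat \<Rightarrow> steiner \<Rightarrow> rat \<Rightarrow> nat set pmf \<Rightarrow>
     int list \<times> int list \<Rightarrow> bool" where
  "good_output \<kappa> \<alpha> Q T I \<epsilon> p out \<longleftrightarrow>
     (\<exists>FA.
        (\<forall>A\<in>Pow (verts I).
           \<forall>out2\<in>set_pmf (output_pmf (return_pmf []) Q (stage2_input I \<epsilon> out A) T).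
             FA A = decode_edges (fst out2)) \<and>
        feasible I (decode_edges (fst out)) FA \<and>
        objective \<kappa> I p (decode_edges (fst out)) FA \<le> \<alpha> * optimum \<kappa> I p)"

text \<open>
  A \<open>\<rho>(\<epsilon>)\<close>-approximation algorithm. The accuracy \<open>\<epsilon>\<close> is given to the programs as part of the
  input. With high probability means: with probability at least \<open>1 - 1/N\<^sup>k\<close>, where \<open>N\<close> is the
  input size and the exponent \<open>k\<close> can be prescribed arbitrarily. The programs know the central
  distribution \<open>p\<close> only through the samples.
\<close>

definition admits_approximation :: "scenario_metric \<Rightarrow> (real \<Rightarrow> real) \<Rightarrow> bool" where
  "admits_approximation \<kappa> \<rho> \<longleftrightarrow>
     (\<forall>k::nat. \<exists>P Q K d. deterministic Q \<and>
        (\<forall>I \<epsilon> p. valid_instance I \<and> 0 < \<epsilon> \<and> set_pmf p \<subseteq> Pow (verts I) \<longrightarrow>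
           (let D = map_pmf (encode_scenario I) p;
                T = time_bound K d I \<epsilon>;
                R = output_pmf D P [encode_input I \<epsilon>] T
            in runs_in_time D P [encode_input I \<epsilon>] T \<and>
               (\<forall>out\<in>set_pmf R. \<forall>A\<in>Pow (verts I).
                  runs_in_time (return_pmf []) Q (stage2_input I \<epsilon> out A) T) \<and>
               measure_pmf.prob R {out. good_output \<kappa> (\<rho> (real_of_rat \<epsilon>)) Q T I \<epsilon> p out}
                 \<ge> 1 - 1 / real (input_size I \<epsilon>) ^ k)))"

end

theory Submission
 imports Defs
begin

text \<open>
  Costs are scaled to integers and \<open>\<lambda>\<close> is replaced by \<open>\<lambda>' = max 1 (\<lambda> / max 1 \<epsilon>)\<close>, which changes the objective
  by a factor of at most \<open>max 1 \<epsilon>\<close>. From about \<open>m \<lambda>'\<close> samples, the radius \<open>R v\<close> of a vertex is the least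
  distance within which \<open>m\<close> sampled scenarios have a terminal, capped by the distance to the root. Pairwise far
  centres are chosen greedily by increasing radius, so that every vertex is within \<open>4 R v\<close> of a centre;
  the first stage buys a tree on the centres, the second stage a greedy tree from the purchased vertices to the scenario.
  A moat-packing argument bounds the cost of a greedy tree by that of any connecting edge set, counting
  only edges near the terminals, and each first-stage edge of the optimum is near a scenario with probability
  about \<open>1 / \<lambda>'\<close>.

  For the discrete metric a tree on all vertices is bought when \<open>r \<lambda>' \<ge> 1\<close>. For the asymmetric metric, transport duality
  gives \<open>y\<close> and \<open>H\<close> such that the optimum pays at most \<open>H A + y \<rho>\<close> on the \<open>\<rho>\<close>-ball of \<open>A\<close>. For
  each guess \<open>Z\<close> of the optimum the algorithm scans the samples, looks for the radius at which the cost of the ball exceeds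
  \<open>4 (Z / r) \<rho>\<close> the most, and buys the vertices that lie in \<open>m\<close> of these balls, enlarged by \<open>3/2\<close>. The first guess that keeps
  the purchases cheap is used; Chernoff bounds and a union bound over all vertex sets bound the remaining excess.
\<close>

text \<open>The time may depend on the inflation only through its quotient by \<open>eps\<close>.
  For \<open>eps > 1\<close> this forbids \<open>inflation\<close> many samples, hence the smaller
  factor \<lambda>', whose loss of \<open>max 1 eps <= 1 + eps\<close> is the only source of the
  \<open>eps\<close> term. Among \<open>m\<close> \<lambda>' samples the count \<open>m\<close>
  marks probability 1/\<lambda>', the point where serving a place in the first stage costs as much
  as in the second. The bought set depends on the very samples that measure its excess; the estimate
  is therefore made uniform over all \<open>2 ^ n\<close> vertex sets, and \<open>m\<close> is at
  least a large multiple of the input size so that the failure probability survives this union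
  bound. The dual multiplier \<open>y\<close> is unknown to the algorithm, but the radius times
  \<open>y\<close> is at most the optimum, so a guess of the optimum divided by the radius replaces
  it. Integer costs make finitely many guesses enough: if the optimum is below the smallest positive
  guess, an optimal solution buys only edges of cost 0 in the first stage, and the guess 0
  works.\<close>

abbreviation "expect p == measure_pmf.expectation p"
abbreviation "ri == real_of_int"
abbreviation "rq == (real_of_rat :: rat => real)"

section \<open>Greedy trees in a pseudometric and the moat-packing bound\<close>

locale pmet =
 fixes d :: "'a => 'a => real"
 assumes d_self [simp]: "d x x = 0" and d_sym: "d x y = d y x"
  and d_tri: "d x z <= d x y + d y z"
begin

lemma d_nonneg [simp]: "0 <= d x y" using d_tri[of x x y] d_sym[of x y] by simp

definition sd :: "'a => 'a set => real" where
 "sd x S = Min (d x ` S)"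

lemma sd_le: "finite S ==> y : S ==> sd x S <= d x y" unfolding sd_def by (intro Min_le) auto

lemma sd_attained:
 assumes "finite S" "S ~= {}"
 obtains y where "y : S" "sd x S = d x y" using Min_in[of "d x ` S"] assms unfolding sd_def by blast

lemma sd_nonneg: "finite S ==> S ~= {} ==> 0 <= sd x S" by (metis sd_attained d_nonneg)

lemma sd_gr_iff: "finite S ==> S ~= {} ==> t < sd x S \<longleftrightarrow> (ALL y:S. t < d x y)" unfolding sd_def by (subst Min_gr_iff) auto

lemma sd_le_iff: "finite S ==> S ~= {} ==> sd x S <= t \<longleftrightarrow> (EX y:S. d x y <= t)" unfolding sd_def by (subst Min_le_iff) auto

lemma sd_tri:
 assumes "finite S" "S ~= {}"
 shows "sd x S <= d x y + sd y S"
proof -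
 obtain z where z: "z : S" "sd y S = d y z" using sd_attained[OF assms] by metis
 show ?thesis using sd_le[OF assms(1) z(1), of x] d_tri[of x z y] z(2) by simp
qed

definition tcost :: "('a \<times> 'a) list => real" where
 "tcost es = (SUM (u, v)<-es. d u v)"

definition ecost :: "('a \<times> 'a) set => real" where
 "ecost E = (SUM (u, v):E. d u v)"

lemma ecost_nonneg [simp]: "0 <= ecost E" unfolding ecost_def by (intro sum_nonneg) auto

lemma tcost_nonneg [simp]: "0 <= tcost es" unfolding tcost_def by (intro sum_list_nonneg) auto

lemma ecost_mono: "finite E' ==> E <= E' ==> ecost E <= ecost E'" unfolding ecost_def by (intro sum_mono2) auto

lemma ecost_Un_le: "finite E ==> finite E' ==> ecost (E Un E') <= ecost E + ecost E'"
 unfolding ecost_def by (subst sum.union_inter [symmetric]) (auto intro: sum_nonneg)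

lemma ecost_insert_le: "finite E ==> ecost (insert (u, v) E) <= d u v + ecost E"
 unfolding ecost_def by (cases "(u, v) : E") (auto simp: insert_absorb)

lemma ecost_set_le: "ecost (set es) <= tcost es"
proof (induction es)
 case (Cons e es)
 thus ?case using ecost_insert_le[of "set es" "fst e" "snd e"] by (auto simp: tcost_def split: prod.splits)
qed (simp add: ecost_def tcost_def)

text \<open>Runs of Prim's algorithm for the tree on \<open>S Un T\<close> with \<open>S\<close>
  contracted. Being a relation, it leaves the tie breaking open, so that only the minimality of each
  edge can be used.\<close>

fun greedy :: "'a set => 'a set => ('a \<times> 'a) list => bool" where
 "greedy S T [] = (T <= S)"
| "greedy S T ((u, v) # es) \<longleftrightarrow>
   u : S & v : T - S & (ALL a:S. ALL b:T - S. d u v <= d a b) & greedy (insert v S) T es"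

text \<open>As in any minimum spanning tree, the edges longer than \<open>tht\<close> count the
  components of the threshold graph (distances at most \<open>tht\<close>) that avoid
  \<open>S\<close>. Induction from the last edge backwards: a long edge into \<open>v\<close> shows
  that all of \<open>T - S\<close> is far from \<open>S\<close>, so what the later blocks leave over
  is one more block, and it contains \<open>v\<close>.\<close>

lemma greedy_blocks:
 assumes "greedy S T es" "0 <= tht"
 shows "EX \<K>. finite \<K> & card \<K> = length (filter (%(u, v). tht < d u v) es) &
  pairwise disjnt \<K> &
  (ALL K:\<K>. K ~= {} & K <= T - S & (ALL x:K. ALL y:(S Un T) - K. tht < d x y))" using assms
proof (induction S T es rule: greedy.induct)
 case (1 S T)
 thus ?case by (intro exI[of _ "{}"]) auto
next
 case (2 S T u v es)
 then obtain \<K> where K: "finite \<K>" "card \<K> = length (filter (%(u, v). tht < d u v) es)"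
   "pairwise disjnt \<K>"
   "!!K. K : \<K> ==> K ~= {} & K <= T - insert v S &
     (ALL x:K. ALL y:(insert v S Un T) - K. tht < d x y)" by auto
 have v: "v : T" "v ~: S" and ST: "insert v S Un T = S Un T" using "2.prems" by auto
 show ?case
 proof (cases "tht < d u v")
  case False
  thus ?thesis using K v ST by (intro exI[of _ \<K>]) (auto simp: ST)
 next
  case True
  define N where "N = (T - S) - \<Union>\<K>"
  have vN: "v : N" using K(4) v unfolding N_def by auto
  have sepN: "tht < d x y" if xy: "x : N" "y : (S Un T) - N" for x y
  proof (cases "y : S")
   case True
   have "d u v <= d y x" using "2.prems"(1) that True by (auto simp: N_def)
   thus ?thesis using \<open>tht < d u v\<close> d_sym[of x y] by simp
  next
   case False
   then obtain K where KK: "K : \<K>" "y : K" using xy unfolding N_def by blast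
   have "x : (insert v S Un T) - K" using that KK unfolding N_def by auto
   thus ?thesis using K(4)[OF KK(1)] KK(2) d_sym[of x y] by auto
  qed
  have notin: "N ~: \<K>" using vN K(4) v by blast
  show ?thesis
  proof (intro exI[of _ "insert N \<K>"] conjI ballI)
   show "card (insert N \<K>) = length (filter (%(u, v). tht < d u v) ((u, v) # es))" using notin K True by simp
   show "pairwise disjnt (insert N \<K>)" using K(3) by (auto simp: pairwise_insert disjnt_def N_def)
   fix L assume L: "L : insert N \<K>"
   show "L ~= {}" using L K(4) vN by auto
   show "L <= T - S" using L K(4) by (auto simp: N_def)
   fix x y assume xy: "x : L" "y : S Un T - L"
   show "tht < d x y" using L xy K(4) sepN ST by blast
  qed (use K in auto)
 qed
qed

definition nbh :: "'a set => real => 'a set" where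
 "nbh K t = {x. EX v:K. d x v <= t}"

definition crosses :: "('a \<times> 'a) set => 'a set => bool" where
 "crosses E U = ((EX (a, b):E. (a : U) ~= (b : U)))"

lemma crosses_if_connected:
 assumes "(x, y) : (E Un E^-1)\<^sup>*" "x : U" "y ~: U"
 shows "crosses E U" using assms
proof (induction rule: rtrancl_induct)
 case (step y z)
 thus ?case unfolding crosses_def by (cases "y : U") auto
qed auto

text \<open>An upper bound for the number of moats of radius \<open>t\<close> around blocks of
  \<open>C\<close> that the edge \<open>a b\<close> can cross: none until the nearer endpoint is
  reached, one until the other is, two until moats from both sides could meet on the edge. The
  integral over \<open>t\<close> is exactly \<open>d a b\<close>.\<close>

definition load :: "'a set => 'a => 'a => real => real" where
 "load C a b t =
   indicator {min (sd a C) (sd b C)..<max (sd a C) (sd b C)} t +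
   2 * indicator {max (sd a C) (sd b C)..<(sd a C + sd b C + d a b) / 2} t"

text \<open>Blocks are more than \<open>2 * t\<close> apart, so an endpoint at distance at most
  \<open>t\<close> from \<open>C\<close> lies only in the moat of the block that contains its
  nearest point of \<open>C\<close>; any other endpoint lies in no moat.\<close>

lemma card_crossed_le_load:
 assumes C: "finite C" "C ~= {}"
  and K: "finite \<K>" "pairwise disjnt \<K>"
   "!!K. K : \<K> ==> K <= C & (ALL x:K. ALL y:C - K. 2 * t < d x y)"
 shows "real (card {K : \<K>. (a : nbh K t) ~= (b : nbh K t)}) <= load C a b t"
proof -
 obtain va where va: "va : C" "sd a C = d a va" using sd_attained[OF C] by metis
 obtain vb where vb: "vb : C" "sd b C = d b vb" using sd_attained[OF C] by metis
 have near: "x : nbh K t \<longleftrightarrow> v : K & sd x C <= t"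
  if "K : \<K>" "v : C" "sd x C = d x v" for K x v
 proof
  assume "x : nbh K t"
  then obtain w where w: "w : K" "d x w <= t" unfolding nbh_def by auto
  have le: "sd x C <= t" using sd_le[OF C(1), of w x] w K(3)[OF that(1)] by auto
  have "d w v <= 2 * t" using d_tri[of w v x] d_sym[of w x] le w that(3) by simp
  hence "v : K" using K(3)[OF that(1)] w(1) that(2) by force
  thus "v : K & sd x C <= t" using le by simp
 qed (use that in "auto simp: nbh_def")
 have na: "a : nbh K t \<longleftrightarrow> va : K & sd a C <= t" if "K : \<K>" for K using near[OF that va] .
 have nb: "b : nbh K t \<longleftrightarrow> vb : K & sd b C <= t" if "K : \<K>" for K using near[OF that vb] .
 define Q where "Q = {K : \<K>. (a : nbh K t) ~= (b : nbh K t)}"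
 have one: "card {K : \<K>. v : K} <= 1" for v using K(1,2) by (auto simp: card_le_Suc0_iff_eq pairwise_def disjnt_def)
 have load_nonneg: "0 <= load C a b t" unfolding load_def by simp
 have "real (card Q) <= load C a b t"
 proof (cases "sd a C <= t"; cases "sd b C <= t")
  assume c: "~ sd a C <= t" "~ sd b C <= t"
  hence "Q = {}" unfolding Q_def using na nb by auto
  thus ?thesis using load_nonneg by simp
 next
  assume c: "sd a C <= t" "~ sd b C <= t"
  hence "card Q <= card {K : \<K>. va : K}" unfolding Q_def using na nb K(1) by (intro card_mono) auto
  moreover have "load C a b t \<ge> 1" unfolding load_def using c by (auto simp: indicator_def)
  ultimately show ?thesis using one[of va] by linarith
 next
  assume c: "~ sd a C <= t" "sd b C <= t"
  hence "card Q <= card {K : \<K>. vb : K}" unfolding Q_def using na nb K(1) by (intro card_mono) auto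
  moreover have "load C a b t \<ge> 1" unfolding load_def using c by (auto simp: indicator_def)
  ultimately show ?thesis using one[of vb] by linarith
 next
  assume c: "sd a C <= t" "sd b C <= t"
  show ?thesis
  proof (cases "2 * t < sd a C + sd b C + d a b")
   case True
   have "Q <= {K : \<K>. va : K} Un {K : \<K>. vb : K}" unfolding Q_def using na nb by auto
   hence "card Q <= card {K : \<K>. va : K} + card {K : \<K>. vb : K}" using K(1) card_mono[of "{K : \<K>. va : K} Un {K : \<K>. vb : K}" Q]
     card_Un_le[of "{K : \<K>. va : K}" "{K : \<K>. vb : K}"] by force
   moreover have "load C a b t \<ge> 2" unfolding load_def using c True by (auto simp: indicator_def)
   ultimately show ?thesis using one[of va] one[of vb] by linarith
  next
   case False
   \<comment> \<open>Past the meeting point both nearest points belong to the same block, so no moat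
     separates the endpoints.\<close>
   have "d va vb <= 2 * t" using False va vb d_tri[of va vb a] d_tri[of a vb b] d_sym[of a va] by linarith
   hence "va : K \<longleftrightarrow> vb : K" if "K : \<K>" for K using K(3)[OF that] va vb d_sym[of va vb] by force
   hence "Q = {}" unfolding Q_def using na nb c by auto
   thus ?thesis using load_nonneg by simp
  qed
 qed
 thus ?thesis unfolding Q_def .
qed

lemma has_integral_load:
 assumes "finite C" "C ~= {}"
 shows "has_bochner_integral lborel (load C a b) (d a b)"
proof -
 have tri: "sd a C <= d a b + sd b C" "sd b C <= d a b + sd a C" using sd_tri[OF assms, of a b] sd_tri[OF assms, of b a] d_sym[of a b] by simp_all
 have *: "has_bochner_integral lborel (indicator {l..<u} :: real => real) (u - l)"
  if "l <= u" for l u using has_bochner_integral_real_indicator[of "{l..<u}" lborel] that by (simp add: measure_def emeasure_lborel_Ico)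
 have "has_bochner_integral lborel (load C a b)
   ((max (sd a C) (sd b C) - min (sd a C) (sd b C)) +
   2 * ((sd a C + sd b C + d a b) / 2 - max (sd a C) (sd b C)))" unfolding load_def using tri
  by (intro has_bochner_integral_add has_bochner_integral_mult_right *) (auto simp: max_def)
 moreover have "(max (sd a C) (sd b C) - min (sd a C) (sd b C)) +
   2 * ((sd a C + sd b C + d a b) / 2 - max (sd a C) (sd b C)) = d a b" by (simp add: max_def min_def field_simps)
 ultimately show ?thesis by simp
qed

text \<open>Weak duality at one radius: if the edge sets \<open>E i\<close> with weights
  \<open>x i\<close> cross every moat with total weight at least 1, the weighted load is at least
  the number of moats.\<close>

lemma card_blocks_le_load:
 assumes C: "finite C" "C ~= {}"
  and K: "finite \<K>" "pairwise disjnt \<K>"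
   "!!K. K : \<K> ==> K <= C & (ALL x:K. ALL y:C - K. 2 * t < d x y)"
  and I: "finite I" "!!i. i : I ==> 0 <= x i & finite (E i)"
  and cov: "!!K. K : \<K> ==> 1 <= (SUM i:I. x i * of_bool (crosses (E i) (nbh K t)))"
 shows "real (card \<K>) <= (SUM i:I. x i * (SUM (a, b):E i. load C a b t))"
proof -
 have "real (card \<K>) <= (SUM K:\<K>. SUM i:I. x i * of_bool (crosses (E i) (nbh K t)))" using sum_mono[of \<K> "%_. 1", OF cov] by simp
 also have "... = (SUM i:I. x i * (SUM K:\<K>. of_bool (crosses (E i) (nbh K t))))" by (subst sum.swap) (simp add: sum_distrib_left)
 also have "... <= (SUM i:I. x i * (SUM (a, b):E i. load C a b t))"
 proof (intro sum_mono mult_left_mono)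
  fix i assume i: "i : I"
  have "(SUM K:\<K>. of_bool (crosses (E i) (nbh K t)) :: real) <=
    (SUM K:\<K>. SUM (a, b):E i. of_bool ((a : nbh K t) ~= (b : nbh K t)))"
  proof (intro sum_mono)
   fix K
   show "(of_bool (crosses (E i) (nbh K t)) :: real) <=
     (SUM (a, b):E i. of_bool ((a : nbh K t) ~= (b : nbh K t)))"
   proof (cases "crosses (E i) (nbh K t)")
    case True
    then obtain a b where ab: "(a, b) : E i" "(a : nbh K t) ~= (b : nbh K t)" unfolding crosses_def by auto
    have "(of_bool (crosses (E i) (nbh K t)) :: real) <=
      (%(a, b). of_bool ((a : nbh K t) ~= (b : nbh K t))) (a, b)" using ab by simp
    also have "... <= (SUM (a, b):E i. of_bool ((a : nbh K t) ~= (b : nbh K t)))" using ab I(2)[OF i] by (intro member_le_sum) auto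
    finally show ?thesis .
   qed (auto intro: sum_nonneg)
  qed
  also have "... = (SUM (a, b):E i. SUM K:\<K>. of_bool ((a : nbh K t) ~= (b : nbh K t)))" by (subst sum.swap) (simp add: case_prod_beta)
  also have "... = (SUM (a, b):E i. real (card {K : \<K>. (a : nbh K t) ~= (b : nbh K t)}))"
   using K(1) by (intro sum.cong refl) (auto simp: sum_of_bool_eq Int_def)
  also have "... <= (SUM (a, b):E i. load C a b t)" using card_crossed_le_load[OF C K] by (intro sum_mono) (auto split: prod.splits)
  finally show "(SUM K:\<K>. of_bool (crosses (E i) (nbh K t)) :: real) <=
    (SUM (a, b):E i. load C a b t)" .
 qed (use I in auto)
 finally show ?thesis .
qed

text \<open>Integration over the radius turns loads into edge lengths. The interval from
  \<open>l j\<close> to \<open>u j\<close> holds the radii at which the packed object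
  \<open>j\<close> counts. Only \<open>0 <= t\<close> has to be supplied, because both sides vanish
  for negative radii.\<close>

lemma integrate_load:
 assumes C: "finite C" "C ~= {}"
  and J: "finite J" "!!j. j : J ==> 0 <= l j & l j <= u j"
  and I: "finite I"
  and le: "!!t. 0 <= t ==> (SUM j:J. indicator {l j..<u j} t) <=
    (SUM i:I. x i * (SUM (a, b):E i. load C a b t))"
 shows "(SUM j:J. u j - l j) <= (SUM i:I. x i * ecost (E i))"
proof -
 have L: "has_bochner_integral lborel (%t. SUM j:J. indicator {l j..<u j} t :: real) (SUM j:J. u j - l j)"
 proof (intro has_bochner_integral_sum)
  fix j assume "j : J"
  thus "has_bochner_integral lborel (indicator {l j..<u j} :: real => real) (u j - l j)"
   using J(2) has_bochner_integral_real_indicator[of "{l j..<u j}" lborel] by (simp add: measure_def emeasure_lborel_Ico)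
 qed
 have R: "has_bochner_integral lborel (%t. SUM i:I. x i * (SUM (a, b):E i. load C a b t))
   (SUM i:I. x i * ecost (E i))" unfolding ecost_def case_prod_beta
  by (intro has_bochner_integral_sum has_bochner_integral_mult_right has_integral_load C)
 have ld: "load C a b t = 0" if "t < 0" for a b t using that sd_nonneg[OF C, of a] sd_nonneg[OF C, of b] unfolding load_def
  by (auto simp: indicator_def)
 have "integral\<^sup>L lborel (%t. SUM j:J. indicator {l j..<u j} t :: real) <=
   integral\<^sup>L lborel (%t. SUM i:I. x i * (SUM (a, b):E i. load C a b t))"
 proof (rule integral_mono)
  fix t :: real
  show "(SUM j:J. indicator {l j..<u j} t) <= (SUM i:I. x i * (SUM (a, b):E i. load C a b t))"
  proof (cases "0 <= t")
   case False
   hence "(SUM j:J. indicator {l j..<u j} t :: real) = 0" using J(2) by (intro sum.neutral) (force simp: indicator_def)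
   thus ?thesis using False by (simp add: ld case_prod_beta)
  qed (use le in auto)
 qed (use L R in "auto simp: has_bochner_integral_iff")
 thus ?thesis using L R by (simp add: has_bochner_integral_iff)
qed

text \<open>Layer-cake form: an edge is counted for all \<open>t\<close> below its length divided by
  \<open>k\<close>, so integration over \<open>t\<close> gives \<open>tcost es / k\<close>.\<close>

lemma length_filter_eq_sum_indicator:
 assumes "0 < k" "0 <= t"
 shows "real (length (filter (%(u, v). k * t < d u v) es)) =
  (SUM j<length es. indicator {0..<d (fst (es ! j)) (snd (es ! j)) / k} t)"
proof -
 have "real (length (filter (%(u, v). k * t < d u v) es)) =
   (SUM j<length es. of_bool (k * t < d (fst (es ! j)) (snd (es ! j))))"
  by (subst length_filter_conv_card) (auto simp: sum_of_bool_eq case_prod_beta Int_def conj_commute)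
 also have "... = (SUM j<length es. indicator {0..<d (fst (es ! j)) (snd (es ! j)) / k} t)"
  using assms by (intro sum.cong refl) (auto simp: indicator_def field_simps)
 finally show ?thesis .
qed

lemma tcost_eq_sum: "tcost es = (SUM j<length es. d (fst (es ! j)) (snd (es ! j)))"
 unfolding tcost_def case_prod_beta by (simp add: sum_list_sum_nth atLeast0LessThan)

lemma greedy_Nil_if_subset: "greedy S T es ==> T <= S ==> es = []" by (cases "(S, T, es)" rule: greedy.cases) auto

text \<open>Blocks are taken at scale \<open>k * t\<close> and moats with radius \<open>t\<close>.
  With \<open>2 <= k\<close> the moats are disjoint; a larger \<open>k\<close> keeps every moat
  within the fraction \<open>1 / k\<close> of the distance to \<open>S\<close>, at the price of the
  factor \<open>k\<close>. Accordingly only moats around blocks far from \<open>S\<close> have to be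
  covered.\<close>

lemma greedy_weighted_le:
 assumes g: "greedy S T es" and S: "finite S" "S ~= {}" and T: "finite T" and k: "2 <= k"
  and I: "finite I" "!!i. i : I ==> 0 <= x i & finite (E i)"
  and cov: "!!K t. 0 <= t ==> K ~= {} ==> K <= T - S ==> (!!v. v : K ==> k * t < sd v S) ==>
   1 <= (SUM i:I. x i * of_bool (crosses (E i) (nbh K t)))"
 shows "tcost es <= k * (SUM i:I. x i * ecost (E i))"
proof (cases "T <= S")
 case True
 hence "es = []" using g greedy_Nil_if_subset by auto
 thus ?thesis using I k by (auto simp: tcost_def intro!: mult_nonneg_nonneg sum_nonneg)
next
 case False
 have C: "finite (T - S)" "T - S ~= {}" using T False by auto
 have "(SUM j<length es. d (fst (es ! j)) (snd (es ! j)) / k - 0) <= (SUM i:I. x i * ecost (E i))"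
 proof (rule integrate_load[OF C _ _ I(1)])
  fix t :: real assume t: "0 <= t"
  obtain \<K> where K: "finite \<K>" "card \<K> = length (filter (%(u, v). k * t < d u v) es)"
    "pairwise disjnt \<K>"
    "!!K. K : \<K> ==> K ~= {} & K <= T - S & (ALL x:K. ALL y:(S Un T) - K. k * t < d x y)" using greedy_blocks[OF g, of "k * t"] t k by auto
  have kt: "2 * t <= k * t" using k t by (simp add: mult_right_mono)
  have "real (card \<K>) <= (SUM i:I. x i * (SUM (a, b):E i. load (T - S) a b t))"
  proof (rule card_blocks_le_load[OF C K(1,3) _ I])
   fix K assume "K : \<K>"
   note K4 = K(4)[OF this]
   show "K <= T - S & (ALL x:K. ALL y:T - S - K. 2 * t < d x y)" using K4 kt by force
   have "k * t < sd v S" if "v : K" for v using K4 that S by (subst sd_gr_iff) auto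
   thus "1 <= (SUM i:I. x i * of_bool (crosses (E i) (nbh K t)))" using K4 t by (intro cov) auto
  qed
  thus "(SUM j<length es. indicator {0..<d (fst (es ! j)) (snd (es ! j)) / k} t) <=
    (SUM i:I. x i * (SUM (a, b):E i. load (T - S) a b t))" using length_filter_eq_sum_indicator[of k t es] K(2) t k by simp
 qed (use k in auto)
 thus ?thesis using k by (simp add: tcost_eq_sum sum_divide_distrib [symmetric] field_simps)
qed

text \<open>A moat of radius \<open>t\<close> crosses an edge only if one endpoint is within
  \<open>t\<close> of a terminal whose distance to \<open>S\<close> exceeds \<open>k * t\<close>.
  This locality is what later allows first-stage edges to be charged only in few scenarios.\<close>

lemma greedy_connected_le:
 assumes g: "greedy S T es" and S: "finite S" "s : S" and T: "finite T" and k: "2 <= k"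
  and E: "finite E" "!!v. v : T ==> (v, s) : (E Un E^-1)\<^sup>*"
 shows "tcost es <=
  k * ecost {(a, b) : E. EX v:T - S. k * d v a < sd v S \<or> k * d v b < sd v S}"
  (is "_ <= k * ecost ?E")
proof -
 have fin: "finite ?E" using E(1) by (rule rev_finite_subset) auto
 have "tcost es <= k * (SUM i:{0::nat}. 1 * ecost ?E)"
 proof (rule greedy_weighted_le[OF g S(1) _ T k])
  fix K t assume K: "0 <= t" "K ~= {}" "K <= T - S" "!!v. v : K ==> k * t < sd v S"
  have sub: "k * d v a < sd v S" if "v : K" "d a v <= t" for v a using K(4)[OF that(1)] that(2) k d_sym[of a v] by (smt (verit) mult_left_mono)
  obtain v where v: "v : K" using K(2) by auto
  have "s ~: nbh K t"
  proof
   assume "s : nbh K t"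
   then obtain w where w: "w : K" "d s w <= t" unfolding nbh_def by auto
   have "k * d w s < d w s" using sub[OF w] sd_le[OF S, of w] by linarith
   thus False using k d_nonneg[of w s] mult_right_mono[of 1 k "d w s"] by linarith
  qed
  moreover have "v : nbh K t" using v K(1) unfolding nbh_def by (auto intro!: bexI[of _ v])
  ultimately have "crosses E (nbh K t)" using crosses_if_connected[OF E(2)] v K(3) by auto
  hence "crosses ?E (nbh K t)" unfolding crosses_def nbh_def using K(3) sub by fastforce
  thus "1 <= (SUM i:{0::nat}. 1 * of_bool (crosses ?E (nbh K t)) :: real)" by simp
 qed (use fin S in auto)
 thus ?thesis by simp
qed

text \<open>
 A ball of radius \<open>ro c\<close> around a centre is only crossed once it contains the demand that is
 responsible for the centre; the growth before that is charged to the growth from \<open>ro c\<close> to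
 \<open>2 ro c\<close>, during which the balls of different centres are still disjoint.
\<close>

lemma greedy_centres_le:
 assumes g: "greedy {s} D es" and D: "finite D" "s ~: D"
  and far: "!!c c'. c : D ==> c' : insert s D ==> c ~= c' ==> 4 * ro c < d c c'"
  and rho: "!!c. c : D ==> 0 <= ro c"
  and I: "finite I" "!!i. i : I ==> 0 <= x i & finite (E i)"
  and cov: "!!U c. c : D ==> s ~: U ==> (!!a. d a c <= ro c ==> a : U) ==>
   1 <= (SUM i:I. x i * of_bool (crosses (E i) U))"
 shows "tcost es <= 4 * (SUM i:I. x i * ecost (E i))"
proof (cases "D = {}")
 case True
 hence "es = []" using g greedy_Nil_if_subset by auto
 thus ?thesis using I by (auto simp: tcost_def intro!: mult_nonneg_nonneg sum_nonneg)
next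
 case False
 let ?X = "SUM i:I. x i * ecost (E i)"
 have C: "finite D" "D ~= {}" using D False by auto
 have one: "(SUM c:D. 2 * ro c - ro c) <= ?X"
 proof (rule integrate_load[OF C _ _ I(1)])
  fix t :: real assume t: "0 <= t"
  define B where "B = {c : D. ro c <= t & t < 2 * ro c}"
  have inj: "inj_on (%c. {c}) B" by (auto simp: inj_on_def)
  have "real (card ((%c. {c}) ` B)) <= (SUM i:I. x i * (SUM (a, b):E i. load D a b t))"
  proof (rule card_blocks_le_load[OF C _ _ _ I])
   fix K assume "K : (%c. {c}) ` B"
   then obtain c where c: "K = {c}" "c : D" "ro c <= t" "t < 2 * ro c" unfolding B_def by auto
   show "K <= D & (ALL x:K. ALL y:D - K. 2 * t < d x y)" using c far[of c] by force
   have "s ~: nbh K t" using c far[of c s] D(2) d_sym[of c s] unfolding nbh_def by force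
   thus "1 <= (SUM i:I. x i * of_bool (crosses (E i) (nbh K t)))" using c by (intro cov[of c]) (auto simp: nbh_def)
  qed (use C in "auto simp: B_def pairwise_def disjnt_def")
  hence "real (card B) <= (SUM i:I. x i * (SUM (a, b):E i. load D a b t))" using card_image[OF inj] by simp
  moreover have "(SUM c:D. indicator {ro c..<2 * ro c} t) = real (card B)" using C unfolding B_def by (simp add: indicator_def sum.If_cases Int_def)
  ultimately show "(SUM c:D. indicator {ro c..<2 * ro c} t) <=
    (SUM i:I. x i * (SUM (a, b):E i. load D a b t))" by simp
 qed (use C rho in auto)
 have DS: "D - {s} = D" using D by auto
 have pt: "real (length (filter (%(u, v). 2 * t < d u v) es)) <=
   (SUM i:I. x i * (SUM (a, b):E i. load D a b t)) + (SUM c:D. indicator {0..<ro c} t)"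
  if t: "0 <= t" for t
 proof -
  obtain \<K> where K: "finite \<K>" "card \<K> = length (filter (%(u, v). 2 * t < d u v) es)"
    "pairwise disjnt \<K>"
    "!!K. K : \<K> ==> K ~= {} & K <= D - {s} & (ALL x:K. ALL y:({s} Un D) - K. 2 * t < d x y)" using greedy_blocks[OF g, of "2 * t"] t by auto
  \<comment> \<open>A block with a centre of radius at most \<open>t\<close> has a moat that must be
    crossed. Every other block contains a centre with \<open>t < ro c\<close>, so there are at most
    as many of them as such centres.\<close>
  define A where "A = {K : \<K>. EX c:K. ro c <= t}"
  have "real (card A) <= (SUM i:I. x i * (SUM (a, b):E i. load D a b t))"
  proof (rule card_blocks_le_load[OF C _ _ _ I])
   fix K assume K': "K : A"
   then obtain c where c: "c : K" "ro c <= t" "K : \<K>" unfolding A_def by auto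
   note K4 = K(4)[OF c(3)]
   show "K <= D & (ALL x:K. ALL y:D - K. 2 * t < d x y)" using K4 DS by auto
   have "s ~: nbh K t"
   proof
    assume "s : nbh K t"
    then obtain v where v: "v : K" "d s v <= t" unfolding nbh_def by auto
    have "2 * t < d v s" using K4 v by auto
    thus False using v t d_sym[of s v] by linarith
   qed
   thus "1 <= (SUM i:I. x i * of_bool (crosses (E i) (nbh K t)))" using c K4 by (intro cov[of c]) (auto simp: nbh_def intro!: bexI[of _ c])
  next
   show "pairwise disjnt A" using K(3) unfolding A_def pairwise_def by auto
  qed (use K(1) in "auto simp: A_def")
  moreover have "card (\<K> - A) <= card {c : D. t < ro c}"
  proof -
   define pk where "pk K = (SOME c. c : K)" for K :: "'a set"
   have pk: "pk K : K" if "K : \<K>" for K unfolding pk_def using K(4)[OF that] by (simp add: some_in_eq)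
   have "inj_on pk (\<K> - A)" using K(3) pk unfolding inj_on_def pairwise_def disjnt_def by (metis DiffD1 disjoint_iff)
   moreover have "pk ` (\<K> - A) <= {c : D. t < ro c}" using pk K(4) unfolding A_def by force
   ultimately show ?thesis using C by (intro card_inj_on_le) auto
  qed
  moreover have "(SUM c:D. indicator {0..<ro c} t) = real (card {c : D. t < ro c})" using C t by (simp add: indicator_def sum.If_cases Int_def)
  moreover have "card \<K> = card A + card (\<K> - A)"
   using K(1) by (subst card_Un_disjoint [symmetric]) (auto simp: A_def intro!: arg_cong[of _ _ card])
  ultimately show ?thesis using K(2) by linarith
 qed
 \<comment> \<open>The integrand is a difference, which \<open>integrate_load\<close> does not
   cover, so the integration is carried out directly.\<close>
 have two: "(SUM j<length es. d (fst (es ! j)) (snd (es ! j)) / 2) - (SUM c:D. ro c) <= ?X"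
 proof -
  have L: "has_bochner_integral lborel
    (%t. (SUM j<length es. indicator {0..<d (fst (es ! j)) (snd (es ! j)) / 2} t) -
       (SUM c:D. indicator {0..<ro c} t) :: real)
    ((SUM j<length es. d (fst (es ! j)) (snd (es ! j)) / 2) - (SUM c:D. ro c))"
  proof (intro has_bochner_integral_diff has_bochner_integral_sum)
   fix c assume "c : D"
   thus "has_bochner_integral lborel (indicator {0..<ro c} :: real => real) (ro c)"
    using rho has_bochner_integral_real_indicator[of "{0..<ro c}" lborel] by (simp add: measure_def emeasure_lborel_Ico)
  next
   fix j
   show "has_bochner_integral lborel (indicator {0..<d (fst (es ! j)) (snd (es ! j)) / 2} :: real => real)
     (d (fst (es ! j)) (snd (es ! j)) / 2)" using has_bochner_integral_real_indicator[of "{0..<d (fst (es ! j)) (snd (es ! j)) / 2}" lborel]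
    by (simp add: measure_def emeasure_lborel_Ico)
  qed
  have R: "has_bochner_integral lborel (%t. SUM i:I. x i * (SUM (a, b):E i. load D a b t)) ?X" unfolding ecost_def case_prod_beta
   by (intro has_bochner_integral_sum has_bochner_integral_mult_right has_integral_load C)
  have "integral\<^sup>L lborel (%t. (SUM j<length es. indicator {0..<d (fst (es ! j)) (snd (es ! j)) / 2} t) -
       (SUM c:D. indicator {0..<ro c} t) :: real) <=
     integral\<^sup>L lborel (%t. SUM i:I. x i * (SUM (a, b):E i. load D a b t))"
  proof (rule integral_mono)
   fix t :: real
   show "(SUM j<length es. indicator {0..<d (fst (es ! j)) (snd (es ! j)) / 2} t) -
       (SUM c:D. indicator {0..<ro c} t) <= (SUM i:I. x i * (SUM (a, b):E i. load D a b t))"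
   proof (cases "0 <= t")
    case True
    thus ?thesis using pt length_filter_eq_sum_indicator[of 2 t es] by force
   next
    case False
    thus ?thesis using I by (auto simp: load_def indicator_def intro!: sum_nonneg mult_nonneg_nonneg)
   qed
  qed (use L R in "auto simp: has_bochner_integral_iff")
  thus ?thesis using L R by (simp add: has_bochner_integral_iff)
 qed
 \<comment> \<open>\<open>two\<close> bounds half the tree cost by \<open>?X\<close> plus the sum of
   the radii, and \<open>one\<close> bounds that sum by \<open>?X\<close>: hence the factor
   4.\<close>
 show ?thesis using one two unfolding tcost_eq_sum by (simp add: sum_divide_distrib [symmetric])
qed

end

section \<open>Monotonicity and connectivity of greedy trees\<close>

context pmet
begin

text \<open>By the layer-cake formula the cost is the integral over \<open>t\<close> of the number
  of edges longer than \<open>t\<close>.\<close>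

lemma tcost_le_if_counts:
 assumes "!!t. 0 <= t ==> length (filter (%(u, v). t < d u v) es') <= length (filter (%(u, v). t < d u v) es)"
 shows "tcost es' <= tcost es"
proof -
 have L: "has_bochner_integral lborel
   (%t. SUM j<length es. indicator {0..<d (fst (es ! j)) (snd (es ! j))} t :: real) (tcost es)" for es unfolding tcost_eq_sum
 proof (intro has_bochner_integral_sum)
  fix j
  show "has_bochner_integral lborel (indicator {0..<d (fst (es ! j)) (snd (es ! j))} :: real => real)
    (d (fst (es ! j)) (snd (es ! j)))" using has_bochner_integral_real_indicator[of "{0..<d (fst (es ! j)) (snd (es ! j))}" lborel]
   by (simp add: measure_def emeasure_lborel_Ico)
 qed
 have "integral\<^sup>L lborel (%t. SUM j<length es'. indicator {0..<d (fst (es' ! j)) (snd (es' ! j))} t :: real) <=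
    integral\<^sup>L lborel (%t. SUM j<length es. indicator {0..<d (fst (es ! j)) (snd (es ! j))} t :: real)"
 proof (rule integral_mono)
  fix t :: real
  show "(SUM j<length es'. indicator {0..<d (fst (es' ! j)) (snd (es' ! j))} t :: real) <=
    (SUM j<length es. indicator {0..<d (fst (es ! j)) (snd (es ! j))} t :: real)"
  proof (cases "0 <= t")
   case True
   thus ?thesis using assms[of t] length_filter_eq_sum_indicator[of 1 t es]
     length_filter_eq_sum_indicator[of 1 t es'] by simp
  qed (auto simp: indicator_def)
 qed (use L in "auto simp: has_bochner_integral_iff")
 thus ?thesis using L[of es] L[of es'] by (simp add: has_bochner_integral_iff)
qed

text \<open>Converse of \<open>greedy_blocks\<close>: the edge that first enters a block starts
  outside of it and is therefore longer than \<open>tht\<close>, and different blocks are entered by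
  different edges.\<close>

lemma card_blocks_le_count:
 assumes "greedy S T es" "finite \<K>" "pairwise disjnt \<K>"
  "!!K. K : \<K> ==> K ~= {} & K <= T - S & (ALL x:K. ALL y:(S Un T) - K. tht < d x y)"
 shows "card \<K> <= length (filter (%(u, v). tht < d u v) es)" using assms
proof (induction S T es arbitrary: \<K> rule: greedy.induct)
 case (1 S T)
 hence "\<K> = {}" by fastforce
 thus ?case by simp
next
 case (2 S T u v es)
 have uv: "u : S" "v : T" "v ~: S" and g: "greedy (insert v S) T es" using "2.prems"(1) by auto
 have ST: "insert v S Un T = S Un T" using uv by auto
 show ?case
 proof (cases "EX K:\<K>. v : K")
  case True
  then obtain K0 where K0: "K0 : \<K>" "v : K0" by auto
  have "u : (S Un T) - K0" using uv "2.prems"(4)[OF K0(1)] by auto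
  hence uv': "tht < d u v" using "2.prems"(4)[OF K0(1)] K0(2) d_sym[of u v] by auto
  have "card (\<K> - {K0}) <= length (filter (%(u, v). tht < d u v) es)"
  proof (rule "2.IH"[OF g])
   show "pairwise disjnt (\<K> - {K0})" using "2.prems"(3) by (auto simp: pairwise_def)
   fix K assume K: "K : \<K> - {K0}"
   hence "v ~: K" using "2.prems"(3) K0 by (auto simp: pairwise_def disjnt_def)
   thus "K ~= {} & K <= T - insert v S & (ALL x:K. ALL y:(insert v S Un T) - K. tht < d x y)" using "2.prems"(4)[of K] K ST by auto
  qed (use "2.prems" in auto)
  thus ?thesis using uv' K0 "2.prems"(2) by (simp add: card_Diff_singleton)
 next
  case False
  have "card \<K> <= length (filter (%(u, v). tht < d u v) es)"
  proof (rule "2.IH"[OF g "2.prems"(2,3)])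
   fix K assume "K : \<K>"
   thus "K ~= {} & K <= T - insert v S & (ALL x:K. ALL y:(insert v S Un T) - K. tht < d x y)" using "2.prems"(4)[of K] False ST by auto
  qed
  thus ?thesis by simp
 qed
qed

text \<open>A block separated from \<open>S' Un T\<close> is also separated from
  \<open>S Un T\<close>, so at every scale the run from \<open>S\<close> has at least as many long
  edges.\<close>

lemma greedy_cost_antimono:
 assumes g: "greedy S T es" "greedy S' T es'" and sub: "S <= S'"
 shows "tcost es' <= tcost es"
proof (rule tcost_le_if_counts)
 fix t :: real assume "0 <= t"
 then obtain \<K> where K: "finite \<K>" "card \<K> = length (filter (%(u, v). t < d u v) es')"
   "pairwise disjnt \<K>"
   "!!K. K : \<K> ==> K ~= {} & K <= T - S' & (ALL x:K. ALL y:(S' Un T) - K. t < d x y)" using greedy_blocks[OF g(2), of t] by auto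
 have "card \<K> <= length (filter (%(u, v). t < d u v) es)"
 proof (rule card_blocks_le_count[OF g(1) K(1,3)])
  fix K assume "K : \<K>"
  from K(4)[OF this]
  show "K ~= {} & K <= T - S & (ALL x:K. ALL y:(S Un T) - K. t < d x y)" using sub by blast
 qed
 thus "length (filter (%(u, v). t < d u v) es') <= length (filter (%(u, v). t < d u v) es)" using K(2) by simp
qed

lemma greedy_connects:
 assumes "greedy S T es" "v : T"
 shows "EX u:S. (v, u) : (set es Un (set es)^-1)\<^sup>*" using assms
proof (induction S T es arbitrary: v rule: greedy.induct)
 case (2 S T a b es)
 let ?R = "set ((a, b) # es) Un (set ((a, b) # es))^-1"
 obtain u where u: "u : insert b S" "(v, u) : (set es Un (set es)^-1)\<^sup>*" using "2.IH"[of v] "2.prems" by auto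
 have "(v, u) : ?R\<^sup>*" by (rule rtrancl_mono[THEN subsetD, OF _ u(2)]) auto
 show ?case
 proof (cases "u = b")
  case True
  have "(u, a) : ?R" using True by simp
  hence "(v, a) : ?R\<^sup>*" using \<open>(v, u) : ?R\<^sup>*\<close> by (rule rtrancl_into_rtrancl[rotated])
  thus ?thesis using "2.prems" by auto
 next
  case False
  thus ?thesis using u \<open>(v, u) : ?R\<^sup>*\<close> by auto
 qed
qed auto

lemma greedy_edges: "greedy S T es ==> (u, v) : set es ==> u : S Un T & v : T & u ~= v" by (induction S T es rule: greedy.induct) auto

end

section \<open>Tie-breaking optimisers and a concrete run of Prim's algorithm\<close>

primrec first_min :: "(nat => bool) => (nat => 'b::linorder) => nat => nat option" where
 "first_min P f 0 = None"
| "first_min P f (Suc k) =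
   (if P k & (case first_min P f k of None => True | Some b => f k < f b) then Some k
   else first_min P f k)"

lemma first_min_None: "first_min P f k = None \<longleftrightarrow> (ALL i<k. ~ P i)" by (induction k) (auto simp: less_Suc_eq split: option.splits)

lemma first_min_Some:
 "first_min P f k = Some b ==> b < k & P b & (ALL i<k. P i --> f b <= f i)"
proof (induction k arbitrary: b)
 case (Suc k)
 show ?case
 proof (cases "first_min P f k")
  case None
  thus ?thesis using Suc.prems first_min_None[THEN iffD1, OF None] by (auto simp: less_Suc_eq split: if_splits)
 next
  case (Some c)
  thus ?thesis using Suc.IH[OF Some] Suc.prems by (fastforce simp: less_Suc_eq split: if_splits)
 qed
qed simp

text \<open>The implicit start value \<open>0\<close> makes \<open>None\<close> mean that no value
  is positive, which is how the program keeps its best gain.\<close>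

primrec first_max :: "(nat => 'b::{linorder,zero}) => nat => nat option" where
 "first_max f 0 = None"
| "first_max f (Suc k) =
   (if (case first_max f k of None => 0 | Some b => f b) < f k then Some k else first_max f k)"

lemma first_max_None: "first_max f k = None ==> i < k ==> f i <= 0" by (induction k) (auto simp: less_Suc_eq split: if_splits option.splits)

lemma first_max_Some:
 "first_max f k = Some b ==> b < k & 0 < f b & (ALL i<k. f i <= f b)"
proof (induction k arbitrary: b)
 case (Suc k)
 show ?case
 proof (cases "first_max f k")
  case None
  thus ?thesis using Suc.prems first_max_None[OF None] by (force simp: less_Suc_eq split: if_splits)
 next
  case (Some c)
  thus ?thesis using Suc.IH[OF Some] Suc.prems by (fastforce simp: less_Suc_eq split: if_splits)
 qed
qed simp

locale core = pmet d for d :: "nat => nat => real" +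
 fixes n s :: nat
 assumes s_less: "s < n"
begin

abbreviation "V == {..<n}"

text \<open>The pair \<open>(u, v)\<close> is coded as \<open>k = u * n + v\<close>, in the order in
  which the program scans the distance matrix, so that ties are broken as in the program. A round
  without a candidate changes nothing.\<close>

primrec prim_state :: "nat set => nat set => nat => nat set \<times> (nat \<times> nat) list" where
 "prim_state S T 0 = (S, [])"
| "prim_state S T (Suc i) =
   (case first_min (%k. k div n : fst (prim_state S T i) & k mod n : T &
             k mod n ~: fst (prim_state S T i)) (%k. d (k div n) (k mod n)) (n * n) of
    None => prim_state S T i
   | Some k => (insert (k mod n) (fst (prim_state S T i)), snd (prim_state S T i) @ [(k div n, k mod n)]))"

definition prim :: "nat set => nat set => (nat \<times> nat) list" where
 "prim S T = snd (prim_state S T n)"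

text \<open>\<open>greedy\<close> without the demand that the run be complete, so that runs can be
  extended at the end by \<open>pre_greedy_snoc\<close>.\<close>

fun pre_greedy :: "nat set => nat set => (nat \<times> nat) list => bool" where
 "pre_greedy S T [] = (True)"
| "pre_greedy S T ((u, v) # es) \<longleftrightarrow>
   u : S & v : T - S & (ALL a:S. ALL b:T - S. d u v <= d a b) & pre_greedy (insert v S) T es"

lemma pre_greedy_snoc:
 "pre_greedy S T (es @ [(u, v)]) \<longleftrightarrow> pre_greedy S T es & u : S Un snd ` set es &
   v : T - (S Un snd ` set es) &
   (ALL a:S Un snd ` set es. ALL b:T - (S Un snd ` set es). d u v <= d a b)" by (induction S T es rule: pre_greedy.induct) auto

lemma greedy_iff_pre: "greedy S T es = (pre_greedy S T es & T <= S Un snd ` set es)" by (induction S T es rule: greedy.induct) auto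

lemma greedy_prim:
 assumes S: "S <= V" "S ~= {}" and T: "T <= V"
 shows "greedy S T (prim S T)"
proof -
 \<comment> \<open>The last conjunct counts rounds: as long as a terminal is missing, every round
   adds a vertex. As there are only \<open>n\<close> vertices and \<open>S\<close> is nonempty,
   \<open>n\<close> rounds suffice.\<close>
 have inv: "pre_greedy S T (snd (prim_state S T i)) &
   fst (prim_state S T i) = S Un snd ` set (snd (prim_state S T i)) &
   fst (prim_state S T i) <= V &
   (T <= fst (prim_state S T i) \<or> card S + i <= card (fst (prim_state S T i)))" for i
 proof (induction i)
  case (Suc i)
  define S' where "S' = fst (prim_state S T i)"
  define es where "es = snd (prim_state S T i)"
  define P where "P = (%k. k div n : S' & k mod n : T & k mod n ~: S')"
  define f where "f = (%k. d (k div n) (k mod n))"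
  have IH: "pre_greedy S T es" "S' = S Un snd ` set es" "S' <= V"
   "T <= S' \<or> card S + i <= card S'" using Suc by (auto simp: S'_def es_def)
  have fin: "finite S'" using IH(3) finite_subset by blast
  have pair: "EX k<n * n. k div n = a & k mod n = b" if "a < n" "b < n" for a b
  proof (intro exI[of _ "a * n + b"] conjI)
   have "a * n + b < Suc a * n" using that by simp
   also have "... <= n * n" using that by (intro mult_le_mono1) simp
   finally show "a * n + b < n * n" .
  qed (use that in auto)
  show ?case
  proof (cases "first_min P f (n * n)")
   case None
   have "T <= S'"
   proof
    fix b assume b: "b : T"
    obtain a where a: "a : S'" using S(2) IH(2) by auto
    obtain k where "k < n * n" "k div n = a" "k mod n = b" using pair[of a b] a b IH(3) T by auto
    thus "b : S'" using None a b unfolding first_min_None P_def by auto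
   qed
   thus ?thesis using None IH by (simp add: S'_def es_def P_def f_def)
  next
   case (Some k)
   note k = first_min_Some[OF Some]
   have st: "prim_state S T (Suc i) = (insert (k mod n) S', es @ [(k div n, k mod n)])" using Some by (simp add: S'_def es_def P_def f_def)
   have min: "f k <= d a b" if ab: "a : S'" "b : T - S'" for a b
   proof -
    obtain k' where "k' < n * n" "k' div n = a" "k' mod n = b" using pair[of a b] ab IH(3) T by auto
    thus ?thesis using k ab unfolding P_def f_def by auto
   qed
   have "pre_greedy S T (es @ [(k div n, k mod n)])" unfolding pre_greedy_snoc using IH k min unfolding P_def f_def IH(2) [symmetric] by auto
   moreover have "card S + Suc i <= card (insert (k mod n) S') \<or> T <= S'" using k fin IH(4) unfolding P_def by auto
   moreover have "insert (k mod n) S' = S Un snd ` set (es @ [(k div n, k mod n)])" using IH(2) by auto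
   moreover have "insert (k mod n) S' <= V" using s_less IH(3) by simp
   ultimately show ?thesis unfolding st by auto
  qed
 qed (use S in auto)
 have "~ card S + n <= card (fst (prim_state S T n))"
 proof -
  have "card (fst (prim_state S T n)) <= n" using card_mono[of V "fst (prim_state S T n)"] inv[of n] by (metis card_lessThan finite_lessThan)
  moreover have "0 < card S" using S finite_subset[OF S(1)] by (simp add: card_gt_0_iff)
  ultimately show ?thesis by linarith
 qed
 thus ?thesis unfolding greedy_iff_pre prim_def using inv[of n] by auto
qed

end

section \<open>Costs of both stages compared with a fixed feasible solution\<close>

locale benchmark = core +
 fixes p :: "nat set pmf" and lam :: real
  and Fo :: "(nat \<times> nat) set" and Go :: "nat set => (nat \<times> nat) set"
 assumes p_sub: "set_pmf p <= Pow V" and lam_ge1: "1 <= lam"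
  and Fo_sub: "Fo <= V \<times> V"
  and Go_sub: "!!A. A <= V ==> Go A <= V \<times> V"
  and conn: "!!A v. A <= V ==> v : A ==> (v, s) : ((Fo Un Go A) Un (Fo Un Go A)^-1)\<^sup>*"
begin

definition mean :: "(nat set => real) => real" where
 "mean f = (SUM A:Pow V. pmf p A * f A)"

abbreviation "cs == ecost Fo"
abbreviation "ca A == ecost (Go A)"

lemma lam_pos: "0 < lam" using lam_ge1 by simp

lemma finite_Fo: "finite Fo" using Fo_sub by (rule finite_subset) auto

lemma finite_Go: "A <= V ==> finite (Go A)" using Go_sub by (rule finite_subset) auto

lemma mean_eq: "expect p f = mean f" unfolding mean_def using p_sub by (subst integral_measure_pmf_real[of "Pow V"]) (auto simp: mult.commute)

lemma mean_mono: "(!!A. A <= V ==> f A <= g A) ==> mean f <= mean g" unfolding mean_def by (intro sum_mono mult_left_mono) auto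

lemma mean_nonneg: "(!!A. A <= V ==> 0 <= f A) ==> 0 <= mean f" unfolding mean_def by (intro sum_nonneg mult_nonneg_nonneg) auto

lemma mean_add: "mean (%A. f A + g A) = mean f + mean g" unfolding mean_def by (simp add: algebra_simps sum.distrib)

lemma mean_cmult: "mean (%A. c * f A) = c * mean f" unfolding mean_def by (simp add: algebra_simps sum_distrib_left)

lemma mean_sum: "mean (%A. SUM i:I. f i A) = (SUM i:I. mean (f i))" unfolding mean_def by (simp add: sum_distrib_left) (rule sum.swap)

lemma mean_const: "mean (%A. c) = c"
proof -
 have "(SUM A:Pow V. pmf p A) = 1" using p_sub by (intro sum_pmf_eq_1) auto
 thus ?thesis unfolding mean_def by (simp add: sum_distrib_right [symmetric])
qed

definition hit :: "nat => real => nat set => bool" where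
 "hit v t A = ((EX j:A. d v j <= t))"

lemma hit_mono: "hit v t A ==> t <= t' ==> hit v t' A" unfolding hit_def by force

lemma mean_of_bool_nonneg [simp]: "0 <= mean (%A. of_bool (P A))" by (intro mean_nonneg) auto

text \<open>A cut around the ball of a centre that leaves out the root is crossed by
  \<open>Fo\<close>, or else by \<open>Go A\<close> for every scenario \<open>A\<close> that hits
  the ball. These scenarios have probability at least \<open>w / lam\<close>, so \<open>Fo\<close>
  with weight 1 and each \<open>Go A\<close> with weight \<open>lam / w * pmf p A\<close> form the
  fractional cover demanded by \<open>greedy_centres_le\<close>.\<close>

lemma centres_cost_le:
 assumes g: "greedy {s} D es" and D: "D <= V" "s ~: D"
  and far: "!!c c'. c : D ==> c' : insert s D ==> c ~= c' ==> 4 * R c < d c c'"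
  and R: "!!v. v : V ==> 0 <= R v"
  and lo: "!!v. v : V ==> R v < d v s ==> w <= lam * mean (%A. of_bool (hit v (R v) A))"
  and w: "0 < w"
 shows "tcost es <= 4 * (cs + lam * mean ca / w)"
proof -
 define I where "I = insert None (Some ` Pow V)"
 define x where "x = case_option 1 (%A. lam / w * pmf p A)"
 define E where "E = case_option Fo Go"
 have "tcost es <= 4 * (SUM i:I. x i * ecost (E i))"
 proof (rule greedy_centres_le[OF g _ D(2) far])
  show "finite D" using D(1) finite_subset by blast
  show "finite I" unfolding I_def by simp
  fix i assume "i : I"
  thus "0 <= x i & finite (E i)" unfolding I_def x_def E_def using finite_Fo finite_Go lam_pos w by auto
 next
  fix U c assume c: "c : D" "s ~: U" "!!a. d a c <= R c ==> a : U"
  have cV: "c : V" using c D by auto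
  have "4 * R c < d c s" using far[of c s] c D(2) by auto
  hence w': "w <= lam * mean (%A. of_bool (hit c (R c) A))" using lo[OF cV] R[OF cV] by auto
  show "1 <= (SUM i:I. x i * of_bool (crosses (E i) U))"
  proof (cases "crosses Fo U")
   case True
   have "x None * of_bool (crosses (E None) U) <= (SUM i:I. x i * of_bool (crosses (E i) U))"
    by (intro member_le_sum) (use lam_pos w in "auto simp: I_def x_def")
   thus ?thesis using True by (simp add: x_def E_def)
  next
   case False
   have cr: "crosses (Go A) U" if A: "A <= V" "hit c (R c) A" for A
   proof -
    obtain j where j: "j : A" "d c j <= R c" using A(2) unfolding hit_def by auto
    have "j : U" using c(3)[of j] j d_sym[of j c] by simp
    hence "crosses (Fo Un Go A) U" using crosses_if_connected[OF conn[OF A(1) j(1)]] c(2) by auto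
    thus ?thesis using False unfolding crosses_def by auto
   qed
   have "lam * mean (%A. of_bool (hit c (R c) A)) <= lam * mean (%A. of_bool (crosses (Go A) U))"
    using cr lam_pos by (intro mult_left_mono mean_mono) auto
   hence "w <= lam * mean (%A. of_bool (crosses (Go A) U))" using w' by simp
   hence "1 <= lam / w * mean (%A. of_bool (crosses (Go A) U))" using w by (simp add: field_simps)
   also have "... = (SUM i:Some ` Pow V. x i * of_bool (crosses (E i) U))" by (subst sum.reindex)
      (auto simp del: sum_mult_of_bool_eq simp: x_def E_def mean_def sum_distrib_left mult.assoc)
   also have "... <= (SUM i:I. x i * of_bool (crosses (E i) U))" by (intro sum_mono2) (auto simp: I_def x_def)
   finally show ?thesis .
  qed
 qed (use R D in auto)
 also have "(SUM i:I. x i * ecost (E i)) = cs + lam * mean ca / w"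
  unfolding I_def by (subst sum.insert) (auto simp: sum.reindex x_def E_def mean_def sum_distrib_left
   sum_divide_distrib mult.assoc intro!: sum.cong)
 finally show ?thesis .
qed

text \<open>The locality of \<open>greedy_connected_le\<close> is used with \<open>k = 8\<close>: a
  first-stage edge is charged in scenario \<open>A\<close> only if an endpoint is within an eighth
  of some terminal's distance to \<open>S\<close>, which is at most \<open>4 * R v\<close>. Then the
  scenario hits a vertex below its radius, which has probability at most \<open>w / lam\<close>. The
  two endpoints of an edge give the factor 2 in front of \<open>w * cs\<close>.\<close>

lemma second_stage_cost_le:
 assumes S: "S <= V" "s : S"
  and cover: "!!v. v : V ==> EX c:S. d v c <= 4 * R v"
  and hi: "!!v t. v : V ==> t < R v ==> lam * mean (%A. of_bool (hit v t A)) <= w"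
  and w: "0 <= w"
  and g: "!!A. A <= V ==> greedy S A (es A)"
 shows "lam * mean (%A. tcost (es A)) <= 8 * (lam * mean ca + 2 * w * cs)"
proof -
 define near where "near a A = ((EX v:A - S. 8 * d v a < sd v S))" for a A
 have fS: "finite S" using S finite_subset by blast
 have sdR: "sd v S <= 4 * R v" if "v : V" for v using cover[OF that] sd_le[OF fS] by (meson order_trans)
 have near_le: "lam * mean (%A. of_bool (near a A)) <= w" for a
 proof -
  define Va where "Va = {v : V - S. 8 * d v a < sd v S}"
  show ?thesis
  proof (cases "Va = {}")
   case True
   hence "mean (%A. of_bool (near a A)) <= mean (%A. 0)" by (intro mean_mono) (auto simp: near_def Va_def)
   hence "lam * mean (%A. of_bool (near a A)) <= 0" using lam_pos by (simp add: mean_const mult_le_0_iff)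
   thus ?thesis using w by simp
  next
   case False
   have fin: "finite Va" unfolding Va_def by simp
   \<comment> \<open>One vertex has to witness nearness for all scenarios: the \<open>v0\<close> in
     \<open>Va\<close> farthest from \<open>a\<close>. Every other vertex of \<open>Va\<close> is
     within \<open>2 * d v0 a < R v0\<close> of it.\<close>
   have "Max ((%v. d v a) ` Va) : (%v. d v a) ` Va" using fin False by (intro Max_in) auto
   then obtain v0 where v0: "v0 : Va" "Max ((%v. d v a) ` Va) = d v0 a" by auto
   have v0_max: "d v a <= d v0 a" if "v : Va" for v using Max_ge[of "(%v. d v a) ` Va" "d v a"] fin that v0(2) by simp
   have "v0 : V" "8 * d v0 a < sd v0 S" using v0(1) unfolding Va_def by auto
   hence lt: "2 * d v0 a < R v0" using sdR[of v0] by simp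
   have "near a A ==> hit v0 (2 * d v0 a) A" if A: "A <= V" for A
   proof -
    assume "near a A"
    then obtain v where v: "v : A" "v : Va" using A unfolding near_def Va_def by auto
    have "d v0 v <= 2 * d v0 a" using d_tri[of v0 v a] v0_max[OF v(2)] d_sym[of a v] by simp
    thus "hit v0 (2 * d v0 a) A" using v(1) unfolding hit_def by auto
   qed
   hence "lam * mean (%A. of_bool (near a A)) <= lam * mean (%A. of_bool (hit v0 (2 * d v0 a) A))"
    using lam_pos by (intro mult_left_mono mean_mono) auto
   also have "... <= w" using hi[OF \<open>v0 : V\<close> lt] .
   finally show ?thesis .
  qed
 qed
 have one: "tcost (es A) <= 8 * (ca A + (SUM (a, b):Fo. d a b * of_bool (near a A) + d a b * of_bool (near b A)))"
  if A: "A <= V" for A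
 proof -
  let ?P = "%(a, b). EX v:A - S. 8 * d v a < sd v S \<or> 8 * d v b < sd v S"
  have fA: "finite A" using A finite_subset by blast
  have "tcost (es A) <= 8 * ecost {(a, b) : Fo Un Go A. EX v:A - S. 8 * d v a < sd v S \<or> 8 * d v b < sd v S}"
   using conn[OF A] finite_Fo finite_Go[OF A] by (intro greedy_connected_le[OF g[OF A] fS S(2) fA]) auto
  also have "ecost {(a, b) : Fo Un Go A. EX v:A - S. 8 * d v a < sd v S \<or> 8 * d v b < sd v S} <=
    ecost (Go A Un {e : Fo. ?P e})" using finite_Fo finite_Go[OF A] by (intro ecost_mono) auto
  also have "... <= ca A + ecost {e : Fo. ?P e}" using finite_Fo finite_Go[OF A] by (intro ecost_Un_le) auto
  also have "ecost {e : Fo. ?P e} = (SUM e:Fo. if ?P e then case e of (a, b) => d a b else 0)"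
   unfolding ecost_def by (rule sum.inter_filter[OF finite_Fo])
  also have "... <= (SUM (a, b):Fo. d a b * of_bool (near a A) + d a b * of_bool (near b A))" by (intro sum_mono) (auto simp: near_def)
  finally show ?thesis by simp
 qed
 have "mean (%A. tcost (es A)) <=
   mean (%A. 8 * (ca A + (SUM (a, b):Fo. d a b * of_bool (near a A) + d a b * of_bool (near b A))))" by (intro mean_mono one)
 also have "... = 8 * (mean ca + (SUM (a, b):Fo. d a b * mean (%A. of_bool (near a A)) +
   d a b * mean (%A. of_bool (near b A))))" by (simp add: mean_cmult mean_add mean_sum case_prod_unfold)
 finally have "mean (%A. tcost (es A)) <= ..." .
 from mult_left_mono[OF this, of lam] have "lam * mean (%A. tcost (es A)) <= 8 * (lam * mean ca +
   (SUM (a, b):Fo. d a b * (lam * mean (%A. of_bool (near a A))) +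
   d a b * (lam * mean (%A. of_bool (near b A)))))" using lam_pos by (simp add: sum_distrib_left case_prod_unfold algebra_simps sum.distrib)
 also have "... <= 8 * (lam * mean ca + (SUM (a, b):Fo. d a b * w + d a b * w))" unfolding case_prod_unfold
  by (intro mult_left_mono add_left_mono sum_mono add_mono near_le d_nonneg) simp
 also have "(SUM (a, b):Fo. d a b * w + d a b * w) = 2 * w * cs" unfolding ecost_def by (simp add: sum_distrib_left case_prod_beta algebra_simps)
 finally show ?thesis .
qed

end

section \<open>Scanning the samples for one guess of the optimum\<close>

context core
begin

definition ball_of :: "nat set => real => nat set" where
 "ball_of A ro = {v : V. EX j:A. d v j <= ro}"

text \<open>The sources include \<open>A\<close> itself: measured is the additional cost of serving
  the whole ball once \<open>A\<close> and \<open>X\<close> are connected.\<close>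

definition ext_cost :: "nat set => nat set => real => real" where
 "ext_cost X A ro = tcost (prim (insert s (A Un X)) (ball_of A ro))"

text \<open>This is \<open>r\<close> times \<open>lam * ext_cost X A ro - 4 * (Z / r) * ro\<close>
  at \<open>ro = sd u A\<close>, written without division. The ball changes only at radii that are
  distances of vertices from \<open>A\<close>.\<close>

definition gain :: "real => real => real => nat set => nat set => nat => real" where
 "gain lam r Z X A u = lam * r * ext_cost X A (sd u A) - 4 * Z * sd u A"

text \<open>The state holds the number of enlarged balls around each vertex, the accumulated
  extension cost, and the number of samples rejected as too costly. Vertices that have reached the
  count \<open>m\<close> are free sources in all later steps.\<close>

definition round_step ::
 "real => real => real => nat => (nat => nat) \<times> real \<times> nat => nat set => (nat => nat) \<times> real \<times> nat" where
 "round_step lam r Z m st A =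
   (let cnt = fst st; th = fst (snd st); bad = snd (snd st); X = {a : V. m <= cnt a} in
   if A = {} then st else
   case first_max (gain lam r Z X A) n of
    None => st
   | Some u =>
     if 84 * Z < ext_cost X A (sd u A) then (cnt, th, bad + 1)
     else (%a. cnt a + of_bool (a : ball_of A (3 / 2 * sd u A)), th + ext_cost X A (sd u A), bad))"

definition round_run ::
 "real => real => real => nat => nat set list => (nat => nat) \<times> real \<times> nat" where
 "round_run lam r Z m As = foldl (round_step lam r Z m) (%_. 0, 0, 0) As"

definition bought :: "nat => (nat => nat) \<times> real \<times> nat => nat set" where
 "bought m st = {a : V. m <= fst st a}"

text \<open>Three tests that a guess at or above the optimum passes on typical samples
  (\<open>benchmark_accepted\<close>), and that, on typical samples, imply the guarantee of
  \<open>excess_mean_le\<close> also for a smaller guess. Hence stopping at the first accepted guess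
  is safe.\<close>

definition accepted :: "real => nat => (nat => nat) \<times> real \<times> nat => bool" where
 "accepted Z m st = (8 * snd (snd st) <= m & fst (snd st) <= 9 * real m * Z &
   tcost (prim {s} (bought m st)) <= 10 * Z)"

lemma ball_of_sub: "ball_of A ro <= V" unfolding ball_of_def by auto

lemma ext_cost_nonneg [simp]: "0 <= ext_cost X A ro" unfolding ext_cost_def by simp

lemma ext_cost_antimono:
 assumes "A <= V" "X <= X'" "X' <= V"
 shows "ext_cost X' A ro <= ext_cost X A ro" unfolding ext_cost_def using assms s_less ball_of_sub
 by (intro greedy_cost_antimono[OF greedy_prim greedy_prim]) auto

text \<open>The fold as a history: \<open>N\<close> are the samples whose balls are counted,
  \<open>B\<close> the rejected ones, \<open>X t\<close> the vertices bought before sample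
  \<open>t\<close>, and \<open>ro t\<close> and \<open>h t\<close> the chosen radius and its
  extension cost.\<close>

lemma round_run_decompose:
 fixes As :: "nat set list"
 obtains N B :: "nat set" and X :: "nat => nat set" and ro h :: "nat => real"
 where "N <= {..<length As}" "B <= {..<length As}" "N Int B = {}"
  "!!t. X t = {a : V. m <= card {t' : N. t' < t & a : ball_of (As ! t') (3 / 2 * ro t')}}"
  "bought m (round_run lam r Z m As) = X (length As)"
  "fst (snd (round_run lam r Z m As)) = (SUM t:N. h t)"
  "snd (snd (round_run lam r Z m As)) = card B"
  "!!t. t : N Un B ==> As ! t ~= {} & (EX u<n. ro t = sd u (As ! t)) & h t = ext_cost (X t) (As ! t) (ro t) &
    4 * Z * ro t < lam * r * h t & (ALL u<n. gain lam r Z (X t) (As ! t) u <= lam * r * h t - 4 * Z * ro t)"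
  "!!t. t : N ==> h t <= 84 * Z" "!!t. t : B ==> 84 * Z < h t"
  "!!t u. t < length As ==> t ~: N Un B ==> As ! t ~= {} ==> u < n ==> gain lam r Z (X t) (As ! t) u <= 0"
proof -
 define st where "st t = foldl (round_step lam r Z m) (%_. 0, 0, 0) (take t As)" for t
 define X where "X t = {a : V. m <= fst (st t) a}" for t
 define ev where "ev t = (if As ! t = {} then None else first_max (gain lam r Z (X t) (As ! t)) n)" for t
 define ro where "ro t = sd (the (ev t)) (As ! t)" for t
 define h where "h t = ext_cost (X t) (As ! t) (ro t)" for t
 define N where "N = {t. t < length As & ev t ~= None & h t <= 84 * Z}"
 define B where "B = {t. t < length As & ev t ~= None & 84 * Z < h t}"
 define C where "C t = ball_of (As ! t) (3 / 2 * ro t)" for t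
 have st_Suc: "st (Suc t) = round_step lam r Z m (st t) (As ! t)" if "t < length As" for t
  using that unfolding st_def by (simp add: take_Suc_conv_app_nth)
 have st: "st t = (%a. card {t' : N. t' < t & a : C t'}, (SUM t':{t' : N. t' < t}. h t'), card {t' : B. t' < t})"
  if "t <= length As" for t using that
 proof (induction t)
  case 0
  thus ?case by (simp add: st_def)
 next
  case (Suc t)
  hence IH: "st t = (%a. card {t' : N. t' < t & a : C t'}, (SUM t':{t' : N. t' < t}. h t'), card {t' : B. t' < t})" by simp
  have fin: "finite N" "finite B" unfolding N_def B_def by auto
  have stepN: "{t' : N. t' < Suc t} = (if t : N then insert t {t' : N. t' < t} else {t' : N. t' < t})" by (auto simp: less_Suc_eq)
  have stepB: "{t' : B. t' < Suc t} = (if t : B then insert t {t' : B. t' < t} else {t' : B. t' < t})" by (auto simp: less_Suc_eq)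
  have stepC: "{t' : N. t' < Suc t & a : C t'} =
    (if t : N & a : C t then insert t {t' : N. t' < t & a : C t'} else {t' : N. t' < t & a : C t'})" for a by (auto simp: less_Suc_eq)
  have Xt: "{a : V. m <= fst (st t) a} = X t" unfolding X_def ..
  show ?case
  proof (cases "ev t")
   case None
   hence nin: "t ~: N" "t ~: B" unfolding N_def B_def by auto
   have "st (Suc t) = st t" using Suc.prems None unfolding st_Suc[OF Suc_le_lessD[OF Suc.prems]] round_step_def Let_def Xt ev_def
    by (auto split: if_splits)
   thus ?thesis unfolding stepN stepB stepC using nin IH by simp
  next
   case (Some u)
   hence ne: "As ! t ~= {}" and fm: "first_max (gain lam r Z (X t) (As ! t)) n = Some u" unfolding ev_def by (auto split: if_splits)
   have rho: "ro t = sd u (As ! t)" using Some unfolding ro_def by simp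
   have hu: "ext_cost (X t) (As ! t) (sd u (As ! t)) = h t" using rho unfolding h_def by simp
   have "st (Suc t) = (if 84 * Z < h t then (fst (st t), fst (snd (st t)), snd (snd (st t)) + 1)
     else (%a. fst (st t) a + of_bool (a : C t), fst (snd (st t)) + h t, snd (snd (st t))))" using ne fm Suc.prems
    unfolding st_Suc[OF Suc_le_lessD[OF Suc.prems]] round_step_def Let_def Xt C_def by (simp add: hu rho)
   moreover have "t : N \<longleftrightarrow> ~ 84 * Z < h t" "t : B \<longleftrightarrow> 84 * Z < h t"
    using Some Suc.prems unfolding N_def B_def by auto
   ultimately show ?thesis unfolding stepN stepB stepC using IH fin by (auto simp: fun_eq_iff)
  qed
 qed
 show thesis
 proof (rule that[of N B X ro h])
  have Ntake: "{t' : N. t' < length As} = N" "{t' : B. t' < length As} = B" unfolding N_def B_def by auto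
  have run: "round_run lam r Z m As = st (length As)" unfolding round_run_def st_def by simp
  show "bought m (round_run lam r Z m As) = X (length As)" unfolding bought_def run X_def ..
  show "fst (snd (round_run lam r Z m As)) = (SUM t:N. h t)" unfolding run st[OF order_refl] Ntake by simp
  show "snd (snd (round_run lam r Z m As)) = card B" unfolding run st[OF order_refl] Ntake by simp
  show "X t = {a : V. m <= card {t' : N. t' < t & a : ball_of (As ! t') (3 / 2 * ro t')}}" for t
  proof (cases "t <= length As")
   case True
   thus ?thesis unfolding X_def using st[OF True] by (simp add: C_def)
  next
   case False
   hence "st t = st (length As)" unfolding st_def by simp
   moreover have "{t' : N. t' < t & a : C t'} = {t' : N. t' < length As & a : C t'}" for a using False unfolding N_def by auto
   ultimately show ?thesis unfolding X_def using st[OF order_refl] by (simp add: C_def)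
  qed
  fix t
  show "As ! t ~= {} & (EX u<n. ro t = sd u (As ! t)) & h t = ext_cost (X t) (As ! t) (ro t) &
    4 * Z * ro t < lam * r * h t & (ALL u<n. gain lam r Z (X t) (As ! t) u <= lam * r * h t - 4 * Z * ro t)"
   if tNB: "t : N Un B"
  proof -
   obtain u where u: "ev t = Some u" using tNB unfolding N_def B_def by auto
   hence ne: "As ! t ~= {}" and fm: "first_max (gain lam r Z (X t) (As ! t)) n = Some u" unfolding ev_def by (auto split: if_splits)
   have rho: "ro t = sd u (As ! t)" using u unfolding ro_def by simp
   have g: "gain lam r Z (X t) (As ! t) u = lam * r * h t - 4 * Z * ro t" unfolding gain_def h_def rho by simp
   show ?thesis using ne first_max_Some[OF fm] rho g by (auto simp: h_def)
  qed
  show "gain lam r Z (X t) (As ! t) u <= 0"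
   if "t < length As" "t ~: N Un B" "As ! t ~= {}" "u < n" for u
  proof -
   have "first_max (gain lam r Z (X t) (As ! t)) n = None" using that unfolding N_def B_def ev_def by (auto simp: not_less)
   thus ?thesis using first_max_None that(4) by blast
  qed
 qed (auto simp: N_def B_def)
qed

end

section \<open>Acceptance of a guess and the excess that remains\<close>

context benchmark
begin

text \<open>The origin of the enlargement by \<open>3 / 2\<close>: an endpoint \<open>a\<close> is
  charged only if \<open>2 * d v a < sd v S <= ro\<close> for some \<open>v\<close> in the ball, so
  \<open>a\<close> is within \<open>3 / 2 * ro\<close> of \<open>A\<close>. Such an \<open>a\<close>
  is no source, in particular not yet bought.\<close>

lemma ext_cost_le:
 assumes A: "A <= V" "A ~= {}" and X: "X <= V"
 shows "ext_cost X A ro <= 2 * (ca (ball_of A ro) + (SUM (a, b):Fo.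
   d a b * (of_bool (a : ball_of A (3 / 2 * ro) & a ~: X) + of_bool (b : ball_of A (3 / 2 * ro) & b ~: X))))"
proof -
 define S where "S = insert s (A Un X)"
 define T where "T = ball_of A ro"
 define C where "C = ball_of A (3 / 2 * ro)"
 let ?P = "%(a, b). EX v:T - S. 2 * d v a < sd v S \<or> 2 * d v b < sd v S"
 have S: "S <= V" "s : S" "finite S" using A X s_less finite_subset[of S V] unfolding S_def by auto
 have T: "T <= V" "finite T" using ball_of_sub finite_subset[of T V] unfolding T_def by auto
 have g: "greedy S T (prim S T)" using S T by (intro greedy_prim) auto
 have touched: "a : C & a ~: X" if v: "v : T - S" "2 * d v a < sd v S" and a: "a : V" for v a
 proof -
  obtain j where j: "j : A" "d v j <= ro" using v unfolding T_def ball_of_def by auto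
  have "sd v S <= d v j" using S j by (intro sd_le) (auto simp: S_def)
  hence "d a j <= 3 / 2 * ro" using d_tri[of a j v] d_sym[of a v] v(2) j(2) by linarith
  moreover have "a ~: X"
  proof
   assume "a : X"
   hence "sd v S <= d v a" using S by (intro sd_le) (auto simp: S_def)
   thus False using v(2) d_nonneg[of v a] by linarith
  qed
  ultimately show ?thesis using a j(1) unfolding C_def ball_of_def by auto
 qed
 have "tcost (prim S T) <= 2 * ecost {(a, b) : Fo Un Go T. EX v:T - S. 2 * d v a < sd v S \<or> 2 * d v b < sd v S}"
  using conn[OF T(1)] finite_Fo finite_Go[OF T(1)] by (intro greedy_connected_le[OF g S(3,2) T(2)]) auto
 also have "ecost {(a, b) : Fo Un Go T. EX v:T - S. 2 * d v a < sd v S \<or> 2 * d v b < sd v S} <=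
   ecost (Go T Un {e : Fo. ?P e})" using finite_Fo finite_Go[OF T(1)] by (intro ecost_mono) auto
 also have "... <= ca T + ecost {e : Fo. ?P e}" using finite_Fo finite_Go[OF T(1)] by (intro ecost_Un_le) auto
 also have "ecost {e : Fo. ?P e} = (SUM e:Fo. if ?P e then case e of (a, b) => d a b else 0)"
  unfolding ecost_def by (rule sum.inter_filter[OF finite_Fo])
 also have "... <= (SUM (a, b):Fo. d a b * (of_bool (a : C & a ~: X) + of_bool (b : C & b ~: X)))"
 proof (intro sum_mono)
  fix e assume e: "e : Fo"
  obtain a b where ab: "e = (a, b)" by (cases e)
  have V: "a : V" "b : V" using e Fo_sub ab by auto
  show "(if ?P e then case e of (a, b) => d a b else 0) <=
    (case e of (a, b) => d a b * (of_bool (a : C & a ~: X) + of_bool (b : C & b ~: X)))"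
   using touched[of _ a] touched[of _ b] V d_nonneg[of a b] unfolding ab by (auto simp: algebra_simps)
 qed
 finally show ?thesis unfolding ext_cost_def S_def T_def C_def by simp
qed

lemma ext_cost_le_simple:
 assumes "A <= V" "A ~= {}" "X <= V"
 shows "ext_cost X A ro <= 2 * (ca (ball_of A ro) + cs)"
proof -
 define S where "S = insert s (A Un X)"
 define T where "T = ball_of A ro"
 have S: "S <= V" "s : S" "finite S" using assms s_less finite_subset[of S V] unfolding S_def by auto
 have T: "T <= V" "finite T" using ball_of_sub finite_subset[of T V] unfolding T_def by auto
 have g: "greedy S T (prim S T)" using S T by (intro greedy_prim) auto
 have "tcost (prim S T) <= 2 * ecost {(a, b) : Fo Un Go T. EX v:T - S. 2 * d v a < sd v S \<or> 2 * d v b < sd v S}"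
  using conn[OF T(1)] finite_Fo finite_Go[OF T(1)] by (intro greedy_connected_le[OF g S(3,2) T(2)]) auto
 also have "... <= 2 * ecost (Go T Un Fo)" using finite_Fo finite_Go[OF T(1)] by (intro mult_left_mono ecost_mono) auto
 also have "... <= 2 * (ca T + cs)" using ecost_Un_le[OF finite_Go[OF T(1)] finite_Fo] by simp
 finally show ?thesis unfolding ext_cost_def S_def T_def .
qed

text \<open>At the last index satisfying \<open>q\<close>, all earlier ones are among the fewer than
  \<open>m\<close> counted there. This bounds how often one endpoint is charged before it is
  bought.\<close>

lemma card_below_threshold_le:
 fixes N :: "nat set"
 assumes "finite N" "!!t. q t ==> w t & card {t' : N. t' < t & w t'} < m"
 shows "card {t : N. q t} <= m"
proof (rule ccontr)
 assume "~ card {t : N. q t} <= m"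
 hence gt: "m < card {t : N. q t}" by simp
 define t where "t = Max {t : N. q t}"
 have fin: "finite {t : N. q t}" using assms(1) by simp
 have "{t : N. q t} ~= {}" using gt by (metis card.empty not_less_zero)
 hence t: "t : {t : N. q t}" unfolding t_def using fin by (intro Max_in)
 have "{t : N. q t} - {t} <= {t' : N. t' < t & w t'}" using Max_ge[OF fin] assms(2) unfolding t_def by force
 hence "card ({t : N. q t} - {t}) <= card {t' : N. t' < t & w t'}" using assms(1) by (intro card_mono) auto
 moreover have "card ({t : N. q t} - {t}) = card {t : N. q t} - 1" using t fin by (simp add: card_Diff_singleton)
 moreover have "card {t' : N. t' < t & w t'} < m" using assms(2)[of t] t by auto
 ultimately show False using gt by linarith
qed

text \<open>The part of the extension cost that a price of \<open>4 * y\<close> per unit of radius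
  does not cover, at the worst radius. From the empty scenario no nonempty one is reachable at
  finite cost, hence the value 0 there.\<close>

definition excess :: "real => nat set => nat set => real" where
 "excess y X A = (if A = {} then 0 else Max (insert 0 ((%u. lam * ext_cost X A (sd u A) - 4 * y * sd u A) ` V)))"

text \<open>\<open>H\<close> and \<open>ys\<close> stand for a dual solution of the benchmark's
  transport problem, and \<open>Z\<close> for a guess that is at least first-stage cost plus dual
  value.\<close>

context
 fixes H :: "nat set => real" and ys r Z :: real and m :: nat and As :: "nat set list"
 assumes H_nonneg: "!!A. A <= V ==> 0 <= H A" and ys: "0 <= ys" and r: "0 < r"
  and dual: "!!A ro. A <= V ==> A ~= {} ==> 0 <= ro ==> lam * ca (ball_of A ro) <= H A + ys * ro"
  and Z: "cs + r * ys + mean H <= Z" and m: "0 < m"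
  and As: "!!t. t < length As ==> As ! t <= V"
begin

lemma Z_parts: "cs <= Z" "r * ys <= Z" "mean H <= Z" "0 <= Z" "0 <= mean H"
proof -
 have "0 <= mean H" by (intro mean_nonneg H_nonneg) auto
 moreover have "0 <= r * ys" "0 <= cs" using r ys by auto
 ultimately show "cs <= Z" "r * ys <= Z" "mean H <= Z" "0 <= Z" "0 <= mean H" using Z by linarith+
qed

text \<open>A chosen radius satisfies \<open>4 * Z * ro < lam * r * h\<close>, and
  \<open>r * ys <= Z\<close>; so the dual price \<open>ys * ro\<close> is at most a quarter of
  \<open>lam * h\<close> and can be absorbed. What remains is charged to \<open>H\<close> of the
  sample and to first-stage edges, at each endpoint at most \<open>m\<close> times.\<close>

lemma benchmark_accepted:
 assumes S1: "(SUM t<length As. min (H (As ! t)) (84 * lam * Z)) <= lam * m * (11 / 10 * mean H + 1 / 20 * Z)"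
  and S2: "8 * card {t. t < length As & 20 * lam * Z < H (As ! t)} <= m"
 shows "accepted Z m (round_run lam r Z m As)"
proof -
 obtain N B X ro h where NB: "N <= {..<length As}" "B <= {..<length As}" "N Int B = {}"
  and X: "!!t. X t = {a : V. m <= card {t' : N. t' < t & a : ball_of (As ! t') (3 / 2 * ro t')}}"
  and fin: "bought m (round_run lam r Z m As) = X (length As)"
   "fst (snd (round_run lam r Z m As)) = (SUM t:N. h t)"
   "snd (snd (round_run lam r Z m As)) = card B"
  and ev: "!!t. t : N Un B ==> As ! t ~= {} & (EX u<n. ro t = sd u (As ! t)) & h t = ext_cost (X t) (As ! t) (ro t) &
    4 * Z * ro t < lam * r * h t & (ALL u<n. gain lam r Z (X t) (As ! t) u <= lam * r * h t - 4 * Z * ro t)"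
  and hN: "!!t. t : N ==> h t <= 84 * Z" and hB: "!!t. t : B ==> 84 * Z < h t" by (rule round_run_decompose[of As m lam r Z]) (rule that)
 have finN: "finite N" "finite B" using NB by (auto intro: finite_subset)
 define C where "C t = ball_of (As ! t) (3 / 2 * ro t)" for t
 have sub: "As ! t <= V" if "t : N Un B" for t using that NB As by blast
 have XV: "X t <= V" for t unfolding X by auto
 have rho0: "0 <= ro t" if "t : N Un B" for t using ev[OF that] sd_nonneg[OF finite_subset[OF sub[OF that] finite_lessThan]] by metis
 have ysr: "ys * ro t <= lam * h t / 4" if t: "t : N Un B" for t
 proof -
  have "r * (ys * ro t) <= Z * ro t" using mult_right_mono[OF Z_parts(2) rho0[OF t]] by (simp add: mult.assoc)
  also have "... <= r * (lam * h t / 4)" using conjunct1[OF conjunct2[OF conjunct2[OF conjunct2[OF ev[OF t]]]]] by (simp add: algebra_simps)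
  finally show ?thesis using r by simp
 qed
 define q where "q a t = (a : C t & a ~: X t)" for a t
 define ld where "ld t = (SUM (a, b):Fo. d a b * (of_bool (q a t) + of_bool (q b t)))" for t
 have h_le: "h t <= 2 * (ca (ball_of (As ! t) (ro t)) + ld t)" if t: "t : N Un B" for t
  using ext_cost_le[OF sub[OF t] _ XV, of t "ro t"] ev[OF t] unfolding ld_def q_def C_def by auto
 have qcount: "(SUM t:N. of_bool (q a t) :: real) <= m" if a: "a : V" for a
 proof -
  have "card {t : N. q a t} <= m"
  proof (rule card_below_threshold_le[OF finN(1), where w = "%t. a : C t"])
   fix t assume "q a t"
   thus "a : C t & card {t' : N. t' < t & a : C t'} < m" unfolding q_def X C_def using a by auto
  qed
  thus ?thesis using finN by (simp add: sum_of_bool_eq Int_def)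
 qed
 have ld_sum: "(SUM t:N. ld t) <= 2 * m * cs"
 proof -
  have "(SUM t:N. ld t) = (SUM (a, b):Fo. d a b * ((SUM t:N. of_bool (q a t)) + (SUM t:N. of_bool (q b t))))" unfolding ld_def
   by (subst sum.swap) (simp del: sum_of_bool_eq add: case_prod_unfold sum_distrib_left distrib_left sum.distrib)
  also have "... <= (SUM (a, b):Fo. d a b * (real m + real m))" using qcount Fo_sub unfolding case_prod_unfold
   by (intro sum_mono mult_left_mono add_mono) auto
  also have "... = 2 * m * cs" unfolding ecost_def by (simp add: sum_distrib_left case_prod_unfold algebra_simps)
  finally show ?thesis .
 qed
 define H' where "H' t = min (H (As ! t)) (84 * lam * Z)" for t
 have H'_nonneg: "0 <= H' t" if "t < length As" for t unfolding H'_def using H_nonneg[OF As[OF that]] lam_pos Z_parts by simp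
 have H'_sum: "(SUM t:N. H' t) <= lam * m * (11 / 10 * mean H + 1 / 20 * Z)"
  using sum_mono2[of "{..<length As}" N H'] NB(1) H'_nonneg S1 unfolding H'_def by force
 have caB: "lam * ca (ball_of (As ! t) (ro t)) <= H (As ! t) + lam * h t / 4" if t: "t : N Un B" for t
  using dual[OF sub[OF t] _ rho0[OF t]] ev[OF t] ysr[OF t] by force
 \<comment> \<open>Truncating \<open>H\<close> at \<open>84 * lam * Z\<close> is harmless here,
   since counted samples have \<open>h t <= 84 * Z\<close>; the truncation is what makes the sum
   concentrate.\<close>
 have "lam * h t <= 4 * H' t + 4 * lam * ld t" if t: "t : N" for t
 proof -
  have ld0: "0 <= ld t" unfolding ld_def by (intro sum_nonneg) auto
  show ?thesis
  proof (cases "H (As ! t) <= 84 * lam * Z")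
   case True
   have "lam * h t <= lam * (2 * (ca (ball_of (As ! t) (ro t)) + ld t))" using h_le[of t] t lam_pos by (intro mult_left_mono) auto
   hence "lam * h t <= 2 * (lam * ca (ball_of (As ! t) (ro t))) + 2 * (lam * ld t)" by (simp add: algebra_simps)
   thus ?thesis using caB[of t] t True unfolding H'_def by (simp add: algebra_simps)
  next
   case False
   have "lam * h t <= lam * (84 * Z)" using hN[OF t] lam_pos by (intro mult_left_mono) auto
   moreover have "lam * (84 * Z) = 84 * lam * Z" by simp
   moreover have "H' t = 84 * lam * Z" using False unfolding H'_def by simp
   moreover have "0 <= 84 * lam * Z" "0 <= 4 * lam * ld t" using lam_pos Z_parts(4) ld0 by simp_all
   ultimately show ?thesis by linarith
  qed
 qed
 hence "(SUM t:N. lam * h t) <= (SUM t:N. 4 * H' t + 4 * lam * ld t)" by (intro sum_mono) auto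
 also have "... = 4 * (SUM t:N. H' t) + 4 * lam * (SUM t:N. ld t)" by (simp add: sum.distrib sum_distrib_left)
 also have "... <= 4 * (lam * m * (11 / 10 * mean H + 1 / 20 * Z)) + 4 * lam * (2 * m * cs)"
  using H'_sum ld_sum lam_pos by (intro add_mono mult_left_mono) auto
 also have "... = lam * (m * (44 / 10 * mean H + 2 / 10 * Z + 8 * cs))" by (simp add: algebra_simps)
 finally have Th: "(SUM t:N. h t) <= m * (44 / 10 * mean H + 2 / 10 * Z + 8 * cs)" using lam_pos by (simp add: sum_distrib_left [symmetric])
 have csH: "cs + mean H <= Z" using Z mult_nonneg_nonneg[of r ys] r ys by linarith
 \<comment> \<open>The constants fit because \<open>84 / 4 - 1 = 20\<close>: a rejected sample has
   \<open>84 * Z < h t\<close>, and \<open>lam * h t / 4 - lam * Z\<close> is at most its value of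
   \<open>H\<close>.\<close>
 have badH: "20 * lam * Z < H (As ! t)" if t: "t : B" for t
 proof -
  have "h t <= 2 * (ca (ball_of (As ! t) (ro t)) + cs)" using ext_cost_le_simple[OF sub[of t] _ XV] ev[of t] t by auto
  hence "lam * h t <= lam * (2 * (ca (ball_of (As ! t) (ro t)) + cs))" using lam_pos by (intro mult_left_mono) auto
  hence "lam * h t <= 2 * (lam * ca (ball_of (As ! t) (ro t))) + 2 * (lam * cs)" by (simp add: algebra_simps)
  also have "... <= 2 * (H (As ! t) + lam * h t / 4) + 2 * (lam * Z)" using caB[of t] t lam_pos Z_parts(1) by (intro add_mono mult_left_mono) auto
  finally have "lam * h t / 4 - lam * Z <= H (As ! t)" by simp
  moreover have "lam * (84 * Z) < lam * h t" using hB[OF t] lam_pos by simp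
  ultimately show ?thesis by simp
 qed
 have manyH: "card {t. t < length As & 20 * lam * Z < H (As ! t)} <= m / 8" using S2 by linarith
 have "card B <= card {t. t < length As & 20 * lam * Z < H (As ! t)}" using badH NB(2) by (intro card_mono) auto
 hence bad: "8 * card B <= m" using S2 by linarith
 \<comment> \<open>Every bought vertex lies in at least \<open>m\<close> enlarged balls, of which at
   most \<open>m / 8\<close> belong to samples with large \<open>H\<close>. So \<open>Fo\<close>
   with weight 1 and the benchmark's solutions for the remaining balls with weight
   \<open>8 / (7 * m)\<close> cross every moat with total weight at least 1.\<close>
 have tree: "tcost (prim {s} (X (length As))) <= 10 * Z"
 proof -
  define N' where "N' = {t : N. H (As ! t) <= 20 * lam * Z}"
  define I where "I = insert None (Some ` N')"
  define x where "x = case_option 1 (%_::nat. 8 / (7 * real m))"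
  define E where "E = case_option Fo (%t. Go (C t))"
  have CV: "C t <= V" for t unfolding C_def by (rule ball_of_sub)
  have N': "N' <= N" "finite N'" using finN unfolding N'_def by auto
  have "tcost (prim {s} (X (length As))) <= 2 * (SUM i:I. x i * ecost (E i))"
  proof (rule greedy_weighted_le[OF greedy_prim])
   fix i assume "i : I"
   thus "0 <= x i & finite (E i)" unfolding I_def x_def E_def using finite_Fo finite_Go[OF CV] by auto
  next
   fix K t assume K: "(0::real) <= t" "K ~= {}" "K <= X (length As) - {s}" "!!v. v : K ==> 2 * t < sd v {s}"
   obtain v where v: "v : K" using K by auto
   have vn: "v : nbh K t" using v K(1) unfolding nbh_def by (auto intro!: bexI[of _ v])
   have sn: "s ~: nbh K t"
   proof
    assume "s : nbh K t"
    then obtain w where w: "w : K" "d s w <= t" unfolding nbh_def by auto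
    thus False using K(4)[OF w(1)] K(1) sd_le[of "{s}" s w] d_sym[of s w] by auto
   qed
   show "1 <= (SUM i:I. x i * of_bool (crosses (E i) (nbh K t)))"
   proof (cases "crosses Fo (nbh K t)")
    case True
    have "x None * of_bool (crosses (E None) (nbh K t)) <= (SUM i:I. x i * of_bool (crosses (E i) (nbh K t)))"
     using N' by (intro member_le_sum) (auto simp: I_def x_def)
    thus ?thesis using True by (simp add: x_def E_def)
   next
    case False
    have cr: "crosses (Go (C t')) (nbh K t)" if "v : C t'" for t'
     using crosses_if_connected[OF conn[OF CV that] vn sn] False unfolding crosses_def by auto
    have "m <= card {t' : N. v : C t'}"
    proof -
     have "m <= card {t' : N. t' < length As & v : C t'}" using v K(3) X[of "length As"] unfolding C_def by auto
     also have "... <= card {t' : N. v : C t'}" using finN by (intro card_mono) auto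
     finally show ?thesis .
    qed
    also have "... <= card ({t' : N'. v : C t'} Un {t. t < length As & 20 * lam * Z < H (As ! t)})"
     using N' finN NB(1) by (intro card_mono) (auto simp: N'_def)
    also have "... <= card {t' : N'. v : C t'} + card {t. t < length As & 20 * lam * Z < H (As ! t)}" by (rule card_Un_le)
    finally have cnt: "7 / 8 * real m <= card {t' : N'. v : C t'}" using manyH by linarith
    have "1 = 8 / (7 * real m) * (7 / 8 * real m)" using m by simp
    also have "... <= 8 / (7 * real m) * card {t' : N'. v : C t'}" using cnt by (intro mult_left_mono) auto
    also have "... = (SUM t':{t' : N'. v : C t'}. 8 / (7 * real m))" by simp
    also have "... = (SUM t':{t' : N'. v : C t'}. x (Some t') * of_bool (crosses (E (Some t')) (nbh K t)))"
     using cr by (intro sum.cong) (auto simp: x_def E_def)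
    also have "... <= (SUM t':N'. x (Some t') * of_bool (crosses (E (Some t')) (nbh K t)))" using N' by (intro sum_mono2) (auto simp: x_def)
    also have "... = (SUM i:Some ` N'. x i * of_bool (crosses (E i) (nbh K t)))" by (subst sum.reindex) (auto simp del: sum_mult_of_bool_eq)
    also have "... <= (SUM i:I. x i * of_bool (crosses (E i) (nbh K t)))" using N' by (intro sum_mono2) (auto simp: I_def x_def)
    finally show ?thesis .
   qed
  qed (use N' s_less XV[of "length As"] finite_subset[OF XV] in "auto simp: I_def")
  also have "(SUM i:I. x i * ecost (E i)) = cs + 8 / (7 * real m) * (SUM t:N'. ca (C t))" unfolding I_def using N'
   by (subst sum.insert) (auto simp: sum.reindex x_def E_def sum_distrib_left)
  finally have 1: "tcost (prim {s} (X (length As))) <= 2 * (cs + 8 / (7 * real m) * (SUM t:N'. ca (C t)))" .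
  have "lam * (SUM t:N'. ca (C t)) <= (SUM t:N'. H' t + 3 / 8 * (lam * h t))" unfolding sum_distrib_left
  proof (intro sum_mono)
   fix t assume t: "t : N'"
   hence tN: "t : N Un B" using N' by auto
   \<comment> \<open>The price \<open>ys * ro t\<close> is at most a quarter of
     \<open>lam * h t\<close>; the enlargement by \<open>3 / 2\<close> turns this into
     \<open>3 / 8\<close>.\<close>
   have "lam * ca (C t) <= H (As ! t) + ys * (3 / 2 * ro t)" unfolding C_def using ev[OF tN] rho0[OF tN] by (intro dual sub[OF tN]) auto
   moreover have "20 * lam * Z <= 84 * lam * Z" using lam_pos Z_parts(4) by (intro mult_right_mono) auto
   moreover have "H (As ! t) <= 20 * lam * Z" using t unfolding N'_def by auto
   ultimately have "H (As ! t) <= 84 * lam * Z" "lam * ca (C t) <= H (As ! t) + ys * (3 / 2 * ro t)" by linarith+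
   moreover from this have "H (As ! t) = H' t" unfolding H'_def by simp
   ultimately show "lam * ca (C t) <= H' t + 3 / 8 * (lam * h t)" using ysr[OF tN] by linarith
  qed
  also have "... <= (SUM t:N. H' t + 3 / 8 * (lam * h t))"
  proof (intro sum_mono2)
   fix t assume "t : N - N'"
   thus "0 <= H' t + 3 / 8 * (lam * h t)" using H'_nonneg[of t] NB(1) ev[of t] lam_pos by (intro add_nonneg_nonneg mult_nonneg_nonneg) auto
  qed (use finN N' in auto)
  also have "... = (SUM t:N. H' t) + lam * (3 / 8 * (SUM t:N. h t))" unfolding sum.distrib sum_distrib_left by (simp add: mult.left_commute)
  also have "... <= lam * m * (11 / 10 * mean H + 1 / 20 * Z) +
    lam * (3 / 8 * (m * (44 / 10 * mean H + 2 / 10 * Z + 8 * cs)))" using H'_sum Th lam_pos by (intro add_mono mult_left_mono) auto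
  also have "... = lam * (m * (275 / 100 * mean H + 125 / 1000 * Z + 3 * cs))" by (simp add: algebra_simps)
  finally have "(SUM t:N'. ca (C t)) <= m * (275 / 100 * mean H + 125 / 1000 * Z + 3 * cs)" using lam_pos by simp
  hence "8 / (7 * real m) * (SUM t:N'. ca (C t)) <= 8 / (7 * real m) * (m * (275 / 100 * mean H + 125 / 1000 * Z + 3 * cs))"
   by (intro mult_left_mono) auto
  also have "... = 8 / 7 * (275 / 100 * mean H + 125 / 1000 * Z + 3 * cs)" using m by simp
  finally have 2: "8 / (7 * real m) * (SUM t:N'. ca (C t)) <= 8 / 7 * (275 / 100 * mean H + 125 / 1000 * Z + 3 * cs)" .
  define Q where "Q = 8 / (7 * real m) * (SUM t:N'. ca (C t))"
  have "T <= 10 * Z" if "T <= 2 * (c + Q)" "Q <= 8 / 7 * (275 / 100 * e + 125 / 1000 * Z + 3 * c)"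
   "c + e <= Z" "0 <= e" "0 <= Z" for T c Q e :: real using that by (simp add: field_simps)
  from this[OF 1[folded Q_def] 2[folded Q_def] csH Z_parts(5,4)] show ?thesis .
 qed
 have "(SUM t:N. h t) <= m * (9 * Z)"
 proof -
  have "44 / 10 * mean H + 2 / 10 * Z + 8 * cs <= 9 * Z" using csH Z_parts by linarith
  hence "m * (44 / 10 * mean H + 2 / 10 * Z + 8 * cs) <= m * (9 * Z)" by (intro mult_left_mono) auto
  thus ?thesis using Th by linarith
 qed
 thus ?thesis unfolding accepted_def fin using bad tree by (simp add: algebra_simps)
qed

text \<open>The accepted guess \<open>Zh\<close> may be below \<open>Z\<close>. Against the final
  \<open>X\<close>, a counted sample has excess at most the extension cost recorded at its own step,
  because extension costs only fall as \<open>X\<close> grows and the price \<open>Z / r\<close> is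
  at least \<open>Zh / r\<close>. The tests bound the recorded costs and the number of rejected
  samples, whose excess is truncated. \<open>S3\<close> speaks about all \<open>X\<close> because
  the bought set depends on the samples.\<close>

lemma excess_mean_le:
 assumes Zh: "0 <= Zh" "Zh <= Z" and acc: "accepted Zh m (round_run lam r Zh m As)"
  and M: "99 / 100 * (m * lam) <= length As"
  and S3: "!!X. X <= V ==> 95 / 100 * (length As * mean (%A. min (excess (Z / r) X A) (2 * lam * cs))) <=
    (SUM t<length As. min (excess (Z / r) X (As ! t)) (2 * lam * cs)) + m / 50 * (lam * cs)"
 defines "X == bought m (round_run lam r Zh m As)"
 shows "mean (excess (Z / r) X) <= 2 * mean H + 10 * Z + 3 / 10 * cs"
proof -
 obtain N B Xt ro h where NB: "N <= {..<length As}" "B <= {..<length As}" "N Int B = {}"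
  and Xt: "!!t. Xt t = {a : V. m <= card {t' : N. t' < t & a : ball_of (As ! t') (3 / 2 * ro t')}}"
  and fin: "bought m (round_run lam r Zh m As) = Xt (length As)"
   "fst (snd (round_run lam r Zh m As)) = (SUM t:N. h t)"
   "snd (snd (round_run lam r Zh m As)) = card B"
  and ev: "!!t. t : N Un B ==> As ! t ~= {} & (EX u<n. ro t = sd u (As ! t)) & h t = ext_cost (Xt t) (As ! t) (ro t) &
    4 * Zh * ro t < lam * r * h t & (ALL u<n. gain lam r Zh (Xt t) (As ! t) u <= lam * r * h t - 4 * Zh * ro t)"
  and no: "!!t u. t < length As ==> t ~: N Un B ==> As ! t ~= {} ==> u < n ==> gain lam r Zh (Xt t) (As ! t) u <= 0"
  by (rule round_run_decompose[of As m lam r Zh]) (rule that)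
 have finN: "finite N" "finite B" using NB by (auto intro: finite_subset)
 define f where "f A = min (excess (Z / r) X A) (2 * lam * cs)" for A
 have XV: "X <= V" "Xt t <= V" for t unfolding X_def bought_def Xt by auto
 have Xsub: "Xt t <= X" if "t <= length As" for t
 proof
  fix a assume a: "a : Xt t"
  have "card {t' : N. t' < t & a : ball_of (As ! t') (3 / 2 * ro t')} <=
    card {t' : N. t' < length As & a : ball_of (As ! t') (3 / 2 * ro t')}" using finN that by (intro card_mono) auto
  thus "a : X" using a unfolding X_def fin(1) Xt by auto
 qed
 have csl: "0 <= 2 * lam * cs" using lam_pos by simp
 have ex0: "0 <= excess y X A" for y X A unfolding excess_def by (auto intro!: Max_ge)
 have Zr: "Zh / r <= Z / r" using Zh r by (simp add: divide_right_mono)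
 have term_le: "r * (lam * ext_cost X A (sd u A) - 4 * (Z / r) * sd u A) <= gain lam r Zh (Xt t) A u"
  if "A <= V" "A ~= {}" "t <= length As" for A u t
 proof -
  have "lam * r * ext_cost X A (sd u A) <= lam * r * ext_cost (Xt t) A (sd u A)"
   using ext_cost_antimono[OF that(1) Xsub[OF that(3)] XV(1)] lam_pos r by (intro mult_left_mono) auto
  moreover have "Zh * sd u A <= Z * sd u A" using Zh sd_nonneg[of A u] that finite_subset[OF that(1)] by (intro mult_right_mono) auto
  ultimately show ?thesis using r unfolding gain_def by (simp add: algebra_simps)
 qed
 have ex_le: "excess (Z / r) X A <= c"
  if "A <= V" "t <= length As" "0 <= c" and le: "A ~= {} ==> (!!u. u < n ==> gain lam r Zh (Xt t) A u <= r * c)" for A t c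
 proof (cases "A = {}")
  case False
  have "lam * ext_cost X A (sd u A) - 4 * (Z / r) * sd u A <= c" if "u < n" for u
   using order_trans[OF term_le[OF \<open>A <= V\<close> False \<open>t <= length As\<close>, of u] le[OF False that]]
    mult_le_cancel_left_pos[OF r] by blast
  thus ?thesis using False that(3) unfolding excess_def by auto
 qed (simp add: excess_def that)
 have fN: "f (As ! t) <= lam * h t" if t: "t : N" for t
 proof -
  have tl: "t <= length As" using t NB by auto
  have "finite (As ! t)" using t NB(1) As[of t] finite_subset[of "As ! t" V] by auto
  moreover have evt: "As ! t ~= {}" "EX u<n. ro t = sd u (As ! t)"
    "!!u. u < n ==> gain lam r Zh (Xt t) (As ! t) u <= lam * r * h t - 4 * Zh * ro t" "0 <= h t" using ev[of t] t by auto
  ultimately have "0 <= ro t" using sd_nonneg[of "As ! t"] by auto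
  hence "0 <= 4 * Zh * ro t" using Zh by simp
  hence "gain lam r Zh (Xt t) (As ! t) u <= r * (lam * h t)" if "u < n" for u using evt(3)[OF that] by (simp add: mult.assoc mult.left_commute)
  hence "excess (Z / r) X (As ! t) <= lam * h t" using As[of t] t NB(1) tl evt(4) lam_pos by (intro ex_le[of _ t]) auto
  thus ?thesis unfolding f_def by simp
 qed
 have fB: "f (As ! t) <= 2 * lam * cs" for t unfolding f_def by simp
 have fno: "f (As ! t) <= 0" if t: "t < length As" "t ~: N Un B" for t
 proof -
  have "excess (Z / r) X (As ! t) <= 0" using As[OF t(1)] t no[OF t] by (intro ex_le[of _ t]) auto
  thus ?thesis unfolding f_def by simp
 qed
 have "(SUM t<length As. f (As ! t)) <=
   (SUM t<length As. (if t : N then lam * h t else 0) + (if t : B then 2 * lam * cs else 0))"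
 proof (intro sum_mono)
  fix t assume "t : {..<length As}"
  thus "f (As ! t) <= (if t : N then lam * h t else 0) + (if t : B then 2 * lam * cs else 0)" using fN[of t] fB[of t] fno[of t] NB(3) by auto
 qed
 also have "... = lam * (SUM t:N. h t) + card B * (2 * lam * cs)" using NB by (simp add: sum.distrib sum.If_cases sum_distrib_left Int_absorb1)
 also have "... <= lam * (9 * m * Zh) + m / 8 * (2 * lam * cs)"
  using acc lam_pos csl unfolding accepted_def fin by (intro add_mono mult_left_mono mult_right_mono) auto
 also have "... <= lam * (9 * m * Z) + m / 8 * (2 * lam * cs)" using Zh lam_pos by (intro add_mono mult_left_mono) auto
 finally have sum: "(SUM t<length As. f (As ! t)) <= m * lam * (9 * Z + cs / 4)" by (simp add: algebra_simps)
 have mf0: "0 <= mean f" using ex0 csl unfolding f_def by (intro mean_nonneg) auto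
 have "95 / 100 * (99 / 100 * (m * lam) * mean f) <= 95 / 100 * (length As * mean f)" using M mf0 by (intro mult_left_mono mult_right_mono) auto
 also have "... <= (SUM t<length As. f (As ! t)) + m / 50 * (lam * cs)" using S3[OF XV(1)] unfolding f_def .
 also have "... <= m * lam * (9 * Z + cs / 4 + cs / 50)" using sum by (simp add: algebra_simps)
 finally have "(m * lam) * (9405 / 10000 * mean f) <= (m * lam) * (9 * Z + cs / 4 + cs / 50)" by (simp add: algebra_simps)
 hence "9405 / 10000 * mean f <= 9 * Z + cs / 4 + cs / 50" using m lam_pos by simp
 hence mf: "mean f <= 10 * Z + 3 / 10 * cs" using Z_parts(4) ecost_nonneg[of Fo] by linarith
 \<comment> \<open>Truncation at \<open>2 * lam * cs\<close> is harmless: what lies beyond is paid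
   by \<open>2 * H A\<close>, because the benchmark serves the ball with edges of cost at most
   \<open>ca\<close> plus \<open>cs\<close>.\<close>
 have "excess (Z / r) X A <= 2 * H A + f A" if A: "A <= V" for A
 proof (cases "A = {}")
  case False
  have "lam * ext_cost X A (sd u A) - 4 * (Z / r) * sd u A <= 2 * H A + 2 * lam * cs" for u
  proof -
   have sd0: "0 <= sd u A" using sd_nonneg[OF finite_subset[OF A finite_lessThan] False] .
   have "lam * ext_cost X A (sd u A) <= lam * (2 * (ca (ball_of A (sd u A)) + cs))"
    using ext_cost_le_simple[OF A False XV(1)] lam_pos by (intro mult_left_mono) auto
   also have "... = 2 * (lam * ca (ball_of A (sd u A))) + 2 * lam * cs" by (simp add: algebra_simps)
   finally have "lam * ext_cost X A (sd u A) <= 2 * (lam * ca (ball_of A (sd u A))) + 2 * lam * cs" .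
   moreover have "lam * ca (ball_of A (sd u A)) <= H A + ys * sd u A" using dual[OF A False sd0] .
   moreover have "ys <= Z / r" using Z_parts(2) r by (simp add: pos_le_divide_eq mult.commute)
   hence "ys * sd u A <= Z / r * sd u A" using sd0 by (intro mult_right_mono)
   ultimately have "lam * ext_cost X A (sd u A) <= 2 * H A + 2 * (Z / r * sd u A) + 2 * lam * cs" by linarith
   moreover have "0 <= Z / r * sd u A" using Z_parts r sd0 by simp
   ultimately show ?thesis unfolding mult.assoc[of 4] by linarith
  qed
  hence "excess (Z / r) X A <= 2 * H A + 2 * lam * cs" using False H_nonneg[OF A] csl unfolding excess_def by auto
  thus ?thesis unfolding f_def using H_nonneg[OF A] by (auto simp: min_def)
 qed (use H_nonneg csl in "auto simp: excess_def f_def")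
 hence "mean (excess (Z / r) X) <= mean (%A. 2 * H A + f A)" by (intro mean_mono) auto
 also have "... = 2 * mean H + mean f" by (simp add: mean_add mean_cmult)
 finally show ?thesis using mf by linarith
qed

text \<open>With the guess 0 a counted sample would need an extension cost that is both positive and
  at most 0. So no sample is counted, nothing is bought, and only the number of rejections has to be
  small.\<close>

lemma zero_accepted:
 assumes S4: "8 * card {t. t < length As & As ! t ~= {} & (EX u<n. 0 < ext_cost {} (As ! t) (sd u (As ! t)))} <= m"
 shows "accepted 0 m (round_run lam r 0 m As)" "bought m (round_run lam r 0 m As) = {}"
proof -
 obtain N B Xt ro h where NB: "N <= {..<length As}" "B <= {..<length As}" "N Int B = {}"
  and Xt: "!!t. Xt t = {a : V. m <= card {t' : N. t' < t & a : ball_of (As ! t') (3 / 2 * ro t')}}"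
  and fin: "bought m (round_run lam r 0 m As) = Xt (length As)"
   "fst (snd (round_run lam r 0 m As)) = (SUM t:N. h t)"
   "snd (snd (round_run lam r 0 m As)) = card B"
  and ev: "!!t. t : N Un B ==> As ! t ~= {} & (EX u<n. ro t = sd u (As ! t)) & h t = ext_cost (Xt t) (As ! t) (ro t) &
    4 * 0 * ro t < lam * r * h t & (ALL u<n. gain lam r 0 (Xt t) (As ! t) u <= lam * r * h t - 4 * 0 * ro t)"
  and hN: "!!t. t : N ==> h t <= 84 * 0" by (rule round_run_decompose[of As m lam r 0]) (rule that)
 have "N = {}"
 proof (rule ccontr)
  assume "N ~= {}"
  then obtain t where t: "t : N" by auto
  have "h t = ext_cost (Xt t) (As ! t) (ro t)" "4 * 0 * ro t < lam * r * h t" using ev[of t] t by blast+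
  moreover from this(1) have "h t = 0" using hN[OF t] ext_cost_nonneg by (metis antisym mult_zero_right)
  ultimately show False by simp
 qed
 hence X0: "Xt t = {}" for t using m unfolding Xt by auto
 have "B <= {t. t < length As & As ! t ~= {} & (EX u<n. 0 < ext_cost {} (As ! t) (sd u (As ! t)))}"
 proof
  fix t assume t: "t : B"
  have ht: "4 * 0 * ro t < lam * r * h t" "h t = ext_cost (Xt t) (As ! t) (ro t)"
    "As ! t ~= {}" "EX u<n. ro t = sd u (As ! t)" using ev[of t] t by blast+
  have "0 < h t" by (rule zero_less_mult_pos[OF _ mult_pos_pos[OF lam_pos r]]) (use ht(1) in simp)
  moreover have "h t = ext_cost {} (As ! t) (ro t)" using ht(2) unfolding X0 .
  moreover note ht(3,4)
  ultimately show "t : {t. t < length As & As ! t ~= {} & (EX u<n. 0 < ext_cost {} (As ! t) (sd u (As ! t)))}" using t NB by auto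
 qed
 hence "card B <= card {t. t < length As & As ! t ~= {} & (EX u<n. 0 < ext_cost {} (As ! t) (sd u (As ! t)))}" by (intro card_mono) auto
 moreover have "tcost (prim {s} {}) = 0" using greedy_Nil_if_subset[OF greedy_prim[of "{s}" "{}"]] s_less by (simp add: tcost_def)
 ultimately show "accepted 0 m (round_run lam r 0 m As)" "bought m (round_run lam r 0 m As) = {}"
  unfolding accepted_def fin X0 \<open>N = {}\<close> using S4 by auto
qed

end

end

section \<open>Chernoff bounds for independent samples\<close>

lemma nn_integral_replicate_pmf_prod:
 assumes "!!x. 0 <= g x"
 shows "(\<integral>\<^sup>+ xs. ennreal (PROD x<-xs. g x) \<partial>measure_pmf (replicate_pmf M p)) =
  (\<integral>\<^sup>+ x. ennreal (g x) \<partial>measure_pmf p) ^ M"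
proof (induction M)
 case (Suc M)
 have pos: "0 <= (PROD x<-xs. g x)" for xs using assms by (induction xs) auto
 have "(\<integral>\<^sup>+ xs. ennreal (PROD x<-xs. g x) \<partial>measure_pmf (replicate_pmf (Suc M) p)) =
   (\<integral>\<^sup>+ x. (\<integral>\<^sup>+ xs. ennreal (g x) * ennreal (PROD x<-xs. g x) \<partial>measure_pmf (replicate_pmf M p)) \<partial>measure_pmf p)"
  by (simp add: nn_integral_bind_pmf nn_integral_map_pmf map_pmf_def [symmetric] ennreal_mult assms pos)
 also have "... = (\<integral>\<^sup>+ x. ennreal (g x) * (\<integral>\<^sup>+ x. ennreal (g x) \<partial>measure_pmf p) ^ M \<partial>measure_pmf p)"
  by (simp add: nn_integral_cmult Suc)
 also have "... = (\<integral>\<^sup>+ x. ennreal (g x) \<partial>measure_pmf p) ^ Suc M" by (simp add: nn_integral_multc)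
 finally show ?case .
qed simp

text \<open>Markov's inequality for a product of independent factors.\<close>

lemma replicate_pmf_tail:
 assumes fin: "finite (set_pmf p)" and g: "!!x. 0 <= g x" and b: "0 < b"
  and c: "expect p g <= c"
 shows "measure_pmf.prob (replicate_pmf M p) {xs. b <= (PROD x<-xs. g x)} <= c ^ M / b"
proof -
 have "0 <= expect p g" by (intro Bochner_Integration.integral_nonneg g)
 hence c0: "0 <= c" using c by simp
 have int: "integrable (measure_pmf p) g" using fin by (rule integrable_measure_pmf_finite)
 have "(\<integral>\<^sup>+ x. ennreal (g x) \<partial>measure_pmf p) <= ennreal c"
  using c nn_integral_eq_integral[OF int] g by (simp add: ennreal_leI)
 hence le: "(\<integral>\<^sup>+ xs. ennreal (PROD x<-xs. g x) \<partial>measure_pmf (replicate_pmf M p)) <= ennreal (c ^ M)"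
  unfolding nn_integral_replicate_pmf_prod[of g M p, OF g] using c0 by (simp add: ennreal_power [symmetric] power_mono)
 have "ennreal b * emeasure (measure_pmf (replicate_pmf M p)) {xs. b <= (PROD x<-xs. g x)} =
   (\<integral>\<^sup>+ xs. ennreal b * indicator {xs. b <= (PROD x<-xs. g x)} xs \<partial>measure_pmf (replicate_pmf M p))"
  by (simp add: nn_integral_cmult_indicator)
 also have "... <= (\<integral>\<^sup>+ xs. ennreal (PROD x<-xs. g x) \<partial>measure_pmf (replicate_pmf M p))"
  by (intro nn_integral_mono) (auto simp: indicator_def intro: ennreal_leI)
 also note le
 finally have "ennreal (b * measure_pmf.prob (replicate_pmf M p) {xs. b <= (PROD x<-xs. g x)}) <= ennreal (c ^ M)"
  using b by (simp add: measure_pmf.emeasure_eq_measure ennreal_mult)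
 hence "b * measure_pmf.prob (replicate_pmf M p) {xs. b <= (PROD x<-xs. g x)} <= c ^ M" using c0 by (simp add: ennreal_le_iff)
 thus ?thesis using b by (simp add: field_simps)
qed

lemma prod_list_exp: "(PROD x<-xs. exp (f x)) = exp (SUM x<-xs. f x :: real)" by (induction xs) (auto simp: exp_add)

lemma exp_chord:
 fixes x :: real
 assumes "0 <= x" "x <= 1"
 shows "exp (t * x) <= 1 + (exp t - 1) * x" using convex_onD[OF exp_convex, of x 0 t] assms by (simp add: algebra_simps)

text \<open>The tilt \<open>t\<close> may have either sign and \<open>k\<close> only has to dominate
  \<open>exp t - 1\<close>, so that both tails are instances.\<close>

lemma chernoff:
 fixes f :: "'a => real"
 assumes fin: "finite (set_pmf p)" and f: "!!x. x : set_pmf p ==> 0 <= f x & f x <= 1"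
  and t: "exp t - 1 <= k"
 shows "measure_pmf.prob (replicate_pmf M p) {xs. M * (k * expect p f) + eta <= (SUM x<-xs. t * f x)}
  <= exp (- eta)"
proof -
 define \<mu> where "\<mu> = expect p f"
 have intf: "integrable (measure_pmf p) g" for g :: "'a => real" using fin by (rule integrable_measure_pmf_finite)
 have "expect p (%x. exp (t * f x)) <= expect p (%x. 1 + k * f x)"
 proof (rule integral_mono_AE[OF intf intf], rule AE_pmfI)
  fix x assume "x : set_pmf p"
  hence fx: "0 <= f x" "f x <= 1" using f by auto
  have "exp (t * f x) <= 1 + (exp t - 1) * f x" using exp_chord[OF fx] .
  also have "... <= 1 + k * f x" using t fx by (simp add: mult_right_mono)
  finally show "exp (t * f x) <= 1 + k * f x" .
 qed
 also have "... = 1 + k * \<mu>" unfolding \<mu>_def using intf by simp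
 also have "... <= exp (k * \<mu>)" by (rule exp_ge_add_one_self)
 finally have c: "expect p (%x. exp (t * f x)) <= exp (k * \<mu>)" .
 have "{xs. M * (k * \<mu>) + eta <= (SUM x<-xs. t * f x)} =
   {xs. exp (M * (k * \<mu>) + eta) <= (PROD x<-xs. exp (t * f x))}" unfolding prod_list_exp by simp
 also have "measure_pmf.prob (replicate_pmf M p) ... <= exp (k * \<mu>) ^ M / exp (M * (k * \<mu>) + eta)"
  by (rule replicate_pmf_tail[OF fin _ _ c]) auto
 also have "... = exp (- eta)" by (simp add: exp_of_nat_mult [symmetric] exp_diff [symmetric] exp_minus exp_add field_simps)
 finally show ?thesis unfolding \<mu>_def .
qed

lemma chernoff_upper:
 fixes f :: "'a => real"
 assumes fin: "finite (set_pmf p)" and f: "!!x. x : set_pmf p ==> 0 <= f x & f x <= c" and c: "0 <= c"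
 shows "measure_pmf.prob (replicate_pmf M p) {xs. 11 / 10 * (M * expect p f) + c * eta < (SUM x<-xs. f x)}
  <= exp (- eta / 10)"
proof (cases "c = 0")
 case True
 have "expect p f = 0" using f True by (intro integral_eq_zero_AE AE_pmfI) force
 moreover have "(SUM x<-xs. f x) = 0" if "ALL x:set xs. x : set_pmf p" for xs using that f True by (induction xs) force+
 ultimately have "set_pmf (replicate_pmf M p) Int {xs. 11 / 10 * (M * expect p f) + c * eta < (SUM x<-xs. f x)} = {}"
  using True by (force simp: set_replicate_pmf in_lists_conv_set)
 thus ?thesis by (metis exp_ge_zero measure_pmf_zero_iff inf_commute)
next
 case False
 hence c: "0 < c" using c by simp
 \<comment> \<open>Tilt \<open>1 / 10\<close>: the quotient of \<open>11 / 100\<close> and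
   \<open>1 / 10\<close> is the factor \<open>11 / 10\<close>, and the deviation enters the exponent
   as \<open>eta / 10\<close>.\<close>
 have "exp (1 / 10 :: real) - 1 <= 11 / 100" using exp_bound[of "1 / 10"] by (simp add: power2_eq_square)
 from chernoff[OF fin _ this, of "%x. f x / c" M "eta / 10"]
 have "measure_pmf.prob (replicate_pmf M p)
   {xs. M * (11 / 100 * expect p (%x. f x / c)) + eta / 10 <= (SUM x<-xs. 1 / 10 * (f x / c))} <= exp (- (eta / 10))" using f c by simp
 moreover have sub: "{xs. 11 / 10 * (M * expect p f) + c * eta < (SUM x<-xs. f x)} <=
   {xs. M * (11 / 100 * expect p (%x. f x / c)) + eta / 10 <= (SUM x<-xs. 1 / 10 * (f x / c))}"
 proof
  fix xs assume "xs : {xs. 11 / 10 * (M * expect p f) + c * eta < (SUM x<-xs. f x)}"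
  hence "11 / 10 * (M * expect p f) + c * eta < (SUM x<-xs. f x)" by simp
  moreover have "(SUM x<-xs. 1 / 10 * (f x / c)) = (SUM x<-xs. f x) / (10 * c)" by (induction xs) (auto simp: add_divide_distrib mult.commute)
  ultimately show "xs : {xs. M * (11 / 100 * expect p (%x. f x / c)) + eta / 10 <= (SUM x<-xs. 1 / 10 * (f x / c))}"
   using c by (simp add: field_simps)
 qed
 ultimately show ?thesis using measure_pmf.finite_measure_mono[OF sub, of "replicate_pmf M p"] by simp
qed

lemma chernoff_lower:
 fixes f :: "'a => real"
 assumes fin: "finite (set_pmf p)" and f: "!!x. x : set_pmf p ==> 0 <= f x & f x <= c" and c: "0 <= c"
 shows "measure_pmf.prob (replicate_pmf M p) {xs. (SUM x<-xs. f x) + c * eta < 95 / 100 * (M * expect p f)}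
  <= exp (- eta / 10)"
proof (cases "c = 0")
 case True
 have "expect p f = 0" using f True by (intro integral_eq_zero_AE AE_pmfI) force
 moreover have "(SUM x<-xs. f x) = 0" if "ALL x:set xs. x : set_pmf p" for xs using that f True by (induction xs) force+
 ultimately have "set_pmf (replicate_pmf M p) Int {xs. (SUM x<-xs. f x) + c * eta < 95 / 100 * (M * expect p f)} = {}"
  using True by (force simp: set_replicate_pmf in_lists_conv_set)
 thus ?thesis by (metis exp_ge_zero measure_pmf_zero_iff inf_commute)
next
 case False
 hence c: "0 < c" using c by simp
 \<comment> \<open>Tilt \<open>- 1 / 10\<close>: from
   \<open>exp (- 1 / 10) - 1 <= - 95 / 1000\<close> comes the factor
   \<open>95 / 100\<close>.\<close>
 have "1 + 1 / 10 + (1 / 10)\<^sup>2 / 2 <= exp (1 / 10 :: real)" by (rule exp_lower_Taylor_quadratic) simp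
 hence "1 <= (1 - 95 / 1000) * exp (1 / 10 :: real)" by (simp add: power2_eq_square)
 hence "exp (- 1 / 10 :: real) - 1 <= - 95 / 1000" by (simp add: exp_minus field_simps)
 from chernoff[OF fin _ this, of "%x. f x / c" M "eta / 10"]
 have "measure_pmf.prob (replicate_pmf M p)
   {xs. M * (- 95 / 1000 * expect p (%x. f x / c)) + eta / 10 <= (SUM x<-xs. - 1 / 10 * (f x / c))} <= exp (- (eta / 10))" using f c by simp
 moreover have sub: "{xs. (SUM x<-xs. f x) + c * eta < 95 / 100 * (M * expect p f)} <=
   {xs. M * (- 95 / 1000 * expect p (%x. f x / c)) + eta / 10 <= (SUM x<-xs. - 1 / 10 * (f x / c))}"
 proof
  fix xs assume "xs : {xs. (SUM x<-xs. f x) + c * eta < 95 / 100 * (M * expect p f)}"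
  hence "(SUM x<-xs. f x) + c * eta < 95 / 100 * (M * expect p f)" by simp
  moreover have "(SUM x<-xs. - 1 / 10 * (f x / c)) = - (SUM x<-xs. f x) / (10 * c)" using c by (induction xs) (auto simp: field_simps)
  ultimately show "xs : {xs. M * (- 95 / 1000 * expect p (%x. f x / c)) + eta / 10 <= (SUM x<-xs. - 1 / 10 * (f x / c))}"
   using c by (simp add: field_simps)
 qed
 ultimately show ?thesis using measure_pmf.finite_measure_mono[OF sub, of "replicate_pmf M p"] by simp
qed

section \<open>Weak and strong duality for the Wasserstein ball\<close>

lemma expectation_le_finite:
 fixes f g :: "'a => real"
 assumes "finite (set_pmf p)" "!!x. x : set_pmf p ==> f x <= g x"
 shows "expect p f <= expect p g" using assms by (intro integral_mono_AE AE_pmfI integrable_measure_pmf_finite)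

text \<open>Weak duality. To avoid the question whether an optimal coupling exists, one of cost
  below \<open>R + \<delta>\<close> is taken and the error sent to 0; its finite cost keeps it off
  the pairs where \<open>kp\<close> is infinite.\<close>

lemma transport_upper_bound:
 fixes w :: "'a => real"
 assumes fin: "finite P" and p: "set_pmf p <= P" and q: "set_pmf q <= P"
  and W: "wasserstein kp p q <= ennreal R" and R: "0 <= R" and y: "0 <= y"
  and le: "!!A A'. A : P ==> A' : P ==> kp A A' < \<top> ==> w A' <= G A + y * enn2real (kp A A')"
 shows "expect q w <= expect p G + y * R"
proof -
 have "expect q w <= expect p G + y * R + e" if e: "0 < e" for e
 proof -
  define \<delta> where "\<delta> = e / (y + 1)"
  have d: "0 < \<delta>" "y * \<delta> <= e" using e y unfolding \<delta>_def by (auto simp: field_simps)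
  have "wasserstein kp p q < ennreal (R + \<delta>)" using W R d by (intro le_less_trans[OF W]) (simp add: ennreal_less_iff)
  then obtain gm where g: "map_pmf fst gm = p" "map_pmf snd gm = q"
   and lt: "(\<integral>\<^sup>+ (A, A'). kp A A' \<partial>measure_pmf gm) < ennreal (R + \<delta>)"
   unfolding wasserstein_def INF_less_iff by auto
  have sub: "set_pmf gm <= P \<times> P" using p q unfolding g(1)[symmetric] g(2)[symmetric] by (force simp: set_map_pmf)
  hence fing: "finite (set_pmf gm)" using fin finite_subset by blast
  have fink: "kp (fst z) (snd z) < \<top>" if "z : set_pmf gm" for z
  proof (rule ccontr)
   assume "~ kp (fst z) (snd z) < \<top>"
   hence top: "kp (fst z) (snd z) = \<top>" using top.not_eq_extremum by blast
   have "(\<integral>\<^sup>+ (A, A'). kp A A' \<partial>measure_pmf gm) \<ge>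
     (\<integral>\<^sup>+ x. \<top> * indicator {z} x \<partial>measure_pmf gm)"
    using top by (intro nn_integral_mono) (auto simp: indicator_def split: prod.splits)
   also have "(\<integral>\<^sup>+ x. \<top> * indicator {z} x \<partial>measure_pmf gm) = \<top>"
    using that by (subst nn_integral_cmult_indicator)
     (auto simp: emeasure_pmf_single ennreal_top_mult pmf_positive_iff set_pmf_iff)
   finally show False using lt by (simp add: top_unique)
  qed
  let ?k = "%z. enn2real (kp (fst z) (snd z))"
  have intg: "integrable (measure_pmf gm) f" for f :: "'a \<times> 'a => real" using fing by (rule integrable_measure_pmf_finite)
  have "ennreal (expect gm ?k) = (\<integral>\<^sup>+ z. ennreal (?k z) \<partial>measure_pmf gm)"
   by (rule nn_integral_eq_integral[OF intg, symmetric]) simp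
  also have "... = (\<integral>\<^sup>+ (A, A'). kp A A' \<partial>measure_pmf gm)"
   using fink by (intro nn_integral_cong_AE AE_pmfI) (auto split: prod.splits)
  finally have "ennreal (expect gm ?k) < ennreal (R + \<delta>)" using lt by simp
  hence k: "expect gm ?k <= R + \<delta>" using R d ennreal_less_iff[of "expect gm ?k" "R + \<delta>"] by (simp del: ennreal_plus)
  have "expect q w = expect gm (%z. w (snd z))" unfolding g(2)[symmetric] by simp
  also have "... <= expect gm (%z. G (fst z) + y * ?k z)" using fing fink sub by (intro expectation_le_finite le) auto
  also have "... = expect p G + y * expect gm ?k" unfolding g(1)[symmetric] using intg by simp
  also have "... <= expect p G + y * (R + \<delta>)" using k y by (simp add: mult_left_mono)
  finally show ?thesis using d by (simp add: algebra_simps)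
 qed
 thus ?thesis by (rule field_le_epsilon)
qed

text \<open>Convex combination of two distributions; applied to couplings it shows that the
  transport value is concave in the budget.\<close>

definition mix :: "real => 'a pmf => 'a pmf => 'a pmf" where
 "mix u p q = bind_pmf (bernoulli_pmf u) (%b. if b then p else q)"

lemma set_mix: "set_pmf (mix u p q) <= set_pmf p Un set_pmf q" unfolding mix_def by (auto split: if_splits)

lemma nn_integral_mix:
 assumes "0 <= u" "u <= 1"
 shows "(\<integral>\<^sup>+ x. f x \<partial>measure_pmf (mix u p q)) =
  (\<integral>\<^sup>+ x. f x \<partial>measure_pmf p) * ennreal u + (\<integral>\<^sup>+ x. f x \<partial>measure_pmf q) * ennreal (1 - u)"
 unfolding mix_def using assms by (simp add: nn_integral_bind_pmf)

lemma expectation_mix: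
 fixes f :: "'a => real"
 assumes u: "0 <= u" "u <= 1" and fin: "finite (set_pmf p)" "finite (set_pmf q)"
 shows "expect (mix u p q) f =
  u * expect p f + (1 - u) * expect q f"
proof -
 define S where "S = set_pmf p Un set_pmf q"
 have S: "finite S" "set_pmf p <= S" "set_pmf q <= S" "set_pmf (mix u p q) <= S" using fin set_mix[of u p q] unfolding S_def by auto
 have pm: "pmf (mix u p q) x = u * pmf p x + (1 - u) * pmf q x" for x unfolding mix_def pmf_bind using u by simp
 have "expect r f = (SUM x:S. f x * pmf r x)" if "set_pmf r <= S" for r using S(1) that by (intro integral_measure_pmf_real) auto
 thus ?thesis using S by (simp add: pm sum_distrib_left sum.distrib [symmetric] distrib_left mult.left_commute)
qed

text \<open>The best value \<open>v\<close> as a function of the transport budget is concave. A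
  supergradient at \<open>R\<close>, an interior point because \<open>0 < R\<close>, is the
  multiplier \<open>y\<close>, and \<open>H A\<close> is the best value of \<open>h\<close> minus
  the price of getting there from \<open>A\<close>. Transporting every point to such a best response
  gives a coupling at which the supergradient inequality yields the bound on the mean of
  \<open>H\<close>.\<close>

lemma transport_duality:
 fixes h :: "'a => real"
 assumes fin: "finite P" and p: "set_pmf p <= P" and R: "0 < R"
  and refl: "!!A. A : P ==> kp A A = 0"
 obtains y H where "0 <= y"
  "!!A A'. A : P ==> A' : P ==> kp A A' < \<top> ==> h A' <= H A + y * enn2real (kp A A')"
  "R * y + expect p H <=
    (SUP q\<in>{q. set_pmf q <= P & wasserstein kp p q <= ennreal R}. expect q h)"
proof -
 define cost where "cost gm = (\<integral>\<^sup>+ (A, A'). kp A A' \<partial>measure_pmf gm)" for gm :: "('a \<times> 'a) pmf"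
 define G where "G x = {gm. map_pmf fst gm = p & set_pmf gm <= P \<times> P & cost gm <= ennreal x}" for x
 define val where "val gm = expect gm (%z. h (snd z))" for gm :: "('a \<times> 'a) pmf"
 define v where "v x = (SUP gm\<in>G x. val gm)" for x
 define B where "B = Max (insert 0 (h ` P))"
 have hB: "h A <= B" if "A : P" for A unfolding B_def using fin that by (intro Max_ge) auto
 have finP: "finite (set_pmf gm)" if "set_pmf gm <= P \<times> P" for gm :: "('a \<times> 'a) pmf" using that fin finite_subset by blast
 have exp_le: "expect q h <= B" if "set_pmf q <= P" for q using expectation_le_finite[of q h "%_. B"] that hB finite_subset[OF that fin] by auto
 have val_eq: "val gm = expect (map_pmf snd gm) h" for gm unfolding val_def by simp
 have val_le: "val gm <= B" if "gm : G x" for gm x unfolding val_eq using that by (intro exp_le) (auto simp: G_def)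
 have bdd: "bdd_above (val ` G x)" for x using val_le by (intro bdd_aboveI2) auto
 have diag: "map_pmf (%A. (A, A)) p : G x" for x
 proof -
  have "cost (map_pmf (%A. (A, A)) p) = (\<integral>\<^sup>+ A. kp A A \<partial>measure_pmf p)"
   unfolding cost_def by (simp add: nn_integral_map_pmf)
  also have "... = (\<integral>\<^sup>+ A. 0 \<partial>measure_pmf p)" using p refl by (intro nn_integral_cong_AE AE_pmfI) auto
  finally show ?thesis using p unfolding G_def by (auto simp: pmf.map_comp o_def)
 qed
 have ne: "G x ~= {}" for x using diag by blast
 have v_ge: "val gm <= v x" if "gm : G x" for gm x unfolding v_def using that bdd by (intro cSUP_upper)
 have v_mono: "v x <= v x'" if "x <= x'" for x x' unfolding v_def
 proof (rule cSUP_mono[OF ne bdd])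
  fix gm assume "gm : G x"
  hence "gm : G x'" using that unfolding G_def by (auto intro: order_trans ennreal_leI)
  thus "EX gm':G x'. val gm <= val gm'" by auto
 qed
 have mixG: "mix u gm gm' : G (u * x + (1 - u) * x')" "val (mix u gm gm') = u * val gm + (1 - u) * val gm'"
  if u: "0 <= u" "u <= 1" and x: "0 <= x" "0 <= x'" and g: "gm : G x" "gm' : G x'" for u x x' gm gm'
 proof -
  have "map_pmf fst (mix u gm gm') = bind_pmf (bernoulli_pmf u) (%b. p)"
   unfolding mix_def map_bind_pmf using g by (intro bind_pmf_cong) (auto simp: G_def)
  moreover have "cost (mix u gm gm') <= ennreal x * ennreal u + ennreal x' * ennreal (1 - u)"
   unfolding cost_def nn_integral_mix[OF u] using g unfolding G_def cost_def by (intro add_mono mult_right_mono) auto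
  moreover have "ennreal x * ennreal u + ennreal x' * ennreal (1 - u) = ennreal (u * x + (1 - u) * x')"
   using u x by (simp add: ennreal_mult [symmetric] ennreal_plus [symmetric] mult.commute del: ennreal_plus)
  ultimately show "mix u gm gm' : G (u * x + (1 - u) * x')" using g set_mix[of u gm gm'] unfolding G_def by auto
  show "val (mix u gm gm') = u * val gm + (1 - u) * val gm'" unfolding val_def using g finP unfolding G_def by (intro expectation_mix u) auto
 qed
 have convex: "convex_on {0..} (%x. - v x)"
 proof (rule convex_onI)
  fix t x x' :: real assume t: "0 < t" "t < 1" and x: "x : {0..}" "x' : {0..}"
  have "(1 - t) * v x + t * v x' <= v ((1 - t) * x + t * x')"
  proof (rule field_le_epsilon)
   fix e :: real assume e: "0 < e"
   obtain gm where g: "gm : G x" "v x - e < val gm" using less_cSUP_iff[OF ne bdd, of "v x - e" x] e unfolding v_def by auto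
   obtain gm' where g': "gm' : G x'" "v x' - e < val gm'" using less_cSUP_iff[OF ne bdd, of "v x' - e" x'] e unfolding v_def by auto
   have "(1 - t) * v x + t * v x' - e = (1 - t) * (v x - e) + t * (v x' - e)" by (simp add: algebra_simps)
   also have "... <= (1 - t) * val gm + t * val gm'" using g g' t by (intro add_mono mult_left_mono) auto
   also have "... <= v ((1 - t) * x + t * x')"
    using v_ge[OF mixG(1)[of "1 - t" x x' gm gm']] mixG(2)[of "1 - t" x x' gm gm'] t x g(1) g'(1) by simp
   finally show "(1 - t) * v x + t * v x' <= v ((1 - t) * x + t * x') + e" by simp
  qed
  thus "- v ((1 - t) *\<^sub>R x + t *\<^sub>R x') <= (1 - t) * - v x + t * - v x'" by simp
 qed simp
 \<comment> \<open>The negated right-hand slope of \<open>- v\<close> at \<open>R\<close>; by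
   convexity of \<open>- v\<close> it is a supergradient of \<open>v\<close> for all budgets
   \<open>0 <= x\<close>.\<close>
 define y where "y = - Inf ((%t. (- v R - - v t) / (R - t)) ` ({R<..} Int {0..}))"
 have super: "v x <= v R + y * (x - R)" if "0 <= x" for x
  using convex_le_Inf_differential[OF convex, of R x] R that unfolding y_def by (simp add: algebra_simps)
 have y0: "0 <= y" using super[of "R + 1"] v_mono[of R "R + 1"] R by simp
 define f where "f A A' = h A' - y * enn2real (kp A A')" for A A'
 define Q where "Q A = {A' : P. kp A A' < \<top>}" for A
 define H where "H A = Max (f A ` Q A)" for A
 have Q: "finite (Q A)" for A unfolding Q_def using fin by simp
 have Qne: "Q A ~= {}" if "A : P" for A unfolding Q_def using refl[OF that] that by force
 have "EX A'. A' : Q A & H A = f A A'" if "A : P" for A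
 proof -
  have "Max (f A ` Q A) : f A ` Q A" using Q Qne[OF that] by (intro Max_in) auto
  thus ?thesis unfolding H_def by auto
 qed
 then obtain \<phi> where phi: "!!A. A : P ==> \<phi> A : Q A & H A = f A (\<phi> A)" by metis
 define gm where "gm = map_pmf (%A. (A, \<phi> A)) p"
 \<comment> \<open>The budget spent by the best responses may lie on either side of
   \<open>R\<close>; \<open>super\<close> covers both.\<close>
 define x0 where "x0 = expect p (%A. enn2real (kp A (\<phi> A)))"
 have finp: "finite (set_pmf p)" using p fin finite_subset by blast
 have int: "integrable (measure_pmf p) f" for f :: "'a => real" using finp by (rule integrable_measure_pmf_finite)
 have x0: "0 <= x0" unfolding x0_def by (intro Bochner_Integration.integral_nonneg) simp
 have "cost gm = (\<integral>\<^sup>+ A. kp A (\<phi> A) \<partial>measure_pmf p)" unfolding cost_def gm_def by (simp add: nn_integral_map_pmf)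
 also have "... = (\<integral>\<^sup>+ A. ennreal (enn2real (kp A (\<phi> A))) \<partial>measure_pmf p)"
  using p phi by (intro nn_integral_cong_AE AE_pmfI) (auto simp: Q_def)
 also have "... = ennreal x0" unfolding x0_def by (rule nn_integral_eq_integral[OF int]) simp
 finally have "gm : G x0" unfolding G_def gm_def using p phi by (auto simp: pmf.map_comp o_def Q_def)
 hence "val gm <= v x0" by (rule v_ge)
 hence "expect p (%A. h (\<phi> A)) <= v R + y * (x0 - R)" using super[OF x0] unfolding val_def gm_def by simp
 moreover have "expect p H = expect p (%A. h (\<phi> A) - y * enn2real (kp A (\<phi> A)))"
  using p phi by (intro integral_cong_AE) (auto intro!: AE_pmfI simp: f_def)
 moreover have "... = expect p (%A. h (\<phi> A)) - y * x0" unfolding x0_def using int by simp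
 moreover have "v R <= (SUP q\<in>{q. set_pmf q <= P & wasserstein kp p q <= ennreal R}. expect q h)" unfolding v_def
 proof (rule cSUP_mono[OF ne])
  show "bdd_above ((%q. expect q h) ` {q. set_pmf q <= P & wasserstein kp p q <= ennreal R})" using exp_le by (intro bdd_aboveI2) auto
  fix gm assume g: "gm : G R"
  have "wasserstein kp p (map_pmf snd gm) <= cost gm" unfolding wasserstein_def cost_def using g by (intro INF_lower) (auto simp: G_def)
  thus "EX q:{q. set_pmf q <= P & wasserstein kp p q <= ennreal R}. val gm <= expect q h"
   using g unfolding val_eq G_def by (intro bexI[of _ "map_pmf snd gm"]) auto
 qed
 ultimately have main: "R * y + expect p H <=
   (SUP q\<in>{q. set_pmf q <= P & wasserstein kp p q <= ennreal R}. expect q h)" by (simp add: algebra_simps)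
 show thesis
 proof (rule that[OF y0 _ main])
  fix A A' assume A: "A : P" "A' : P" "kp A A' < \<top>"
  have "f A A' <= H A" unfolding H_def using A Q by (intro Max_ge) (auto simp: Q_def)
  thus "h A' <= H A + y * enn2real (kp A A')" unfolding f_def by simp
 qed
qed

section \<open>A structured language, its semantics and its compilation\<close>

definition upd :: "state => nat => nat => int => state" where
 "upd s x i v = s(x := (s x)(i := v))"

lemma upd_same [simp]: "upd s x i v x = (s x)(i := v)" unfolding upd_def by auto

lemma upd_other [simp]: "y ~= x ==> upd s x i v y = s y" unfolding upd_def by auto

abbreviation Var :: "nat => aexp" where "Var x == Get x (Const 0)"

definition inc :: "nat => state => state" where
 "inc i s = upd s i 0 (s i 0 + 1)"

text \<open>Counted loops only. By \<open>wf\<close> the body writes neither the counter nor the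
  bound, so the number of iterations is fixed on entry and the semantics \<open>den\<close> is a
  total function.\<close>

datatype prg =
  PAsg nat aexp aexp
 | PSeq prg prg  (infixr \<open>;;\<close> 60)
 | PIf aexp prg prg
 | PFor nat nat prg  \<comment> \<open>counter, bound, body\<close>

abbreviation for_guard :: "nat => nat => aexp" where
 "for_guard i b == Sub (Var b) (Var i)"

abbreviation inc_exp :: "nat => aexp" where
 "inc_exp i == Add (Var i) (Const 1)"

primrec compile :: "prg => com" where
 "compile (PAsg x a e) = Assign x a e"
| "compile (c1 ;; c2) = Seq (compile c1) (compile c2)"
| "compile (PIf a c1 c2) = Cond a (compile c1) (compile c2)"
| "compile (PFor i b c) =
   Seq (Assign i (Const 0) (Const 0))
     (While (for_guard i b) (Seq (compile c) (Assign i (Const 0) (inc_exp i))))"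

primrec den :: "prg => state => state" where
 "den (PAsg x a e) = (%s. upd s x (nat (aval a s)) (aval e s))"
| "den (c1 ;; c2) = (%s. den c2 (den c1 s))"
| "den (PIf a c1 c2) = (%s. if aval a s > 0 then den c1 s else den c2 s)"
| "den (PFor i b c) = (%s. ((%s. inc i (den c s)) ^^ nat (s b 0)) (upd s i 0 0))"

definition for_state :: "nat => prg => state => nat => state" where
 "for_state i c s j = ((%s. inc i (den c s)) ^^ j) (upd s i 0 0)"

lemma for_state_0 [simp]: "for_state i c s 0 = upd s i 0 0"
 and for_state_Suc: "for_state i c s (Suc j) = inc i (den c (for_state i c s j))" unfolding for_state_def by auto

lemma den_PFor: "den (PFor i b c) s = for_state i c s (nat (s b 0))" unfolding for_state_def by simp

text \<open>Exact numbers of machine steps. A loop pays 3 for \<open>Seq\<close>, the initialisation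
  and the failing test, and in every iteration 3 for the test, \<open>Seq\<close> and the
  increment.\<close>

primrec stp :: "prg => state => nat" where
 "stp (PAsg x a e) = (%s. 1)"
| "stp (c1 ;; c2) = (%s. 1 + stp c1 s + stp c2 (den c1 s))"
| "stp (PIf a c1 c2) = (%s. 1 + (if aval a s > 0 then stp c1 s else stp c2 s))"
| "stp (PFor i b c) = (%s. 3 + (SUM j<nat (s b 0). stp c (for_state i c s j) + 3))"

primrec tm :: "prg => state => nat" where
 "tm (PAsg x a e) = (%s. 1 + acost a s + acost e s)"
| "tm (c1 ;; c2) = (%s. 1 + tm c1 s + tm c2 (den c1 s))"
| "tm (PIf a c1 c2) = (%s. 1 + acost a s + (if aval a s > 0 then tm c1 s else tm c2 s))"
| "tm (PFor i b c) = (%s. 1 + (1 + acost (Const 0) s + acost (Const 0) s) +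
   (SUM j<nat (s b 0). (1 + acost (for_guard i b) (for_state i c s j)) + 1 + tm c (for_state i c s j) +
    (1 + acost (Const 0) s + acost (inc_exp i) (den c (for_state i c s j)))) +
   (1 + acost (for_guard i b) (for_state i c s (nat (s b 0)))))"

primrec wr :: "prg => nat set" where
 "wr (PAsg x a e) = {x}"
| "wr (c1 ;; c2) = wr c1 Un wr c2"
| "wr (PIf a c1 c2) = wr c1 Un wr c2"
| "wr (PFor i b c) = insert i (wr c)"

primrec wf :: "prg => bool" where
 "wf (PAsg x a e) = (True)"
| "wf (c1 ;; c2) \<longleftrightarrow> wf c1 & wf c2"
| "wf (PIf a c1 c2) = (wf c1 & wf c2)"
| "wf (PFor i b c) = (i ~= b & i ~: wr c & b ~: wr c & wf c)"

lemma den_frame: "x ~: wr c ==> den c s x = s x"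
proof (induction c arbitrary: s)
 case (PFor i b c)
 have "for_state i c s j x = s x" for j using PFor by (induction j) (auto simp: for_state_Suc inc_def)
 thus ?case by (simp only: den_PFor)
qed auto

lemma for_state_frame: "x ~= i ==> x ~: wr c ==> for_state i c s j x = s x" by (induction j) (auto simp: for_state_Suc inc_def den_frame)

lemma for_state_counter: "i ~: wr c ==> for_state i c s j i 0 = int j" by (induction j) (auto simp: for_state_Suc inc_def den_frame)

lemma den_PFor_invariant:
 assumes "i ~: wr c" "Inv 0 (upd s i 0 0)"
  and "!!j s'. j < nat (s b 0) ==> s' i 0 = int j ==> Inv j s' ==> Inv (Suc j) (inc i (den c s'))"
 shows "Inv (nat (s b 0)) (den (PFor i b c) s)"
proof -
 have "j <= nat (s b 0) ==> Inv j (for_state i c s j)" for j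
 proof (induction j)
  case (Suc j)
  thus ?case unfolding for_state_Suc using assms(3)[of j "for_state i c s j"] for_state_counter[OF assms(1), of s j] by simp
 qed (use assms in simp)
 thus ?thesis unfolding den_PFor by simp
qed

text \<open>Unfolds at the first step and starts anywhere, whereas \<open>run\<close> unfolds at the
  last step and starts in the initial configuration.\<close>

primrec stepn :: "int list pmf => nat => config => config pmf" where
 "stepn D 0 cfg = return_pmf cfg"
| "stepn D (Suc k) cfg = bind_pmf (step D cfg) (stepn D k)"

lemma stepn_add: "stepn D (j + k) cfg = bind_pmf (stepn D j cfg) (stepn D k)"
 by (induction j arbitrary: cfg) (auto simp: bind_return_pmf bind_assoc_pmf intro!: bind_pmf_cong)

lemma run_eq_stepn: "run D P xss k = stepn D k ([P], initial_state xss, 0)"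
proof (induction k)
 case (Suc k)
 have "stepn D (k + 1) ([P], initial_state xss, 0) = bind_pmf (run D P xss k) (step D)" unfolding stepn_add Suc
 proof (intro bind_pmf_cong refl)
  have "stepn D 0 = return_pmf" by (rule ext) simp
  thus "stepn D 1 c = step D c" for c by (simp add: bind_return_pmf')
 qed
 thus ?case by simp
qed simp

lemma stepn_idle: "stepn D k ([], s, t) = return_pmf ([], s, t)" by (induction k) (auto simp: bind_return_pmf)

text \<open>A stretch of the run without randomness: after exactly \<open>k\<close> steps the
  configuration is certain.\<close>

definition reaches :: "int list pmf => config => nat => config => bool" where
 "reaches D c k c' = (stepn D k c = return_pmf c')"

lemma reaches_trans: "reaches D c j c' ==> reaches D c' k c'' ==> reaches D c (j + k) c''"
 unfolding reaches_def stepn_add by (simp add: bind_return_pmf)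

lemma reaches_step: "step D c = return_pmf c' ==> reaches D c' k c'' ==> reaches D c (Suc k) c''" unfolding reaches_def by (simp add: bind_return_pmf)

lemma reaches_refl: "reaches D c 0 c" unfolding reaches_def by simp

lemma reaches_one: "step D c = return_pmf c' ==> reaches D c 1 c'" using reaches_step[OF _ reaches_refl] by simp

lemma reaches_compile:
 "wf c ==> reaches D (compile c # cs, s, t) (stp c s) (cs, den c s, t + tm c s)"
proof (induction c arbitrary: cs s t)
 case (PAsg x a e)
 have "step D (compile (PAsg x a e) # cs, s, t) = return_pmf (cs, den (PAsg x a e) s, t + tm (PAsg x a e) s)" by (simp add: upd_def add.assoc)
 thus ?case using reaches_one by simp
next
 case (PSeq c1 c2)
 have "reaches D (compile c1 # compile c2 # cs, s, t + 1) (stp c1 s) (compile c2 # cs, den c1 s, t + 1 + tm c1 s)"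
  by (intro PSeq.IH) (use PSeq.prems in auto)
 moreover have "reaches D (compile c2 # cs, den c1 s, t + 1 + tm c1 s) (stp c2 (den c1 s))
   (cs, den c2 (den c1 s), t + 1 + tm c1 s + tm c2 (den c1 s))" by (intro PSeq.IH) (use PSeq.prems in auto)
 ultimately have "reaches D (compile c1 # compile c2 # cs, s, t + 1) (stp c1 s + stp c2 (den c1 s))
   (cs, den c2 (den c1 s), t + 1 + tm c1 s + tm c2 (den c1 s))" by (rule reaches_trans)
 thus ?case by (auto intro!: reaches_step simp: algebra_simps)
next
 case (PIf a c1 c2)
 show ?case
 proof (cases "aval a s > 0")
  case True
  hence "reaches D (compile c1 # cs, s, t + 1 + acost a s) (stp c1 s) (cs, den c1 s, t + 1 + acost a s + tm c1 s)"
   by (intro PIf.IH) (use PIf.prems in auto)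
  thus ?thesis using True by (auto intro!: reaches_step simp: algebra_simps)
 next
  case False
  hence "reaches D (compile c2 # cs, s, t + 1 + acost a s) (stp c2 s) (cs, den c2 s, t + 1 + acost a s + tm c2 s)"
   by (intro PIf.IH) (use PIf.prems in auto)
  thus ?thesis using False by (auto intro!: reaches_step simp: algebra_simps)
 qed
next
 case (PFor i b c)
 define N where "N = nat (s b 0)"
 define W where "W = While (for_guard i b) (Seq (compile c) (Assign i (Const 0) (inc_exp i)))"
 let ?s = "for_state i c s"
 define ft where "ft j = (1 + acost (for_guard i b) (?s j)) + 1 + tm c (?s j) +
    (1 + acost (Const 0) s + acost (inc_exp i) (den c (?s j)))" for j
 have wf: "i ~= b" "i ~: wr c" "b ~: wr c" "wf c" using PFor.prems by auto
 have guard: "aval (for_guard i b) (?s j) = s b 0 - int j" for j using for_state_frame[of b i c s j] for_state_counter[of i c s j] wf by simp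
 have it: "reaches D (W # cs, ?s 0, t) (SUM j<k. stp c (?s j) + 3) (W # cs, ?s k, t + (SUM j<k. ft j))"
  if "k <= N" for k t using that
 proof (induction k)
  case 0
  thus ?case by (simp add: reaches_refl)
 next
  case (Suc k)
  have pos: "aval (for_guard i b) (?s k) > 0" using Suc.prems unfolding guard N_def by simp
  let ?t = "t + (SUM j<k. ft j)"
  have "reaches D (compile c # Assign i (Const 0) (inc_exp i) # W # cs, ?s k, ?t + 1 + acost (for_guard i b) (?s k) + 1)
    (stp c (?s k)) (Assign i (Const 0) (inc_exp i) # W # cs, den c (?s k), ?t + 1 + acost (for_guard i b) (?s k) + 1 + tm c (?s k))"
   by (rule PFor.IH[OF wf(4)])
  moreover have "reaches D (Assign i (Const 0) (inc_exp i) # W # cs, den c (?s k), ?t + 1 + acost (for_guard i b) (?s k) + 1 + tm c (?s k))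
    1 (W # cs, ?s (Suc k), ?t + ft k)" by (rule reaches_one) (simp add: for_state_Suc inc_def upd_def ft_def)
  ultimately have "reaches D (compile c # Assign i (Const 0) (inc_exp i) # W # cs, ?s k, ?t + 1 + acost (for_guard i b) (?s k) + 1)
    (stp c (?s k) + 1) (W # cs, ?s (Suc k), ?t + ft k)" by (rule reaches_trans)
  hence "reaches D (W # cs, ?s k, ?t) (Suc (Suc (stp c (?s k) + 1))) (W # cs, ?s (Suc k), ?t + ft k)" using pos unfolding W_def
   by (intro reaches_step[where c' = "(Seq (compile c) (Assign i (Const 0) (inc_exp i)) # While (for_guard i b) (Seq (compile c) (Assign i (Const 0) (inc_exp i))) # cs, ?s k, ?t + 1 + acost (for_guard i b) (?s k))"] reaches_step) auto
  from reaches_trans[OF Suc.IH this] show ?case using Suc.prems by (simp add: add.assoc eval_nat_numeral)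
 qed
 have "reaches D (W # cs, ?s N, t') 1 (cs, ?s N, t' + (1 + acost (for_guard i b) (?s N)))" for t'
 proof (rule reaches_one)
  have "~ aval (for_guard i b) (?s N) > 0" unfolding guard N_def by simp
  thus "step D (W # cs, ?s N, t') = return_pmf (cs, ?s N, t' + (1 + acost (for_guard i b) (?s N)))" unfolding W_def by simp
 qed
 from reaches_trans[OF it[OF order_refl] this]
 have "reaches D (W # cs, ?s 0, t'') ((SUM j<N. stp c (?s j) + 3) + 1)
   (cs, ?s N, t'' + (SUM j<N. ft j) + (1 + acost (for_guard i b) (?s N)))" for t'' .
 from this[of "t + 1 + (1 + acost (Const 0) s + acost (Const 0) s)"]
 have "reaches D (compile (PFor i b c) # cs, s, t) (Suc (Suc ((SUM j<N. stp c (?s j) + 3) + 1)))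
   (cs, ?s N, t + 1 + (1 + acost (Const 0) s + acost (Const 0) s) + (SUM j<N. ft j) + (1 + acost (for_guard i b) (?s N)))"
  by (intro reaches_step[where c' = "(Assign i (Const 0) (Const 0) # W # cs, s, t + 1)"] reaches_step)
    (auto simp: W_def upd_def)
 thus ?case unfolding den_PFor N_def ft_def by (simp add: algebra_simps eval_nat_numeral)
qed

section \<open>Bit lengths and running times of tame programs\<close>

primrec esize :: "aexp => nat" where
 "esize (Const z) = 1"
| "esize (Get x a) = 1 + esize a"
| "esize (Add a b) = 1 + esize a + esize b"
| "esize (Sub a b) = 1 + esize a + esize b"
| "esize (Mul a b) = 1 + esize a + esize b"
| "esize (Div a b) = 1 + esize a + esize b"

fun static :: "nat set => aexp => bool" where
 "static St (Const z) = (True)"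
| "static St (Get x a) = (x : St)"
| "static St _ = (False)"

text \<open>
 In a tame expression every product has a factor whose length is bounded in advance. The lengths of
 all numbers then grow only additively in the number of executed commands, so that the time is
 polynomial in this number.
\<close>

primrec tame :: "nat set => nat => aexp => bool" where
 "tame St vc (Const z) = (\<bar>z\<bar> < 2 ^ vc)"
| "tame St vc (Get x a) = (tame St vc a)"
| "tame St vc (Add a b) = (tame St vc a & tame St vc b)"
| "tame St vc (Sub a b) = (tame St vc a & tame St vc b)"
| "tame St vc (Mul a b) = (tame St vc a & tame St vc b & (static St a \<or> static St b))"
| "tame St vc (Div a b) = (tame St vc a & tame St vc b)"

definition bounded_by :: "nat => state => bool" where
 "bounded_by w s = ((ALL x i. \<bar>s x i\<bar> < 2 ^ w))"

definition static_by :: "nat set => nat => state => bool" where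
 "static_by St v s = ((ALL x:St. ALL i. \<bar>s x i\<bar> < 2 ^ v))"

lemma abs_div_le: "\<bar>a div b\<bar> <= \<bar>a :: int\<bar>"
proof -
 have *: "\<bar>a div b\<bar> <= \<bar>a\<bar>" if "0 < b" for a b :: int
 proof (cases "0 <= a")
  case True
  thus ?thesis using that zdiv_mono2[of a 1 b] by (simp add: pos_imp_zdiv_nonneg_iff)
 next
  case False
  have "a * 1 <= a div b"
  proof -
   have "a * b <= a * 1" using False that by (simp add: mult_le_cancel_left)
   hence "a * b div b <= a div b" using that by (intro zdiv_mono1) auto
   thus ?thesis using that by simp
  qed
  moreover have "a div b < 0" using False that by (simp add: div_neg_pos_less0)
  ultimately show ?thesis by simp
 qed
 show ?thesis using *[of b a] *[of "- b" "- a"] by (cases b "0 :: int" rule: linorder_cases) auto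
qed

text \<open>Each node of the expression adds at most \<open>v + 1\<close> bits: a sum adds one bit,
  a product with a static factor adds \<open>v\<close>, a quotient adds none, and an array access is
  again bounded by \<open>w\<close> bits.\<close>

lemma aval_bound:
 assumes "tame St vc a" "bounded_by w s" "static_by St v s" "vc <= v" "v <= w"
 shows "\<bar>aval a s\<bar> < 2 ^ (w + esize a * (v + 1))" using assms(1)
proof (induction a)
 case (Const z)
 have "(2::int) ^ vc <= 2 ^ (w + esize (Const z) * (v + 1))" using assms by (intro power_increasing) auto
 thus ?case using Const by simp
next
 case (Get x a)
 have "(2::int) ^ w <= 2 ^ (w + esize (Get x a) * (v + 1))" by (intro power_increasing) auto
 thus ?case using assms(2) unfolding bounded_by_def by (metis aval.simps(2) order_less_le_trans)
next
 case (Add a b)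
 have p: "(2::int) ^ (w + esize c * (v + 1)) * 2 <= 2 ^ (w + (1 + esize a + esize b) * (v + 1))" if "c = a \<or> c = b" for c
  unfolding power_Suc2 [symmetric] using that by (intro power_increasing) (auto simp: algebra_simps)
 have "\<bar>aval a s + aval b s\<bar> <= \<bar>aval a s\<bar> + \<bar>aval b s\<bar>" by simp
 moreover have "\<bar>aval a s\<bar> < 2 ^ (w + esize a * (v + 1))" "\<bar>aval b s\<bar> < 2 ^ (w + esize b * (v + 1))" using Add by simp_all
 ultimately show ?case unfolding aval.simps esize.simps using p[of a, OF disjI1[OF refl]] p[of b, OF disjI2[OF refl]] by linarith
next
 case (Sub a b)
 have p: "(2::int) ^ (w + esize c * (v + 1)) * 2 <= 2 ^ (w + (1 + esize a + esize b) * (v + 1))" if "c = a \<or> c = b" for c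
  unfolding power_Suc2 [symmetric] using that by (intro power_increasing) (auto simp: algebra_simps)
 have "\<bar>aval a s - aval b s\<bar> <= \<bar>aval a s\<bar> + \<bar>aval b s\<bar>" by simp
 moreover have "\<bar>aval a s\<bar> < 2 ^ (w + esize a * (v + 1))" "\<bar>aval b s\<bar> < 2 ^ (w + esize b * (v + 1))" using Sub by simp_all
 ultimately show ?case unfolding aval.simps esize.simps using p[of a, OF disjI1[OF refl]] p[of b, OF disjI2[OF refl]] by linarith
next
 case (Mul a b)
 have st: "\<bar>aval c s\<bar> < 2 ^ v" if "tame St vc c" "static St c" for c
 proof (cases c)
  case (Const z)
  have "(2::int) ^ vc <= 2 ^ v" using assms(4) by (intro power_increasing) auto
  with that(1) show ?thesis unfolding Const aval.simps tame.simps by (rule less_le_trans)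
 next
  case (Get x a)
  thus ?thesis using that assms(3) unfolding static_by_def by simp
 qed (use that in auto)
 have le: "(2::int) ^ (w + esize c * (v + 1)) * 2 ^ v <= 2 ^ (w + (1 + esize a + esize b) * (v + 1))" if "c = a \<or> c = b" for c
  unfolding power_add [symmetric] using that by (intro power_increasing) (auto simp: algebra_simps)
 have "\<bar>aval a s * aval b s\<bar> < 2 ^ (w + (1 + esize a + esize b) * (v + 1))"
 proof (cases "static St b")
  case True
  have "\<bar>aval a s\<bar> * \<bar>aval b s\<bar> < 2 ^ (w + esize a * (v + 1)) * 2 ^ v" using Mul st[of b] True by (intro mult_strict_mono') auto
  thus ?thesis using le[of a] by (simp add: abs_mult)
 next
  case False
  have "\<bar>aval b s\<bar> * \<bar>aval a s\<bar> < 2 ^ (w + esize b * (v + 1)) * 2 ^ v"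
   using Mul st[of a] False by (intro mult_strict_mono') auto
  thus ?thesis using le[of b] by (simp add: abs_mult mult.commute)
 qed
 thus ?case by simp
next
 case (Div a b)
 have "\<bar>aval a s\<bar> < 2 ^ (w + esize a * (v + 1))" using Div by simp
 also have "... <= 2 ^ (w + (1 + esize a + esize b) * (v + 1))" by (intro power_increasing add_left_mono mult_le_mono1) auto
 finally show ?case using abs_div_le[of "aval a s" "aval b s"] by simp
qed

lemma bit_size_le: "\<bar>z\<bar> < 2 ^ k ==> bit_size z <= k + 1"
 unfolding bit_size_def using floorlog_leI[of "nat \<bar>z\<bar>" 2 k] by (simp add: nat_less_iff)

lemma acost_bound:
 assumes "tame St vc a" "bounded_by w s" "static_by St v s" "vc <= v" "v <= w" "esize a <= K"
 shows "acost a s <= esize a * (w + K * (v + 1) + 1)"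
proof -
 define Q where "Q = w + K * (v + 1) + 1"
 have b: "bit_size (aval a s) <= Q" if "tame St vc a" "esize a <= K" for a
  using bit_size_le[OF aval_bound[OF that(1) assms(2-5)]] mult_le_mono1[OF that(2), of "v + 1"] unfolding Q_def by linarith
 have "acost a s <= esize a * Q" using assms(1,6)
 proof (induction a)
  case (Const z)
  thus ?case using b[OF Const] by simp
 next
  case (Get x a)
  thus ?case using b[OF Get.prems] by simp
 next
  case (Add a1 a2)
  thus ?case using b[OF Add.prems] by (simp add: add_mult_distrib)
 next
  case (Sub a1 a2)
  thus ?case using b[OF Sub.prems] by (simp add: add_mult_distrib)
 next
  case (Mul a1 a2)
  hence "acost a1 s <= esize a1 * Q" "acost a2 s <= esize a2 * Q" by auto
  thus ?case using b[OF Mul.prems] by (simp add: add_mult_distrib)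
 next
  case (Div a1 a2)
  thus ?case using b[OF Div.prems] by (simp add: add_mult_distrib)
 qed
 thus ?thesis unfolding Q_def .
qed

lemma bounded_by_mono: "bounded_by w s ==> w <= w' ==> bounded_by w' s" unfolding bounded_by_def
 by (intro allI, rule less_le_trans[of _ "2 ^ w"]) (auto intro!: power_increasing)

lemma bounded_by_upd: "bounded_by w s ==> \<bar>v\<bar> < 2 ^ w ==> bounded_by w (upd s x i v)" unfolding bounded_by_def upd_def by auto

primrec tame_prg :: "nat set => nat => nat => prg => bool" where
 "tame_prg St vc K (PAsg x a e) = (x ~: St & tame St vc a & tame St vc e & esize a <= K & esize e <= K)"
| "tame_prg St vc K (c1 ;; c2) \<longleftrightarrow> tame_prg St vc K c1 & tame_prg St vc K c2"
| "tame_prg St vc K (PIf a c1 c2) = (tame St vc a & esize a <= K & tame_prg St vc K c1 & tame_prg St vc K c2)"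
| "tame_prg St vc K (PFor i b c) = (i ~: St & tame_prg St vc K c)"

lemma tame_prg_wr: "tame_prg St vc K c ==> wr c Int St = {}" by (induction c) auto

lemma static_by_den: "static_by St v s ==> tame_prg St vc K c ==> static_by St v (den c s)" using tame_prg_wr[of St vc K c] unfolding static_by_def
 by (metis (no_types, lifting) disjoint_iff den_frame)

lemma static_by_for_state:
 "static_by St v s ==> tame_prg St vc K c ==> i ~: St ==> static_by St v (for_state i c s j)" using tame_prg_wr[of St vc K c] unfolding static_by_def
 by (metis (no_types, lifting) disjoint_iff for_state_frame)

text \<open>Bounds the time of one machine step, which evaluates at most two expressions of size at
  most \<open>K\<close>, while the state holds \<open>w\<close>-bit numbers.\<close>

definition step_cost :: "nat => nat => nat => nat" where
 "step_cost K v w = 3 + 2 * (K * (w + K * (v + 1) + 1))"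

lemma step_cost_mono: "w <= w' ==> step_cost K v w <= step_cost K v w'" unfolding step_cost_def by (intro add_left_mono mult_left_mono) auto

text \<open>Every machine step lengthens the numbers by at most \<open>K * (v + 1)\<close> bits. So
  lengths grow linearly in the number of steps, and the time is at most this number times the cost
  of a step at the largest length.\<close>

lemma den_tm_bound:
 assumes "tame_prg St vc K c" "wf c" "bounded_by w s" "static_by St v s"
  and v: "1 <= vc" "vc <= v" "5 <= K" and "v <= w"
 shows "bounded_by (w + stp c s * (K * (v + 1))) (den c s) &
  tm c s <= stp c s * step_cost K v (w + stp c s * (K * (v + 1)))"
proof -
 define G where "G = K * (v + 1)"
 \<comment> \<open>Plain arithmetic stated over variables, so that the large products stay atomic
   when it is applied.\<close>
 have aux1: "1 + x <= 3 + 2 * Q" if "x <= Q" for x Q :: nat using that by simp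
 have aux2: "1 + x + y <= 3 + 2 * Q" if "x <= Q" "y <= Q" for x y Q :: nat using that by simp
 have aux3: "1 + a + b <= (1 + k1 + k2) * S" if "a <= k1 * S" "b <= k2 * S" "1 <= S" for a b k1 k2 S :: nat
  using that by (simp add: add_mult_distrib)
 have aux4: "1 + x + a <= (1 + k) * S" if "1 + x <= S" "a <= k * S" for a x k S :: nat using that by simp
 have aux5: "f + (g + 1 + a + e) <= (k + l + 3) * S"
  if "f <= k * S" "g <= S" "1 <= S" "a <= l * S" "e <= S" for f g a e k l S :: nat using that by (simp add: add_mult_distrib)
 have aux6: "1 + a + f + g <= (3 + k) * S" if "1 <= S" "a <= S" "f <= k * S" "g <= S" for a f g k S :: nat using that by (simp add: add_mult_distrib)
 have ac: "acost a s <= K * (w + K * (v + 1) + 1)" if "tame St vc a" "esize a <= K"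
   "bounded_by w s" "static_by St v s" "v <= w" for a w s
  using order_trans[OF acost_bound[OF that(1,3,4) v(2) that(5,2)] mult_le_mono1[OF that(2)]] .
 have ac1: "1 + acost a s <= step_cost K v w" if "tame St vc a" "esize a <= K"
   "bounded_by w s" "static_by St v s" "v <= w" for a w s unfolding step_cost_def by (rule aux1[OF ac[OF that]])
 have ac2: "1 + acost a s + acost e s <= step_cost K v w" if "tame St vc a" "esize a <= K"
   "tame St vc e" "esize e <= K" "bounded_by w s" "static_by St v s" "v <= w" for a e w s
  unfolding step_cost_def by (rule aux2[OF ac[OF that(1,2,5-7)] ac[OF that(3-7)]])
 have one: "(2::int) ^ 1 <= 2 ^ vc" using v by (intro power_increasing) auto
 have c01: "tame St vc (Const 0)" "tame St vc (Const 1)" using one by auto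
 have guard: "tame St vc (for_guard i b)" "esize (for_guard i b) <= K"
   "tame St vc (inc_exp i)" "esize (inc_exp i) <= K" for i b using c01 v by auto
 have pow: "\<bar>aval a s\<bar> < 2 ^ (w + G)" if "tame St vc a" "esize a <= K" "bounded_by w s" "static_by St v s" "v <= w" for a w s
 proof -
  have "(2::int) ^ (w + esize a * (v + 1)) <= 2 ^ (w + G)" unfolding G_def using that by (intro power_increasing add_left_mono mult_le_mono1) auto
  thus ?thesis using aval_bound[OF that(1,3,4) v(2) that(5)] by linarith
 qed
 have "bounded_by (w + stp c s * G) (den c s) & tm c s <= stp c s * step_cost K v (w + stp c s * G)" using assms(1-4) \<open>v <= w\<close>
 proof (induction c arbitrary: s w)
  case (PAsg x a e)
  have "bounded_by (w + G) (den (PAsg x a e) s)" unfolding den.simps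
  proof (rule bounded_by_upd)
   show "bounded_by (w + G) s" using PAsg by (intro bounded_by_mono[of w s "w + G"]) auto
   show "\<bar>aval e s\<bar> < 2 ^ (w + G)" using PAsg by (intro pow) auto
  qed
  moreover have "1 + acost a s + acost e s <= step_cost K v w" using PAsg by (intro ac2) auto
  moreover have "step_cost K v w <= step_cost K v (w + G)" by (intro step_cost_mono) simp
  ultimately show ?case by simp
 next
  case (PSeq c1 c2)
  let ?k1 = "stp c1 s" and ?k2 = "stp c2 (den c1 s)"
  have 1: "bounded_by (w + ?k1 * G) (den c1 s)" "tm c1 s <= ?k1 * step_cost K v (w + ?k1 * G)" using PSeq by auto
  have "static_by St v (den c1 s)" using PSeq static_by_den by auto
  hence 2: "bounded_by (w + ?k1 * G + ?k2 * G) (den c2 (den c1 s))"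
    "tm c2 (den c1 s) <= ?k2 * step_cost K v (w + ?k1 * G + ?k2 * G)" using PSeq.IH(2)[of "w + ?k1 * G" "den c1 s"] PSeq.prems 1 by auto
  let ?W = "w + (1 + ?k1 + ?k2) * G"
  have "w + ?k1 * G <= ?W" "w + ?k1 * G + ?k2 * G <= ?W" by (auto simp: algebra_simps)
  hence sc: "step_cost K v (w + ?k1 * G) <= step_cost K v ?W"
   "step_cost K v (w + ?k1 * G + ?k2 * G) <= step_cost K v ?W" by (auto intro: step_cost_mono)
  have "bounded_by ?W (den c2 (den c1 s))" using 2(1) by (rule bounded_by_mono) (auto simp: algebra_simps)
  moreover have "1 + tm c1 s + tm c2 (den c1 s) <= (1 + ?k1 + ?k2) * step_cost K v ?W"
   by (rule aux3[OF order_trans[OF 1(2) mult_le_mono2[OF sc(1)]] order_trans[OF 2(2) mult_le_mono2[OF sc(2)]]])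
     (simp add: step_cost_def)
  ultimately show ?case by simp
 next
  case (PIf a c1 c2)
  define c where "c = (if aval a s > 0 then c1 else c2)"
  let ?k = "stp c s"
  have IH: "bounded_by (w + ?k * G) (den c s)" "tm c s <= ?k * step_cost K v (w + ?k * G)" using PIf unfolding c_def by (auto split: if_splits)
  let ?W = "w + (1 + ?k) * G"
  have sc: "step_cost K v w <= step_cost K v ?W" "step_cost K v (w + ?k * G) <= step_cost K v ?W" by (auto intro!: step_cost_mono)
  have "bounded_by ?W (den c s)" using IH(1) by (rule bounded_by_mono) auto
  moreover have "1 + acost a s <= step_cost K v w" using PIf.prems by (intro ac1) auto
  hence "1 + acost a s + tm c s <= (1 + ?k) * step_cost K v ?W"
   by (intro aux4[OF order_trans[OF _ sc(1)] order_trans[OF IH(2) mult_le_mono2[OF sc(2)]]])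
  ultimately show ?case unfolding c_def by (auto split: if_splits)
 next
  case (PFor i b c)
  let ?s = "for_state i c s"
  define k where "k j = (SUM l<j. stp c (?s l) + 3)" for j
  define N where "N = nat (s b 0)"
  have tc: "tame_prg St vc K c" "wf c" "i ~: St" and sb: "static_by St v s" using PFor.prems by auto
  have sbj: "static_by St v (?s j)" for j using static_by_for_state[OF sb tc(1,3)] .
  define ft where "ft j = (1 + acost (for_guard i b) (?s j)) + 1 + tm c (?s j) +
    (1 + acost (Const 0) s + acost (inc_exp i) (den c (?s j)))" for j
  have it: "bounded_by (w + k j * G) (?s j) & (SUM l<j. ft l) <= k j * step_cost K v (w + k j * G)" for j
  proof (induction j)
   case 0
   thus ?case using PFor.prems by (auto simp: k_def intro!: bounded_by_upd)
  next
   case (Suc j)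
   let ?kj = "stp c (?s j)" and ?w = "w + k j * G"
   have B: "bounded_by (?w + ?kj * G) (den c (?s j))" "tm c (?s j) <= ?kj * step_cost K v (?w + ?kj * G)"
    using PFor.IH[OF tc(1,2) _ sbj[of j], of ?w] Suc \<open>v <= w\<close> PFor.prems by auto
   have sbd: "static_by St v (den c (?s j))" using static_by_den[OF sbj tc(1)] .
   have kS: "k (Suc j) = k j + ?kj + 3" unfolding k_def by simp
   let ?W = "w + k (Suc j) * G"
   have vw: "v <= ?w" "v <= ?w + ?kj * G" using PFor.prems by auto
   have "\<bar>aval (inc_exp i) (den c (?s j))\<bar> < 2 ^ (?w + ?kj * G + G)" by (rule pow[OF guard(3,4) B(1) sbd vw(2)])
   moreover have "bounded_by (?w + ?kj * G + G) (den c (?s j))" using B(1) by (rule bounded_by_mono) simp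
   ultimately have "bounded_by (?w + ?kj * G + G) (?s (Suc j))" unfolding for_state_Suc inc_def by (intro bounded_by_upd) auto
   hence b: "bounded_by ?W (?s (Suc j))" by (rule bounded_by_mono) (auto simp: kS algebra_simps)
   have sc: "step_cost K v ?w <= step_cost K v ?W" "step_cost K v (?w + ?kj * G) <= step_cost K v ?W"
    by (auto intro!: step_cost_mono simp: kS algebra_simps)
   have 1: "1 + acost (for_guard i b) (?s j) <= step_cost K v ?W" using ac1[OF guard(1,2) conjunct1[OF Suc] sbj vw(1)] sc(1) by (rule order_trans)
   have 2: "1 + acost (Const 0) s + acost (inc_exp i) (den c (?s j)) <= step_cost K v ?W"
   proof -
    have "1 + acost (Const 0) (den c (?s j)) + acost (inc_exp i) (den c (?s j)) <= step_cost K v ?W"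
     using ac2[OF c01(1) _ guard(3,4) B(1) sbd vw(2)] v by (intro order_trans[OF _ sc(2)]) auto
    thus ?thesis by (simp only: acost.simps(1))
   qed
   have "(SUM l<j. ft l) + ft j <= (k j + ?kj + 3) * step_cost K v ?W" unfolding ft_def
    by (rule aux5[OF order_trans[OF conjunct2[OF Suc, unfolded ft_def] mult_le_mono2[OF sc(1)]] 1 _
       order_trans[OF B(2) mult_le_mono2[OF sc(2)]] 2]) (simp add: step_cost_def)
   thus ?case using b unfolding kS by simp
  qed
  let ?W = "w + (3 + k N) * G"
  have vw: "v <= w + k N * G" using PFor.prems by auto
  have sc: "step_cost K v (w + k N * G) <= step_cost K v ?W" "step_cost K v w <= step_cost K v ?W" by (auto intro!: step_cost_mono)
  have "bounded_by ?W (?s N)" using conjunct1[OF it[of N]] by (rule bounded_by_mono) auto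
  moreover have "1 + (1 + acost (Const 0) s + acost (Const 0) s) + (SUM l<N. ft l) + (1 + acost (for_guard i b) (?s N))
    <= (3 + k N) * step_cost K v ?W"
  proof (rule aux6)
   show "1 + acost (Const 0) s + acost (Const 0) s <= step_cost K v ?W"
    using ac2[OF c01(1) _ c01(1), of w s] PFor.prems v by (intro order_trans[OF _ sc(2)]) auto
   show "1 + acost (for_guard i b) (?s N) <= step_cost K v ?W" using ac1[OF guard(1,2) conjunct1[OF it] sbj vw] sc(1) by (rule order_trans)
   show "(SUM l<N. ft l) <= k N * step_cost K v ?W" using order_trans[OF conjunct2[OF it] mult_le_mono2[OF sc(1)]] .
   show "1 <= step_cost K v ?W" unfolding step_cost_def by simp
  qed
  moreover have "stp (PFor i b c) s = 3 + k N" unfolding k_def N_def by simp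
  moreover have "tm (PFor i b c) s = 1 + (1 + acost (Const 0) s + acost (Const 0) s) + (SUM l<N. ft l) + (1 + acost (for_guard i b) (?s N))"
   unfolding ft_def N_def tm.simps by simp
  moreover have "den (PFor i b c) s = ?s N" unfolding den_PFor N_def ..
  ultimately show ?case by metis
 qed
 thus ?thesis unfolding G_def .
qed

primrec bnds :: "prg => nat set" where
 "bnds (PAsg x a e) = {}"
| "bnds (c1 ;; c2) = bnds c1 Un bnds c2"
| "bnds (PIf a c1 c2) = bnds c1 Un bnds c2"
| "bnds (PFor i b c) = insert b (bnds c)"

text \<open>Both branches of a conditional are added, which makes the bound depend on the loop
  bounds \<open>bt\<close> alone and not on the state.\<close>

primrec max_steps :: "prg => (nat => nat) => nat" where
 "max_steps (PAsg x a e) bt = 1"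
| "max_steps (c1 ;; c2) bt = 1 + max_steps c1 bt + max_steps c2 bt"
| "max_steps (PIf a c1 c2) bt = 1 + max_steps c1 bt + max_steps c2 bt"
| "max_steps (PFor i b c) bt = 3 + bt b * (max_steps c bt + 3)"

lemma stp_le_max_steps:
 assumes "bnds c Int W = {}" "wr c <= W" "!!b. b : bnds c ==> nat (s b 0) <= bt b"
 shows "stp c s <= max_steps c bt" using assms
proof (induction c arbitrary: s)
 case (PSeq c1 c2)
 have "stp c1 s <= max_steps c1 bt" using PSeq by (intro PSeq.IH) auto
 moreover have "den c1 s b = s b" if "b : bnds c2" for b using that PSeq.prems by (intro den_frame) auto
 hence "stp c2 (den c1 s) <= max_steps c2 bt" using PSeq.prems by (intro PSeq.IH) auto
 ultimately show ?case by simp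
next
 case (PIf a c1 c2)
 have "stp c1 s <= max_steps c1 bt" "stp c2 s <= max_steps c2 bt" using PIf.prems by (auto intro!: PIf.IH)
 thus ?case by simp
next
 case (PFor i b c)
 have "stp c (for_state i c s j) <= max_steps c bt" for j
 proof (rule PFor.IH)
  fix b' assume b': "b' : bnds c"
  hence "for_state i c s j b' = s b'" using PFor.prems by (intro for_state_frame) auto
  thus "nat (for_state i c s j b' 0) <= bt b'" using PFor.prems b' by auto
 qed (use PFor.prems in auto)
 hence "(SUM j<nat (s b 0). stp c (for_state i c s j) + 3) <= (SUM j<nat (s b 0). max_steps c bt + 3)" by (intro sum_mono) simp
 also have "... <= bt b * (max_steps c bt + 3)" using PFor.prems by (simp add: mult_le_mono1)
 finally show ?case by simp
qed simp

section \<open>Two loops outside the structured language: halving and sampling\<close>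

abbreviation halving :: "nat => nat => com" where
 "halving x l == While (Var x) (Seq (Assign x (Const 0) (Div (Var x) (Const 2))) (Assign l (Const 0) (inc_exp l)))"

lemma reaches_halving:
 assumes xl: "x ~= l"
 shows "0 <= s x 0 ==> bounded_by w s ==> static_by {} v s ==> 2 <= v ==> v <= w ==>
  EX t'. reaches D (halving x l # cs, s, t) (1 + 4 * floorlog 2 (nat (s x 0)))
   (cs, upd (upd s x 0 0) l 0 (s l 0 + int (floorlog 2 (nat (s x 0)))), t + t') &
   t' <= (1 + 4 * floorlog 2 (nat (s x 0))) * step_cost 5 v (w + floorlog 2 (nat (s x 0)) * (5 * (v + 1)))"
proof (induction "nat (s x 0)" arbitrary: s t w rule: less_induct)
 case less
 have tm: "tame {} 2 (Var x)" "tame {} 2 (Div (Var x) (Const 2))" "tame {} 2 (inc_exp l)" "tame {} 2 (Const 0)" by auto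
 have ac: "acost a s' <= 5 * (w' + 5 * (v + 1) + 1)"
  if "tame {} 2 a" "esize a <= 5" "bounded_by w' s'" "v <= w'" for a s' w'
 proof -
  have "static_by {} v s'" unfolding static_by_def by simp
  from acost_bound[OF that(1,3) this less.prems(4) that(4,2)]
  show ?thesis using mult_le_mono1[OF that(2), of "w' + 5 * (v + 1) + 1"] by linarith
 qed
 show ?case
 proof (cases "s x 0 = 0")
  case True
  have eq: "upd (upd s x 0 0) l 0 (s l 0 + int (floorlog 2 (nat (s x 0)))) = s" using True xl by (auto simp: upd_def fun_eq_iff floorlog_def)
  have "reaches D (halving x l # cs, s, t) 1 (cs, s, t + (1 + acost (Var x) s))" by (rule reaches_one) (use True in simp)
  moreover have "1 + acost (Var x) s <= step_cost 5 v w" using ac[OF tm(1) _ less.prems(2,5)] unfolding step_cost_def by simp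
  ultimately show ?thesis using True eq by (intro exI[of _ "1 + acost (Var x) s"]) (simp add: floorlog_def)
 next
  case False
  hence pos: "0 < s x 0" using less.prems(1) by simp
  define s1 where "s1 = upd s x 0 (s x 0 div 2)"
  define s2 where "s2 = upd s1 l 0 (s1 l 0 + 1)"
  have fl: "floorlog 2 (nat (s x 0)) = Suc (floorlog 2 (nat (s x 0) div 2))" using pos compute_floorlog[of 2 "nat (s x 0)"] by auto
  have x2: "s2 x 0 = s x 0 div 2" "nat (s2 x 0) = nat (s x 0) div 2" using xl pos unfolding s2_def s1_def by (auto simp: nat_div_distrib)
  have b1: "bounded_by w s1" unfolding s1_def using less.prems(2) abs_div_le[of "s x 0" 2]
   by (intro bounded_by_upd) (auto simp: bounded_by_def intro: le_less_trans)
  have "\<bar>s1 l 0 + 1\<bar> < 2 ^ (w + 5 * (v + 1))"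
  proof -
   have "\<bar>s1 l 0\<bar> < 2 ^ w" using b1 unfolding bounded_by_def by simp
   moreover have "(2::int) ^ w * 2 <= 2 ^ (w + 5 * (v + 1))" unfolding power_Suc2 [symmetric] by (intro power_increasing) auto
   moreover have "(1::int) <= 2 ^ w" by simp
   ultimately show ?thesis by linarith
  qed
  hence b2: "bounded_by (w + 5 * (v + 1)) s2" unfolding s2_def using bounded_by_mono[OF b1, of "w + 5 * (v + 1)"] by (intro bounded_by_upd) auto
  define c1 where "c1 = 1 + acost (Var x) s"
  define c2 where "c2 = 1 + acost (Const 0) s + acost (Div (Var x) (Const 2)) s"
  define c3 where "c3 = 1 + acost (Const 0) s1 + acost (inc_exp l) s1"
  let ?t = "t + c1 + 1 + c2 + c3"
  obtain t' where t': "reaches D (halving x l # cs, s2, ?t) (1 + 4 * floorlog 2 (nat (s2 x 0)))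
    (cs, upd (upd s2 x 0 0) l 0 (s2 l 0 + int (floorlog 2 (nat (s2 x 0)))), ?t + t')"
   "t' <= (1 + 4 * floorlog 2 (nat (s2 x 0))) *
    step_cost 5 v ((w + 5 * (v + 1)) + floorlog 2 (nat (s2 x 0)) * (5 * (v + 1)))"
  proof -
   have lt: "nat (s2 x 0) < nat (s x 0)" "0 <= s2 x 0" using x2 pos by auto
   have "static_by {} v s2" "v <= w + 5 * (v + 1)" using less.prems by (auto simp: static_by_def)
   from less.hyps[OF lt b2 this(1) less.prems(4) this(2)] show ?thesis using that by blast
  qed
  have st: "upd (upd s2 x 0 0) l 0 (s2 l 0 + int (floorlog 2 (nat (s2 x 0)))) =
    upd (upd s x 0 0) l 0 (s l 0 + int (floorlog 2 (nat (s x 0))))"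
   unfolding x2(2) fl using xl unfolding s2_def s1_def by (auto simp: upd_def fun_eq_iff)
  have "reaches D (halving x l # cs, s, t) (Suc (Suc (Suc (Suc (1 + 4 * floorlog 2 (nat (s2 x 0)))))))
    (cs, upd (upd s2 x 0 0) l 0 (s2 l 0 + int (floorlog 2 (nat (s2 x 0)))), ?t + t')" using t'(1) pos
   by (intro reaches_step[where c' = "(Seq (Assign x (Const 0) (Div (Var x) (Const 2))) (Assign l (Const 0) (inc_exp l)) # halving x l # cs, s, t + c1)"]
      reaches_step[where c' = "(Assign x (Const 0) (Div (Var x) (Const 2)) # Assign l (Const 0) (inc_exp l) # halving x l # cs, s, t + c1 + 1)"]
      reaches_step[where c' = "(Assign l (Const 0) (inc_exp l) # halving x l # cs, s1, t + c1 + 1 + c2)"]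
      reaches_step[where c' = "(halving x l # cs, s2, ?t)"])
     (auto simp: s1_def s2_def upd_def c1_def c2_def c3_def)
  hence 1: "reaches D (halving x l # cs, s, t) (1 + 4 * floorlog 2 (nat (s x 0)))
    (cs, upd (upd s x 0 0) l 0 (s l 0 + int (floorlog 2 (nat (s x 0)))), t + (c1 + 1 + c2 + c3 + t'))"
  proof -
   have "Suc (Suc (Suc (Suc (1 + 4 * floorlog 2 (nat (s2 x 0)))))) = 1 + 4 * floorlog 2 (nat (s x 0))" unfolding x2(2) fl by simp
   moreover have "?t + t' = t + (c1 + 1 + c2 + c3 + t')" by simp
   moreover assume "reaches D (halving x l # cs, s, t) (Suc (Suc (Suc (Suc (1 + 4 * floorlog 2 (nat (s2 x 0)))))))
    (cs, upd (upd s2 x 0 0) l 0 (s2 l 0 + int (floorlog 2 (nat (s2 x 0)))), ?t + t')"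
   ultimately show ?thesis unfolding st by (simp only:)
  qed
  define S where "S = step_cost 5 v (w + floorlog 2 (nat (s x 0)) * (5 * (v + 1)))"
  have wS: "step_cost 5 v w <= S" unfolding S_def by (intro step_cost_mono) simp
  have "c1 <= S" "c2 <= S" "c3 <= S" "1 <= S"
  proof -
   show "c1 <= S" unfolding c1_def using ac[OF tm(1) _ less.prems(2,5)] by (intro order_trans[OF _ wS]) (simp add: step_cost_def)
   show "c2 <= S" unfolding c2_def using ac[OF tm(4) _ less.prems(2,5)] ac[OF tm(2) _ less.prems(2,5)]
    by (intro order_trans[OF _ wS]) (simp add: step_cost_def)
   show "c3 <= S" unfolding c3_def using ac[OF tm(4) _ b1 less.prems(5)] ac[OF tm(3) _ b1 less.prems(5)]
    by (intro order_trans[OF _ wS]) (simp add: step_cost_def)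
   show "1 <= S" unfolding S_def step_cost_def by simp
  qed
  moreover have "t' <= (1 + 4 * floorlog 2 (nat (s x 0) div 2)) * S" using t'(2) unfolding S_def x2(2) fl by (simp add: algebra_simps)
  ultimately have "c1 + 1 + c2 + c3 + t' <= (1 + 4 * floorlog 2 (nat (s x 0))) * S" unfolding fl by (simp add: algebra_simps)
  thus ?thesis using 1 unfolding S_def by blast
 qed
qed

abbreviation sampling :: "nat => nat => nat => prg => com" where
 "sampling i b x c ==
   While (for_guard i b) (Seq (Sample x) (Seq (compile c) (Assign i (Const 0) (inc_exp i))))"

definition draw :: "nat => nat => prg => state => int list => state" where
 "draw i x c s xs = inc i (den c (s(x := array_of xs)))"

primrec draw_time :: "nat => nat => nat => prg => state => int list list => nat" where
 "draw_time i b x c s [] = 1 + acost (for_guard i b) s"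
| "draw_time i b x c s (xs # xss) =
   (1 + acost (for_guard i b) s) + 1 + (1 + list_size xs) + 1 + tm c (s(x := array_of xs)) +
   (1 + acost (Const 0) s + acost (inc_exp i) (den c (s(x := array_of xs)))) +
   draw_time i b x c (draw i x c s xs) xss"

text \<open>The number of steps per sample is the constant \<open>kc\<close>, not merely bounded:
  then all outcomes leave the loop at the same step, and the configuration is the image of a list of
  \<open>M\<close> independent samples.\<close>

lemma stepn_sampling:
 assumes wf: "wf c" "i ~: wr c" "b ~: wr c" "i ~= b" "i ~= x" "b ~= x"
  and Inv: "!!s xs. Inv s ==> xs : set_pmf D ==> stp c (s(x := array_of xs)) = kc & Inv (draw i x c s xs)"
 shows "Inv s ==> s b 0 - s i 0 = int M ==>
  stepn D (M * (5 + kc) + 1) (sampling i b x c # cs, s, t) =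
  map_pmf (%xss. (cs, foldl (draw i x c) s xss, t + draw_time i b x c s xss)) (replicate_pmf M D)"
proof (induction M arbitrary: s t)
 case 0
 thus ?case by (simp add: bind_return_pmf)
next
 case (Suc M)
 let ?g = "1 + acost (for_guard i b) s"
 have pos: "aval (for_guard i b) s > 0" using Suc.prems(2) by simp
 have it: "stepn D (2 + kc + (M * (5 + kc) + 1))
   (Seq (compile c) (Assign i (Const 0) (inc_exp i)) # sampling i b x c # cs, s(x := array_of xs), t + ?g + 1 + (1 + list_size xs)) =
   map_pmf (%xss. (cs, foldl (draw i x c) s (xs # xss), t + draw_time i b x c s (xs # xss))) (replicate_pmf M D)"
  if xs: "xs : set_pmf D" for xs
 proof -
  define s1 where "s1 = s(x := array_of xs)"
  let ?t1 = "t + ?g + 1 + (1 + list_size xs)"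
  let ?t2 = "?t1 + 1 + tm c s1 + (1 + acost (Const 0) s + acost (inc_exp i) (den c s1))"
  have kc: "stp c s1 = kc" and inv: "Inv (draw i x c s xs)" using Inv[OF Suc.prems(1) xs] unfolding s1_def by auto
  have "reaches D (compile c # Assign i (Const 0) (inc_exp i) # sampling i b x c # cs, s1, ?t1 + 1) kc
    (Assign i (Const 0) (inc_exp i) # sampling i b x c # cs, den c s1, ?t1 + 1 + tm c s1)"
   using reaches_compile[OF wf(1)] unfolding kc [symmetric] .
  moreover have "reaches D (Assign i (Const 0) (inc_exp i) # sampling i b x c # cs, den c s1, ?t1 + 1 + tm c s1) 1
    (sampling i b x c # cs, draw i x c s xs, ?t2)" by (rule reaches_one) (simp add: draw_def inc_def upd_def s1_def)
  ultimately have "reaches D (compile c # Assign i (Const 0) (inc_exp i) # sampling i b x c # cs, s1, ?t1 + 1) (kc + 1)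
    (sampling i b x c # cs, draw i x c s xs, ?t2)" by (rule reaches_trans)
  hence "reaches D (Seq (compile c) (Assign i (Const 0) (inc_exp i)) # sampling i b x c # cs, s1, ?t1) (Suc (kc + 1))
    (sampling i b x c # cs, draw i x c s xs, ?t2)" by (intro reaches_step) auto
  hence r: "stepn D (2 + kc) (Seq (compile c) (Assign i (Const 0) (inc_exp i)) # sampling i b x c # cs, s1, ?t1) =
    return_pmf (sampling i b x c # cs, draw i x c s xs, ?t2)" unfolding reaches_def by (simp add: eval_nat_numeral)
  have "draw i x c s xs b = s b" "draw i x c s xs i 0 = s i 0 + 1" unfolding draw_def inc_def using wf den_frame[of b c] den_frame[of i c] by auto
  hence "draw i x c s xs b 0 - draw i x c s xs i 0 = int M" using Suc.prems(2) by simp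
  from Suc.IH[OF inv this, of ?t2]
  show ?thesis unfolding stepn_add[of D "2 + kc" "M * (5 + kc) + 1"] s1_def [symmetric] r bind_return_pmf
   by (simp only: foldl_Cons draw_time.simps s1_def [symmetric] add.assoc)
 qed
 have k: "Suc M * (5 + kc) + 1 = Suc (Suc (Suc (2 + kc + (M * (5 + kc) + 1))))" by simp
 have "stepn D (Suc M * (5 + kc) + 1) (sampling i b x c # cs, s, t) =
   bind_pmf D (%xs. stepn D (2 + kc + (M * (5 + kc) + 1))
   (Seq (compile c) (Assign i (Const 0) (inc_exp i)) # sampling i b x c # cs, s(x := array_of xs), t + ?g + 1 + (1 + list_size xs)))"
  unfolding k stepn.simps using pos by (simp add: bind_return_pmf bind_map_pmf)
 also have "... = bind_pmf D (%xs. map_pmf (%xss. (cs, foldl (draw i x c) s (xs # xss), t + draw_time i b x c s (xs # xss))) (replicate_pmf M D))"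
  using it by (intro bind_pmf_cong refl)
 also have "... = map_pmf (%xss. (cs, foldl (draw i x c) s xss, t + draw_time i b x c s xss)) (replicate_pmf (Suc M) D)"
  by (simp add: map_bind_pmf map_pmf_def bind_assoc_pmf bind_return_pmf)
 finally show ?case .
qed

text \<open>Sampled lists do not come from tame assignments, so their entries are bounded
  separately, through membership in \<open>X\<close>.\<close>

lemma draw_bound:
 assumes c: "tame_prg St vc K c" "wf c" "x ~: St" "i ~: St" and v: "1 <= vc" "vc <= v" "5 <= K"
  and Inv: "!!s xs. Inv s ==> xs : X ==> stp c (s(x := array_of xs)) = kc & Inv (draw i x c s xs)"
  and X: "!!xs j. xs : X ==> \<bar>array_of xs j\<bar> < 2 ^ v" "!!xs. xs : X ==> list_size xs <= lz"
 shows "Inv s ==> bounded_by w s ==> static_by St v s ==> v <= w ==> set xss <= X ==>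
  bounded_by (w + length xss * ((kc + 1) * (K * (v + 1)))) (foldl (draw i x c) s xss) &
  draw_time i b x c s xss <= (1 + length xss) * ((kc + 5) * step_cost K v (w + length xss * ((kc + 1) * (K * (v + 1)))) + lz)"
proof (induction xss arbitrary: s w)
 case Nil
 have "1 + acost (for_guard i b) s <= step_cost K v w"
 proof -
  have t: "tame St vc (for_guard i b)" using v by (simp add: order_less_le_trans[of 0 1])
  have "esize (for_guard i b) <= K" using v by simp
  from order_trans[OF acost_bound[OF t Nil(2,3) v(2) Nil(4) this] mult_le_mono1[OF this]]
  show ?thesis unfolding step_cost_def by linarith
 qed
 moreover have "step_cost K v w <= (kc + 5) * step_cost K v w" by simp
 ultimately have "draw_time i b x c s [] <= (kc + 5) * step_cost K v w" unfolding draw_time.simps by (rule order_trans)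
 thus ?case using Nil.prems by (simp del: draw_time.simps)
next
 case (Cons xs xss)
 define G where "G = K * (v + 1)"
 define s1 where "s1 = s(x := array_of xs)"
 define w1 where "w1 = w + (kc + 1) * G"
 have xs: "xs : X" "set xss <= X" using Cons.prems by auto
 have kc: "stp c s1 = kc" and inv: "Inv (draw i x c s xs)" using Inv[OF Cons.prems(1) xs(1)] unfolding s1_def by auto
 have pw: "(2::int) ^ v <= 2 ^ w" using Cons.prems(4) by (intro power_increasing) auto
 have b1: "bounded_by w s1" using Cons.prems(2) less_le_trans[OF X(1)[OF xs(1)] pw] unfolding bounded_by_def s1_def by auto
 have st1: "static_by St v s1" using Cons.prems(3) c(3) unfolding static_by_def s1_def by auto
 have B: "bounded_by (w + kc * G) (den c s1)" "tm c s1 <= kc * step_cost K v (w + kc * G)"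
  using den_tm_bound[OF c(1,2) b1 st1 v Cons.prems(4)] unfolding kc G_def by auto
 have st2: "static_by St v (den c s1)" using static_by_den[OF st1 c(1)] .
 have one: "(2::int) ^ 1 <= 2 ^ vc" using v by (intro power_increasing) auto
 have t: "tame St vc (for_guard i b)" "tame St vc (inc_exp i)" "tame St vc (Const 0)"
  and e: "esize (for_guard i b) <= K" "esize (inc_exp i) <= K" "esize (Const 0) <= K" using one v by auto
 have vw: "v <= w + kc * G" using Cons.prems by simp
 have "\<bar>aval (inc_exp i) (den c s1)\<bar> < 2 ^ ((w + kc * G) + esize (inc_exp i) * (v + 1))" using aval_bound[OF t(2) B(1) st2 v(2) vw] .
 also have "(2::int) ^ ((w + kc * G) + esize (inc_exp i) * (v + 1)) <= 2 ^ w1"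
 proof (intro power_increasing)
  have "esize (inc_exp i) * (v + 1) <= G" unfolding G_def using e(2) by (rule mult_le_mono1)
  thus "(w + kc * G) + esize (inc_exp i) * (v + 1) <= w1" unfolding w1_def add_mult_distrib by linarith
 qed simp
 finally have "bounded_by w1 (draw i x c s xs)" unfolding draw_def inc_def s1_def [symmetric]
  using bounded_by_mono[OF B(1), of w1] unfolding w1_def by (intro bounded_by_upd) auto
 moreover have "static_by St v (draw i x c s xs)"
  unfolding draw_def inc_def s1_def [symmetric] using st2 c(4) unfolding static_by_def by (metis upd_other)
 moreover have "v <= w1" using Cons.prems unfolding w1_def by simp
 ultimately have IH: "bounded_by (w1 + length xss * ((kc + 1) * G)) (foldl (draw i x c) (draw i x c s xs) xss)"
   "draw_time i b x c (draw i x c s xs) xss <= (1 + length xss) * ((kc + 5) * step_cost K v (w1 + length xss * ((kc + 1) * G)) + lz)"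
  using Cons.IH[OF inv, of w1] xs(2) unfolding G_def by auto
 define W where "W = w + length (xs # xss) * ((kc + 1) * G)"
 have W: "w1 + length xss * ((kc + 1) * G) = W" unfolding W_def w1_def by simp
 define S where "S = step_cost K v W"
 have sc: "step_cost K v w <= S" "step_cost K v (w + kc * G) <= S" unfolding S_def W_def by (auto intro!: step_cost_mono simp: algebra_simps)
 have ac: "1 + acost a s' <= S" if "tame St vc a" "esize a <= K" "bounded_by w' s'" "static_by St v s'" "v <= w'" "step_cost K v w' <= S" for a s' w'
 proof -
  have "acost a s' <= K * (w' + K * (v + 1) + 1)" using order_trans[OF acost_bound[OF that(1,3,4) v(2) that(5,2)] mult_le_mono1[OF that(2)]] .
  hence "1 + acost a s' <= step_cost K v w'" unfolding step_cost_def by linarith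
  thus ?thesis using that(6) by linarith
 qed
 have "1 + acost (for_guard i b) s <= S" using ac[OF t(1) e(1) Cons.prems(2,3,4) sc(1)] .
 moreover have "1 + acost (inc_exp i) (den c s1) <= S" using ac[OF t(2) e(2) B(1) st2 vw sc(2)] .
 moreover have "1 + acost (Const 0) s <= S" using ac[OF t(3) e(3) Cons.prems(2,3,4) sc(1)] .
 moreover have "3 <= S" unfolding S_def step_cost_def by simp
 moreover have "tm c s1 <= kc * S" using order_trans[OF B(2) mult_le_mono2[OF sc(2)]] .
 moreover have "list_size xs <= lz" using X(2)[OF xs(1)] .
 ultimately have "(1 + acost (for_guard i b) s) + 1 + (1 + list_size xs) + 1 + tm c s1 +
   (1 + acost (Const 0) s + acost (inc_exp i) (den c s1)) <= (kc + 5) * S + lz" unfolding add_mult_distrib by linarith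
 thus ?case using IH unfolding G_def [symmetric] W_def [symmetric] S_def [symmetric] W s1_def by (simp add: algebra_simps)
qed

section \<open>The program for Prim's algorithm\<close>

abbreviation "aN == 4::nat"
abbreviation "aS == 5::nat"
abbreviation "aNN == 6::nat"
abbreviation "aDEN == 7::nat"
abbreviation "aC == 8::nat"
abbreviation "aIN == 32::nat"
abbreviation "aTT == 33::nat"
abbreviation "aTOT == 34::nat"
abbreviation "aEP == 37::nat"
abbreviation "aK == 38::nat"
abbreviation "aUU == 39::nat"
abbreviation "aVV == 40::nat"
abbreviation "aBB == 41::nat"
abbreviation "aIT == 42::nat"

abbreviation assign :: "nat => aexp => prg" (infix \<open>:=:\<close> 61) where
 "x :=: e == PAsg x (Const 0) e"

abbreviation skip :: prg where "skip == 99 :=: Const 0"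

abbreviation Vminus1 :: "nat => aexp" where "Vminus1 x == Sub (Var x) (Const 1)"

text \<open>\<open>aBB\<close> holds the best pair index plus one, and \<open>0\<close> as long as
  there is none; \<open>enc_opt\<close> is this encoding.\<close>

definition prim_scan :: prg where
 "prim_scan = PFor aK aNN (
   aUU :=: Div (Var aK) (Var aN) ;;
   aVV :=: Sub (Var aK) (Mul (Var aUU) (Var aN)) ;;
   PIf (Get aIN (Var aUU))
    (PIf (Get aTT (Var aVV))
     (PIf (Sub (Const 1) (Get aIN (Var aVV)))
       (PIf (Var aBB)
        (PIf (Sub (Get aC (Vminus1 aBB)) (Get aC (Var aK))) (aBB :=: inc_exp aK) skip)
        (aBB :=: inc_exp aK))
       skip)
     skip)
    skip)"

text \<open>Edges are appended to array \<open>0\<close>, overwriting the input list, with the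
  smaller endpoint first as \<open>edges\<close> demands. The counter \<open>aEP\<close> is not
  reset between runs, so that consecutive runs concatenate their outputs.\<close>

definition prim_add :: prg where
 "prim_add = PIf (Var aBB) (
   aUU :=: Div (Vminus1 aBB) (Var aN) ;;
   aVV :=: Sub (Vminus1 aBB) (Mul (Var aUU) (Var aN)) ;;
   PAsg aIN (Var aVV) (Const 1) ;;
   aTOT :=: Add (Var aTOT) (Get aC (Vminus1 aBB)) ;;
   PIf (Sub (Var aVV) (Var aUU))
    (PAsg 0 (Add (Mul (Const 2) (Var aEP)) (Const 1)) (Var aUU) ;;
    PAsg 0 (Add (Mul (Const 2) (Var aEP)) (Const 2)) (Var aVV))
    (PAsg 0 (Add (Mul (Const 2) (Var aEP)) (Const 1)) (Var aVV) ;;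
    PAsg 0 (Add (Mul (Const 2) (Var aEP)) (Const 2)) (Var aUU)) ;;
   aEP :=: inc_exp aEP ;;
   0 :=: Mul (Const 2) (Var aEP))
  skip"

definition prim_prg :: prg where
 "prim_prg = aTOT :=: Const 0 ;; PFor aIT aN (aBB :=: Const 0 ;; prim_scan ;; prim_add)"

lemma wr_prim: "wr prim_prg = {aTOT, aIT, aBB, aK, aUU, aVV, aIN, aEP, 0, 99}" unfolding prim_prg_def prim_scan_def prim_add_def by auto

lemma wf_prim: "wf prim_prg" unfolding prim_prg_def prim_scan_def prim_add_def by simp

definition enc_opt :: "nat option => int" where
 "enc_opt x = (case x of None => 0 | Some k => int k + 1)"

lemma enc_opt_simps [simp]: "enc_opt None = 0" "enc_opt (Some k) = int k + 1" unfolding enc_opt_def by auto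

definition out_list :: "state => (nat \<times> nat) list => bool" where
 "out_list st es = (st aEP 0 = int (length es) & st 0 0 = 2 * int (length es) &
   (ALL j<length es. st 0 (2 * j + 1) = int (min (fst (es ! j)) (snd (es ! j))) &
          st 0 (2 * j + 2) = int (max (fst (es ! j)) (snd (es ! j)))))"

definition setof :: "nat => state => nat => nat set" where
 "setof n st x = {v. v < n & 0 < st x v}"

context core
begin

definition env :: "state => bool" where
 "env st = (st aN 0 = int n & st aNN 0 = int (n * n) & st aS 0 = int s &
   (ALL k<n * n. ri (st aC k) = d (k div n) (k mod n)))"

lemma n_pos: "0 < n" using s_less by simp

lemma env_frame: "env st ==> (!!x. x : {aN, aNN, aS, aC} ==> st' x = st x) ==> env st'" unfolding env_def by auto

lemma den_prim_scan:
 assumes e: "env st" and b: "st aBB 0 = 0"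
 defines "S == setof n st aIN" and "T == setof n st aTT"
 shows "den prim_scan st aBB 0 = enc_opt (first_min (%k. k div n : S & k mod n : T & k mod n ~: S)
   (%k. d (k div n) (k mod n)) (n * n))"
proof -
 define P where "P = (%k. k div n : S & k mod n : T & k mod n ~: S)"
 define f where "f = (%k. d (k div n) (k mod n))"
 define Inv where "Inv j t = (t aBB 0 = enc_opt (first_min P f j) &
   (ALL x. x ~: {aBB, aK, aUU, aVV, 99} --> t x = st x))" for j and t :: state
 have nn: "nat (st aNN 0) = n * n" using e unfolding env_def by (simp del: of_nat_mult)
 have "Inv (nat (st aNN 0)) (den prim_scan st)" unfolding prim_scan_def
 proof (rule den_PFor_invariant)
  show "Inv 0 (upd st aK 0 0)" using b unfolding Inv_def by auto
 next
  fix j t assume j: "j < nat (st aNN 0)" and tk: "t aK 0 = int j" and I: "Inv j t"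
  have jn: "j < n * n" using j nn by simp
  hence dm: "j div n < n" "j mod n < n" using n_pos by (auto simp: less_mult_imp_div_less)
  have fr: "t aN = st aN" "t aC = st aC" "t aIN = st aIN" "t aTT = st aTT" using I unfolding Inv_def by auto
  have tn: "st aN 0 = int n" using e unfolding env_def by simp
  have vv: "int j - int j div int n * int n = int (j mod n)" by (metis minus_div_mult_eq_mod of_nat_mod)
  have uu: "nat (int j div int n) = j div n" by (simp add: nat_div_distrib)
  have Pj: "P j = (0 < st aIN (j div n) & 0 < st aTT (j mod n) & ~ 0 < st aIN (j mod n))" unfolding P_def S_def T_def setof_def using dm by auto
  have c: "ri (st aC k) = f k" if "k < n * n" for k using e that unfolding env_def f_def by auto
  have cmp: "st aC j < st aC k \<longleftrightarrow> f j < f k" if "k < n * n" for k using c[OF that] c[OF jn] by linarith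
  show "Inv (Suc j) (inc aK (den (aUU :=: Div (Var aK) (Var aN) ;;
   aVV :=: Sub (Var aK) (Mul (Var aUU) (Var aN)) ;;
   PIf (Get aIN (Var aUU))
    (PIf (Get aTT (Var aVV))
     (PIf (Sub (Const 1) (Get aIN (Var aVV)))
       (PIf (Var aBB)
        (PIf (Sub (Get aC (Vminus1 aBB)) (Get aC (Var aK))) (aBB :=: inc_exp aK) skip)
        (aBB :=: inc_exp aK))
       skip)
     skip)
    skip) t))"
  proof (cases "first_min P f j")
   case None
   thus ?thesis using I unfolding Inv_def inc_def by (auto simp: tk fr tn vv uu Pj)
  next
   case (Some b)
   have "b < n * n" using first_min_Some[OF Some] jn by simp
   thus ?thesis using I Some unfolding Inv_def inc_def by (auto simp: tk fr tn vv uu Pj cmp)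
  qed
 qed auto
 thus ?thesis unfolding Inv_def nn P_def f_def by simp
qed

lemma out_list_snoc:
 assumes o: "out_list t es"
  and "t' aEP 0 = t aEP 0 + 1" "t' 0 0 = 2 * (t aEP 0 + 1)"
  and "!!i. i ~= 0 ==> i ~= nat (2 * t aEP 0 + 1) ==> i ~= nat (2 * t aEP 0 + 2) ==> t' 0 i = t 0 i"
  and "t' 0 (nat (2 * t aEP 0 + 1)) = int (min u v)" "t' 0 (nat (2 * t aEP 0 + 2)) = int (max u v)"
 shows "out_list t' (es @ [(u, v)])"
proof -
 have ep: "t aEP 0 = int (length es)" using o unfolding out_list_def by simp
 have n1: "nat (2 * t aEP 0 + 1) = 2 * length es + 1" "nat (2 * t aEP 0 + 2) = 2 * length es + 2" unfolding ep by simp_all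
 have "t' 0 (2 * j + 1) = int (min (fst ((es @ [(u, v)]) ! j)) (snd ((es @ [(u, v)]) ! j))) &
    t' 0 (2 * j + 2) = int (max (fst ((es @ [(u, v)]) ! j)) (snd ((es @ [(u, v)]) ! j)))"
  if j: "j < Suc (length es)" for j
 proof (cases "j < length es")
  case True
  thus ?thesis using o assms(4)[of "2 * j + 1"] assms(4)[of "2 * j + 2"] unfolding out_list_def n1 by (auto simp: nth_append)
 next
  case False
  hence "j = length es" using j by simp
  thus ?thesis using assms(5,6) unfolding n1 by simp
 qed
 thus ?thesis using assms(2,3) ep unfolding out_list_def by simp
qed

text \<open>Runs made only for their cost do not keep track of the output array, hence the condition
  in the second claim.\<close>

lemma den_prim_prg:
 assumes e: "env st"
 defines "S == setof n st aIN" and "T == setof n st aTT"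
 shows "ri (den prim_prg st aTOT 0) = tcost (prim S T)"
  and "out_list st es0 ==> out_list (den prim_prg st) (es0 @ prim S T)"
proof -
 define st0 where "st0 = upd st aTOT 0 0"
 define W where "W = {aTOT, aIT, aBB, aK, aUU, aVV, aIN, aEP, 0, 99}"
 define body where "body = (aBB :=: Const 0 ;; prim_scan ;; prim_add)"
 define Inv where "Inv i t = (setof n t aIN = fst (prim_state S T i) &
   ri (t aTOT 0) = tcost (snd (prim_state S T i)) &
   (out_list st es0 --> out_list t (es0 @ snd (prim_state S T i))) &
   (ALL x. x ~: W --> t x = st x))" for i and t :: state
 have n0: "nat (st0 aN 0) = n" using e unfolding env_def st0_def by simp
 have "Inv (nat (st0 aN 0)) (den (PFor aIT aN body) st0)"
 proof (rule den_PFor_invariant)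
  show "aIT ~: wr body" unfolding body_def prim_scan_def prim_add_def by auto
  show "Inv 0 (upd st0 aIT 0 0)" unfolding Inv_def st0_def by (auto simp: S_def setof_def tcost_def out_list_def W_def)
 next
  fix i t assume I: "Inv i t" and i: "i < nat (st0 aN 0)"
  define S' where "S' = fst (prim_state S T i)"
  define es where "es = snd (prim_state S T i)"
  define t1 where "t1 = upd t aBB 0 0"
  define t2 where "t2 = den prim_scan t1"
  define fm where "fm = first_min (%k. k div n : S' & k mod n : T & k mod n ~: S') (%k. d (k div n) (k mod n)) (n * n)"
  have frt: "t x = st x" if "x ~: W" for x using I that unfolding Inv_def by auto
  have et: "env t1" unfolding t1_def by (rule env_frame[OF e]) (auto simp: frt W_def)
  have fr2: "t2 x = t1 x" if "x ~: {aBB, aK, aUU, aVV, 99}" for x unfolding t2_def using that by (intro den_frame) (auto simp: prim_scan_def)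
  have bb: "t2 aBB 0 = enc_opt fm"
  proof -
   have "setof n t1 aIN = S'" using I unfolding Inv_def t1_def S'_def setof_def by auto
   moreover have "setof n t1 aTT = T" unfolding t1_def T_def setof_def using frt[of aTT] by (auto simp: W_def)
   ultimately show ?thesis unfolding t2_def fm_def using den_prim_scan[OF et] by (auto simp: t1_def)
  qed
  have den: "den body t = den prim_add t2" unfolding body_def t1_def t2_def by simp
  have Is: "setof n t aIN = S'" "ri (t aTOT 0) = tcost es"
    "out_list st es0 ==> out_list t (es0 @ es)" using I unfolding Inv_def S'_def es_def by auto
  have t2t: "t2 x = t x" if "x ~: {aBB, aK, aUU, aVV, 99}" for x using fr2[OF that] that unfolding t1_def by auto
  show "Inv (Suc i) (inc aIT (den body t))"
  proof (cases fm)
   case None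
   hence st: "prim_state S T (Suc i) = (S', es)" unfolding fm_def S'_def es_def by simp
   have "den prim_add t2 = upd t2 99 0 0" using bb None unfolding prim_add_def by simp
   thus ?thesis unfolding Inv_def st den inc_def using Is t2t frt by (auto simp: setof_def out_list_def W_def)
  next
   case (Some k)
   note k = first_min_Some[OF Some[unfolded fm_def]]
   define u v where "u = k div n" and "v = k mod n"
   have uv: "u < n" "v < n" using k n_pos unfolding u_def v_def by (auto simp: less_mult_imp_div_less)
   have st: "prim_state S T (Suc i) = (insert v S', es @ [(u, v)])" using Some unfolding fm_def S'_def es_def u_def v_def by simp
   have vv: "int k - int k div int n * int n = int v" "nat (int k div int n) = u" "int k div int n = int u"
    unfolding u_def v_def by (metis minus_div_mult_eq_mod of_nat_mod, auto simp: nat_div_distrib zdiv_int)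
   have tn: "t2 aN 0 = int n" using t2t[of aN] frt[of aN] e unfolding env_def W_def by simp
   have ck: "ri (t2 aC k) = d u v" using t2t[of aC] frt[of aC] e k unfolding env_def W_def u_def v_def by simp
   define t3 where "t3 = den prim_add t2"
   have bk: "t2 aBB 0 = int k + 1" using bb Some by simp
   have t3IN: "t3 aIN = (t2 aIN)(v := 1)" and t3TOT: "t3 aTOT 0 = t2 aTOT 0 + t2 aC k"
    and t3EP: "t3 aEP 0 = t2 aEP 0 + 1" and t30: "t3 0 0 = 2 * (t2 aEP 0 + 1)" unfolding t3_def prim_add_def using vv tn bk by auto
   have t3o: "t3 0 j = t2 0 j" if "j ~= 0" "j ~= nat (2 * t2 aEP 0 + 1)" "j ~= nat (2 * t2 aEP 0 + 2)" for j
    unfolding t3_def prim_add_def using vv tn bk that by auto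
   have fr3: "t3 x = t2 x" if "x ~: {aUU, aVV, aIN, aTOT, 0, aEP, 99}" for x
    unfolding t3_def using that by (intro den_frame) (auto simp: prim_add_def)
   have "out_list t3 (es0 @ es @ [(u, v)])" if o: "out_list st es0"
   proof -
    have o2: "out_list t2 (es0 @ es)" using Is(3)[OF o] t2t[of 0] t2t[of aEP] unfolding out_list_def by auto
    hence ep: "t2 aEP 0 = int (length (es0 @ es))" unfolding out_list_def by simp
    have "t3 0 (nat (2 * t2 aEP 0 + 1)) = int (min u v)" "t3 0 (nat (2 * t2 aEP 0 + 2)) = int (max u v)"
     unfolding t3_def prim_add_def using vv tn bk ep by (auto simp: min_def max_def nat_eq_iff)
    from out_list_snoc[OF o2 t3EP t30 t3o this] show ?thesis by simp
   qed
   moreover have "setof n t3 aIN = insert v S'" using Is(1) t2t[of aIN] uv unfolding setof_def t3IN by auto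
   moreover have "ri (t3 aTOT 0) = tcost (es @ [(u, v)])" using Is(2) t2t[of aTOT] ck unfolding t3TOT tcost_def by simp
   moreover have "t3 x = st x" if "x ~: W" for x using fr3[of x] t2t[of x] frt[of x] that unfolding W_def by auto
   ultimately show ?thesis unfolding Inv_def st den inc_def t3_def [symmetric] by (auto simp: setof_def out_list_def W_def)
  qed
 qed
 moreover have "den prim_prg st = den (PFor aIT aN body) st0" unfolding prim_prg_def body_def st0_def by (simp del: den.simps(4))
 ultimately have I: "Inv n (den prim_prg st)" unfolding n0 by simp
 show "ri (den prim_prg st aTOT 0) = tcost (prim S T)" using I unfolding Inv_def prim_def by simp
 show "out_list (den prim_prg st) (es0 @ prim S T)" if "out_list st es0" using I that unfolding Inv_def prim_def by simp
qed

lemma env_C: "env st ==> v < n ==> j < n ==> ri (st aC (v * n + j)) = d v j"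
proof -
 assume a: "env st" "v < n" "j < n"
 have "v * n + j < Suc v * n" using a by simp
 also have "... <= n * n" using a by (intro mult_le_mono1) simp
 finally show ?thesis using a unfolding env_def by auto
qed

lemma env_n: "env st ==> st aN 0 = int n" "env st ==> st aS 0 = int s" "env st ==> nat (st aN 0) = n" unfolding env_def by auto

end

lemma nat_idx: "nat (int a * int b + int c) = a * b + c" by (metis nat_int of_nat_add of_nat_mult)

section \<open>Programs for the radii and the centres\<close>

abbreviation "aMm == 15::nat"
abbreviation "aM == 16::nat"
abbreviation "aSA == 23::nat"
abbreviation "aR == 43::nat"
abbreviation "aD == 44::nat"
abbreviation "aV == 45::nat"
abbreviation "aU == 46::nat"
abbreviation "aT == 47::nat"
abbreviation "aJ == 48::nat"
abbreviation "aCT == 49::nat"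
abbreviation "aHIT == 50::nat"
abbreviation "aCOV == 51::nat"
abbreviation "aB == 52::nat"
abbreviation "aIT2 == 53::nat"
abbreviation "aCc == 54::nat"

abbreviation idx :: "nat => nat => aexp" where
 "idx a b == Add (Mul (Var a) (Var aN)) (Var b)"

text \<open>Conditions test for positivity, so \<open>a <= b\<close> is tested as \<open>b - a + 1 > 0\<close>.\<close>

abbreviation le_test :: "aexp => aexp => aexp" where
 "le_test a b == Add (Sub b a) (Const 1)"

definition hit_body :: prg where
 "hit_body = PIf (Get aSA (idx aT aJ))
   (PIf (le_test (Get aC (idx aV aJ)) (Get aC (idx aV aU))) (aHIT :=: Const 1) skip) skip"

definition hit_prg :: prg where
 "hit_prg = aHIT :=: Const 0 ;; PFor aJ aN hit_body"

definition count_body :: prg where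
 "count_body = hit_prg ;; aCT :=: Add (Var aCT) (Var aHIT)"

definition radius_body :: prg where
 "radius_body = aCT :=: Const 0 ;; PFor aT aM count_body ;;
   PIf (le_test (Var aMm) (Var aCT))
    (PIf (Sub (Get aR (Var aV)) (Get aC (idx aV aU))) (PAsg aR (Var aV) (Get aC (idx aV aU))) skip) skip"

definition radii_body :: prg where
 "radii_body = PAsg aR (Var aV) (Get aC (idx aV aS)) ;; PFor aU aN radius_body"

definition radii_prg :: prg where
 "radii_prg = PFor aV aN radii_body"

lemmas radii_defs = radii_prg_def radii_body_def radius_body_def count_body_def hit_prg_def hit_body_def

definition samples :: "nat => state => nat set list => bool" where
 "samples n st As = (st aM 0 = int (length As) &
   (ALL t<length As. As ! t <= {..<n} & (ALL j<n. st aSA (t * n + j) = of_bool (j : As ! t))))"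

context core
begin

definition hits :: "nat set list => nat => real => nat" where
 "hits As v t = length (filter (%A. EX j:A. d v j <= t) As)"

text \<open>Starting at the distance to the root caps the radius there. The candidates are the
  distances \<open>d v u\<close>, since the number of hits changes nowhere else.\<close>

primrec radius_upto :: "nat => nat set list => nat => nat => real" where
 "radius_upto m As v 0 = d v s"
| "radius_upto m As v (Suc u) =
   (if m <= hits As v (d v u) & d v u < radius_upto m As v u then d v u else radius_upto m As v u)"

definition rad :: "nat => nat set list => nat => real" where
 "rad m As v = radius_upto m As v n"

lemma samples_frame: "samples n st As ==> st' aM = st aM ==> st' aSA = st aSA ==> samples n st' As" unfolding samples_def by simp

lemma den_hit:
 assumes e: "env st" and As: "samples n st As" and t: "st aT 0 = int t" "t < length As"
  and v: "st aV 0 = int v" "v < n" and u: "st aU 0 = int u" "u < n"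
 shows "den hit_prg st aHIT 0 = of_bool (EX j:As ! t. d v j <= d v u)"
proof -
 define st0 where "st0 = upd st aHIT 0 0"
 define Inv where "Inv i q = (q aHIT 0 = of_bool (EX j<i. j : As ! t & d v j <= d v u) &
   (ALL x. x ~: {aHIT, aJ, 99} --> q x = st x))" for i and q :: state
 have n0: "nat (st0 aN 0) = n" using env_n[OF e] by (simp add: st0_def)
 have "Inv (nat (st0 aN 0)) (den (PFor aJ aN hit_body) st0)"
 proof (rule den_PFor_invariant)
  show "Inv 0 (upd st0 aJ 0 0)" unfolding Inv_def st0_def by auto
 next
  fix i q assume i: "i < nat (st0 aN 0)" and qi: "q aJ 0 = int i" and I: "Inv i q"
  have fr: "q x = st x" if "x ~: {aHIT, aJ, 99}" for x using I that unfolding Inv_def by auto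
  have sa: "0 < st aSA (t * n + i) \<longleftrightarrow> i : As ! t" using As t i n0 unfolding samples_def by auto
  have le: "0 < st aC (v * n + u) - st aC (v * n + i) + 1 \<longleftrightarrow> d v i <= d v u"
   using env_C[OF e v(2) u(2)] env_C[OF e v(2), of i] i n0 by linarith
  show "Inv (Suc i) (inc aJ (den hit_body q))" using I sa le unfolding Inv_def inc_def hit_body_def
   by (auto simp: fr qi t v u env_n[OF e] nat_idx less_Suc_eq)
 qed (auto simp: hit_body_def)
 hence "Inv n (den (PFor aJ aN hit_body) st0)" unfolding n0 .
 moreover have "den hit_prg st = den (PFor aJ aN hit_body) st0" unfolding hit_prg_def st0_def by (simp del: den.simps(4))
 moreover have "(EX j<n. j : As ! t & d v j <= d v u) \<longleftrightarrow> (EX j:As ! t. d v j <= d v u)"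
  using As t(2) unfolding samples_def by auto
 ultimately show ?thesis unfolding Inv_def by simp
qed

lemma den_count:
 assumes e: "env st" and As: "samples n st As"
  and v: "st aV 0 = int v" "v < n" and u: "st aU 0 = int u" "u < n" and c: "st aCT 0 = 0"
 shows "den (PFor aT aM count_body) st aCT 0 = int (hits As v (d v u))"
proof -
 define Inv where "Inv i q = (q aCT 0 = int (hits (take i As) v (d v u)) &
   (ALL x. x ~: {aCT, aT, aHIT, aJ, 99} --> q x = st x))" for i and q :: state
 have n0: "nat (st aM 0) = length As" using As unfolding samples_def by simp
 have "Inv (nat (st aM 0)) (den (PFor aT aM count_body) st)"
 proof (rule den_PFor_invariant)
  show "Inv 0 (upd st aT 0 0)" unfolding Inv_def using c by (auto simp: hits_def)
 next
  fix i q assume i: "i < nat (st aM 0)" and qi: "q aT 0 = int i" and I: "Inv i q"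
  have fr: "q x = st x" if "x ~: {aCT, aT, aHIT, aJ, 99}" for x using I that unfolding Inv_def by auto
  have h: "den hit_prg q aHIT 0 = of_bool (EX j:As ! i. d v j <= d v u)"
   using i n0 v u qi by (intro den_hit env_frame[OF e] samples_frame[OF As]) (auto simp: fr)
  have fr2: "den hit_prg q x = q x" if "x ~: {aHIT, aJ, 99}" for x using that by (intro den_frame) (auto simp: hit_prg_def hit_body_def)
  have tk: "take (Suc i) As = take i As @ [As ! i]" using i n0 by (simp add: take_Suc_conv_app_nth)
  show "Inv (Suc i) (inc aT (den count_body q))" using I h unfolding Inv_def inc_def count_body_def tk by (auto simp: fr2 hits_def)
 qed (auto simp: count_body_def hit_prg_def hit_body_def)
 thus ?thesis unfolding Inv_def n0 by simp
qed

lemma den_radii: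
 assumes e: "env st" and As: "samples n st As" and m: "st aMm 0 = int m"
 shows "v < n ==> ri (den radii_prg st aR v) = rad m As v"
proof -
 define Inv where "Inv i q = ((ALL v<i. ri (q aR v) = rad m As v) &
   (ALL x. x ~: {aR, aV, aU, aCT, aT, aHIT, aJ, 99} --> q x = st x))" for i and q :: state
 have n0: "nat (st aN 0) = n" using env_n[OF e] by simp
 have "Inv (nat (st aN 0)) (den radii_prg st)" unfolding radii_prg_def
 proof (rule den_PFor_invariant)
  show "Inv 0 (upd st aV 0 0)" unfolding Inv_def by auto
 next
  fix v q assume v: "v < nat (st aN 0)" and qv: "q aV 0 = int v" and I: "Inv v q"
  have fr: "q x = st x" if "x ~: {aR, aV, aU, aCT, aT, aHIT, aJ, 99}" for x using I that unfolding Inv_def by auto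
  have eq: "env q" by (rule env_frame[OF e]) (auto simp: fr)
  have vn: "v < n" using v n0 by simp
  define q0 where "q0 = upd q aR v (q aC (v * n + s))"
  define J where "J u p = (ri (p aR v) = radius_upto m As v u & (ALL w. w ~= v --> p aR w = q aR w) &
    (ALL x. x ~: {aR, aU, aCT, aT, aHIT, aJ, 99} --> p x = q x))" for u and p :: state
  have q0n: "nat (q0 aN 0) = n" using env_n[OF eq] by (simp add: q0_def)
  have "J (nat (q0 aN 0)) (den (PFor aU aN radius_body) q0)"
  proof (rule den_PFor_invariant)
   show "J 0 (upd q0 aU 0 0)" using env_C[OF eq vn s_less] unfolding J_def q0_def by auto
  next
   fix u p assume u: "u < nat (q0 aN 0)" and pu: "p aU 0 = int u" and JJ: "J u p"
   have frp: "p x = q x" if "x ~: {aR, aU, aCT, aT, aHIT, aJ, 99}" for x using JJ that unfolding J_def by auto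
   have un: "u < n" using u q0n by simp
   define p1 where "p1 = upd p aCT 0 0"
   define p2 where "p2 = den (PFor aT aM count_body) p1"
   have ep1: "env p1" by (rule env_frame[OF eq]) (auto simp: frp p1_def)
   have "samples n p1 As" by (rule samples_frame[OF As]) (auto simp: frp fr p1_def)
   hence ct: "p2 aCT 0 = int (hits As v (d v u))" unfolding p2_def using frp[of aV] qv pu vn un by (intro den_count ep1) (auto simp: p1_def)
   have fr2: "p2 x = p x" if "x ~: {aCT, aT, aHIT, aJ, 99}" for x
   proof -
    have "p2 x = p1 x" unfolding p2_def using that by (intro den_frame) (auto simp: count_body_def hit_prg_def hit_body_def)
    thus ?thesis using that by (auto simp: p1_def)
   qed
   have den: "den radius_body p = den (PIf (le_test (Var aMm) (Var aCT))
    (PIf (Sub (Get aR (Var aV)) (Get aC (idx aV aU))) (PAsg aR (Var aV) (Get aC (idx aV aU))) skip) skip) p2"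
    unfolding radius_body_def p2_def p1_def by (simp del: den.simps(4))
   have c: "ri (q aC (v * n + u)) = d v u" using env_C[OF eq vn un] .
   have lt: "q aC (v * n + u) < p aR v \<longleftrightarrow> d v u < radius_upto m As v u" using c JJ unfolding J_def by linarith
   have qn: "q aN 0 = int n" using env_n[OF eq] by simp
   have qm: "q aMm 0 = int m" using fr[of aMm] m by simp
   show "J (Suc u) (inc aU (den radius_body p))" using JJ c lt unfolding J_def inc_def den by (auto simp: fr2 frp ct qm pu qv qn nat_idx)
  qed (auto simp: radius_body_def count_body_def hit_prg_def hit_body_def)
  moreover have "den radii_body q = den (PFor aU aN radius_body) q0"
   unfolding radii_body_def q0_def using qv env_n[OF eq] by (simp del: den.simps(4) add: nat_idx)
  ultimately have JJ: "J n (den radii_body q)" unfolding q0n by simp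
  show "Inv (Suc v) (inc aV (den radii_body q))" using I JJ unfolding Inv_def J_def inc_def rad_def by (auto simp: less_Suc_eq)
 qed (auto simp: radii_body_def radius_body_def count_body_def hit_prg_def hit_body_def)
 thus "v < n ==> ri (den radii_prg st aR v) = rad m As v" unfolding Inv_def n0 by simp
qed

end

definition cov_body :: prg where
 "cov_body = PIf (Get aD (Var aCc))
   (PIf (le_test (Get aC (idx aV aCc)) (Mul (Const 4) (Get aR (Var aV)))) (aCOV :=: Const 1) skip) skip"

definition pick_body :: prg where
 "pick_body = aCOV :=: Const 0 ;; PFor aCc aN cov_body ;;
   PIf (Var aCOV) skip
    (PIf (Var aB) (PIf (Sub (Get aR (Vminus1 aB)) (Get aR (Var aV))) (aB :=: inc_exp aV) skip)
     (aB :=: inc_exp aV))"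

definition centre_body :: prg where
 "centre_body = aB :=: Const 0 ;; PFor aV aN pick_body ;;
   PIf (Var aB) (PAsg aD (Vminus1 aB) (Const 1)) skip"

definition centres_prg :: prg where
 "centres_prg = PFor aV aN (PAsg aD (Var aV) (Const 0)) ;; PAsg aD (Var aS) (Const 1) ;;
   PFor aIT2 aN centre_body"

lemmas centres_defs = centres_prg_def centre_body_def pick_body_def cov_body_def

context core
begin

text \<open>Once everything is covered, further rounds change nothing; \<open>n\<close> rounds are
  enough by \<open>centres_cover\<close>.\<close>

primrec centres :: "(nat => real) => nat => nat set" where
 "centres R 0 = {s}"
| "centres R (Suc i) =
   (case first_min (%v. ~ (EX c:centres R i. d v c <= 4 * R v)) R n of
    None => centres R i | Some v => insert v (centres R i))"

lemma centres_sub: "centres R i <= V" "s : centres R i" using s_less by (induction i) (auto split: option.splits dest!: first_min_Some)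

lemma den_centres:
 assumes e: "env st" and R: "!!v. v < n ==> ri (st aR v) = R v"
 shows "setof n (den centres_prg st) aD = centres R n"
proof -
 define W where "W = {aD, aIT2, aB, aV, aCOV, aCc, 99::nat}"
 define st1 where "st1 = den (PFor aV aN (PAsg aD (Var aV) (Const 0))) st"
 have n0: "nat (st aN 0) = n" using env_n[OF e] by simp
 have "(%i q. (ALL v<i. q aD v = 0) & (ALL x. x ~: {aD, aV} --> q x = st x)) (nat (st aN 0)) st1"
  unfolding st1_def by (rule den_PFor_invariant) (auto simp: inc_def less_Suc_eq)
 hence D1: "st1 aD v = 0" if "v < n" for v using that unfolding n0 by auto
 have fr1: "st1 x = st x" if "x ~: {aD, aV}" for x unfolding st1_def using that by (intro den_frame) auto
 define st2 where "st2 = upd st1 aD s 1"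
 define Inv where "Inv i q = (setof n q aD = centres R i & (ALL x. x ~: W --> q x = st x))" for i and q :: state
 have n2: "nat (st2 aN 0) = n" using fr1[of aN] env_n[OF e] by (simp add: st2_def)
 have "Inv (nat (st2 aN 0)) (den (PFor aIT2 aN centre_body) st2)"
 proof (rule den_PFor_invariant)
  show "aIT2 ~: wr centre_body" by (auto simp: centres_defs)
  show "Inv 0 (upd st2 aIT2 0 0)" using D1 s_less fr1 unfolding Inv_def st2_def W_def setof_def by auto
 next
  fix i q assume I: "Inv i q" and i: "i < nat (st2 aN 0)"
  have fr: "q x = st x" if "x ~: W" for x using I that unfolding Inv_def by auto
  have SD: "setof n q aD = centres R i" using I unfolding Inv_def by simp
  define P where "P v = (~ (EX c:centres R i. d v c <= 4 * R v))" for v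
  define q0 where "q0 = upd q aB 0 0"
  have q0n: "nat (q0 aN 0) = n" using fr[of aN] env_n[OF e] by (simp add: q0_def W_def)
  define J where "J v p = (p aB 0 = enc_opt (first_min P R v) &
    (ALL x. x ~: {aB, aV, aCOV, aCc, 99} --> p x = q x))" for v and p :: state
  have "J (nat (q0 aN 0)) (den (PFor aV aN pick_body) q0)"
  proof (rule den_PFor_invariant)
   show "aV ~: wr pick_body" by (auto simp: centres_defs)
   show "J 0 (upd q0 aV 0 0)" unfolding J_def q0_def by auto
  next
   fix v p assume v: "v < nat (q0 aN 0)" and pv: "p aV 0 = int v" and JJ: "J v p"
   have vn: "v < n" using v q0n by simp
   have frp: "p x = q x" if "x ~: {aB, aV, aCOV, aCc, 99}" for x using JJ that unfolding J_def by auto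
   define p0 where "p0 = upd p aCOV 0 0"
   define p1 where "p1 = den (PFor aCc aN cov_body) p0"
   have ep: "env p0" by (rule env_frame[OF e]) (auto simp: p0_def frp fr W_def)
   have p0n: "nat (p0 aN 0) = n" using env_n[OF ep] by simp
   have "(%c x. x aCOV 0 = of_bool (EX c'<c. c' : centres R i & d v c' <= 4 * R v) &
     (ALL y. y ~: {aCOV, aCc, 99} --> x y = p0 y)) (nat (p0 aN 0)) p1" unfolding p1_def
   proof (rule den_PFor_invariant)
    fix c x assume c: "c < nat (p0 aN 0)" and xc: "x aCc 0 = int c"
     and X: "x aCOV 0 = of_bool (EX c'<c. c' : centres R i & d v c' <= 4 * R v) &
     (ALL y. y ~: {aCOV, aCc, 99} --> x y = p0 y)"
    have frx: "x y = p0 y" if "y ~: {aCOV, aCc, 99}" for y using X that by auto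
    have cn: "c < n" using c p0n by simp
    have Dc: "0 < p0 aD c \<longleftrightarrow> c : centres R i" using SD cn frp[of aD] unfolding p0_def setof_def by auto
    have Rv: "ri (p0 aR v) = R v" using R[OF vn] fr[of aR] frp[of aR] by (simp add: p0_def W_def)
    have le: "0 < 4 * p0 aR v - p0 aC (v * n + c) + 1 \<longleftrightarrow> d v c <= 4 * R v" using env_C[OF ep vn cn] Rv by linarith
    have pv0: "p0 aV 0 = int v" using pv by (simp add: p0_def)
    show "inc aCc (den cov_body x) aCOV 0 = of_bool (EX c'<Suc c. c' : centres R i & d v c' <= 4 * R v) &
     (ALL y. y ~: {aCOV, aCc, 99} --> inc aCc (den cov_body x) y = p0 y)" using X Dc le unfolding inc_def cov_body_def
     by (auto simp: frx xc pv0 env_n[OF ep] nat_idx less_Suc_eq)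
   qed (auto simp: p0_def cov_body_def)
   hence cov: "p1 aCOV 0 = of_bool (~ P v)" and fr1: "p1 y = p0 y" if "y ~: {aCOV, aCc, 99}" for y
    using that centres_sub(1)[of R i] unfolding p0n P_def by auto
   have cov: "p1 aCOV 0 = of_bool (~ P v)" using cov[of aN] by simp
   have den: "den pick_body p = den (PIf (Var aCOV) skip
    (PIf (Var aB) (PIf (Sub (Get aR (Vminus1 aB)) (Get aR (Var aV))) (aB :=: inc_exp aV) skip)
     (aB :=: inc_exp aV))) p1" unfolding pick_body_def p1_def p0_def by (simp del: den.simps(4))
   have p1x: "p1 aB = p aB" "p1 aV 0 = int v" "p1 aR = q aR" using fr1[of aB] fr1[of aV] fr1[of aR] pv frp[of aR] by (auto simp: p0_def)
   have fr1': "p1 y = p y" if "y ~: {aCOV, aCc, 99}" for y using fr1[OF that] that by (auto simp: p0_def)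
   have qR: "ri (q aR w) = R w" if "w < n" for w using R[OF that] fr[of aR] by (simp add: W_def)
   show "J (Suc v) (inc aV (den pick_body p))"
   proof (cases "first_min P R v")
    case None
    thus ?thesis using JJ cov unfolding J_def inc_def den by (auto simp: p1x fr1' frp pv)
   next
    case (Some b)
    have bn: "b < n" using first_min_Some[OF Some] vn by simp
    have lt: "q aR v < q aR b \<longleftrightarrow> R v < R b" using qR[OF bn] qR[OF vn] by linarith
    show ?thesis using JJ cov Some lt unfolding J_def inc_def den by (auto simp: p1x fr1' frp pv)
   qed
  qed
  hence JJ: "J n (den (PFor aV aN pick_body) q0)" unfolding q0n .
  define q1 where "q1 = den (PFor aV aN pick_body) q0"
  have bq: "q1 aB 0 = enc_opt (first_min P R n)" and frq: "q1 x = q x" if "x ~: {aB, aV, aCOV, aCc, 99}" for x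
   using JJ that unfolding J_def q1_def by auto
  have bq: "q1 aB 0 = enc_opt (first_min P R n)" using bq[of aN] by simp
  have den: "den centre_body q = den (PIf (Var aB) (PAsg aD (Vminus1 aB) (Const 1)) skip) q1"
   unfolding centre_body_def q1_def q0_def by (simp del: den.simps(4))
  have qD: "q1 aD = q aD" using frq[of aD] by simp
  show "Inv (Suc i) (inc aIT2 (den centre_body q))"
  proof (cases "first_min P R n")
   case None
   hence c: "centres R (Suc i) = centres R i" by (simp add: P_def [abs_def])
   have "setof n (inc aIT2 (den centre_body q)) aD = centres R i" using None bq SD unfolding den inc_def by (auto simp: setof_def qD)
   moreover have "inc aIT2 (den centre_body q) x = st x" if "x ~: W" for x
    using that fr[of x] frq[of x] None bq unfolding den inc_def by (auto simp: W_def)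
   ultimately show ?thesis unfolding Inv_def c by simp
  next
   case (Some b)
   hence c: "centres R (Suc i) = insert b (centres R i)" by (simp add: P_def [abs_def])
   have bn: "b < n" using first_min_Some[OF Some] by simp
   have "setof n (inc aIT2 (den centre_body q)) aD = insert b (centres R i)"
    using Some bq bn unfolding SD [symmetric] den inc_def by (auto simp: setof_def qD)
   moreover have "inc aIT2 (den centre_body q) x = st x" if "x ~: W" for x
    using that fr[of x] frq[of x] Some bq unfolding den inc_def by (auto simp: W_def)
   ultimately show ?thesis unfolding Inv_def c by simp
  qed
 qed
 hence "Inv n (den (PFor aIT2 aN centre_body) st2)" unfolding n2 .
 moreover have "den centres_prg st = den (PFor aIT2 aN centre_body) st2"
  unfolding centres_prg_def st2_def st1_def using env_n(2)[OF e] den_frame[of aS "PFor aV aN (PAsg aD (Var aV) (Const 0))" st]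
  by (simp del: den.simps(4))
 ultimately show ?thesis unfolding Inv_def by simp
qed

end

section \<open>Programs for the rounds of the asymmetric case\<close>

abbreviation "aUn == 12::nat"
abbreviation "aI == 17::nat"
abbreviation "aZ == 18::nat"
abbreviation "aK1 == 19::nat"
abbreviation "aK2 == 20::nat"
abbreviation "aDONE == 55::nat"
abbreviation "aXX == 56::nat"
abbreviation "aCNT == 57::nat"
abbreviation "aTH == 58::nat"
abbreviation "aBAD == 59::nat"
abbreviation "aI2 == 60::nat"
abbreviation "aT2 == 61::nat"
abbreviation "aV2 == 62::nat"
abbreviation "aJ2 == 63::nat"
abbreviation "aU2 == 64::nat"
abbreviation "aDA == 65::nat"
abbreviation "aBEST == 66::nat"
abbreviation "aBH == 67::nat"
abbreviation "aBRHO == 68::nat"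
abbreviation "aEX == 69::nat"
abbreviation "aA == 70::nat"

text \<open>The value \<open>-1\<close> stands for an infinite distance and remains exactly when the
  sample is empty; \<open>choose_body\<close> then skips every candidate.\<close>

definition dist_body :: prg where
 "dist_body = PIf (Get aSA (idx aT2 aJ2))
   (PIf (Add (Get aDA (Var aV2)) (Const 1))
    (PIf (Sub (Get aDA (Var aV2)) (Get aC (idx aV2 aJ2))) (PAsg aDA (Var aV2) (Get aC (idx aV2 aJ2))) skip)
    (PAsg aDA (Var aV2) (Get aC (idx aV2 aJ2))))
   skip"

definition dist_prg :: prg where
 "dist_prg = PFor aV2 aN (PAsg aDA (Var aV2) (Const (-1)) ;; PFor aJ2 aN dist_body)"

definition setup_body :: prg where
 "setup_body = PAsg aIN (Var aA) (Add (Get aSA (idx aT2 aA)) (Get aXX (Var aA))) ;;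
   PIf (le_test (Get aDA (Var aA)) (Get aDA (Var aU2))) (PAsg aTT (Var aA) (Const 1)) (PAsg aTT (Var aA) (Const 0))"

definition choose_body :: prg where
 "choose_body = PIf (Add (Get aDA (Var aU2)) (Const 1))
   (PFor aA aN setup_body ;; PAsg aIN (Var aS) (Const 1) ;; prim_prg ;;
   aEX :=: Sub (Mul (Var aK1) (Var aTOT)) (Mul (Get aK2 (Var aI2)) (Get aDA (Var aU2))) ;;
   PIf (Sub (Var aEX) (Var aBEST))
    (aBEST :=: Var aEX ;; aBH :=: Var aTOT ;; aBRHO :=: Get aDA (Var aU2)) skip)
   skip"

definition choose_prg :: prg where
 "choose_prg = aBEST :=: Const 0 ;; aBH :=: Const 0 ;; aBRHO :=: Const 0 ;; PFor aU2 aN choose_body"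

text \<open>Comparing twice the distance with three times the chosen radius is membership in the
  ball enlarged by \<open>3 / 2\<close>, in integers.\<close>

definition load_body :: prg where
 "load_body = PIf (le_test (Mul (Const 2) (Get aDA (Var aA))) (Mul (Const 3) (Var aBRHO)))
    (PAsg aCNT (Var aA) (Add (Get aCNT (Var aA)) (Const 1))) skip ;;
   PIf (le_test (Var aMm) (Get aCNT (Var aA))) (PAsg aXX (Var aA) (Const 1)) skip"

definition load_prg :: prg where
 "load_prg = PIf (Var aBEST)
   (PIf (Sub (Mul (Var aUn) (Var aBH)) (Mul (Const 84) (Get aZ (Var aI2))))
    (aBAD :=: inc_exp aBAD)
    (aTH :=: Add (Var aTH) (Var aBH) ;; PFor aA aN load_body))
   skip"

definition sample_body :: prg where
 "sample_body = dist_prg ;; choose_prg ;; load_prg"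

definition reset_body :: prg where
 "reset_body = PAsg aXX (Var aA) (Const 0) ;; PAsg aCNT (Var aA) (Const 0)"

definition round_prg :: prg where
 "round_prg = aTH :=: Const 0 ;; aBAD :=: Const 0 ;; PFor aA aN reset_body ;; PFor aT2 aM sample_body"

definition root_body :: "nat => prg" where
 "root_body x = PAsg aIN (Var aA) (Const 0) ;; PAsg aTT (Var aA) (Get x (Var aA))"

definition tree_prg :: "nat => prg" where
 "tree_prg x = PFor aA aN (root_body x) ;; PAsg aIN (Var aS) (Const 1) ;; prim_prg"

definition test_prg :: prg where
 "test_prg = tree_prg aXX ;;
   PIf (le_test (Mul (Const 8) (Var aBAD)) (Var aMm))
    (PIf (le_test (Mul (Var aUn) (Var aTH)) (Mul (Mul (Const 9) (Var aMm)) (Get aZ (Var aI2))))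
     (PIf (le_test (Mul (Var aUn) (Var aTOT)) (Mul (Const 10) (Get aZ (Var aI2)))) (aDONE :=: Const 1) skip)
     skip)
    skip"

text \<open>After the first accepted guess the loop idles, so \<open>aXX\<close> keeps the vertices
  bought in that round.\<close>

definition asym_prg :: prg where
 "asym_prg = aDONE :=: Const 0 ;; PFor aA aN reset_body ;;
   PFor aI2 aI (PIf (Var aDONE) skip (round_prg ;; test_prg))"

lemmas asym_defs = asym_prg_def test_prg_def tree_prg_def root_body_def round_prg_def reset_body_def
 sample_body_def load_prg_def load_body_def choose_prg_def choose_body_def setup_body_def dist_prg_def
 dist_body_def

context core
begin

lemma sd_insert: "finite B ==> B ~= {} ==> sd v (insert j B) = min (d v j) (sd v B)" unfolding sd_def by simp

lemma sd_singleton: "sd v {j} = d v j" unfolding sd_def by simp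

lemma den_dist:
 assumes e: "env st" and As: "samples n st As" and t: "st aT2 0 = int t" "t < length As" and v: "v < n"
 shows "As ! t = {} ==> den dist_prg st aDA v = - 1"
  and "As ! t ~= {} ==> ri (den dist_prg st aDA v) = sd v (As ! t)"
proof -
 define A where "A = As ! t"
 define ok where "ok B x v = ((if B = {} then x = -1 else ri x = sd v B & 0 <= x))" for B and x :: int and v
 define Inv where "Inv i q = ((ALL v<i. ok A (q aDA v) v) &
   (ALL x. x ~: {aDA, aV2, aJ2, 99} --> q x = st x))" for i and q :: state
 have AV: "A <= V" using As t unfolding samples_def A_def by auto
 have n0: "nat (st aN 0) = n" using env_n[OF e] by simp
 have "Inv (nat (st aN 0)) (den dist_prg st)" unfolding dist_prg_def
 proof (rule den_PFor_invariant)
  show "Inv 0 (upd st aV2 0 0)" unfolding Inv_def by auto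
 next
  fix v q assume v: "v < nat (st aN 0)" and qv: "q aV2 0 = int v" and I: "Inv v q"
  have fr: "q x = st x" if "x ~: {aDA, aV2, aJ2, 99}" for x using I that unfolding Inv_def by auto
  have eq: "env q" by (rule env_frame[OF e]) (auto simp: fr)
  have vn: "v < n" using v n0 by simp
  define q0 where "q0 = upd q aDA v (-1)"
  define J where "J j p = (ok {i : A. i < j} (p aDA v) v & (ALL w. w ~= v --> p aDA w = q aDA w) &
    (ALL x. x ~: {aDA, aJ2, 99} --> p x = q x))" for j and p :: state
  have q0n: "nat (q0 aN 0) = n" using env_n[OF eq] by (simp add: q0_def)
  have "J (nat (q0 aN 0)) (den (PFor aJ2 aN dist_body) q0)"
  proof (rule den_PFor_invariant)
   show "J 0 (upd q0 aJ2 0 0)" unfolding J_def q0_def ok_def by auto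
  next
   fix j p assume j: "j < nat (q0 aN 0)" and pj: "p aJ2 0 = int j" and JJ: "J j p"
   have frp: "p x = q x" if "x ~: {aDA, aJ2, 99}" for x using JJ that unfolding J_def by auto
   have jn: "j < n" using j q0n by simp
   have sa: "st aSA (t * n + j) = of_bool (j : A)" using As t jn unfolding samples_def A_def by auto
   have c: "ri (q aC (v * n + j)) = d v j" using env_C[OF eq vn jn] .
   have c0: "0 <= q aC (v * n + j)" using c d_nonneg[of v j] by linarith
   have qq: "q aSA = st aSA" "q aT2 0 = int t" "q aN 0 = int n" using fr[of aSA] fr[of aT2] t env_n[OF eq] by auto
   define B where "B = {i : A. i < j}"
   have finB: "finite B" unfolding B_def by simp
   have Bs: "{i : A. i < Suc j} = (if j : A then insert j B else B)" unfolding B_def by (auto simp: less_Suc_eq)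
   have okB: "ok B (p aDA v) v" using JJ unfolding J_def B_def by simp
   show "J (Suc j) (inc aJ2 (den dist_body p))"
   proof (cases "j : A")
    case False
    thus ?thesis using JJ sa okB unfolding J_def inc_def dist_body_def Bs by (auto simp: frp qq pj qv nat_idx)
   next
    case True
    have sa1: "st aSA (t * n + j) = 1" using sa True by simp
    show ?thesis
    proof (cases "B = {}")
     case True
     thus ?thesis using JJ sa1 okB c c0 \<open>j : A\<close> unfolding J_def inc_def dist_body_def Bs ok_def
      by (auto simp: frp qq pj qv nat_idx sd_singleton)
    next
     case False
     have lt: "q aC (v * n + j) < p aDA v \<longleftrightarrow> d v j < sd v B" and ge: "0 < p aDA v + 1"
      using c okB False unfolding ok_def by auto
     have "ri (inc aJ2 (den dist_body p) aDA v) = sd v (insert j B) & 0 <= inc aJ2 (den dist_body p) aDA v"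
      using JJ sa1 okB c c0 lt ge False sd_insert[OF finB False, of v j] unfolding J_def inc_def dist_body_def ok_def
      by (auto simp: frp qq pj qv nat_idx min_def)
     moreover have "(ALL w. w ~= v --> inc aJ2 (den dist_body p) aDA w = q aDA w) &
       (ALL x. x ~: {aDA, aJ2, 99} --> inc aJ2 (den dist_body p) x = q x)"
      using JJ unfolding J_def inc_def dist_body_def by (auto simp: frp qq pj qv nat_idx)
     ultimately show ?thesis unfolding J_def Bs using \<open>j : A\<close> by (auto simp: ok_def)
    qed
   qed
  qed (auto simp: dist_body_def)
  moreover have "den (PAsg aDA (Var aV2) (Const (-1)) ;; PFor aJ2 aN dist_body) q = den (PFor aJ2 aN dist_body) q0"
   unfolding q0_def using qv by (simp del: den.simps(4))
  ultimately have "J n (den (PAsg aDA (Var aV2) (Const (-1)) ;; PFor aJ2 aN dist_body) q)" unfolding q0n by simp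
  moreover have "{i : A. i < n} = A" using AV by auto
  ultimately show "Inv (Suc v) (inc aV2 (den (PAsg aDA (Var aV2) (Const (-1)) ;; PFor aJ2 aN dist_body) q))"
   using I unfolding Inv_def J_def inc_def by (auto simp: less_Suc_eq)
 qed (auto simp: dist_body_def)
 hence "ok A (den dist_prg st aDA v) v" unfolding Inv_def n0 using v by simp
 thus "As ! t = {} ==> den dist_prg st aDA v = - 1"
  "As ! t ~= {} ==> ri (den dist_prg st aDA v) = sd v (As ! t)" unfolding ok_def A_def by auto
qed

lemma ball_of_sd:
 assumes "A <= V" "A ~= {}"
 shows "ball_of A ro = {v : V. sd v A <= ro}" unfolding ball_of_def using sd_le_iff[OF finite_subset[OF assms(1)] assms(2)] by auto

text \<open>Real parameters are represented by integers: gains are multiplied by \<open>kp\<close>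
  and guesses by the content of \<open>aUn\<close>. Both factors are positive, so comparisons keep
  their meaning.\<close>

definition params :: "state => real => real => real => nat => bool" where
 "params st kp lam r m \<longleftrightarrow> 0 < kp & st aMm 0 = int m & ri (st aK1 0) = kp * (lam * r) & 0 < st aUn 0"

definition at_grid :: "state => real => nat => real => bool" where
 "at_grid st kp i Z \<longleftrightarrow> st aI2 0 = int i & ri (st aK2 i) = kp * (4 * Z) &
   ri (st aZ i) = ri (st aUn 0) * Z"

lemma den_choose:
 assumes e: "env st" and As: "samples n st As" and t: "st aT2 0 = int t" "t < length As"
  and par: "params st kp lam r m" and grid: "at_grid st kp i Z"
  and X: "X <= V" "!!a. a < n ==> st aXX a = of_bool (a : X)"
  and dA: "As ! t ~= {}" "!!v. v < n ==> ri (st aDA v) = sd v (As ! t)"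
 defines "f == first_max (gain lam r Z X (As ! t)) n"
 shows "f = None ==> den choose_prg st aBEST 0 = 0"
  and "f = Some u ==> 0 < den choose_prg st aBEST 0 &
   ri (den choose_prg st aBH 0) = ext_cost X (As ! t) (sd u (As ! t)) &
   ri (den choose_prg st aBRHO 0) = sd u (As ! t)"
proof -
 define A where "A = As ! t"
 define g where "g = gain lam r Z X A"
 have AV: "A <= V" "A ~= {}" using As t dA unfolding samples_def A_def by auto
 have kap: "0 < kp" using par unfolding params_def by simp
 define W where "W = {aBEST, aBH, aBRHO, aU2, aA, aIN, aTT, aEX} Un wr prim_prg"
 define st0 where "st0 = upd (upd (upd st aBEST 0 0) aBH 0 0) aBRHO 0 0"
 define Inv where "Inv u q = ((case first_max g u of None => q aBEST 0 = 0
   | Some w => ri (q aBEST 0) = kp * g w & ri (q aBH 0) = ext_cost X A (sd w A) &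
         ri (q aBRHO 0) = sd w A) &
   (ALL x. x ~: W --> q x = st x))" for u and q :: state
 have n0: "nat (st0 aN 0) = n" using env_n[OF e] by (simp add: st0_def)
 have "Inv (nat (st0 aN 0)) (den (PFor aU2 aN choose_body) st0)"
 proof (rule den_PFor_invariant)
  show "aU2 ~: wr choose_body" by (auto simp: choose_body_def setup_body_def wr_prim)
  show "Inv 0 (upd st0 aU2 0 0)" unfolding Inv_def st0_def W_def by auto
 next
  fix u q assume u: "u < nat (st0 aN 0)" and qu: "q aU2 0 = int u" and I: "Inv u q"
  have un: "u < n" using u n0 by simp
  have fr: "q x = st x" if "x ~: W" for x using I that unfolding Inv_def by auto
  have frs: "q aN = st aN" "q aNN = st aNN" "q aS = st aS" "q aC = st aC" "q aSA = st aSA" "q aT2 = st aT2"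
    "q aXX = st aXX" "q aDA = st aDA" "q aK1 = st aK1" "q aK2 = st aK2" "q aI2 = st aI2" by (auto intro!: fr simp: W_def wr_prim)
  have du: "0 < q aDA u + 1" using dA(2)[OF un] sd_nonneg[of A u] AV finite_subset[OF AV(1)] frs unfolding A_def
   by (smt (verit) finite_lessThan of_int_0_le_iff)
  define q1 where "q1 = den (PFor aA aN setup_body) q"
  have "(%a p. (ALL b<a. (0 < p aIN b \<longleftrightarrow> b : A Un X) & (0 < p aTT b \<longleftrightarrow> sd b A <= sd u A)) &
    (ALL x. x ~: {aA, aIN, aTT} --> p x = q x)) (nat (q aN 0)) q1" unfolding q1_def
  proof (rule den_PFor_invariant)
   fix a p assume a: "a < nat (q aN 0)" and pa: "p aA 0 = int a"
    and P: "(ALL b<a. (0 < p aIN b \<longleftrightarrow> b : A Un X) & (0 < p aTT b \<longleftrightarrow> sd b A <= sd u A)) &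
    (ALL x. x ~: {aA, aIN, aTT} --> p x = q x)"
   have an: "a < n" using a frs env_n[OF e] by simp
   have frp: "p x = q x" if "x ~: {aA, aIN, aTT}" for x using P that by auto
   have sa: "st aSA (t * n + a) = of_bool (a : A)" using As t an unfolding samples_def A_def by auto
   have le: "0 < st aDA u - st aDA a + 1 \<longleftrightarrow> sd a A <= sd u A" using dA(2)[OF un] dA(2)[OF an] unfolding A_def by linarith
   have pp: "p aSA = st aSA" "p aT2 = st aT2" "p aN = st aN" "p aXX = st aXX" "p aDA = st aDA" "p aU2 = q aU2"
    using frp[of aSA] frp[of aT2] frp[of aN] frp[of aXX] frp[of aDA] frp[of aU2] frs by simp_all
   show "(ALL b<Suc a. (0 < inc aA (den setup_body p) aIN b \<longleftrightarrow> b : A Un X) &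
     (0 < inc aA (den setup_body p) aTT b \<longleftrightarrow> sd b A <= sd u A)) &
    (ALL x. x ~: {aA, aIN, aTT} --> inc aA (den setup_body p) x = q x)" using P le unfolding inc_def setup_body_def
    by (auto simp: pp pa t env_n[OF e] nat_idx sa X(2)[OF an] qu less_Suc_eq frp)
  qed (auto simp: setup_body_def)
  hence IN1: "!!b. b < n ==> 0 < q1 aIN b \<longleftrightarrow> b : A Un X" and TT1: "!!b. b < n ==> 0 < q1 aTT b \<longleftrightarrow> sd b A <= sd u A"
   and fr1: "!!x. x ~: {aA, aIN, aTT} ==> q1 x = q x" using env_n[OF e] frs by auto
  define q2 where "q2 = upd q1 aIN s 1"
  have e2: "env q2" by (rule env_frame[OF e]) (auto simp: q2_def fr1 frs)
  have IN2: "setof n q2 aIN = insert s (A Un X)" using IN1 s_less AV X(1) unfolding setof_def q2_def by auto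
  have TT2: "setof n q2 aTT = ball_of A (sd u A)" using TT1 unfolding setof_def q2_def ball_of_sd[OF AV] by auto
  define q3 where "q3 = den prim_prg q2"
  have tot: "ri (q3 aTOT 0) = ext_cost X A (sd u A)" unfolding q3_def den_prim_prg(1)[OF e2] IN2 TT2 ext_cost_def ..
  have fr3: "q3 x = q x" if "x ~: {aA, aIN, aTT} Un wr prim_prg" for x
   using that den_frame[of x prim_prg q2] fr1[of x] unfolding q3_def q2_def by auto
  have frs3: "q3 aK1 = st aK1" "q3 aK2 = st aK2" "q3 aI2 = st aI2" "q3 aDA = st aDA" "q3 aU2 = q aU2"
    "q3 aBEST = q aBEST" "q3 aBH = q aBH" "q3 aBRHO = q aBRHO" by (auto simp: fr3 wr_prim frs)
  define ex where "ex = q3 aK1 0 * q3 aTOT 0 - q3 aK2 i * q3 aDA u"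
  have ex: "ri ex = kp * g u" unfolding ex_def g_def gain_def using par grid tot dA(2)[OF un] unfolding params_def at_grid_def A_def
   by (simp add: frs3 algebra_simps)
  have den: "den choose_body q = den (aEX :=: Sub (Mul (Var aK1) (Var aTOT)) (Mul (Get aK2 (Var aI2)) (Get aDA (Var aU2))) ;;
   PIf (Sub (Var aEX) (Var aBEST))
    (aBEST :=: Var aEX ;; aBH :=: Var aTOT ;; aBRHO :=: Get aDA (Var aU2)) skip) q3"
  proof -
   have "q1 aS 0 = int s" using fr1[of aS] frs env_n[OF e] by simp
   thus ?thesis unfolding choose_body_def q3_def q2_def q1_def using du qu by (simp del: den.simps(4))
  qed
  have best: "q aBEST 0 < ex \<longleftrightarrow> (case first_max g u of None => 0 | Some w => g w) < g u"
  proof -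
   have "ri (q aBEST 0) = kp * (case first_max g u of None => 0 | Some w => g w)" using I unfolding Inv_def by (auto split: option.splits)
   hence "q aBEST 0 < ex \<longleftrightarrow> kp * (case first_max g u of None => 0 | Some w => g w) < kp * g u" using ex by linarith
   thus ?thesis using kap by simp
  qed
  define q4 where "q4 = upd q3 aEX 0 ex"
  have i2: "st aI2 0 = int i" using grid unfolding at_grid_def by simp
  have den2: "den choose_body q = (if q aBEST 0 < ex
    then upd (upd (upd q4 aBEST 0 ex) aBH 0 (q3 aTOT 0)) aBRHO 0 (q3 aDA u) else upd q4 99 0 0)"
   unfolding den q4_def ex_def using i2 qu by (simp add: frs3)
  have fr4: "ALL x. x ~: W --> inc aU2 (den choose_body q) x = st x" unfolding den2 inc_def q4_def W_def using fr3 fr by (auto simp: wr_prim W_def)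
  show "Inv (Suc u) (inc aU2 (den choose_body q))"
  proof (cases "q aBEST 0 < ex")
   case True
   hence "first_max g (Suc u) = Some u" using best by simp
   thus ?thesis unfolding Inv_def using fr4 True ex tot dA(2)[OF un] unfolding den2 inc_def A_def by (auto simp: frs3)
  next
   case False
   hence "first_max g (Suc u) = first_max g u" using best by simp
   thus ?thesis unfolding Inv_def using fr4 False I unfolding den2 inc_def Inv_def by (auto simp: frs3 q4_def split: option.splits)
  qed
 qed
 moreover have "den choose_prg st = den (PFor aU2 aN choose_body) st0" unfolding choose_prg_def st0_def by (simp del: den.simps(4))
 ultimately have I: "Inv n (den choose_prg st)" unfolding n0 by simp
 have fg: "f = first_max g n" unfolding f_def g_def A_def ..
 show "f = None ==> den choose_prg st aBEST 0 = 0" using I unfolding Inv_def fg by auto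
 show "f = Some u ==> 0 < den choose_prg st aBEST 0 &
   ri (den choose_prg st aBH 0) = ext_cost X (As ! t) (sd u (As ! t)) &
   ri (den choose_prg st aBRHO 0) = sd u (As ! t)"
 proof -
  assume f: "f = Some u"
  hence b: "ri (den choose_prg st aBEST 0) = kp * g u" using I unfolding Inv_def fg by auto
  have "0 < g u" using first_max_Some[of g n u] f fg by simp
  hence "0 < ri (den choose_prg st aBEST 0)" unfolding b using kap by simp
  thus ?thesis using I f unfolding Inv_def fg A_def by auto
 qed
qed

definition round_rep :: "state => nat => (nat => nat) \<times> real \<times> nat => bool" where
 "round_rep st m z = ((ALL a<n. st aCNT a = int (fst z a) & st aXX a = of_bool (m <= fst z a)) &
   ri (st aTH 0) = fst (snd z) & st aBAD 0 = int (snd (snd z)))"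

lemma den_sample_body:
 assumes e: "env st" and As: "samples n st As" and t: "st aT2 0 = int t" "t < length As"
  and par: "params st kp lam r m" and grid: "at_grid st kp i Z" and rep: "round_rep st m z"
 shows "round_rep (den sample_body st) m (round_step lam r Z m z (As ! t))"
proof -
 define A where "A = As ! t"
 define X where "X = {a : V. m <= fst z a}"
 define st1 where "st1 = den dist_prg st"
 define st2 where "st2 = den choose_prg st1"
 have AV: "A <= V" using As t unfolding samples_def A_def by auto
 have fr1: "st1 x = st x" if "x ~: {aDA, aV2, aJ2, 99}" for x
  unfolding st1_def using that by (intro den_frame) (auto simp: dist_prg_def dist_body_def)
 define W where "W = {aBEST, aBH, aBRHO, aU2, aA, aIN, aTT, aEX} Un wr prim_prg"
 have fr2: "st2 x = st1 x" if "x ~: W" for x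
  unfolding st2_def using that by (intro den_frame) (auto simp: choose_prg_def choose_body_def setup_body_def W_def wr_prim)
 have frs2: "st2 aCNT = st aCNT" "st2 aXX = st aXX" "st2 aTH = st aTH" "st2 aBAD = st aBAD" "st2 aUn = st aUn"
   "st2 aZ = st aZ" "st2 aI2 = st aI2" "st2 aMm = st aMm" "st2 aN = st aN" "st2 aDA = st1 aDA" using fr1 by (auto simp: fr2 W_def wr_prim)
 have den: "den sample_body st = den load_prg st2" unfolding sample_body_def st2_def st1_def by simp
 have e1: "env st1" by (rule env_frame[OF e]) (auto simp: fr1)
 have As1: "samples n st1 As" by (rule samples_frame[OF As]) (auto simp: fr1)
 have par1: "params st1 kp lam r m" using par fr1 unfolding params_def by simp
 have grid1: "at_grid st1 kp i Z" using grid fr1 unfolding at_grid_def by simp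
 have t1: "st1 aT2 0 = int t" using t fr1 by simp
 have XV: "X <= V" unfolding X_def by auto
 have X1: "st1 aXX a = of_bool (a : X)" if "a < n" for a using rep that fr1[of aXX] unfolding round_rep_def X_def by auto
 have repz: "!!a. a < n ==> st aCNT a = int (fst z a)" "!!a. a < n ==> st aXX a = of_bool (m <= fst z a)"
   "ri (st aTH 0) = fst (snd z)" "st aBAD 0 = int (snd (snd z))" using rep unfolding round_rep_def by auto
 have none: ?thesis if b: "st2 aBEST 0 = 0" and z: "round_step lam r Z m z (As ! t) = z"
  unfolding z den load_prg_def using b repz unfolding round_rep_def by (simp add: frs2)
 show ?thesis
 proof (cases "A = {}")
  case True
  have d1: "st1 aDA v = -1" if "v < n" for v unfolding st1_def using den_dist(1)[OF e As t that] True A_def by simp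
  \<comment> \<open>All distances are \<open>-1\<close>, so every candidate is skipped and the empty
    sample leaves the state of the round as it is.\<close>
  have "st2 aBEST 0 = 0"
  proof -
   define st0 where "st0 = upd (upd (upd st1 aBEST 0 0) aBH 0 0) aBRHO 0 0"
   have "(%u q. q aBEST 0 = 0 & q aDA = st1 aDA) (nat (st0 aN 0)) (den (PFor aU2 aN choose_body) st0)"
   proof (rule den_PFor_invariant)
    show "aU2 ~: wr choose_body" by (auto simp: choose_body_def setup_body_def wr_prim)
    fix u q assume u: "u < nat (st0 aN 0)" and qu: "q aU2 0 = int u" and I: "q aBEST 0 = 0 & q aDA = st1 aDA"
    have "u < n" using u env_n[OF e1] by (simp add: st0_def)
    thus "inc aU2 (den choose_body q) aBEST 0 = 0 & inc aU2 (den choose_body q) aDA = st1 aDA"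
     using I d1[of u] qu unfolding choose_body_def inc_def by simp
   qed (auto simp: st0_def)
   thus ?thesis unfolding st2_def choose_prg_def st0_def by (simp del: den.simps(4))
  qed
  moreover have "round_step lam r Z m z (As ! t) = z" using True unfolding round_step_def A_def by simp
  ultimately show ?thesis by (rule none)
 next
  case False
  have d1: "ri (st1 aDA v) = sd v A" if "v < n" for v unfolding st1_def A_def using den_dist(2)[OF e As t that] False A_def by simp
  have ch1: "st2 aBEST 0 = 0" if "first_max (gain lam r Z X A) n = None" unfolding st2_def using that False X1 d1 unfolding A_def
   by (intro den_choose(1)[OF e1 As1 t1 t(2) par1 grid1 XV]) auto
  have ch2: "0 < st2 aBEST 0 & ri (st2 aBH 0) = ext_cost X A (sd u A) & ri (st2 aBRHO 0) = sd u A"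
   if "first_max (gain lam r Z X A) n = Some u" for u unfolding st2_def using that False X1 d1 unfolding A_def
   by (intro den_choose(2)[OF e1 As1 t1 t(2) par1 grid1 XV]) auto
  show ?thesis
  proof (cases "first_max (gain lam r Z X A) n")
   case None
   have "round_step lam r Z m z (As ! t) = z" using False None unfolding round_step_def A_def [symmetric] Let_def X_def [symmetric] by simp
   thus ?thesis using ch1[OF None] by (intro none)
  next
   case (Some u)
   define ro where "ro = sd u A"
   define h where "h = ext_cost X A ro"
   have b: "0 < st2 aBEST 0" "ri (st2 aBH 0) = h" "ri (st2 aBRHO 0) = ro" using ch2[OF Some] unfolding h_def ro_def by auto
   have step: "round_step lam r Z m z (As ! t) = (if 84 * Z < h then (fst z, fst (snd z), snd (snd z) + 1)
     else (%a. fst z a + of_bool (a : ball_of A (3 / 2 * ro)), fst (snd z) + h, snd (snd z)))"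
    using False Some unfolding round_step_def A_def [symmetric] Let_def X_def [symmetric] h_def ro_def by simp
   have U: "0 < ri (st aUn 0)" using par unfolding params_def by simp
   have badc: "0 < st aUn 0 * st2 aBH 0 - 84 * st aZ i \<longleftrightarrow> 84 * Z < h"
   proof -
    have "0 < st aUn 0 * st2 aBH 0 - 84 * st aZ i \<longleftrightarrow> 0 < ri (st aUn 0 * st2 aBH 0 - 84 * st aZ i)" by linarith
    also have "ri (st aUn 0 * st2 aBH 0 - 84 * st aZ i) = ri (st aUn 0) * (h - 84 * Z)"
     using b(2) grid unfolding at_grid_def by (simp add: algebra_simps)
    also have "0 < ... \<longleftrightarrow> 84 * Z < h" using U by (simp add: zero_less_mult_iff)
    finally show ?thesis .
   qed
   have i2: "st aI2 0 = int i" using grid unfolding at_grid_def by simp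
   show ?thesis
   proof (cases "84 * Z < h")
    case True
    have "den load_prg st2 = upd st2 aBAD 0 (st2 aBAD 0 + 1)" unfolding load_prg_def using b(1) badc True i2 by (simp add: frs2)
    thus ?thesis unfolding den step using True repz unfolding round_rep_def by (simp add: frs2)
   next
    case F: False
    define st3 where "st3 = upd st2 aTH 0 (st2 aTH 0 + st2 aBH 0)"
    have den3: "den load_prg st2 = den (PFor aA aN load_body) st3"
     unfolding load_prg_def st3_def using b(1) badc F i2 by (simp add: frs2 del: den.simps(4))
    define c where "c a = fst z a + of_bool (a : ball_of A (3 / 2 * ro))" for a
    have n3: "nat (st3 aN 0) = n" using env_n[OF e] by (simp add: st3_def frs2)
    have "(%a q. (ALL b<n. if b < a then q aCNT b = int (c b) & q aXX b = of_bool (m <= c b)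
       else q aCNT b = int (fst z b) & q aXX b = of_bool (m <= fst z b)) &
      (ALL x. x ~: {aA, aCNT, aXX, 99} --> q x = st3 x)) (nat (st3 aN 0)) (den (PFor aA aN load_body) st3)"
    proof (rule den_PFor_invariant)
     fix a q assume a: "a < nat (st3 aN 0)" and qa: "q aA 0 = int a"
      and Q: "(ALL b<n. if b < a then q aCNT b = int (c b) & q aXX b = of_bool (m <= c b)
       else q aCNT b = int (fst z b) & q aXX b = of_bool (m <= fst z b)) &
      (ALL x. x ~: {aA, aCNT, aXX, 99} --> q x = st3 x)"
     have an: "a < n" using a n3 by simp
     have frq: "q x = st3 x" if "x ~: {aA, aCNT, aXX, 99}" for x using Q that by auto
     have qq: "q aDA = st1 aDA" "q aBRHO = st2 aBRHO" "q aMm 0 = int m"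
      using frq[of aDA] frq[of aBRHO] frq[of aMm] par unfolding params_def by (auto simp: st3_def frs2)
     have qa': "q aCNT a = int (fst z a)" "q aXX a = of_bool (m <= fst z a)" using Q an by auto
     have le: "0 < 3 * st2 aBRHO 0 - 2 * st1 aDA a + 1 \<longleftrightarrow> a : ball_of A (3 / 2 * ro)"
     proof -
      have "0 < 3 * st2 aBRHO 0 - 2 * st1 aDA a + 1 \<longleftrightarrow> ri (2 * st1 aDA a) <= ri (3 * st2 aBRHO 0)" by linarith
      also have "... \<longleftrightarrow> 2 * sd a A <= 3 * ro" using b(3) d1[OF an] by simp
      finally show ?thesis unfolding ball_of_sd[OF AV False] using an by auto
     qed
     define q1 where "q1 = inc aA (den load_body q)"
     have q1a: "q1 aCNT a = int (c a)" "q1 aXX a = of_bool (m <= c a)" unfolding q1_def inc_def load_body_def c_def using le qa'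
      by (auto simp: qa qq)
     have q1b: "q1 aCNT b = q aCNT b" "q1 aXX b = q aXX b" if "b ~= a" for b
      unfolding q1_def inc_def load_body_def using that by (auto simp: qa qq)
     have fr: "q1 x = q x" if "x ~: {aA, aCNT, aXX, 99}" for x unfolding q1_def inc_def load_body_def using that by auto
     show "(ALL b<n. if b < Suc a then inc aA (den load_body q) aCNT b = int (c b) & inc aA (den load_body q) aXX b = of_bool (m <= c b)
       else inc aA (den load_body q) aCNT b = int (fst z b) & inc aA (den load_body q) aXX b = of_bool (m <= fst z b)) &
      (ALL x. x ~: {aA, aCNT, aXX, 99} --> inc aA (den load_body q) x = st3 x)" unfolding q1_def [symmetric]
     proof (intro conjI allI impI)
      fix b assume "b < n"
      thus "if b < Suc a then q1 aCNT b = int (c b) & q1 aXX b = of_bool (m <= c b)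
       else q1 aCNT b = int (fst z b) & q1 aXX b = of_bool (m <= fst z b)"
       using Q q1a q1b[of b] by (cases "b = a") (auto simp: less_Suc_eq split: if_splits)
     qed (use fr frq in auto)
    qed (use repz in "auto simp: load_body_def st3_def frs2")
    hence C: "!!a. a < n ==> den load_prg st2 aCNT a = int (c a) & den load_prg st2 aXX a = of_bool (m <= c a)"
     and fr: "!!x. x ~: {aA, aCNT, aXX, 99} ==> den load_prg st2 x = st3 x" unfolding n3 den3 by auto
    have "ri (st3 aTH 0) = fst (snd z) + h" using repz b(2) by (simp add: st3_def frs2)
    thus ?thesis unfolding den step using F C fr[of aTH] fr[of aBAD] repz unfolding round_rep_def c_def by (simp add: st3_def frs2)
   qed
  qed
 qed
qed

end

section \<open>The discrete case and the final output\<close>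

abbreviation "aFL == 25::nat"

definition discrete_prg :: prg where
 "discrete_prg = PFor aA aN (PIf (Var aFL) (PAsg aXX (Var aA) (Const 1)) (PAsg aXX (Var aA) (Const 0)))"

definition marks_body :: prg where
 "marks_body = PIf (Get aD (Var aA)) (PAsg 1 (inc_exp aA) (Const 1))
   (PIf (Get aXX (Var aA)) (PAsg 1 (inc_exp aA) (Const 1)) (PAsg 1 (inc_exp aA) (Const 0)))"

text \<open>Resetting \<open>aEP\<close> and the length cell discards what earlier runs left in
  array \<open>0\<close>. The auxiliary output is the indicator of the centres and the other bought
  vertices, from which the second stage starts.\<close>

definition final_prg :: prg where
 "final_prg = aEP :=: Const 0 ;; 0 :=: Const 0 ;; tree_prg aD ;; tree_prg aXX ;;
   1 :=: Var aN ;; PFor aA aN marks_body"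

definition main_prg :: "prg => prg" where
 "main_prg c = radii_prg ;; centres_prg ;; c ;; final_prg"

lemma prim_writes: "x ~: {aTOT, aIT, aBB, aK, aUU, aVV, aIN, aEP, 0, 99} ==> den prim_prg st x = st x" by (rule den_frame) (simp add: wr_prim)

lemma wr_round_test: "wr round_prg Un wr test_prg <=
  {99, aTOT, aIT, aBB, aK, aUU, aVV, aIN, aTT, aEP, 0, aA, aDONE, aXX, aCNT, aTH, aBAD, aT2, aV2, aJ2, aU2, aDA, aBEST, aBH, aBRHO, aEX}"
 by (simp add: asym_defs wr_prim)

context core
begin

lemma den_tree:
 assumes e: "env st" and x: "x ~: {aA, aIN, aTT}"
 shows "ri (den (tree_prg x) st aTOT 0) = tcost (prim {s} (setof n st x))"
  and "out_list st es0 ==> out_list (den (tree_prg x) st) (es0 @ prim {s} (setof n st x))"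
  and "y ~: {aA, aTT, aTOT, aIT, aBB, aK, aUU, aVV, aIN, aEP, 0, 99} ==> den (tree_prg x) st y = st y"
proof -
 define st1 where "st1 = den (PFor aA aN (root_body x)) st"
 have "(%a q. (ALL b<a. q aIN b = 0 & q aTT b = st x b) & (ALL y. y ~: {aA, aIN, aTT} --> q y = st y)) (nat (st aN 0)) st1"
  unfolding st1_def by (rule den_PFor_invariant) (use x in "auto simp: root_body_def inc_def less_Suc_eq")
 hence IN1: "!!b. b < n ==> st1 aIN b = 0 & st1 aTT b = st x b"
  and fr1: "!!y. y ~: {aA, aIN, aTT} ==> st1 y = st y" using env_n[OF e] by auto
 define st2 where "st2 = upd st1 aIN s 1"
 have e2: "env st2" by (rule env_frame[OF e]) (auto simp: st2_def fr1)
 have IN2: "setof n st2 aIN = {s}" using IN1 s_less unfolding setof_def st2_def by auto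
 have TT2: "setof n st2 aTT = setof n st x" using IN1 unfolding setof_def st2_def by auto
 have den: "den (tree_prg x) st = den prim_prg st2"
  unfolding tree_prg_def st2_def st1_def using env_n[OF e] fr1[of aS, unfolded st1_def] by (simp del: den.simps(4))
 show "ri (den (tree_prg x) st aTOT 0) = tcost (prim {s} (setof n st x))" unfolding den den_prim_prg(1)[OF e2] IN2 TT2 ..
 show "out_list (den (tree_prg x) st) (es0 @ prim {s} (setof n st x))" if "out_list st es0"
 proof -
  have "out_list st2 es0" using that fr1[of 0] fr1[of aEP] unfolding out_list_def st2_def by simp
  from den_prim_prg(2)[OF e2 this] show ?thesis unfolding den IN2 TT2 .
 qed
 show "den (tree_prg x) st y = st y" if "y ~: {aA, aTT, aTOT, aIT, aBB, aK, aUU, aVV, aIN, aEP, 0, 99}" for y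
  unfolding den using that prim_writes[of y st2] fr1[of y] by (auto simp: st2_def)
qed

lemma den_reset:
 assumes e: "env st"
 shows "a < n ==> den (PFor aA aN reset_body) st aXX a = 0 & den (PFor aA aN reset_body) st aCNT a = 0"
proof -
 have "(%a q. (ALL b<a. q aXX b = 0 & q aCNT b = 0)) (nat (st aN 0)) (den (PFor aA aN reset_body) st)"
  by (rule den_PFor_invariant) (auto simp: reset_body_def inc_def less_Suc_eq)
 thus "a < n ==> ?thesis" using env_n[OF e] by auto
qed

lemma den_round:
 assumes e: "env st" and As: "samples n st As" and par: "params st kp lam r m" and grid: "at_grid st kp i Z" and m: "0 < m"
 shows "round_rep (den round_prg st) m (round_run lam r Z m As)"
proof -
 define st0 where "st0 = den (PFor aA aN reset_body) (upd (upd st aTH 0 0) aBAD 0 0)"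
 have fr0: "st0 x = st x" if "x ~: {aA, aXX, aCNT, aTH, aBAD}" for x
 proof -
  have "st0 x = upd (upd st aTH 0 0) aBAD 0 0 x" unfolding st0_def using that by (intro den_frame) (auto simp: reset_body_def)
  thus ?thesis using that by auto
 qed
 have TH0: "st0 aTH 0 = 0" "st0 aBAD 0 = 0" unfolding st0_def
  using den_frame[of aTH "PFor aA aN reset_body"] den_frame[of aBAD "PFor aA aN reset_body"] by (auto simp: reset_body_def simp del: den.simps)
 have e': "env (upd (upd st aTH 0 0) aBAD 0 0)" by (rule env_frame[OF e]) auto
 have X0: "st0 aXX a = 0" "st0 aCNT a = 0" if "a < n" for a using den_reset[OF e' that] unfolding st0_def by auto
 define W where "W = wr sample_body"
 have Wn: "x ~: W" if "x : {aN, aNN, aS, aC, aM, aSA, aMm, aK1, aUn, aI2, aK2, aZ, aT2}" for x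
  using that unfolding W_def by (auto simp: asym_defs wr_prim)
 define Inv where "Inv j q = (round_rep q m (foldl (round_step lam r Z m) (%_. 0, 0, 0) (take j As)) &
   (ALL x. x ~: W & x ~= aT2 --> q x = st0 x))" for j and q :: state
 have len: "nat (st0 aM 0) = length As" using As fr0[of aM] unfolding samples_def by simp
 have "Inv (nat (st0 aM 0)) (den (PFor aT2 aM sample_body) st0)"
 proof (rule den_PFor_invariant)
  show "aT2 ~: wr sample_body" using Wn[of aT2] unfolding W_def by simp
  show "Inv 0 (upd st0 aT2 0 0)" unfolding Inv_def round_rep_def using X0 TH0 m by auto
 next
  fix t q assume t: "t < nat (st0 aM 0)" and qt: "q aT2 0 = int t" and I: "Inv t q"
  have fr: "q x = st x" if "x : {aN, aNN, aS, aC, aM, aSA, aMm, aK1, aUn, aI2, aK2, aZ}" for x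
  proof -
   have "q x = st0 x" using I Wn[of x] that unfolding Inv_def by auto
   thus ?thesis using fr0[of x] that by auto
  qed
  have "env q" by (rule env_frame[OF e]) (auto simp: fr)
  moreover have "samples n q As" by (rule samples_frame[OF As]) (auto simp: fr)
  moreover have "params q kp lam r m" using par fr unfolding params_def by simp
  moreover have "at_grid q kp i Z" using grid fr unfolding at_grid_def by simp
  ultimately have "round_rep (den sample_body q) m (round_step lam r Z m (foldl (round_step lam r Z m) (%_. 0, 0, 0) (take t As)) (As ! t))"
   using I t len qt unfolding Inv_def by (intro den_sample_body) auto
  moreover have "foldl (round_step lam r Z m) (%_. 0, 0, 0) (take (Suc t) As) =
    round_step lam r Z m (foldl (round_step lam r Z m) (%_. 0, 0, 0) (take t As)) (As ! t)" using t len by (simp add: take_Suc_conv_app_nth)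
  moreover have "ALL x. x ~: W & x ~= aT2 --> inc aT2 (den sample_body q) x = st0 x"
   using I den_frame[of _ sample_body q] unfolding Inv_def inc_def W_def by auto
  ultimately show "Inv (Suc t) (inc aT2 (den sample_body q))" unfolding Inv_def by (simp add: round_rep_def inc_def)
 qed
 moreover have "den round_prg st = den (PFor aT2 aM sample_body) st0" unfolding round_prg_def st0_def by (simp del: den.simps(4))
 ultimately show ?thesis unfolding Inv_def len round_run_def by simp
qed

lemma den_test:
 assumes e: "env st" and par: "params st kp lam r m" and grid: "at_grid st kp i Z" and rep: "round_rep st m z"
  and don: "st aDONE 0 = 0"
 shows "den test_prg st aDONE 0 = of_bool (accepted Z m z)"
proof -
 define st1 where "st1 = den (tree_prg aXX) st"
 have fr1: "st1 y = st y" if "y ~: {aA, aTT, aTOT, aIT, aBB, aK, aUU, aVV, aIN, aEP, 0, 99}" for y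
  unfolding st1_def using den_tree(3)[OF e _ that] by simp
 have X: "setof n st aXX = bought m z" using rep unfolding round_rep_def setof_def bought_def by auto
 have tot: "ri (st1 aTOT 0) = tcost (prim {s} (bought m z))" unfolding st1_def using den_tree(1)[OF e] X by simp
 have frs: "st1 aBAD = st aBAD" "st1 aMm = st aMm" "st1 aUn = st aUn" "st1 aTH = st aTH" "st1 aZ = st aZ"
   "st1 aI2 = st aI2" "st1 aDONE = st aDONE" by (auto simp: fr1)
 have U: "0 < ri (st aUn 0)" and mm: "st aMm 0 = int m" using par unfolding params_def by auto
 have Zi: "ri (st aZ i) = ri (st aUn 0) * Z" and i2: "st aI2 0 = int i" using grid unfolding at_grid_def by auto
 have th: "ri (st aTH 0) = fst (snd z)" "st aBAD 0 = int (snd (snd z))" using rep unfolding round_rep_def by auto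
 have c1: "0 < st aMm 0 - 8 * st aBAD 0 + 1 \<longleftrightarrow> 8 * snd (snd z) <= m" unfolding mm th by auto
 have c2: "0 < 9 * st aMm 0 * st aZ i - st aUn 0 * st aTH 0 + 1 \<longleftrightarrow> fst (snd z) <= 9 * real m * Z"
 proof -
  have "0 < 9 * st aMm 0 * st aZ i - st aUn 0 * st aTH 0 + 1 \<longleftrightarrow>
    ri (st aUn 0 * st aTH 0) <= ri (9 * st aMm 0 * st aZ i)" by linarith
  also have "... \<longleftrightarrow> ri (st aUn 0) * fst (snd z) <= ri (st aUn 0) * (9 * real m * Z)"
   using th Zi mm by (simp add: algebra_simps)
  finally show ?thesis using U by (simp add: mult.assoc)
 qed
 have c3: "0 < 10 * st aZ i - st aUn 0 * st1 aTOT 0 + 1 \<longleftrightarrow> tcost (prim {s} (bought m z)) <= 10 * Z"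
 proof -
  have "0 < 10 * st aZ i - st aUn 0 * st1 aTOT 0 + 1 \<longleftrightarrow>
    ri (st aUn 0 * st1 aTOT 0) <= ri (10 * st aZ i)" by linarith
  also have "... \<longleftrightarrow> ri (st aUn 0) * tcost (prim {s} (bought m z)) <= ri (st aUn 0) * (10 * Z)"
   using tot Zi by (simp add: algebra_simps)
  finally show ?thesis using U by simp
 qed
 show ?thesis unfolding test_prg_def accepted_def using c1 c2 c3 don by (simp add: st1_def [symmetric] frs i2)
qed

text \<open>The first accepted guess decides. It need not be the guess \<open>i\<close> that is
  known to be accepted, hence the existential \<open>j <= i\<close>.\<close>

lemma den_asym:
 assumes e: "env st" and As: "samples n st As" and par: "params st kp lam r m" and m: "0 < m"
  and I: "st aI 0 = int I"
  and Zs: "!!i. i < I ==> ri (st aK2 i) = kp * (4 * Zs i) & ri (st aZ i) = ri (st aUn 0) * Zs i"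
  and i: "i < I" "accepted (Zs i) m (round_run lam r (Zs i) m As)"
 shows "EX j<=i. accepted (Zs j) m (round_run lam r (Zs j) m As) &
   setof n (den asym_prg st) aXX = bought m (round_run lam r (Zs j) m As)"
proof -
 define acc where "acc j = (accepted (Zs j) m (round_run lam r (Zs j) m As))" for j
 define body where "body = PIf (Var aDONE) skip (round_prg ;; test_prg)"
 define W where "W = insert aI2 (insert aDONE (wr body Un {aA, aXX, aCNT}))"
 define st0 where "st0 = den (PFor aA aN reset_body) (upd st aDONE 0 0)"
 have wrb: "wr body <= {aDONE, 99} Un wr round_prg Un wr test_prg" unfolding body_def by auto
 have Wn: "x ~: W" if "x : {aN, aNN, aS, aC, aM, aSA, aMm, aK1, aUn, aK2, aZ, aI}" for x
 proof -
  have "W <= {aI2, 99, aTOT, aIT, aBB, aK, aUU, aVV, aIN, aTT, aEP, 0, aA, aDONE, aXX, aCNT, aTH, aBAD, aT2, aV2, aJ2,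
    aU2, aDA, aBEST, aBH, aBRHO, aEX}" using wr_round_test wrb unfolding W_def by (simp add: le_sup_iff) (blast dest: subsetD)
  moreover have "x ~: {aI2, 99, aTOT, aIT, aBB, aK, aUU, aVV, aIN, aTT, aEP, 0, aA, aDONE, aXX, aCNT, aTH, aBAD, aT2, aV2, aJ2,
    aU2, aDA, aBEST, aBH, aBRHO, aEX}" using that by (elim insertE emptyE) simp_all
  ultimately show ?thesis by (rule contra_subsetD)
 qed
 have fr0: "st0 x = st x" if "x ~: W" for x
 proof -
  have "st0 x = upd st aDONE 0 0 x" unfolding st0_def using that by (intro den_frame) (auto simp: reset_body_def W_def)
  thus ?thesis using that unfolding W_def by auto
 qed
 have d0: "st0 aDONE 0 = 0" unfolding st0_def using den_frame[of aDONE "PFor aA aN reset_body"] by (simp add: reset_body_def del: den.simps)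
 have n0: "nat (st0 aI 0) = I" using fr0[OF Wn[of aI]] I by simp
 define Inv where "Inv k q = ((if EX j<k. acc j then q aDONE 0 = 1 & (EX j<k. acc j & (ALL j'<j. ~ acc j') & setof n q aXX = bought m (round_run lam r (Zs j) m As))
   else q aDONE 0 = 0) & (ALL x. x ~: W --> q x = st x))" for k and q :: state
 have "Inv (nat (st0 aI 0)) (den (PFor aI2 aI body) st0)"
 proof (rule den_PFor_invariant)
  have "wr body <= {99, aTOT, aIT, aBB, aK, aUU, aVV, aIN, aTT, aEP, 0, aA, aDONE, aXX, aCNT, aTH, aBAD, aT2, aV2, aJ2,
    aU2, aDA, aBEST, aBH, aBRHO, aEX}" unfolding body_def by (simp add: asym_defs wr_prim)
  thus "aI2 ~: wr body" by (rule contra_subsetD) simp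
  have "upd st0 aI2 0 0 x = st x" if "x ~: W" for x using fr0[OF that] that unfolding W_def by (simp add: upd_def)
  thus "Inv 0 (upd st0 aI2 0 0)" unfolding Inv_def using d0 by simp
 next
  fix k q assume k: "k < nat (st0 aI 0)" and qk: "q aI2 0 = int k" and Q: "Inv k q"
  have kI: "k < I" using k n0 by simp
  have frq: "q x = st x" if "x ~: W" for x using Q that unfolding Inv_def by auto
  have fr': "inc aI2 (den body q) x = st x" if "x ~: W" for x
   using that den_frame[of x body q] frq[OF that] unfolding inc_def W_def by (simp add: upd_def)
  show "Inv (Suc k) (inc aI2 (den body q))"
  proof (cases "EX j<k. acc j")
   case True
   hence don: "q aDONE 0 = 1" using Q unfolding Inv_def by simp
   obtain j where j: "j < k" "acc j" "ALL j'<j. ~ acc j'" "setof n q aXX = bought m (round_run lam r (Zs j) m As)"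
    using Q True unfolding Inv_def by auto
   have den: "den body q = upd q 99 0 0" unfolding body_def using don by simp
   have "setof n (inc aI2 (den body q)) aXX = setof n q aXX" unfolding den inc_def setof_def by simp
   hence "EX j<Suc k. acc j & (ALL j'<j. ~ acc j') &
     setof n (inc aI2 (den body q)) aXX = bought m (round_run lam r (Zs j) m As)" using j by (intro exI[of _ j]) simp
   moreover have "inc aI2 (den body q) aDONE 0 = 1" unfolding den inc_def using don by simp
   moreover have "EX j<Suc k. acc j" using True by (auto simp: less_Suc_eq)
   ultimately show ?thesis unfolding Inv_def using fr' by simp
  next
   case False
   hence don: "q aDONE 0 = 0" using Q unfolding Inv_def by simp
   define q1 where "q1 = den round_prg q"
   have den: "den body q = den test_prg q1" unfolding body_def q1_def using don by simp
   have eq: "env q" by (rule env_frame[OF e]) (use frq Wn in auto)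
   have sq: "samples n q As" by (rule samples_frame[OF As]) (use frq Wn in auto)
   have pq: "params q kp lam r m" using par frq Wn unfolding params_def by simp
   have gq: "at_grid q kp k (Zs k)" using Zs[OF kI] frq Wn qk unfolding at_grid_def by simp
   have rep: "round_rep q1 m (round_run lam r (Zs k) m As)" unfolding q1_def by (rule den_round[OF eq sq pq gq m])
   have fr1: "q1 x = q x" if "x : {aN, aNN, aS, aC, aMm, aK1, aUn, aI2, aK2, aZ, aDONE}" for x
   proof -
    have "x ~: wr round_prg" using that by (elim insertE emptyE) (simp_all add: asym_defs wr_prim)
    thus ?thesis unfolding q1_def by (rule den_frame)
   qed
   have "env q1" by (rule env_frame[OF eq]) (auto simp: fr1)
   moreover have "params q1 kp lam r m" using pq fr1 unfolding params_def by simp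
   moreover have "at_grid q1 kp k (Zs k)" using gq fr1 unfolding at_grid_def by simp
   ultimately have dn: "den test_prg q1 aDONE 0 = of_bool (acc k)" unfolding acc_def using rep don fr1[of aDONE] by (intro den_test) auto
   have "den test_prg q1 aXX = q1 aXX" by (rule den_frame) (simp add: asym_defs wr_prim)
   hence X: "setof n (inc aI2 (den body q)) aXX = bought m (round_run lam r (Zs k) m As)"
    using rep unfolding den inc_def setof_def bought_def round_rep_def by auto
   have ex: "(EX j<Suc k. acc j) \<longleftrightarrow> acc k" using False by (auto simp: less_Suc_eq)
   have dd: "inc aI2 (den body q) aDONE 0 = of_bool (acc k)" unfolding den inc_def using dn by simp
   have "EX j<Suc k. acc j & (ALL j'<j. ~ acc j') &
     setof n (inc aI2 (den body q)) aXX = bought m (round_run lam r (Zs j) m As)" if "acc k" using X that False by (intro exI[of _ k]) simp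
   thus ?thesis unfolding Inv_def ex using fr' dd by simp
  qed
 qed
 moreover have "den asym_prg st = den (PFor aI2 aI body) st0" unfolding asym_prg_def st0_def body_def by (simp del: den.simps(4))
 ultimately have "Inv I (den asym_prg st)" unfolding n0 by simp
 then obtain j where j: "j < I" "acc j" "ALL j'<j. ~ acc j'" "setof n (den asym_prg st) aXX = bought m (round_run lam r (Zs j) m As)"
  using i unfolding Inv_def acc_def by (auto split: if_splits)
 have "j <= i" using j(3) i(2) unfolding acc_def [symmetric] by (meson not_le)
 thus ?thesis using j unfolding acc_def by auto
qed

lemma den_discrete:
 assumes e: "env st"
 shows "setof n (den discrete_prg st) aXX = (if 0 < st aFL 0 then V else {})"
proof -
 have "(%a q. (ALL b<a. q aXX b = of_bool (0 < st aFL 0)) & q aFL = st aFL) (nat (st aN 0)) (den discrete_prg st)"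
  unfolding discrete_prg_def by (rule den_PFor_invariant) (auto simp: inc_def less_Suc_eq)
 thus ?thesis using env_n[OF e] unfolding setof_def by auto
qed

lemma den_final:
 assumes e: "env st"
 defines "D == setof n st aD" and "X == setof n st aXX"
 shows "out_list (den final_prg st) (prim {s} D @ prim {s} X)"
  and "den final_prg st 1 0 = int n" and "a < n ==> den final_prg st 1 (Suc a) = of_bool (a : D Un X)"
proof -
 define st0 where "st0 = upd (upd st aEP 0 0) 0 0 0"
 define st1 where "st1 = den (tree_prg aD) st0"
 define st2 where "st2 = den (tree_prg aXX) st1"
 define st3 where "st3 = upd st2 1 0 (st2 aN 0)"
 have e0: "env st0" by (rule env_frame[OF e]) (auto simp: st0_def)
 have fr1: "st1 y = st0 y" if "y ~: {aA, aTT, aTOT, aIT, aBB, aK, aUU, aVV, aIN, aEP, 0, 99}" for y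
  unfolding st1_def using den_tree(3)[OF e0 _ that] by simp
 have e1: "env st1" by (rule env_frame[OF e0]) (auto simp: fr1)
 have fr2: "st2 y = st1 y" if "y ~: {aA, aTT, aTOT, aIT, aBB, aK, aUU, aVV, aIN, aEP, 0, 99}" for y
  unfolding st2_def using den_tree(3)[OF e1 _ that] by simp
 have DX: "setof n st0 aD = D" "setof n st1 aXX = X" unfolding D_def X_def setof_def using fr1[of aXX] by (auto simp: st0_def)
 have "out_list st0 []" unfolding out_list_def st0_def by simp
 hence "out_list st1 ([] @ prim {s} D)" unfolding st1_def DX(1) [symmetric] by (intro den_tree(2)[OF e0]) auto
 hence o2: "out_list st2 (prim {s} D @ prim {s} X)" unfolding st2_def DX(2) [symmetric] using den_tree(2)[OF e1, of aXX "prim {s} D"] by simp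
 have den: "den final_prg st = den (PFor aA aN marks_body) st3" unfolding final_prg_def st3_def st2_def st1_def st0_def by (simp del: den.simps(4))
 have s3n: "nat (st3 aN 0) = n" using env_n[OF e1] fr2[of aN] by (simp add: st3_def)
 have fr3: "den final_prg st y = st3 y" if "y ~: {aA, 1}" for y unfolding den using that by (intro den_frame) (auto simp: marks_body_def)
 show "out_list (den final_prg st) (prim {s} D @ prim {s} X)" using o2 fr3[of 0] fr3[of aEP] unfolding out_list_def by (simp add: st3_def)
 have mk: "0 < st3 aD a \<longleftrightarrow> a : D" "0 < st3 aXX a \<longleftrightarrow> a : X" if "a < n" for a
  using that fr2[of aD] fr1[of aD] fr2[of aXX] fr1[of aXX] unfolding D_def X_def setof_def by (auto simp: st3_def st0_def)
 have "(%a q. (ALL b<a. q 1 (Suc b) = of_bool (b : D Un X)) & q 1 0 = st3 1 0 & q aD = st3 aD & q aXX = st3 aXX)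
   (nat (st3 aN 0)) (den (PFor aA aN marks_body) st3)"
 proof (rule den_PFor_invariant)
  fix a q assume a: "a < nat (st3 aN 0)" and qa: "q aA 0 = int a"
   and Q: "(ALL b<a. q 1 (Suc b) = of_bool (b : D Un X)) & q 1 0 = st3 1 0 & q aD = st3 aD & q aXX = st3 aXX"
  have an: "a < n" using a s3n by simp
  have na: "nat (int a + 1) = Suc a" by simp
  show "(ALL b<Suc a. inc aA (den marks_body q) 1 (Suc b) = of_bool (b : D Un X)) & inc aA (den marks_body q) 1 0 = st3 1 0 &
    inc aA (den marks_body q) aD = st3 aD & inc aA (den marks_body q) aXX = st3 aXX"
   using Q mk[OF an] unfolding inc_def marks_body_def by (auto simp: qa na less_Suc_eq)
 qed (auto simp: marks_body_def)
 thus "den final_prg st 1 0 = int n" "a < n ==> den final_prg st 1 (Suc a) = of_bool (a : D Un X)"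
  unfolding s3n den using env_n[OF e1] fr2[of aN] by (auto simp: st3_def)
qed

end

section \<open>Polynomial bounds and program segments\<close>

definition poly_bounded :: "(nat => nat) => bool" where
 "poly_bounded f = ((EX K d. ALL N>0. f N <= K * N ^ d))"

lemma poly_bounded_const: "poly_bounded (%N. c)" unfolding poly_bounded_def by (intro exI[of _ c] exI[of _ 0]) simp

lemma poly_bounded_id: "poly_bounded (%N. N)" unfolding poly_bounded_def by (intro exI[of _ 1]) simp

lemma poly_bounded_add:
 assumes "poly_bounded f" "poly_bounded g"
 shows "poly_bounded (%N. f N + g N)"
proof -
 obtain K d K' d' where f: "ALL N>0. f N <= K * N ^ d" and g: "ALL N>0. g N <= K' * N ^ d'" using assms unfolding poly_bounded_def by blast
 have "f N + g N <= (K + K') * N ^ (d + d')" if N: "N > 0" for N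
 proof -
  have "K * N ^ d <= K * N ^ (d + d')" "K' * N ^ d' <= K' * N ^ (d + d')" using N by (auto intro!: mult_le_mono2 power_increasing)
  hence "f N <= K * N ^ (d + d')" "g N <= K' * N ^ (d + d')" using f g N le_trans by blast+
  thus ?thesis by (simp add: algebra_simps)
 qed
 thus ?thesis unfolding poly_bounded_def by blast
qed

lemma poly_bounded_mult:
 assumes "poly_bounded f" "poly_bounded g"
 shows "poly_bounded (%N. f N * g N)"
proof -
 obtain K d K' d' where f: "ALL N>0. f N <= K * N ^ d" and g: "ALL N>0. g N <= K' * N ^ d'" using assms unfolding poly_bounded_def by blast
 have "f N * g N <= (K * K') * N ^ (d + d')" if N: "N > 0" for N
 proof -
  have "f N * g N <= (K * N ^ d) * (K' * N ^ d')" using f g N by (intro mult_le_mono) auto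
  thus ?thesis by (simp add: power_add algebra_simps)
 qed
 thus ?thesis unfolding poly_bounded_def by blast
qed

lemmas poly_intros = poly_bounded_const poly_bounded_id poly_bounded_add poly_bounded_mult

lemma poly_bounded_max_steps:
 assumes "poly_bounded B"
 shows "poly_bounded (%N. max_steps c (%_. B N))"
proof (induction c)
 case (PAsg x a e)
 show ?case unfolding max_steps.simps by (rule poly_bounded_const)
next
 case (PFor i b c)
 show ?case unfolding max_steps.simps by (intro poly_intros assms PFor)
next
 case (PSeq c1 c2)
 thus ?case unfolding max_steps.simps by (intro poly_intros)
next
 case (PIf a c1 c2)
 thus ?case unfolding max_steps.simps by (intro poly_intros)
qed

text \<open>The whole program is cut into segments because each may choose its own static arrays: a
  number computed in one segment can be a factor in the next, whose static bit bound is the length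
  reached so far.\<close>

definition seg :: "nat => prg => bool" where
 "seg vc c = ((EX St. tame_prg St vc 50 c) & wf c & bnds c Int wr c = {})"

definition seg_bits :: "prg => nat => nat => nat" where
 "seg_bits c B w = w + max_steps c (%_. B) * (50 * (w + 1))"

definition seg_time :: "prg => nat => nat => nat" where
 "seg_time c B w = max_steps c (%_. B) * step_cost 50 w (seg_bits c B w)"

lemma poly_bounded_seg:
 assumes "poly_bounded B" "poly_bounded w"
 shows "poly_bounded (%N. seg_bits c (B N) (w N))" "poly_bounded (%N. seg_time c (B N) (w N))" unfolding seg_time_def seg_bits_def step_cost_def
 by (intro poly_intros poly_bounded_max_steps assms)+

text \<open>Steps and time share one bound and the clock starts anywhere, so that bounds simply add
  along a composition.\<close>

definition reaches_in :: "int list pmf => nat => com list \<times> state => com list \<times> state => bool" where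
 "reaches_in D T a b = ((ALL t. EX k<=T. EX t'<=T. reaches D (fst a, snd a, t) k (fst b, snd b, t + t')))"

lemma reaches_in_trans: "reaches_in D T a b ==> reaches_in D T' b c ==> reaches_in D (T + T') a c" unfolding reaches_in_def
proof
 fix t assume "ALL t. EX k<=T. EX t'<=T. reaches D (fst a, snd a, t) k (fst b, snd b, t + t')"
  and 2: "ALL t. EX k<=T'. EX t'<=T'. reaches D (fst b, snd b, t) k (fst c, snd c, t + t')"
 then obtain k t' where 1: "k <= T" "t' <= T" "reaches D (fst a, snd a, t) k (fst b, snd b, t + t')" by blast
 obtain k' t'' where "k' <= T'" "t'' <= T'" "reaches D (fst b, snd b, t + t') k' (fst c, snd c, t + t' + t'')" using 2 by blast
 with 1 reaches_trans[OF 1(3)] show "EX k<=T + T'. EX t'<=T + T'. reaches D (fst a, snd a, t) k (fst c, snd c, t + t')"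
  by (intro exI[of _ "k + k'"] conjI exI[of _ "t' + t''"]) (auto simp: add.assoc)
qed

lemma reaches_in_Seq: "reaches_in D T (c1 # c2 # cs, s) b ==> reaches_in D (1 + T) (Seq c1 c2 # cs, s) b"
 by (rule reaches_in_trans[of _ 1 _ "(c1 # c2 # cs, s)"]) (force simp: reaches_in_def intro!: exI[of _ 1] reaches_one)+

lemma reaches_in_seg:
 assumes "seg vc c" "bounded_by w s" "1 <= vc" "vc <= w" "!!b. b : bnds c ==> nat (s b 0) <= B"
 shows "reaches_in D (seg_time c B w) (compile c # cs, s) (cs, den c s)"
  and "bounded_by (seg_bits c B w) (den c s)"
proof -
 have st: "stp c s <= max_steps c (%_. B)" by (rule stp_le_max_steps[of c "wr c"]) (use assms in "auto simp: seg_def")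
 obtain St where "tame_prg St vc 50 c" using assms(1) unfolding seg_def by blast
 moreover have "static_by St w s" using assms unfolding static_by_def bounded_by_def by auto
 ultimately have *: "bounded_by (w + stp c s * (50 * (w + 1))) (den c s)"
  "tm c s <= stp c s * step_cost 50 w (w + stp c s * (50 * (w + 1)))" using den_tm_bound[of St vc 50 c w s w] assms unfolding seg_def by auto
 have le: "w + stp c s * (50 * (w + 1)) <= seg_bits c B w" unfolding seg_bits_def using st by (intro add_left_mono mult_le_mono) auto
 show "bounded_by (seg_bits c B w) (den c s)" using *(1) le by (rule bounded_by_mono)
 have "tm c s <= seg_time c B w" unfolding seg_time_def using *(2) by (rule order_trans) (intro mult_le_mono st step_cost_mono le)
 moreover have "stp c s <= seg_time c B w"
 proof -
  have "stp c s * 1 <= max_steps c (%_. B) * step_cost 50 w (seg_bits c B w)" by (intro mult_le_mono st) (simp add: step_cost_def)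
  thus ?thesis unfolding seg_time_def by simp
 qed
 ultimately show "reaches_in D (seg_time c B w) (compile c # cs, s) (cs, den c s)"
  using reaches_compile[of c D cs s] assms unfolding seg_def reaches_in_def fst_conv snd_conv by blast
qed

section \<open>Programs that prepare the input\<close>

abbreviation "aLN == 9::nat"
abbreviation "aLD == 10::nat"
abbreviation "aCS == 11::nat"
abbreviation "aBIG == 13::nat"
abbreviation "aL == 14::nat"
abbreviation "aTS == 21::nat"
abbreviation "aBUF == 22::nat"
abbreviation "aKK == 26::nat"
abbreviation "aZC == 27::nat"

abbreviation inp_cell :: "int => aexp" where "inp_cell j == Get 0 (Const j)"
abbreviation cost_cell :: "int => aexp" where "cost_cell j == Get 0 (Add (Const j) (Mul (Const 2) (Var aKK)))"

definition read_prg :: prg where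
 "read_prg = aN :=: inp_cell 1 ;; aS :=: inp_cell 2 ;; aNN :=: Mul (inp_cell 1) (inp_cell 1)"

text \<open>The product of all denominators serves as common denominator and makes the costs
  integers; its length stays polynomial because every factor is an input number.\<close>

definition scale_prg :: prg where
 "scale_prg = aDEN :=: Const 1 ;; PFor aKK aNN (aDEN :=: Mul (Var aDEN) (cost_cell 10)) ;;
   PFor aKK aNN (PAsg aC (Var aKK) (Mul (cost_cell 9) (Div (Var aDEN) (cost_cell 10))))"

text \<open>Cells 3, 4 and 7, 8 of the input hold numerator and denominator of the inflation and of
  \<open>eps\<close>. The quotient of \<open>aLN\<close> and \<open>aLD\<close> is
  \<open>max 1 (inflation / max 1 eps)\<close>, and \<open>aBIG\<close> collects a number whose
  length bounds those of all input entries.\<close>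

definition sizes_prg :: prg where
 "sizes_prg = aCS :=: Const 1 ;; PFor aKK aNN (aCS :=: Add (Var aCS) (Get aC (Var aKK))) ;;
   PFor aKK 0 (aBIG :=: Add (Var aBIG) (Get 0 (inc_exp aKK))) ;;
   PIf (Sub (inp_cell 7) (inp_cell 8))
    (PIf (Sub (Mul (inp_cell 4) (inp_cell 7)) (Mul (inp_cell 3) (inp_cell 8)))
     (aLN :=: Const 1 ;; aLD :=: Const 1)
     (aLN :=: Mul (inp_cell 3) (inp_cell 8) ;; aLD :=: Mul (inp_cell 4) (inp_cell 7)))
    (aLN :=: inp_cell 3 ;; aLD :=: inp_cell 4)"

definition unit_prg :: prg where
 "unit_prg = aUn :=: Mul (Mul (Const 200) (Var aCS)) (inp_cell 6) ;;
   aBIG :=: Add (Var aBIG) (Mul (Var aUn) (Var aCS))"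

text \<open>\<open>aM\<close> is the threshold \<open>aMm\<close> times \<open>aLN / aLD\<close>,
  rounded down. The \<open>+ 1\<close> in \<open>aFL\<close> turns the strict positivity test into
  the weak inequality that the radius times this factor is at least 1.\<close>

definition count_prg :: "int => prg" where
 "count_prg k0 =
   aMm :=: Mul (Const k0) (Add (Mul (Add (Const 9) (Mul (Const 2) (Var aNN))) (Var aL)) (Add (Const 9) (Mul (Const 2) (Var aNN)))) ;;
   aM :=: Div (Mul (Var aMm) (Var aLN)) (Var aLD) ;;
   aI :=: Add (Var aL) (Const 2) ;;
   aFL :=: Add (Sub (Mul (inp_cell 5) (Var aLN)) (Mul (inp_cell 6) (Var aLD))) (Const 1) ;;
   aK1 :=: Mul (Mul (Mul (Var aLN) (inp_cell 5)) (Var aDEN)) (Var aUn)"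

text \<open>The guesses are \<open>0, 1, 2, 4, ...\<close> in units of the reciprocal of
  \<open>aUn\<close>.\<close>

definition grid_body :: prg where
 "grid_body = PAsg aZ (Var aKK) (Var aZC) ;;
   PAsg aK2 (Var aKK) (Mul (Mul (Mul (Const 4) (Var aZC)) (Var aLD)) (inp_cell 6)) ;;
   PIf (Var aZC) (aZC :=: Mul (Const 2) (Var aZC)) (aZC :=: Const 1)"

definition grid_prg :: prg where
 "grid_prg = PFor aKK aI grid_body"

definition copy_prg :: prg where
 "copy_prg = PFor aKK aN (PAsg aSA (idx aTS aKK) (Get aBUF (inc_exp aKK)))"

lemmas pre_defs = read_prg_def scale_prg_def sizes_prg_def unit_prg_def count_prg_def grid_prg_def grid_body_def copy_prg_def

lemma segI: "tame_prg St vc 50 c ==> wf c ==> bnds c Int wr c = {} ==> seg vc c" unfolding seg_def by blast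

lemma seg_pre:
 assumes "10 <= vc"
 shows "seg vc read_prg" "seg vc scale_prg" "seg vc sizes_prg" "seg vc unit_prg" "seg vc grid_prg" "seg vc copy_prg"
  "\<bar>k0\<bar> < 2 ^ vc ==> seg vc (count_prg k0)"
proof -
 have "(2::int) ^ 10 <= 2 ^ vc" using assms by (intro power_increasing) auto
 hence c: "\<bar>z\<bar> < 1024 ==> \<bar>z\<bar> < 2 ^ vc" for z :: int by simp
 note cc = c[of 0] c[of 1] c[of 2] c[of 3] c[of 4] c[of 5] c[of 6] c[of 7] c[of 8] c[of 9] c[of 10] c[of 200]
 show "seg vc read_prg" "seg vc scale_prg" "seg vc sizes_prg" "seg vc unit_prg" "seg vc grid_prg" "seg vc copy_prg"
  "\<bar>k0\<bar> < 2 ^ vc ==> seg vc (count_prg k0)" using cc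
   segI[of "{0}" vc read_prg] segI[of "{0}" vc scale_prg] segI[of "{0}" vc sizes_prg] segI[of "{0, aCS}" vc unit_prg]
   segI[of "{0, aLD}" vc grid_prg] segI[of "{aN}" vc copy_prg] segI[of "{0, aNN, aL, aLN, aLD, aDEN, aUn}" vc "count_prg k0"]
  by (simp_all add: pre_defs)
qed

text \<open>One choice of static arrays and of loop bounds serves all parts of
  \<open>main_prg\<close>, so that \<open>ok\<close> is closed under sequencing.\<close>

lemma seg_main:
 assumes "10 <= vc"
 shows "seg vc (main_prg asym_prg)" "seg vc (main_prg discrete_prg)"
proof -
 have "(2::int) ^ 10 <= 2 ^ vc" using assms by (intro power_increasing) auto
 hence c: "\<bar>z\<bar> < 1024 ==> \<bar>z\<bar> < 2 ^ vc" for z :: int by simp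
 note cc = c[of 0] c[of 1] c[of 2] c[of 3] c[of 4] c[of 8] c[of 9] c[of 10] c[of 84]
 define Bd :: "nat set" where "Bd = {aN, aNN, aM, aI}"
 define St :: "nat set" where "St = {aN, aNN, aC, aMm, aUn, aK1, aK2, aZ}"
 define ok where "ok c = (tame_prg St vc 50 c & wf c &
   bnds c <= Bd & wr c Int Bd = {})" for c
 have "ok radii_prg" unfolding ok_def St_def Bd_def using cc by (simp add: radii_defs)
 moreover have "ok centres_prg" unfolding ok_def St_def Bd_def using cc by (simp add: centres_defs)
 moreover have disc: "ok discrete_prg" unfolding ok_def St_def Bd_def using cc by (simp add: discrete_prg_def)
 moreover have "ok final_prg" unfolding ok_def St_def Bd_def using cc wf_prim
  by (simp add: final_prg_def marks_body_def tree_prg_def root_body_def wr_prim)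
    (simp add: prim_prg_def prim_scan_def prim_add_def)
 moreover have asym: "ok asym_prg" unfolding ok_def St_def Bd_def using cc wf_prim
  by (simp add: asym_defs wr_prim)  (simp add: prim_prg_def prim_scan_def prim_add_def)
 ultimately have main: "ok (main_prg c)" if "ok c" for c
 proof -
  have comp: "ok (c1 ;; c2)" if "ok c1" "ok c2" for c1 c2 using that unfolding ok_def wr.simps bnds.simps wf.simps tame_prg.simps by blast
  show ?thesis unfolding main_prg_def using that \<open>ok radii_prg\<close> \<open>ok centres_prg\<close> \<open>ok final_prg\<close> by (intro comp)
 qed
 have "seg vc c" if "ok c" for c
 proof (rule segI)
  show "tame_prg St vc 50 c" "wf c" using that unfolding ok_def by simp_all
  show "bnds c Int wr c = {}" using that unfolding ok_def by blast
 qed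
 thus "seg vc (main_prg asym_prg)" "seg vc (main_prg discrete_prg)" using main asym disc by simp_all
qed

text \<open>Flattens the row-wise encoding of the distance matrix into a list indexed by
  \<open>k = u * n + v\<close>.\<close>

lemma concat_blocks:
 "concat (map (%u. concat (map (%v. f u v) [0..<n])) [0..<m]) = concat (map (%k. f (k div n) (k mod n)) [0..<m * n])"
proof (induction m)
 case (Suc m)
 have "[0..<Suc m * n] = [0..<m * n] @ map (%v. v + m * n) [0..<n]"
  unfolding map_add_upt using upt_add_eq_append[of 0 "m * n" n] by (simp add: add.commute)
 moreover have "concat (map (%k. f (k div n) (k mod n)) (map (%v. v + m * n) [0..<n])) = concat (map (%v. f m v) [0..<n])"
  unfolding map_map by (intro arg_cong[of _ _ concat] map_cong) auto
 ultimately show ?case using Suc by simp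
qed simp

lemma concat_pairs:
 "length (concat (map (%k. [f k, g k]) [0..<N])) = 2 * N"
 "k < N ==> concat (map (%k. [f k, g k]) [0..<N]) ! (2 * k) = f k"
 "k < N ==> concat (map (%k. [f k, g k]) [0..<N]) ! (2 * k + 1) = g k"
proof -
 show len: "length (concat (map (%k. [f k, g k]) [0..<N])) = 2 * N" for N by (induction N) auto
 show "k < N ==> concat (map (%k. [f k, g k]) [0..<N]) ! (2 * k) = f k" by (induction N) (auto simp: nth_append len less_Suc_eq)
 show "k < N ==> concat (map (%k. [f k, g k]) [0..<N]) ! (2 * k + 1) = g k" by (induction N) (auto simp: nth_append len less_Suc_eq)
qed

section \<open>Integer data of an instance and correctness of the preparation\<close>

abbreviation num :: "rat => int" where "num q == fst (quotient_of q)"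
abbreviation dnm :: "rat => int" where "dnm q == snd (quotient_of q)"

lemma dnm_pos: "0 < dnm q" using quotient_of_denom_pos' by simp

lemma rat_eq: "rq q = ri (num q) / ri (dnm q)"
 using quotient_of_div[of q "num q" "dnm q"] by (metis of_rat_divide of_rat_of_int_eq prod.collapse)

lemma num_nonneg: "0 <= q ==> 0 <= num q"
proof -
 assume "0 <= q"
 hence "0 <= ri (num q) / ri (dnm q)" unfolding rat_eq [symmetric] by simp
 thus ?thesis using dnm_pos[of q] by (simp add: zero_le_divide_iff)
qed

lemma num_pos: "0 < q ==> 0 < num q"
proof -
 assume "0 < q"
 hence "0 < ri (num q) / ri (dnm q)" unfolding rat_eq [symmetric] by simp
 thus ?thesis using dnm_pos[of q] by (simp add: zero_less_divide_iff)
qed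

locale dr_input =
 fixes I :: steiner and eps :: rat and p :: "nat set pmf"
 assumes valid: "valid_instance I" and eps_pos: "0 < eps" and p_subset: "set_pmf p <= Pow (verts I)"
begin

abbreviation "n == num_verts I"
abbreviation "s == root_vert I"
abbreviation "inp == encode_input I eps"
abbreviation "dball kp == distribution_ball kp I p"

definition cst :: "nat => rat" where "cst k = dist_cost I (k div n) (k mod n)"
definition DEN :: int where "DEN = (PROD k<n * n. dnm (cst k))"
definition Cc :: "nat => int" where "Cc k = num (cst k) * (DEN div dnm (cst k))"
text \<open>Sends numbers outside the vertex set to vertex 0, so that \<open>d\<close> is a
  pseudometric on all of \<open>nat\<close>, as the locale \<open>core\<close> requires.\<close>

definition clip :: "nat => nat" where "clip u = (if u < n then u else 0)"
definition d :: "nat => nat => real" where "d u v = ri DEN * rq (dist_cost I (clip u) (clip v))"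
definition CS :: int where "CS = 1 + (SUM k<n * n. Cc k)"
text \<open>The unit \<open>1 / U\<close> of the guesses is chosen for \<open>small_cs\<close> and
  \<open>small_mean\<close>: \<open>CS\<close> exceeds every distance between vertices, the
  denominator of the radius bounds the radius away from 0, and \<open>200\<close> leaves the
  margin.\<close>

definition U :: int where "U = 200 * CS * dnm (radius I)"
text \<open>Dominates every input number and \<open>U\<close> times the optimum, so that its binary
  length \<open>L\<close> controls both the input size and the number of doublings in the grid of
  guesses.\<close>

definition BIG :: int where "BIG = (SUM k<length inp. inp ! k) + U * CS"
definition L :: nat where "L = floorlog 2 (nat BIG)"
definition LN :: int where
 "LN = (if dnm eps < num eps then if num (inflation I) * dnm eps < dnm (inflation I) * num eps then 1
   else num (inflation I) * dnm eps else num (inflation I))"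
definition LD :: int where
 "LD = (if dnm eps < num eps then if num (inflation I) * dnm eps < dnm (inflation I) * num eps then 1
   else dnm (inflation I) * num eps else dnm (inflation I))"

lemma s_lt: "s < n" using valid unfolding valid_instance_def verts_def by simp

lemma clip_lt: "clip u < n" using s_lt unfolding clip_def by auto

lemma div_mod_lt: "k < n * n ==> k div n < n & k mod n < n" using s_lt by (auto simp: less_mult_imp_div_less)

lemma DEN_pos: "0 < DEN" unfolding DEN_def by (intro prod_pos) (simp add: dnm_pos)

lemma Cc_eq: assumes "k < n * n" shows "ri (Cc k) = ri DEN * rq (cst k)"
proof -
 have "dnm (cst k) dvd DEN" unfolding DEN_def using assms by (intro dvd_prodI) auto
 hence "ri (DEN div dnm (cst k)) = ri DEN / ri (dnm (cst k))" by (rule real_of_int_div)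
 thus ?thesis unfolding Cc_def rat_eq by simp
qed

lemma Cc_d: "k < n * n ==> ri (Cc k) = d (k div n) (k mod n)" using Cc_eq[of k] div_mod_lt[of k] unfolding d_def clip_def cst_def by simp

lemma cost_nonneg: "u < n ==> v < n ==> 0 <= dist_cost I u v"
 and cost_sym: "u < n ==> v < n ==> dist_cost I u v = dist_cost I v u"
 and cost_self: "u < n ==> dist_cost I u u = 0"
 and cost_tri: "u < n ==> v < n ==> w < n ==> dist_cost I u w <= dist_cost I u v + dist_cost I v w"
 using valid unfolding valid_instance_def verts_def by blast+

sublocale core d n s
proof
 show "d x x = 0" for x unfolding d_def using cost_self[OF clip_lt] by simp
 show "d x y = d y x" for x y unfolding d_def using cost_sym[OF clip_lt clip_lt] by simp
 show "d x z <= d x y + d y z" for x y z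
 proof -
  have "rq (dist_cost I (clip x) (clip z)) <= rq (dist_cost I (clip x) (clip y) + dist_cost I (clip y) (clip z))"
   using cost_tri[OF clip_lt clip_lt clip_lt] by (simp only: of_rat_less_eq)
  thus ?thesis unfolding d_def using DEN_pos by (simp add: of_rat_add distrib_left [symmetric])
 qed
qed (rule s_lt)

lemma inflation_ge1: "1 <= inflation I" and radius_nonneg: "0 <= radius I" using valid unfolding valid_instance_def by auto

lemma inp_eq: "inp = [int n, int s, num (inflation I), dnm (inflation I), num (radius I), dnm (radius I), num eps, dnm eps] @
  concat (map (%k. [num (cst k), dnm (cst k)]) [0..<n * n])" unfolding encode_input_def encode_rat_def concat_blocks cst_def by simp

lemma length_inp: "length inp = 8 + 2 * (n * n)" unfolding inp_eq length_append concat_pairs(1) by simp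

lemma inp_cells:
 "array_of inp 0 = 8 + 2 * int (n * n)" "array_of inp 1 = int n" "array_of inp (Suc 0) = int n" "array_of inp 2 = int s"
 "array_of inp 3 = num (inflation I)" "array_of inp 4 = dnm (inflation I)" "array_of inp 5 = num (radius I)"
 "array_of inp 6 = dnm (radius I)" "array_of inp 7 = num eps" "array_of inp 8 = dnm eps" unfolding array_of_def length_inp by (auto simp: inp_eq)

lemma inp_cost_cells:
 assumes "k < n * n"
 shows "array_of inp (9 + 2 * k) = num (cst k)" "array_of inp (10 + 2 * k) = dnm (cst k)"
proof -
 let ?xs = "[int n, int s, num (inflation I), dnm (inflation I), num (radius I), dnm (radius I), num eps, dnm eps]"
 let ?ys = "concat (map (%k. [num (cst k), dnm (cst k)]) [0..<n * n])"
 have nth: "(?xs @ ?ys) ! (length ?xs + j) = ?ys ! j" for j by (rule nth_append_length_plus)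
 have "array_of inp (9 + 2 * k) = (?xs @ ?ys) ! (length ?xs + 2 * k)" "array_of inp (10 + 2 * k) = (?xs @ ?ys) ! (length ?xs + (2 * k + 1))"
  unfolding array_of_def length_inp using assms by (auto simp: inp_eq)
 thus "array_of inp (9 + 2 * k) = num (cst k)" "array_of inp (10 + 2 * k) = dnm (cst k)" unfolding nth using concat_pairs(2,3)[OF assms] by metis+
qed

lemma den_read: "st 0 = array_of inp ==> den read_prg st aN 0 = int n & den read_prg st aS 0 = int s & den read_prg st aNN 0 = int (n * n)"
 unfolding read_prg_def using inp_cells by simp

lemma den_scale:
 assumes "st 0 = array_of inp" "st aNN 0 = int (n * n)"
 shows "den scale_prg st aDEN 0 = DEN" "k < n * n ==> den scale_prg st aC k = Cc k"
proof -
 define st1 where "st1 = den (PFor aKK aNN (aDEN :=: Mul (Var aDEN) (cost_cell 10))) (upd st aDEN 0 1)"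
 have nn: "nat (upd st aDEN 0 1 aNN 0) = n * n" using assms by (simp del: of_nat_mult)
 have "(%j q. q aDEN 0 = (PROD k<j. dnm (cst k)) & q 0 = st 0 & q aNN = st aNN) (nat (upd st aDEN 0 1 aNN 0)) st1" unfolding st1_def
 proof (rule den_PFor_invariant)
  fix j q assume j: "j < nat (upd st aDEN 0 1 aNN 0)" and qj: "q aKK 0 = int j"
   and Q: "q aDEN 0 = (PROD k<j. dnm (cst k)) & q 0 = st 0 & q aNN = st aNN"
  have jn: "j < n * n" using j unfolding nn .
  have na: "nat (10 + 2 * int j) = 10 + 2 * j" by simp
  show "inc aKK (den (aDEN :=: Mul (Var aDEN) (cost_cell 10)) q) aDEN 0 = (PROD k<Suc j. dnm (cst k)) &
    inc aKK (den (aDEN :=: Mul (Var aDEN) (cost_cell 10)) q) 0 = st 0 & inc aKK (den (aDEN :=: Mul (Var aDEN) (cost_cell 10)) q) aNN = st aNN"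
   using Q inp_cost_cells(2)[OF jn] by (simp add: inc_def qj na assms)
 qed auto
 hence s1: "st1 aDEN 0 = DEN" "st1 0 = array_of inp" "st1 aNN = st aNN" unfolding nn DEN_def assms by auto
 have nn1: "nat (st1 aNN 0) = n * n" using assms s1 by (simp del: of_nat_mult)
 let ?c = "PAsg aC (Var aKK) (Mul (cost_cell 9) (Div (Var aDEN) (cost_cell 10)))"
 have den: "den scale_prg st = den (PFor aKK aNN ?c) st1" unfolding scale_prg_def st1_def by (simp del: den.simps(4))
 have "(%j q. (ALL k<j. q aC k = Cc k) & q 0 = array_of inp & q aDEN 0 = DEN) (nat (st1 aNN 0)) (den (PFor aKK aNN ?c) st1)"
 proof (rule den_PFor_invariant)
  fix j q assume j: "j < nat (st1 aNN 0)" and qj: "q aKK 0 = int j"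
   and Q: "(ALL k<j. q aC k = Cc k) & q 0 = array_of inp & q aDEN 0 = DEN"
  have jn: "j < n * n" using j unfolding nn1 .
  have na: "nat (10 + 2 * int j) = 10 + 2 * j" "nat (9 + 2 * int j) = 9 + 2 * j" by simp_all
  have v: "q 0 (9 + 2 * j) = num (cst j)" "q 0 (10 + 2 * j) = dnm (cst j)" "q aDEN 0 = DEN" using Q inp_cost_cells[OF jn] by auto
  have de: "den ?c q = upd q aC j (Cc j)" unfolding Cc_def by (simp add: qj na v)
  show "(ALL k<Suc j. inc aKK (den ?c q) aC k = Cc k) & inc aKK (den ?c q) 0 = array_of inp & inc aKK (den ?c q) aDEN 0 = DEN"
   using Q unfolding de by (simp add: inc_def less_Suc_eq)
 qed (use s1 in auto)
 thus "den scale_prg st aDEN 0 = DEN" "k < n * n ==> den scale_prg st aC k = Cc k" unfolding nn1 den by auto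
qed

lemma array_of_Suc: "k < length inp ==> array_of inp (Suc k) = inp ! k" unfolding array_of_def by simp

lemma den_sizes:
 assumes "st 0 = array_of inp" "st aNN 0 = int (n * n)" "!!k. k < n * n ==> st aC k = Cc k" "st aBIG 0 = 0"
 shows "den sizes_prg st aCS 0 = CS" "den sizes_prg st aBIG 0 = (SUM k<length inp. inp ! k)"
  "den sizes_prg st aLN 0 = LN" "den sizes_prg st aLD 0 = LD"
proof -
 let ?c1 = "aCS :=: Add (Var aCS) (Get aC (Var aKK))" and ?c2 = "aBIG :=: Add (Var aBIG) (Get 0 (inc_exp aKK))"
 define st1 where "st1 = den (PFor aKK aNN ?c1) (upd st aCS 0 1)"
 have nn: "nat (upd st aCS 0 1 aNN 0) = n * n" using assms by (simp del: of_nat_mult)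
 have "(%j q. q aCS 0 = 1 + (SUM k<j. Cc k) & q aC = st aC) (nat (upd st aCS 0 1 aNN 0)) st1"
  unfolding st1_def by (rule den_PFor_invariant) (use nn assms(3) in "auto simp: inc_def")
 hence s1: "st1 aCS 0 = CS" unfolding nn CS_def by auto
 have fr1: "st1 x = st x" if "x ~: {aCS, aKK}" for x
 proof -
  have "st1 x = upd st aCS 0 1 x" unfolding st1_def using that by (intro den_frame) auto
  thus ?thesis using that by auto
 qed
 define st2 where "st2 = den (PFor aKK 0 ?c2) st1"
 have "st1 0 0 = 8 + 2 * int (n * n)" unfolding fr1[of 0, simplified] assms(1) inp_cells(1) ..
 hence nn1: "nat (st1 0 0) = length inp" unfolding length_inp by (simp del: of_nat_mult add: nat_add_distrib nat_mult_distrib)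
 have "(%j q. q aBIG 0 = (SUM k<j. inp ! k) & q 0 = array_of inp) (nat (st1 0 0)) st2" unfolding st2_def
 proof (rule den_PFor_invariant)
  fix j q assume j: "j < nat (st1 0 0)" and qj: "q aKK 0 = int j" and Q: "q aBIG 0 = (SUM k<j. inp ! k) & q 0 = array_of inp"
  have "array_of inp (Suc j) = inp ! j" using j unfolding nn1 by (rule array_of_Suc)
  moreover have "nat (int j + 1) = Suc j" by simp
  ultimately show "inc aKK (den ?c2 q) aBIG 0 = (SUM k<Suc j. inp ! k) & inc aKK (den ?c2 q) 0 = array_of inp" using Q by (simp add: inc_def qj)
 qed (use assms fr1[of aBIG] fr1[of 0] in auto)
 hence s2: "st2 aBIG 0 = (SUM k<length inp. inp ! k)" "st2 0 = array_of inp" unfolding nn1 by auto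
 have s2': "st2 aCS 0 = CS" using den_frame[of aCS "PFor aKK 0 ?c2" st1] s1 unfolding st2_def by simp
 let ?c3 = "PIf (Sub (inp_cell 7) (inp_cell 8))
    (PIf (Sub (Mul (inp_cell 4) (inp_cell 7)) (Mul (inp_cell 3) (inp_cell 8)))
     (aLN :=: Const 1 ;; aLD :=: Const 1)
     (aLN :=: Mul (inp_cell 3) (inp_cell 8) ;; aLD :=: Mul (inp_cell 4) (inp_cell 7)))
    (aLN :=: inp_cell 3 ;; aLD :=: inp_cell 4)"
 have den: "den sizes_prg st = den ?c3 st2" unfolding sizes_prg_def st2_def st1_def by (simp del: den.simps(4))
 show "den sizes_prg st aCS 0 = CS" "den sizes_prg st aBIG 0 = (SUM k<length inp. inp ! k)"
  "den sizes_prg st aLN 0 = LN" "den sizes_prg st aLD 0 = LD" unfolding den LN_def LD_def using s2 s2' inp_cells by simp_all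
qed

definition zc :: "nat => int" where "zc i = (if i = 0 then 0 else 2 ^ (i - 1))"

lemma zc_Suc: "zc (Suc j) = (if 0 < zc j then 2 * zc j else 1)" unfolding zc_def by (cases j) auto

lemma den_grid:
 assumes "st 0 = array_of inp" "st aLD 0 = LD" "st aZC 0 = 0" "i < nat (st aI 0)"
 shows "den grid_prg st aZ i = zc i" "den grid_prg st aK2 i = 4 * zc i * LD * dnm (radius I)"
proof -
 have "(%j q. (ALL i<j. q aZ i = zc i & q aK2 i = 4 * zc i * LD * dnm (radius I)) & q aZC 0 = zc j & q 0 = st 0 & q aLD = st aLD)
   (nat (st aI 0)) (den grid_prg st)" unfolding grid_prg_def
 proof (rule den_PFor_invariant)
  fix j q assume qj: "q aKK 0 = int j"
   and Q: "(ALL i<j. q aZ i = zc i & q aK2 i = 4 * zc i * LD * dnm (radius I)) & q aZC 0 = zc j & q 0 = st 0 & q aLD = st aLD"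
  show "(ALL i<Suc j. inc aKK (den grid_body q) aZ i = zc i & inc aKK (den grid_body q) aK2 i = 4 * zc i * LD * dnm (radius I)) &
    inc aKK (den grid_body q) aZC 0 = zc (Suc j) & inc aKK (den grid_body q) 0 = st 0 & inc aKK (den grid_body q) aLD = st aLD"
   using Q assms inp_cells unfolding zc_Suc grid_body_def by (auto simp: inc_def qj less_Suc_eq)
 qed (use assms in "auto simp: grid_body_def zc_def")
 thus "den grid_prg st aZ i = zc i" "den grid_prg st aK2 i = 4 * zc i * LD * dnm (radius I)" using assms(4) by auto
qed

lemma copy_spec:
 assumes "st aN 0 = int n" "st aTS 0 = int t" "st aBUF = array_of (encode_scenario I A)"
 shows "j < n ==> den copy_prg st aSA (t * n + j) = of_bool (j : A)"
  "i < t * n ==> den copy_prg st aSA i = st aSA i"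
proof -
 let ?c = "PAsg aSA (idx aTS aKK) (Get aBUF (inc_exp aKK))"
 have nn: "nat (st aN 0) = n" using assms by simp
 have "(%j q. (ALL i<j. q aSA (t * n + i) = of_bool (i : A)) & (ALL i<t * n. q aSA i = st aSA i) & q aN = st aN & q aTS = st aTS & q aBUF = st aBUF)
   (nat (st aN 0)) (den copy_prg st)" unfolding copy_prg_def
 proof (rule den_PFor_invariant)
  fix j q assume j: "j < nat (st aN 0)" and qj: "q aKK 0 = int j"
   and Q: "(ALL i<j. q aSA (t * n + i) = of_bool (i : A)) & (ALL i<t * n. q aSA i = st aSA i) & q aN = st aN & q aTS = st aTS & q aBUF = st aBUF"
  have "nat (int j + 1) = Suc j" by simp
  moreover have "array_of (encode_scenario I A) (Suc j) = of_bool (j : A)" using j unfolding nn array_of_def encode_scenario_def by simp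
  ultimately have de: "den ?c q = upd q aSA (t * n + j) (of_bool (j : A))" using Q by (simp add: qj assms nat_idx)
  show "(ALL i<Suc j. inc aKK (den ?c q) aSA (t * n + i) = of_bool (i : A)) & (ALL i<t * n. inc aKK (den ?c q) aSA i = st aSA i) &
    inc aKK (den ?c q) aN = st aN & inc aKK (den ?c q) aTS = st aTS & inc aKK (den ?c q) aBUF = st aBUF"
   using Q unfolding de by (auto simp: inc_def less_Suc_eq)
 qed auto
 thus "j < n ==> den copy_prg st aSA (t * n + j) = of_bool (j : A)"
  "i < t * n ==> den copy_prg st aSA i = st aSA i" unfolding nn by auto
qed

end

section \<open>The solver and its polynomial time bound\<close>

definition solver :: "nat => prg => com" where
 "solver k0 c = Seq (compile read_prg) (Seq (compile scale_prg) (Seq (compile sizes_prg) (Seq (compile unit_prg)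
   (Seq (halving aBIG aL) (Seq (compile (count_prg (int k0))) (Seq (compile grid_prg)
   (Seq (sampling aTS aM aBUF copy_prg) (compile (main_prg c)))))))))"

definition bits1 :: "nat => nat => nat" where "bits1 vc N = seg_bits read_prg N (N + vc)"
definition bits2 :: "nat => nat => nat" where "bits2 vc N = seg_bits scale_prg N (bits1 vc N)"
definition bits3 :: "nat => nat => nat" where "bits3 vc N = seg_bits sizes_prg N (bits2 vc N)"
definition bits4 :: "nat => nat => nat" where "bits4 vc N = seg_bits unit_prg N (bits3 vc N)"
text \<open>Bounds all loop bounds after the halving loop: the numbers of vertices and of matrix
  entries, the \<open>L + 2\<close> guesses, and the number of samples.\<close>

definition loops :: "nat => nat => nat => nat" where
 "loops vc k0 N = N + (bits4 vc N + 2) + k0 * (9 + 2 * N) * (bits4 vc N + 1) * N"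
definition bits5 :: "nat => nat => nat => nat" where
 "bits5 vc k0 N = seg_bits (count_prg (int k0)) (loops vc k0 N) (bits4 vc N)"
definition bits6 :: "nat => nat => nat => nat" where "bits6 vc k0 N = seg_bits grid_prg (loops vc k0 N) (bits5 vc k0 N)"
definition bits7 :: "nat => nat => nat => nat" where
 "bits7 vc k0 N = bits6 vc k0 N + loops vc k0 N * ((4 + 4 * N) * (50 * (bits6 vc k0 N + 1)))"

definition pre_time :: "nat => nat => nat => nat" where
 "pre_time vc k0 N = 1 + (seg_time read_prg N (N + vc) + (1 + (seg_time scale_prg N (bits1 vc N) +
   (1 + (seg_time sizes_prg N (bits2 vc N) + (1 + (seg_time unit_prg N (bits3 vc N) +
   (1 + ((1 + 4 * bits4 vc N) * step_cost 5 (bits4 vc N) (bits4 vc N + bits4 vc N * (5 * (bits4 vc N + 1))) +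
   (1 + (seg_time (count_prg (int k0)) (loops vc k0 N) (bits4 vc N) + (1 + (seg_time grid_prg (loops vc k0 N) (bits5 vc k0 N) + 1)))))))))))))"

definition sample_time :: "nat => nat => nat => nat" where
 "sample_time vc k0 N = (1 + loops vc k0 N) * ((8 + 4 * N) * step_cost 50 (bits6 vc k0 N) (bits7 vc k0 N) + (1 + 2 * N))"

definition solver_time :: "nat => nat => prg => nat => nat" where
 "solver_time vc k0 c N = pre_time vc k0 N + (sample_time vc k0 N + loops vc k0 N * (8 + 4 * N) + 1) +
   seg_time (main_prg c) (loops vc k0 N) (bits7 vc k0 N) + (1 + 4 * N * N) + (1 + 2 * N)"

lemma poly_bounded_solver_time: "poly_bounded (solver_time vc k0 c)"
proof -
 note [intro!] = poly_intros poly_bounded_seg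
 have w1: "poly_bounded (bits1 vc)" unfolding bits1_def by (intro poly_bounded_seg poly_intros)
 have w2: "poly_bounded (bits2 vc)" unfolding bits2_def by (intro poly_bounded_seg poly_intros w1)
 have w3: "poly_bounded (bits3 vc)" unfolding bits3_def by (intro poly_bounded_seg poly_intros w2)
 have w4: "poly_bounded (bits4 vc)" unfolding bits4_def by (intro poly_bounded_seg poly_intros w3)
 have B: "poly_bounded (loops vc k0)" unfolding loops_def by (intro poly_intros w4)
 have w5: "poly_bounded (bits5 vc k0)" unfolding bits5_def by (intro poly_bounded_seg B w4)
 have w6: "poly_bounded (bits6 vc k0)" unfolding bits6_def by (intro poly_bounded_seg B w5)
 have w7: "poly_bounded (bits7 vc k0)" unfolding bits7_def by (intro poly_intros B w6)
 show ?thesis unfolding solver_time_def sample_time_def pre_time_def step_cost_def by (intro poly_intros poly_bounded_seg w1 w2 w3 w4 w5 w6 w7 B)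
qed

lemma bit_size_bound: "\<bar>x\<bar> < 2 ^ bit_size x"
proof -
 have "nat \<bar>x\<bar> < 2 ^ floorlog 2 (nat \<bar>x\<bar>)" using floorlog_leD[of 2 "nat \<bar>x\<bar>" "floorlog 2 (nat \<bar>x\<bar>)"] by simp
 hence "\<bar>x\<bar> < 2 ^ floorlog 2 (nat \<bar>x\<bar>)" by (simp add: nat_less_iff)
 also have "(2::int) ^ floorlog 2 (nat \<bar>x\<bar>) <= 2 ^ bit_size x" unfolding bit_size_def by (intro power_increasing) auto
 finally show ?thesis .
qed

lemma bit_size_le_list_size: "x : set xs ==> bit_size x < list_size xs"
 unfolding list_size_def using member_le_sum_list[of "bit_size x" "map bit_size xs"] by simp

lemma length_less_list_size: "length xs < list_size xs"
proof -
 have "sum_list (map (%x. 1) xs) <= sum_list (map bit_size xs)" by (intro sum_list_mono) (simp add: bit_size_def)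
 thus ?thesis unfolding list_size_def by (simp add: sum_list_triv)
qed

lemma array_of_bound: "list_size xs <= w ==> \<bar>array_of xs i\<bar> < 2 ^ w"
proof -
 assume w: "list_size xs <= w"
 consider "i = 0" | "i ~= 0" "i <= length xs" | "i > length xs" by linarith
 thus ?thesis
 proof cases
  case 1
  have "length xs < 2 ^ length xs" by (rule less_exp)
  hence "int (length xs) < 2 ^ length xs" by (metis of_nat_less_iff of_nat_numeral of_nat_power)
  also have "(2::int) ^ length xs <= 2 ^ w" using length_less_list_size[of xs] w by (intro power_increasing) auto
  finally show ?thesis using 1 unfolding array_of_def by simp
 next
  case 2
  let ?x = "xs ! (i - 1)"
  have "?x : set xs" using 2 by simp
  hence "(2::int) ^ bit_size ?x <= 2 ^ w" using bit_size_le_list_size[of ?x xs] w by (intro power_increasing) auto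
  from less_le_trans[OF bit_size_bound this] show ?thesis using 2 unfolding array_of_def by simp
 qed (auto simp: array_of_def)
qed

lemma bounded_initial_state: "(!!xs. xs : set xss ==> list_size xs <= w) ==> bounded_by w (initial_state xss)"
 unfolding bounded_by_def initial_state_def by (auto intro!: array_of_bound)

lemma wr_pre: "wr read_prg = {aN, aS, aNN}" "wr scale_prg = {aDEN, aKK, aC}" "wr sizes_prg = {aCS, aKK, aBIG, aLN, aLD}"
 "wr unit_prg = {aUn, aBIG}" "wr (count_prg k) = {aMm, aM, aI, aFL, aK1}" "wr grid_prg = {aKK, aZ, aK2, aZC}"
 "wr copy_prg = {aKK, aSA}" unfolding pre_defs by auto

lemma bnds_pre: "bnds read_prg = {}" "bnds scale_prg = {aNN}" "bnds sizes_prg = {aNN, 0}" "bnds unit_prg = {}"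
 "bnds (count_prg k) = {}" "bnds grid_prg = {aI}" unfolding pre_defs by auto

context dr_input
begin

abbreviation "N == input_size I eps + nat \<lceil>inflation I / eps\<rceil>"

definition lm :: real where "lm = ri LN / ri LD"

lemma LD_pos: "0 < LD" and LD_le_LN: "LD <= LN"
 and lm_eq: "lm = max 1 (rq (inflation I) / max 1 (rq eps))"
proof -
 have p: "0 < dnm (inflation I)" "0 < num eps" "0 < dnm eps" "0 < dnm (inflation I) * num eps"
  using dnm_pos num_pos[OF eps_pos] by (auto intro!: mult_pos_pos)
 show L0: "0 < LD" unfolding LD_def using p by auto
 have "1 <= ri (num (inflation I)) / ri (dnm (inflation I))"
  using inflation_ge1 unfolding rat_eq [symmetric] by (metis of_rat_1 of_rat_less_eq)
 hence infl: "dnm (inflation I) <= num (inflation I)" using p(1) by (simp add: le_divide_eq)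
 thus "LD <= LN" unfolding LD_def LN_def by auto
 have e1: "1 < rq eps \<longleftrightarrow> dnm eps < num eps" unfolding rat_eq using p by (simp add: less_divide_eq)
 show "lm = max 1 (rq (inflation I) / max 1 (rq eps))"
 proof (cases "dnm eps < num eps")
  case True
  have v: "rq (inflation I) / max 1 (rq eps) =
    ri (num (inflation I) * dnm eps) / ri (dnm (inflation I) * num eps)" using e1 True by (simp add: rat_eq max_def)
  show ?thesis
  proof (cases "num (inflation I) * dnm eps < dnm (inflation I) * num eps")
   case t: True
   hence "ri (num (inflation I) * dnm eps) / ri (dnm (inflation I) * num eps) <= 1"
    using p(4) by (subst divide_le_eq_1_pos) linarith+
   thus ?thesis unfolding v lm_def LN_def LD_def using t True by simp
  next
   case False
   hence "1 <= ri (num (inflation I) * dnm eps) / ri (dnm (inflation I) * num eps)"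
    using p(4) by (subst le_divide_eq_1_pos) linarith+
   thus ?thesis unfolding v lm_def LN_def LD_def using False True by (simp add: max_def)
  qed
 next
  case False
  have "1 <= rq (inflation I)" using inflation_ge1 by (metis of_rat_1 of_rat_less_eq)
  thus ?thesis using False e1 unfolding lm_def LN_def LD_def by (simp add: rat_eq[of "inflation I"] max_def)
 qed
qed

lemma lm_ge1: "1 <= lm" unfolding lm_eq by simp

text \<open>This is what the division by \<open>max 1 eps\<close> buys: \<open>mm k0 * lm\<close>
  samples stay polynomial in the input size and the quotient of inflation and
  \<open>eps\<close>.\<close>

lemma lm_le: "lm <= real (nat \<lceil>inflation I / eps\<rceil>)" "1 <= nat \<lceil>inflation I / eps\<rceil>"
proof -
 have q: "0 < inflation I / eps" using inflation_ge1 eps_pos by simp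
 hence c: "1 <= \<lceil>inflation I / eps\<rceil>" by (simp add: one_le_ceiling)
 thus "1 <= nat \<lceil>inflation I / eps\<rceil>" by linarith
 have "inflation I / eps <= of_int \<lceil>inflation I / eps\<rceil>" by (rule le_of_int_ceiling)
 hence "rq (inflation I / eps) <= ri \<lceil>inflation I / eps\<rceil>" by (metis of_rat_less_eq of_rat_of_int_eq)
 hence "rq (inflation I) / rq eps <= real (nat \<lceil>inflation I / eps\<rceil>)" using c by (simp add: of_rat_divide)
 moreover have "rq (inflation I) / max 1 (rq eps) <= rq (inflation I) / rq eps"
  using eps_pos inflation_ge1 by (intro divide_left_mono) auto
 ultimately show "lm <= real (nat \<lceil>inflation I / eps\<rceil>)" unfolding lm_eq using c by auto
qed

text \<open>The bracket is at least the input size, by \<open>mm_ge\<close>; this links the failure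
  probabilities to the input size.\<close>

definition mm :: "nat => nat" where "mm k0 = k0 * ((9 + 2 * (n * n)) * L + (9 + 2 * (n * n)))"
definition MM :: "nat => nat" where "MM k0 = nat (int (mm k0) * LN div LD)"
abbreviation "smp k0 == replicate_pmf (MM k0) p"

lemma MM_bounds: "real (MM k0) <= real (mm k0) * lm" "real (mm k0) * lm < real (MM k0) + 1"
proof -
 have "0 <= int (mm k0) * LN div LD" using LD_pos LD_le_LN by (intro pos_imp_zdiv_nonneg_iff[THEN iffD2]) auto
 hence "int (MM k0) = int (mm k0) * LN div LD" unfolding MM_def by simp
 hence "real (MM k0) = ri \<lfloor>real (mm k0) * lm\<rfloor>"
  unfolding lm_def using floor_divide_of_int_eq[of "int (mm k0) * LN" LD, where 'a = real]
  by (metis (no_types) of_int_mult of_int_of_nat_eq times_divide_eq_right)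
 thus "real (MM k0) <= real (mm k0) * lm" "real (mm k0) * lm < real (MM k0) + 1" by linarith+
qed

text \<open>\<open>s4\<close> and \<open>s5\<close> are the states before and after the halving
  loop, whose effect is written out in \<open>s5\<close>; \<open>pre\<close> is the state in which
  sampling starts.\<close>

definition s4 :: state where "s4 = den unit_prg (den sizes_prg (den scale_prg (den read_prg (initial_state [inp]))))"
definition s5 :: state where "s5 = upd (upd s4 aBIG 0 0) aL 0 (int L)"
definition pre :: "nat => state" where "pre k0 = den grid_prg (den (count_prg (int k0)) s5)"

lemma init0: "initial_state [inp] 0 = array_of inp" "x ~= 0 ==> initial_state [inp] x = (%_. 0)" unfolding initial_state_def by auto

lemma nn_le: "8 + 2 * (n * n) < input_size I eps" "n < input_size I eps"
proof -
 show *: "8 + 2 * (n * n) < input_size I eps" unfolding input_size_def using length_less_list_size[of inp] length_inp by simp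
 have "n <= n * n" by simp
 thus "n < input_size I eps" using * by linarith
qed

lemma inp_nonneg: "x : set inp ==> 0 <= x"
proof -
 have "0 <= num (cst k)" if "k < n * n" for k unfolding cst_def using div_mod_lt[OF that] by (intro num_nonneg cost_nonneg) auto
 thus "x : set inp ==> 0 <= x" unfolding inp_eq
  using dnm_pos[THEN less_imp_le] num_nonneg[of "inflation I"] inflation_ge1 num_nonneg[OF radius_nonneg] num_pos[OF eps_pos] by auto
qed

lemma Cc_nonneg: "k < n * n ==> 0 <= Cc k" using Cc_d[of k] d_nonneg[of "k div n" "k mod n"] by linarith

lemma CS_ge1: "1 <= CS" unfolding CS_def using sum_nonneg[of "{..<n * n}" Cc] Cc_nonneg by auto

lemma U_pos: "0 < U" unfolding U_def using CS_ge1 dnm_pos[of "radius I"] by simp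

lemma inp_sum_nonneg: "0 <= (SUM k<length inp. inp ! k)" by (intro sum_nonneg inp_nonneg) auto

lemma s4_values:
 "s4 0 = array_of inp" "s4 aN 0 = int n" "s4 aS 0 = int s" "s4 aNN 0 = int (n * n)" "s4 aDEN 0 = DEN"
 "k < n * n ==> s4 aC k = Cc k" "s4 aLN 0 = LN" "s4 aLD 0 = LD" "s4 aUn 0 = U" "s4 aBIG 0 = BIG"
 "x ~: {0, aN, aS, aNN, aDEN, aC, aLN, aLD, aUn, aBIG, aCS, aKK} ==> s4 x = (%_. 0)"
proof -
 define a0 where "a0 = initial_state [inp]"
 define a1 where "a1 = den read_prg a0"
 define a2 where "a2 = den scale_prg a1"
 define a3 where "a3 = den sizes_prg a2"
 have a4: "s4 = den unit_prg a3" unfolding s4_def a3_def a2_def a1_def a0_def ..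
 have z: "a0 x = (%_. 0)" if "x ~= 0" for x unfolding a0_def using init0(2)[OF that] .
 have f1: "a1 x = a0 x" if "x ~: wr read_prg" for x unfolding a1_def using that by (rule den_frame)
 have f2: "a2 x = a1 x" if "x ~: wr scale_prg" for x unfolding a2_def using that by (rule den_frame)
 have f3: "a3 x = a2 x" if "x ~: wr sizes_prg" for x unfolding a3_def using that by (rule den_frame)
 have f4: "s4 x = a3 x" if "x ~: wr unit_prg" for x unfolding a4 using that by (rule den_frame)
 note f = f1 f2 f3 f4
 have v0: "a0 0 = array_of inp" unfolding a0_def by (rule init0)
 have v1: "a1 aN 0 = int n" "a1 aS 0 = int s" "a1 aNN 0 = int (n * n)" unfolding a1_def using den_read[of a0, OF v0] by auto
 have b1: "a1 0 = array_of inp" using v0 f1[of 0] by (simp add: wr_pre)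
 have v2: "a2 aDEN 0 = DEN" "!!k. k < n * n ==> a2 aC k = Cc k" unfolding a2_def using den_scale[of a1, OF b1 v1(3)] by auto
 have b2: "a2 0 = array_of inp" "a2 aNN 0 = int (n * n)" "a2 aBIG 0 = 0"
  using b1 v1(3) z[of aBIG] f1[of aBIG] f2[of 0] f2[of aNN] f2[of aBIG] by (simp_all add: wr_pre)
 note v3 = den_sizes[of a2, OF b2(1,2) v2(2) b2(3), folded a3_def]
 have b3: "a3 0 = array_of inp" using b2 f3[of 0] by (simp add: wr_pre)
 show "s4 aUn 0 = U" "s4 aBIG 0 = BIG" unfolding a4 unit_prg_def U_def BIG_def using b3 v3 inp_cells(8) by simp_all
 show "s4 0 = array_of inp" "s4 aN 0 = int n" "s4 aS 0 = int s" "s4 aNN 0 = int (n * n)" "s4 aDEN 0 = DEN"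
 "k < n * n ==> s4 aC k = Cc k" "s4 aLN 0 = LN" "s4 aLD 0 = LD" using b3 v1 v2 v3 by (simp_all add: f wr_pre)
 show "x ~: {0, aN, aS, aNN, aDEN, aC, aLN, aLD, aUn, aBIG, aCS, aKK} ==> s4 x = (%_. 0)" by (simp add: f wr_pre z)
qed

lemma pre_values:
 "env (pre k0)" "pre k0 aMm 0 = int (mm k0)" "pre k0 aM 0 = int (MM k0)" "pre k0 aI 0 = int L + 2"
 "pre k0 aFL 0 = num (radius I) * LN - dnm (radius I) * LD + 1" "pre k0 aK1 0 = LN * num (radius I) * DEN * U"
 "pre k0 aUn 0 = U" "pre k0 aTS 0 = 0"
 "i < L + 2 ==> pre k0 aZ i = zc i & pre k0 aK2 i = 4 * zc i * LD * dnm (radius I)"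
proof -
 define a6 where "a6 = den (count_prg (int k0)) s5"
 have f5: "s5 x = s4 x" if "x ~: {aBIG, aL}" for x unfolding s5_def using that by auto
 have f6: "a6 x = s5 x" if "x ~: wr (count_prg (int k0))" for x unfolding a6_def using that by (rule den_frame)
 have f7: "pre k0 x = a6 x" if "x ~: wr grid_prg" for x unfolding pre_def a6_def using that by (rule den_frame)
 note f = f5 f6 f7
 have L5: "s5 aL 0 = int L" unfolding s5_def by simp
 have b5: "s5 0 = array_of inp" "s5 aNN 0 = int (n * n)" "s5 aLN 0 = LN" "s5 aLD 0 = LD" "s5 aDEN 0 = DEN" "s5 aUn 0 = U"
  using s4_values by (simp_all add: f5)
 have M0: "0 <= int (mm k0) * LN div LD" using LD_pos LD_le_LN by (intro pos_imp_zdiv_nonneg_iff[THEN iffD2]) auto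
 have mi: "int k0 * ((9 + 2 * int (n * n)) * int L + (9 + 2 * int (n * n))) = int (mm k0)" unfolding mm_def by simp
 have v6: "a6 aMm 0 = int (mm k0)" "a6 aM 0 = int (MM k0)" "a6 aI 0 = int L + 2"
   "a6 aFL 0 = num (radius I) * LN - dnm (radius I) * LD + 1" "a6 aK1 0 = LN * num (radius I) * DEN * U"
  unfolding a6_def count_prg_def using b5 L5 inp_cells(7,8) M0 by (simp_all add: MM_def mi del: of_nat_mult)
 show "pre k0 aMm 0 = int (mm k0)" "pre k0 aM 0 = int (MM k0)" "pre k0 aI 0 = int L + 2"
  "pre k0 aFL 0 = num (radius I) * LN - dnm (radius I) * LD + 1" "pre k0 aK1 0 = LN * num (radius I) * DEN * U" using v6 by (simp_all add: f wr_pre)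
 show "pre k0 aUn 0 = U" "pre k0 aTS 0 = 0" using s4_values(9) s4_values(11)[of aTS] by (simp_all add: f wr_pre)
 have "ri (pre k0 aC k) = d (k div n) (k mod n)" if "k < n * n" for k using s4_values(6)[OF that] Cc_d[OF that] by (simp add: f wr_pre)
 thus "env (pre k0)" unfolding env_def using s4_values by (simp add: f wr_pre)
 show "i < L + 2 ==> pre k0 aZ i = zc i & pre k0 aK2 i = 4 * zc i * LD * dnm (radius I)" unfolding pre_def a6_def [symmetric]
  using den_grid[of a6 i] v6(3) s4_values(1,8) s4_values(11)[of aZC] by (simp add: f wr_pre nat_add_distrib)
qed

lemma reaches_pre:
 fixes k0 :: nat
 defines "vc == 10 + k0"
 shows "reaches_in D (pre_time vc k0 N) ([solver k0 c], initial_state [inp])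
   ([sampling aTS aM aBUF copy_prg, compile (main_prg c)], pre k0)" (is ?P)
  and "bounded_by (bits6 vc k0 N) (pre k0)" and "L <= bits4 vc N"
proof -
 have vc: "10 <= vc" "1 <= vc" unfolding vc_def by auto
 have "int k0 < 2 ^ vc"
 proof -
  have "k0 < 2 ^ k0" by (rule less_exp)
  also have "(2::nat) ^ k0 <= 2 ^ vc" unfolding vc_def by (intro power_increasing) auto
  finally show ?thesis by (metis of_nat_less_iff of_nat_numeral of_nat_power)
 qed
 hence k0: "\<bar>int k0\<bar> < 2 ^ vc" by simp
 define a0 where "a0 = initial_state [inp]"
 define a1 where "a1 = den read_prg a0"
 define a2 where "a2 = den scale_prg a1"
 define a3 where "a3 = den sizes_prg a2"
 have a4: "s4 = den unit_prg a3" unfolding s4_def a3_def a2_def a1_def a0_def ..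
 define a6 where "a6 = den (count_prg (int k0)) s5"
 have a7: "pre k0 = den grid_prg a6" unfolding pre_def a6_def ..
 have nn: "nat (a1 aNN 0) <= N" using den_read[of a0] nn_le init0 unfolding a1_def a0_def by (simp del: of_nat_mult)
 have f2: "a2 x = a1 x" if "x ~: wr scale_prg" for x unfolding a2_def using that by (rule den_frame)
 have f1: "a1 x = a0 x" if "x ~: wr read_prg" for x unfolding a1_def using that by (rule den_frame)
 have z0: "nat (a2 0 0) <= N"
 proof -
  have "a2 0 0 = 8 + 2 * int (n * n)" using inp_cells(1) init0(1) by (simp add: f1 f2 wr_pre a0_def)
  thus ?thesis using nn_le(1) by linarith
 qed
 have w0: "bounded_by (N + vc) a0" unfolding a0_def by (rule bounded_initial_state) (simp add: input_size_def)
 note S1 = reaches_in_seg[OF seg_pre(1)[OF vc(1)] w0 vc(2), of N, folded a1_def bits1_def]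
 have w1: "bounded_by (bits1 vc N) a1" by (rule S1(2)) (simp_all add: bnds_pre)
 have v1: "vc <= bits1 vc N" unfolding bits1_def seg_bits_def by simp
 note S2 = reaches_in_seg[OF seg_pre(2)[OF vc(1)] w1 vc(2) v1, of N, folded a2_def bits2_def]
 have w2: "bounded_by (bits2 vc N) a2" by (rule S2(2)) (simp add: bnds_pre nn)
 have v2: "vc <= bits2 vc N" unfolding bits2_def seg_bits_def using v1 by simp
 note S3 = reaches_in_seg[OF seg_pre(3)[OF vc(1)] w2 vc(2) v2, of N, folded a3_def bits3_def]
 have B3: "b : bnds sizes_prg ==> nat (a2 b 0) <= N" for b using z0 nn f2[of aNN] by (auto simp: bnds_pre wr_pre)
 have w3: "bounded_by (bits3 vc N) a3" by (rule S3(2)) (rule B3)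
 have v3: "vc <= bits3 vc N" unfolding bits3_def seg_bits_def using v2 by simp
 note S4 = reaches_in_seg[OF seg_pre(4)[OF vc(1)] w3 vc(2) v3, of N, folded a4 bits4_def]
 have w4: "bounded_by (bits4 vc N) s4" by (rule S4(2)) (simp add: bnds_pre)
 have v4: "vc <= bits4 vc N" unfolding bits4_def seg_bits_def using v3 by simp
 have BIG0: "0 <= BIG" unfolding BIG_def using inp_sum_nonneg U_pos CS_ge1 by simp
 have "BIG < 2 ^ bits4 vc N" using w4 s4_values(10) unfolding bounded_by_def by (metis abs_less_iff)
 hence "nat BIG < 2 ^ bits4 vc N" using BIG0 by (simp add: nat_less_iff)
 thus Lb: "L <= bits4 vc N" unfolding L_def by (intro floorlog_leI) auto
 have w5: "bounded_by (bits4 vc N) s5"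
 proof -
  have "int L < 2 ^ bits4 vc N"
  proof -
   have "L < 2 ^ L" by (rule less_exp)
   also have "(2::nat) ^ L <= 2 ^ bits4 vc N" using Lb by (intro power_increasing) auto
   finally show ?thesis by (metis of_nat_less_iff of_nat_numeral of_nat_power)
  qed
  thus ?thesis unfolding s5_def by (intro bounded_by_upd w4) auto
 qed
 let ?b = "bits4 vc N"
 have H: "reaches_in D ((1 + 4 * ?b) * step_cost 5 ?b (?b + ?b * (5 * (?b + 1)))) (halving aBIG aL # cs, s4) (cs, s5)" for cs
  unfolding reaches_in_def fst_conv snd_conv
 proof
  fix t
  have "static_by {} ?b s4" unfolding static_by_def by simp
  from reaches_halving[of aBIG aL s4 ?b ?b D cs t, OF _ _ w4 this] BIG0 v4 vc s4_values(10) s4_values(11)[of aL]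
  obtain t' where r: "reaches D (halving aBIG aL # cs, s4, t) (1 + 4 * L) (cs, s5, t + t')"
   and t': "t' <= (1 + 4 * L) * step_cost 5 ?b (?b + L * (5 * (?b + 1)))" unfolding s5_def L_def by auto
  have "(1 + 4 * L) * step_cost 5 ?b (?b + L * (5 * (?b + 1))) <= (1 + 4 * ?b) * step_cost 5 ?b (?b + ?b * (5 * (?b + 1)))"
   using Lb by (intro mult_le_mono step_cost_mono add_left_mono) auto
  moreover have "(1 + 4 * L) * 1 <= (1 + 4 * ?b) * step_cost 5 ?b (?b + ?b * (5 * (?b + 1)))"
   using Lb by (intro mult_le_mono) (auto simp: step_cost_def)
  ultimately show "EX k<=(1 + 4 * ?b) * step_cost 5 ?b (?b + ?b * (5 * (?b + 1))). EX t'<=(1 + 4 * ?b) * step_cost 5 ?b (?b + ?b * (5 * (?b + 1))).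
    reaches D (halving aBIG aL # cs, s4, t) k (cs, s5, t + t')" using r t' by (intro exI[of _ "1 + 4 * L"] conjI exI[of _ t']) auto
 qed
 note S6 = reaches_in_seg[OF seg_pre(7)[OF vc(1) k0] w5 vc(2) v4, of "loops vc k0 N", folded a6_def bits5_def]
 have w6: "bounded_by (bits5 vc k0 N) a6" by (rule S6(2)) (simp add: bnds_pre)
 have v6: "vc <= bits5 vc k0 N" unfolding bits5_def seg_bits_def using v4 by simp
 note S7 = reaches_in_seg[OF seg_pre(5)[OF vc(1)] w6 vc(2) v6, of "loops vc k0 N", folded a7 bits6_def]
 have B7: "b : bnds grid_prg ==> nat (a6 b 0) <= loops vc k0 N" for b
 proof -
  assume "b : bnds grid_prg"
  moreover have "a6 aI 0 = int L + 2" using pre_values(4)[of k0] den_frame[of aI grid_prg a6] unfolding a7 by (simp add: wr_pre)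
  ultimately show ?thesis using Lb by (auto simp: bnds_pre loops_def nat_add_distrib)
 qed
 show "bounded_by (bits6 vc k0 N) (pre k0)" by (rule S7(2)) (rule B7)
 show ?P unfolding solver_def pre_time_def a0_def [symmetric]
  apply (rule reaches_in_Seq, rule reaches_in_trans[OF S1(1)], simp, simp add: bnds_pre)
  apply (rule reaches_in_Seq, rule reaches_in_trans[OF S2(1)], simp add: bnds_pre nn)
  apply (rule reaches_in_Seq, rule reaches_in_trans[OF S3(1)], erule B3)
  apply (rule reaches_in_Seq, rule reaches_in_trans[OF S4(1)], simp add: bnds_pre)
  apply (rule reaches_in_Seq, rule reaches_in_trans[OF H])
  apply (rule reaches_in_Seq, rule reaches_in_trans[OF S6(1)], simp add: bnds_pre)
  apply (rule reaches_in_Seq, rule reaches_in_trans[OF S7(1)], erule B7)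
  apply (auto simp: reaches_in_def intro!: exI[of _ 1] reaches_one)
  done
qed

end

section \<open>Output formats, the second-stage program and the complete runs\<close>

lemma map_replicate_pmf: "replicate_pmf k (map_pmf f p) = map_pmf (map f) (replicate_pmf k p)"
 by (induction k) (simp_all add: bind_map_pmf map_bind_pmf)

definition flat :: "(nat \<times> nat) list => int list" where
 "flat es = concat (map (%e. [int (min (fst e) (snd e)), int (max (fst e) (snd e))]) es)"

definition normalized :: "(nat \<times> nat) list => (nat \<times> nat) set" where
 "normalized es = (%e. (min (fst e) (snd e), max (fst e) (snd e))) ` set es"

lemma decode_flat: "decode_edges (flat es) = normalized es" unfolding flat_def normalized_def by (induction es) auto

lemma list_of_out_list:
 assumes "out_list st es"
 shows "list_of (st 0) = flat es"
proof (rule nth_equalityI)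
 let ?f = "%k. int (min (fst (es ! k)) (snd (es ! k)))" and ?g = "%k. int (max (fst (es ! k)) (snd (es ! k)))"
 have "map (%e. [int (min (fst e) (snd e)), int (max (fst e) (snd e))]) es = map (%k. [?f k, ?g k]) [0..<length es]" by (rule nth_equalityI) auto
 hence fl: "flat es = concat (map (%k. [?f k, ?g k]) [0..<length es])" unfolding flat_def by simp
 have n0: "nat (st 0 0) = 2 * length es" using assms unfolding out_list_def by simp
 thus len: "length (list_of (st 0)) = length (flat es)" unfolding list_of_def fl concat_pairs(1) by simp
 fix i assume "i < length (list_of (st 0))"
 hence i: "i < 2 * length es" unfolding list_of_def n0 by simp
 hence li: "list_of (st 0) ! i = st 0 (Suc i)" unfolding list_of_def n0 by simp
 show "list_of (st 0) ! i = flat es ! i"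
 proof (cases "even i")
  case True
  then obtain k where k: "i = 2 * k" by blast
  hence kl: "k < length es" using i by simp
  hence "st 0 (2 * k + 1) = ?f k" using assms unfolding out_list_def by blast
  moreover have "flat es ! i = ?f k" unfolding fl k by (rule concat_pairs(2)[OF kl])
  ultimately show ?thesis using li k by simp
 next
  case False
  then obtain k where k: "i = 2 * k + 1" by (auto elim: oddE)
  hence kl: "k < length es" using i by simp
  hence "st 0 (2 * k + 2) = ?g k" using assms unfolding out_list_def by blast
  moreover have "flat es ! i = ?g k" unfolding fl k by (rule concat_pairs(3)[OF kl])
  ultimately show ?thesis using li k by simp
 qed
qed

lemma list_size_bound: "(!!x. x : set xs ==> bit_size x <= b) ==> list_size xs <= 1 + length xs * b"
 unfolding list_size_def using sum_list_mono[of xs bit_size "%_. b"] by (simp add: sum_list_triv)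

lemma bit_size_int: "u < n ==> bit_size (int u) <= n"
proof -
 assume "u < n"
 moreover have "floorlog 2 u <= u" by (rule floorlog_leI) (auto simp: less_exp)
 ultimately show ?thesis unfolding bit_size_def by simp
qed

lemma list_size_flat:
 assumes "!!u v. (u, v) : set es ==> u < n & v < n"
 shows "list_size (flat es) <= 1 + 2 * length es * n"
proof -
 have "bit_size x <= n" if "x : set (flat es)" for x
 proof -
  obtain u v where "(u, v) : set es" "x = int (min u v) \<or> x = int (max u v)" using \<open>x : set (flat es)\<close> unfolding flat_def by auto
  thus ?thesis using assms[of u v] by (auto intro!: bit_size_int)
 qed
 moreover have "length (flat es) = 2 * length es" unfolding flat_def by (induction es) auto
 ultimately show ?thesis using list_size_bound[of "flat es" n] by simp
qed

text \<open>Array \<open>2\<close> holds the indicator of the connected vertices written by the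
  solver and array \<open>3\<close> the scenario; the shift by one skips the length cell.\<close>

definition load2_prg :: prg where
 "load2_prg = PAsg aIN (Var aA) (Get 2 (inc_exp aA)) ;; PAsg aTT (Var aA) (Get 3 (inc_exp aA))"

definition stage2_prg :: prg where
 "stage2_prg = PFor aA aN load2_prg ;; aEP :=: Const 0 ;; 0 :=: Const 0 ;; prim_prg"

definition completer :: com where
 "completer = Seq (compile read_prg) (Seq (compile scale_prg) (compile stage2_prg))"

lemma seg_stage2: "seg 10 stage2_prg" by (rule segI[of "{aN}"])
   (simp_all add: stage2_prg_def load2_prg_def prim_prg_def prim_scan_def prim_add_def)

lemma deterministic_completer: "deterministic completer"
proof -
 have "deterministic (compile c)" for c by (induction c) auto
 thus ?thesis unfolding completer_def by simp
qed

text \<open>Bounds the size of every list handed to the completer; the final \<open>10\<close>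
  leaves room for its constants, which are below \<open>2 ^ 10\<close>.\<close>

definition data_size :: "nat => nat" where "data_size N = N + (1 + 4 * N * N) + (1 + 2 * N) + 10"

definition completer_time :: "nat => nat" where
 "completer_time N = 1 + (seg_time read_prg N (data_size N) + (1 + (seg_time scale_prg N (seg_bits read_prg N (data_size N)) +
   seg_time stage2_prg N (seg_bits scale_prg N (seg_bits read_prg N (data_size N)))))) + (1 + 2 * N * N) + (1 + 4 * N * N)"

lemma poly_bounded_completer_time: "poly_bounded completer_time"
proof -
 have d: "poly_bounded data_size" unfolding data_size_def by (intro poly_intros)
 show ?thesis unfolding completer_time_def by (intro poly_intros poly_bounded_seg d)
qed

context core
begin

lemma length_prim: "length (prim S T) <= n"
proof -
 have "length (snd (prim_state S T i)) <= i" for i by (induction i) (auto split: option.splits)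
 thus ?thesis unfolding prim_def .
qed

lemma prim_edges:
 assumes "S <= V" "S ~= {}" "T <= V" "(u, v) : set (prim S T)"
 shows "u < n" "v < n" "u ~= v" using greedy_edges[OF greedy_prim[OF assms(1-3)] assms(4)] assms by auto

end

context dr_input
begin

abbreviation "enc == encode_scenario I"

definition drawn :: "nat => nat set list => state" where
 "drawn k0 As = foldl (draw aTS aBUF copy_prg) (pre k0) (map enc As)"

lemma drawn_spec:
 "drawn k0 As aTS 0 = int (length As) & (ALL x. x ~: {aTS, aBUF, aKK, aSA} --> drawn k0 As x = pre k0 x) &
  (ALL t<length As. ALL j<n. drawn k0 As aSA (t * n + j) = of_bool (j : As ! t))"
proof (induction As rule: rev_induct)
 case Nil
 thus ?case unfolding drawn_def using pre_values(8)[of k0] by simp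
next
 case (snoc A As)
 define q where "q = drawn k0 As"
 define q1 where "q1 = q(aBUF := array_of (enc A))"
 have step: "drawn k0 (As @ [A]) = inc aTS (den copy_prg q1)" unfolding drawn_def q1_def q_def draw_def by simp
 have q: "q aTS 0 = int (length As)" "!!x. x ~: {aTS, aBUF, aKK, aSA} ==> q x = pre k0 x"
  "!!t j. t < length As ==> j < n ==> q aSA (t * n + j) = of_bool (j : As ! t)" using snoc unfolding q_def by auto
 have fr: "den copy_prg q1 x = q1 x" if "x ~: {aKK, aSA}" for x using that by (intro den_frame) (simp add: wr_pre)
 have "q1 aN 0 = int n" using q(2)[of aN] env_n[OF pre_values(1)] unfolding q1_def by simp
 have "q1 aTS 0 = int (length As)" "q1 aBUF = array_of (enc A)" using q(1) unfolding q1_def by simp_all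
 note cp = copy_spec[of q1 "length As" A]
 have "drawn k0 (As @ [A]) aSA (t * n + j) = of_bool (j : (As @ [A]) ! t)" if "t < length (As @ [A])" "j < n" for t j
 proof (cases "t < length As")
  case True
  have "t * n + j < Suc t * n" using that by simp
  also have "... <= length As * n" using True by (intro mult_le_mono1) simp
  finally have "den copy_prg q1 aSA (t * n + j) = q1 aSA (t * n + j)"
   using cp(2) \<open>q1 aN 0 = int n\<close> \<open>q1 aTS 0 = int (length As)\<close> \<open>q1 aBUF = array_of (enc A)\<close> by blast
  thus ?thesis using q(3)[OF True that(2)] True unfolding step q1_def by (simp add: inc_def nth_append)
 next
  case False
  hence "t = length As" using that by simp
  thus ?thesis using cp(1)[of j] \<open>q1 aN 0 = int n\<close> \<open>q1 aTS 0 = int (length As)\<close> \<open>q1 aBUF = array_of (enc A)\<close> that(2)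
   unfolding step by (simp add: inc_def nth_append)
 qed
 moreover have "drawn k0 (As @ [A]) aTS 0 = int (length (As @ [A]))" unfolding step using fr[of aTS] q(1) by (simp add: inc_def q1_def)
 moreover have "drawn k0 (As @ [A]) x = pre k0 x" if "x ~: {aTS, aBUF, aKK, aSA}" for x
  unfolding step inc_def using that fr[of x] q(2)[OF that] by (simp add: q1_def)
 ultimately show ?case by blast
qed

definition radii_state :: "nat => nat set list => state" where "radii_state k0 As = den radii_prg (drawn k0 As)"
definition centres_state :: "nat => nat set list => state" where "centres_state k0 As = den centres_prg (radii_state k0 As)"

definition CD :: "nat => nat set list => nat set" where "CD k0 As = centres (rad (mm k0) As) n"
definition XS :: "nat => prg => nat set list => nat set" where "XS k0 c As = setof n (den c (centres_state k0 As)) aXX"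

lemma CD_sub: "CD k0 As <= V" "s : CD k0 As" unfolding CD_def using centres_sub by auto

lemma XS_sub: "XS k0 c As <= V" unfolding XS_def setof_def by auto

definition fin :: "nat => prg => nat set list => state" where "fin k0 c As = den (main_prg c) (drawn k0 As)"

lemma centres_state_frame: "x ~: {aTS, aBUF, aKK, aSA} Un wr radii_prg Un wr centres_prg ==> centres_state k0 As x = pre k0 x"
 unfolding centres_state_def radii_state_def using drawn_spec[of k0 As] by (simp add: den_frame)

lemma wr_radii_centres: "wr radii_prg Un wr centres_prg <= {aR, aV, aU, aCT, aT, aHIT, aJ, aD, aIT2, aB, aCOV, aCc, 99}"
 by (simp add: centres_defs radii_defs)

lemma centres_state_values:
 assumes As: "As : set_pmf (smp k0)"
 shows "env (centres_state k0 As)" "samples n (centres_state k0 As) As"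
  "setof n (centres_state k0 As) aD = CD k0 As" "length As = MM k0" "set As <= Pow V"
proof -
 show len: "length As = MM k0" and sub: "set As <= Pow V" using As p_subset unfolding set_replicate_pmf verts_def by auto
 have d: "drawn k0 As x = pre k0 x" if "x ~: {aTS, aBUF, aKK, aSA}" for x using drawn_spec that by blast
 have e: "env (drawn k0 As)" by (rule env_frame[OF pre_values(1)[of k0]]) (auto simp: d)
 have "As ! t <= {..<n}" if "t < length As" for t using sub nth_mem[OF that] by auto
 hence sm: "samples n (drawn k0 As) As" unfolding samples_def using drawn_spec[of k0 As] pre_values(3)[of k0] len by (simp add: d)
 have m: "drawn k0 As aMm 0 = int (mm k0)" using pre_values(2) by (simp add: d)
 have fr: "centres_state k0 As x = drawn k0 As x" "radii_state k0 As x = drawn k0 As x"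
  if "x ~: {aR, aV, aU, aCT, aT, aHIT, aJ, aD, aIT2, aB, aCOV, aCc, 99}" for x
 proof -
  have "x ~: wr radii_prg" "x ~: wr centres_prg" using that wr_radii_centres by blast+
  thus "centres_state k0 As x = drawn k0 As x" "radii_state k0 As x = drawn k0 As x"
   unfolding centres_state_def radii_state_def by (simp_all add: den_frame)
 qed
 show "env (centres_state k0 As)" by (rule env_frame[OF e]) (auto simp: fr)
 show "samples n (centres_state k0 As) As" by (rule samples_frame[OF sm]) (auto simp: fr)
 have er: "env (radii_state k0 As)" by (rule env_frame[OF e]) (auto simp: fr)
 show "setof n (centres_state k0 As) aD = CD k0 As" unfolding centres_state_def CD_def
  by (rule den_centres[OF er]) (unfold radii_state_def, rule den_radii[OF e sm m])
qed

lemma wr_second: "c : {asym_prg, discrete_prg} ==> x : {aN, aNN, aS, aC, aD} ==> x ~: wr c"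
 by (elim insertE emptyE) (simp_all add: asym_defs discrete_prg_def wr_prim)

lemma fin_output:
 assumes As: "As : set_pmf (smp k0)" and c: "c : {asym_prg, discrete_prg}"
 shows "list_of (fin k0 c As 0) = flat (prim {s} (CD k0 As) @ prim {s} (XS k0 c As))"
  and "list_of (fin k0 c As 1) = map (%a. of_bool (a : CD k0 As Un XS k0 c As)) [0..<n]"
proof -
 note v = centres_state_values[OF As]
 define q where "q = den c (centres_state k0 As)"
 have fr: "q x = centres_state k0 As x" if "x : {aN, aNN, aS, aC, aD}" for x unfolding q_def using wr_second[OF c that] by (rule den_frame)
 have e: "env q" by (rule env_frame[OF v(1)]) (auto simp: fr)
 have D: "setof n q aD = CD k0 As" using v(3) fr[of aD] unfolding setof_def by simp
 have X: "setof n q aXX = XS k0 c As" unfolding q_def XS_def ..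
 have f: "fin k0 c As = den final_prg q" unfolding fin_def main_prg_def q_def centres_state_def radii_state_def by simp
 note F = den_final[OF e, unfolded D X, folded f]
 show "list_of (fin k0 c As 0) = flat (prim {s} (CD k0 As) @ prim {s} (XS k0 c As))" by (rule list_of_out_list[OF F(1)])
 show "list_of (fin k0 c As 1) = map (%a. of_bool (a : CD k0 As Un XS k0 c As)) [0..<n]" unfolding list_of_def F(2) using F(3) by simp
qed

lemma list_size_enc: "list_size (enc A) <= 1 + 2 * n"
proof -
 have "list_size (enc A) <= 1 + length (enc A) * 2" by (rule list_size_bound) (auto simp: encode_scenario_def bit_size_def floorlog_def)
 thus ?thesis unfolding encode_scenario_def by simp
qed

lemma loops_ge:
 fixes k0 :: nat
 defines "vc == 10 + k0"
 shows "n <= loops vc k0 N" "n * n <= loops vc k0 N" "L + 2 <= loops vc k0 N" "MM k0 <= loops vc k0 N"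
proof -
 have Lb: "L <= bits4 vc N" unfolding vc_def by (rule reaches_pre(3))
 show "n <= loops vc k0 N" "n * n <= loops vc k0 N" "L + 2 <= loops vc k0 N" using nn_le Lb unfolding loops_def by auto
 have "mm k0 = k0 * (9 + 2 * (n * n)) * (L + 1)" unfolding mm_def by (simp add: algebra_simps)
 also have "... <= k0 * (9 + 2 * N) * (bits4 vc N + 1)" using Lb nn_le by (intro mult_le_mono) auto
 finally have mm: "mm k0 <= k0 * (9 + 2 * N) * (bits4 vc N + 1)" .
 have "real (MM k0) <= real (mm k0) * real N" using MM_bounds(1)[of k0] lm_le(1) by (elim order_trans) (intro mult_left_mono, auto)
 hence "MM k0 <= mm k0 * N" by (metis of_nat_le_iff of_nat_mult)
 also have "... <= k0 * (9 + 2 * N) * (bits4 vc N + 1) * N" using mm by (rule mult_le_mono1)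
 finally show "MM k0 <= loops vc k0 N" unfolding loops_def by simp
qed

lemma bnds_main: "c : {asym_prg, discrete_prg} ==> bnds (main_prg c) <= {aN, aNN, aM, aI}"
 by (elim insertE emptyE) (simp_all add: main_prg_def centres_defs radii_defs asym_defs discrete_prg_def final_prg_def
   marks_body_def prim_prg_def prim_scan_def prim_add_def)

lemma stp_copy: "q aN 0 = int n ==> stp copy_prg q = 3 + 4 * n" unfolding copy_prg_def by simp

text \<open>For every outcome of the samples the program halts within the same bound, and a halted
  configuration stays put. Hence the run has the same form for all \<open>T\<close> beyond
  \<open>T0\<close>.\<close>

lemma run_solver:
 fixes k0 :: nat
 assumes c: "c : {asym_prg, discrete_prg}"
 defines "T0 == solver_time (10 + k0) k0 c N"
 obtains tt where "!!T. T0 <= T ==> run (map_pmf enc p) (solver k0 c) [inp] T =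
    map_pmf (%As. ([], fin k0 c As, tt As)) (smp k0)"
  and "!!As. As : set_pmf (smp k0) ==>
    tt As + list_size (list_of (fin k0 c As 0)) + list_size (list_of (fin k0 c As 1)) <= T0"
proof -
 define vc where "vc = 10 + k0"
 have vc: "10 <= vc" "1 <= vc" unfolding vc_def by auto
 define D where "D = map_pmf enc p"
 define R where "R = smp k0"
 define B where "B = loops vc k0 N"
 define kc where "kc = 3 + 4 * n"
 let ?samp = "sampling aTS aM aBUF copy_prg" and ?main = "compile (main_prg c)"
 have "EX k<=pre_time vc k0 N. EX t'<=pre_time vc k0 N. reaches D ([solver k0 c], initial_state [inp], 0) k ([?samp, ?main], pre k0, 0 + t')"
  using reaches_pre(1)[of D k0 c] unfolding reaches_in_def vc_def fst_conv snd_conv by (rule spec)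
 then obtain k1 t1 where k1: "k1 <= pre_time vc k0 N" "t1 <= pre_time vc k0 N"
  and r1: "reaches D ([solver k0 c], initial_state [inp], 0) k1 ([?samp, ?main], pre k0, t1)" by auto
 define Inv where "Inv q = (q aN 0 = int n)" for q :: state
 have Inv: "stp copy_prg (q(aBUF := array_of xs)) = kc & Inv (draw aTS aBUF copy_prg q xs)" if "Inv q" for q xs
 proof
  show "stp copy_prg (q(aBUF := array_of xs)) = kc" unfolding kc_def using that by (intro stp_copy) (simp add: Inv_def)
  have "den copy_prg (q(aBUF := array_of xs)) aN = q aN" using den_frame[of aN copy_prg "q(aBUF := array_of xs)"] by (simp add: wr_pre)
  thus "Inv (draw aTS aBUF copy_prg q xs)" using that unfolding Inv_def draw_def by (simp add: inc_def)
 qed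
 have I0: "Inv (pre k0)" unfolding Inv_def using env_n[OF pre_values(1)] by simp
 define ks where "ks = MM k0 * (5 + kc) + 1"
 define dt where "dt As = draw_time aTS aM aBUF copy_prg (pre k0) (map enc As)" for As
 have r2: "stepn D ks ([?samp, ?main], pre k0, t1) = map_pmf (%As. ([?main], drawn k0 As, t1 + dt As)) R"
 proof -
  have "wf copy_prg" by (simp add: pre_defs)
  hence "stepn D ks (?samp # [?main], pre k0, t1) = map_pmf (%xss. ([?main], foldl (draw aTS aBUF copy_prg) (pre k0) xss,
    t1 + draw_time aTS aM aBUF copy_prg (pre k0) xss)) (replicate_pmf (MM k0) D)"
   unfolding ks_def using Inv I0 pre_values(3,8)[of k0] by (intro stepn_sampling[where Inv = Inv]) (auto simp: wr_pre)
  thus ?thesis unfolding D_def map_replicate_pmf R_def drawn_def dt_def by (simp add: map_pmf_comp)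
 qed
 have w6: "bounded_by (bits6 vc k0 N) (pre k0)" unfolding vc_def by (rule reaches_pre(2))
 have v6: "N + vc <= bits6 vc k0 N" unfolding bits6_def bits5_def bits4_def bits3_def bits2_def bits1_def seg_bits_def by simp
 have len: "length As = MM k0" if "As : set_pmf R" for As using centres_state_values(4) that unfolding R_def by blast
 have db: "bounded_by (bits7 vc k0 N) (drawn k0 As) & dt As <= sample_time vc k0 N" if As: "As : set_pmf R" for As
 proof -
  let ?w = "bits6 vc k0 N"
  have "tame_prg {aN} vc 50 copy_prg"
  proof -
   have "(2::int) ^ 10 <= 2 ^ vc" using vc by (intro power_increasing) auto
   thus ?thesis by (simp add: pre_defs)
  qed
  moreover have "1 + 2 * n <= ?w"
  proof -
   have "n <= n * n" by simp
   thus ?thesis using v6 nn_le by linarith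
  qed
  ultimately have *: "bounded_by (?w + length (map enc As) * ((kc + 1) * (50 * (?w + 1)))) (drawn k0 As) &
    dt As <= (1 + length (map enc As)) * ((kc + 5) * step_cost 50 ?w (?w + length (map enc As) * ((kc + 1) * (50 * (?w + 1)))) + (1 + 2 * n))"
   unfolding drawn_def dt_def using vc v6 Inv I0 w6 by (intro draw_bound[where St = "{aN}" and Inv = Inv and X = "range enc" and vc = vc])
     (auto simp: pre_defs static_by_def bounded_by_def intro!: list_size_enc[simplified] array_of_bound[OF order_trans[OF list_size_enc[simplified]]])
  have lb: "length (map enc As) <= B" using len[OF As] loops_ge(4)[of k0] unfolding B_def vc_def by simp
  have kb: "kc + 1 <= 4 + 4 * N" "kc + 5 <= 8 + 4 * N" using nn_le unfolding kc_def by auto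
  have wl: "?w + length (map enc As) * ((kc + 1) * (50 * (?w + 1))) <= bits7 vc k0 N"
   unfolding bits7_def B_def [symmetric] by (intro add_left_mono mult_le_mono lb kb order_refl)
  have "dt As <= (1 + B) * ((8 + 4 * N) * step_cost 50 ?w (bits7 vc k0 N) + (1 + 2 * N))"
   using nn_le by (intro order_trans[OF conjunct2[OF *]] mult_le_mono add_mono lb kb step_cost_mono wl) auto
  thus ?thesis using bounded_by_mono[OF conjunct1[OF *] wl] unfolding sample_time_def B_def by simp
 qed
 define T3 where "T3 = seg_time (main_prg c) B (bits7 vc k0 N)"
 \<comment> \<open>Steps and time of the last segment depend on the samples; a choice function makes
   them part of the map applied to the samples.\<close>
 have "ALL As:set_pmf R. EX kt. fst kt <= T3 & snd kt <= T3 &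
   reaches D ([?main], drawn k0 As, t1 + dt As) (fst kt) ([], fin k0 c As, t1 + dt As + snd kt)"
 proof
  fix As assume As: "As : set_pmf R"
  have fr: "drawn k0 As x = pre k0 x" if "x : {aN, aNN, aM, aI}" for x using drawn_spec[of k0 As] that by auto
  have "nat (drawn k0 As b 0) <= B" if "b : bnds (main_prg c)" for b
  proof -
   have b: "b : {aN, aNN, aM, aI}" using bnds_main[OF c] that by blast
   have "pre k0 aN 0 = int n" "pre k0 aNN 0 = int (n * n)" using pre_values(1)[of k0] unfolding env_def by auto
   with b show ?thesis unfolding fr[OF b] using pre_values(3,4)[of k0] loops_ge[of k0] unfolding B_def vc_def
    by (elim insertE emptyE) (simp_all del: of_nat_mult add: nat_add_distrib)
  qed
  moreover have "seg vc (main_prg c)" using c seg_main[OF vc(1)] by auto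
  moreover have "vc <= bits7 vc k0 N" using v6 unfolding bits7_def by simp
  ultimately have "reaches_in D T3 (?main # [], drawn k0 As) ([], fin k0 c As)"
   unfolding T3_def fin_def using db[OF As] vc by (intro reaches_in_seg(1)) auto
  thus "EX kt. fst kt <= T3 & snd kt <= T3 &
   reaches D ([?main], drawn k0 As, t1 + dt As) (fst kt) ([], fin k0 c As, t1 + dt As + snd kt)"
   unfolding reaches_in_def fst_conv snd_conv by (metis fst_conv snd_conv)
 qed
 from bchoice[OF this] obtain kt where kt: "!!As. As : set_pmf R ==> fst (kt As) <= T3 & snd (kt As) <= T3 &
   reaches D ([?main], drawn k0 As, t1 + dt As) (fst (kt As)) ([], fin k0 c As, t1 + dt As + snd (kt As))" by blast
 define tt where "tt As = t1 + dt As + snd (kt As)" for As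
 have ksb: "ks <= B * (8 + 4 * N) + 1"
  unfolding ks_def kc_def using loops_ge(4)[of k0] nn_le unfolding B_def vc_def by (intro add_right_mono mult_le_mono) auto
 have T0: "T0 = pre_time vc k0 N + (sample_time vc k0 N + B * (8 + 4 * N) + 1) + T3 + (1 + 4 * N * N) + (1 + 2 * N)"
  unfolding T0_def solver_time_def T3_def B_def vc_def by simp
 show thesis
 proof
  fix T assume "T0 <= T"
  hence "k1 + ks + T3 <= T" using k1 ksb unfolding T0 by linarith
  define rest where "rest = T - k1 - ks"
  have T: "T = k1 + (ks + rest)" and rest: "T3 <= rest" using \<open>k1 + ks + T3 <= T\<close> unfolding rest_def by auto
  have r3: "stepn D rest ([?main], drawn k0 As, t1 + dt As) = return_pmf ([], fin k0 c As, tt As)" if "As : set_pmf R" for As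
  proof -
   have "rest = fst (kt As) + (rest - fst (kt As))" using kt[OF that] rest by simp
   hence "stepn D rest ([?main], drawn k0 As, t1 + dt As) = bind_pmf (stepn D (fst (kt As)) ([?main], drawn k0 As, t1 + dt As)) (stepn D (rest - fst (kt As)))"
    by (metis stepn_add)
   thus ?thesis using kt[OF that] unfolding reaches_def tt_def by (simp add: bind_return_pmf stepn_idle)
  qed
  have "run D (solver k0 c) [inp] T = bind_pmf (stepn D ks ([?samp, ?main], pre k0, t1)) (stepn D rest)"
   unfolding run_eq_stepn T using r1 unfolding reaches_def stepn_add by (simp add: bind_return_pmf)
  also have "... = bind_pmf R (%As. return_pmf ([], fin k0 c As, tt As))" unfolding r2 bind_map_pmf by (intro bind_pmf_cong refl r3)
  finally show "run (map_pmf enc p) (solver k0 c) [inp] T = map_pmf (%As. ([], fin k0 c As, tt As)) (smp k0)"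
   unfolding D_def R_def by (simp add: map_pmf_def)
 next
  fix As assume "As : set_pmf (smp k0)"
  hence As: "As : set_pmf R" unfolding R_def .
  have tt: "tt As <= pre_time vc k0 N + sample_time vc k0 N + T3" unfolding tt_def using k1 db[OF As] kt[OF As] by linarith
  note fo = fin_output[OF As[unfolded R_def] c]
  let ?es = "prim {s} (CD k0 As) @ prim {s} (XS k0 c As)"
  have "list_size (flat ?es) <= 1 + 2 * length ?es * n"
   using prim_edges[of "{s}" "CD k0 As"] prim_edges[of "{s}" "XS k0 c As"] s_lt CD_sub XS_sub by (intro list_size_flat) auto
  also have "... <= 1 + 2 * (2 * N) * N"
   using length_prim[of "{s}" "CD k0 As"] length_prim[of "{s}" "XS k0 c As"] nn_le by (intro add_left_mono mult_le_mono) auto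
  finally have o0: "list_size (list_of (fin k0 c As 0)) <= 1 + 4 * N * N" unfolding fo by simp
  have "list_size (enc (CD k0 As Un XS k0 c As)) <= 1 + 2 * N" using list_size_enc[of "CD k0 As Un XS k0 c As"] nn_le by simp
  hence o1: "list_size (list_of (fin k0 c As 1)) <= 1 + 2 * N" unfolding fo encode_scenario_def .
  show "tt As + list_size (list_of (fin k0 c As 0)) + list_size (list_of (fin k0 c As 1)) <= T0" using tt o0 o1 unfolding T0 by linarith
 qed
qed

text \<open>Array \<open>1\<close> still holds the stage-I list \<open>fs\<close> at the end. It
  counts as output, so its size enters the time bound.\<close>

lemma run_completer:
 assumes E: "E <= V" "E ~= {}" and A: "A <= V" and fs: "list_size fs <= 1 + 4 * N * N"
 defines "T0 == completer_time N"
 obtains st t where "!!T. T0 <= T ==> run D completer [inp, fs, enc E, enc A] T = return_pmf ([], st, t)"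
  and "t + list_size (list_of (st 0)) + list_size (list_of (st 1)) <= T0"
  and "list_of (st 0) = flat (prim E A)"
proof -
 define a0 where "a0 = initial_state [inp, fs, enc E, enc A]"
 define a1 where "a1 = den read_prg a0"
 define a2 where "a2 = den scale_prg a1"
 define a3 where "a3 = den stage2_prg a2"
 have i0: "a0 0 = array_of inp" "a0 1 = array_of fs" "a0 2 = array_of (enc E)" "a0 3 = array_of (enc A)"
  unfolding a0_def initial_state_def by (auto simp: numeral_nat)
 have f1: "a1 x = a0 x" if "x ~: wr read_prg" for x unfolding a1_def using that by (rule den_frame)
 have f2: "a2 x = a1 x" if "x ~: wr scale_prg" for x unfolding a2_def using that by (rule den_frame)
 have v1: "a1 aN 0 = int n" "a1 aS 0 = int s" "a1 aNN 0 = int (n * n)" unfolding a1_def using den_read[of a0, OF i0(1)] by auto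
 have b1: "a1 0 = array_of inp" using i0 f1[of 0] by (simp add: wr_pre)
 have v2: "k < n * n ==> a2 aC k = Cc k" for k unfolding a2_def using den_scale[of a1, OF b1 v1(3)] by auto
 have v2': "a2 aN 0 = int n" "a2 aS 0 = int s" "a2 aNN 0 = int (n * n)" using v1 by (simp_all add: f2 wr_pre)
 have e2: "env a2" unfolding env_def using v2 v2' Cc_d by simp
 define b where "b = den (PFor aA aN load2_prg) a2"
 have n2: "nat (a2 aN 0) = n" using v2' by simp
 have "(%j q. (ALL a<j. q aIN a = of_bool (a : E) & q aTT a = of_bool (a : A)) & q 2 = array_of (enc E) & q 3 = array_of (enc A))
   (nat (a2 aN 0)) b" unfolding b_def
 proof (rule den_PFor_invariant)
  fix j q assume j: "j < nat (a2 aN 0)" and qj: "q aA 0 = int j"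
   and Q: "(ALL a<j. q aIN a = of_bool (a : E) & q aTT a = of_bool (a : A)) & q 2 = array_of (enc E) & q 3 = array_of (enc A)"
  have en: "array_of (enc S) (Suc j) = of_bool (j : S)" for S using j unfolding n2 array_of_def encode_scenario_def by simp
  have na: "nat (int j + 1) = Suc j" by simp
  show "(ALL a<Suc j. inc aA (den load2_prg q) aIN a = of_bool (a : E) & inc aA (den load2_prg q) aTT a = of_bool (a : A)) &
    inc aA (den load2_prg q) 2 = array_of (enc E) & inc aA (den load2_prg q) 3 = array_of (enc A)"
   using Q unfolding load2_prg_def by (auto simp: inc_def qj na en less_Suc_eq)
 qed (auto simp: load2_prg_def i0 f1 f2 wr_pre)
 hence b: "!!a. a < n ==> b aIN a = of_bool (a : E) & b aTT a = of_bool (a : A)" unfolding n2 by auto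
 have fb: "b x = a2 x" if "x ~: {aA, aIN, aTT}" for x unfolding b_def using that by (intro den_frame) (simp add: load2_prg_def)
 define b' where "b' = upd (upd b aEP 0 0) 0 0 0"
 have a3': "a3 = den prim_prg b'" unfolding a3_def stage2_prg_def b'_def b_def by (simp del: den.simps(4))
 have eb: "env b'" by (rule env_frame[OF e2]) (auto simp: b'_def fb)
 have "setof n b' aIN = E" "setof n b' aTT = A" unfolding setof_def b'_def using b E A by auto
 moreover have "out_list b' []" unfolding out_list_def b'_def by simp
 ultimately have ol: "out_list a3 (prim E A)" unfolding a3' using den_prim_prg(2)[OF eb, of "[]"] by simp
 have w0: "bounded_by (data_size N) a0" unfolding a0_def
 proof (rule bounded_initial_state)
  fix xs assume "xs : set [inp, fs, enc E, enc A]"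
  then consider "xs = inp" | "xs = fs" | S where "xs = enc S" by auto
  thus "list_size xs <= data_size N"
  proof cases
   case 3
   thus ?thesis using list_size_enc[of S] nn_le unfolding data_size_def by simp
  qed (use fs in "auto simp: data_size_def input_size_def")
 qed
 have nn: "nat (a1 aNN 0) <= N" "nat (a2 aN 0) <= N" "nat (a2 aNN 0) <= N" using v1 v2' nn_le by (simp_all del: of_nat_mult)
 have v0: "10 <= data_size N" unfolding data_size_def by simp
 note S1 = reaches_in_seg[OF seg_pre(1)[OF order_refl] w0 _ v0, of N, folded a1_def]
 have w1: "bounded_by (seg_bits read_prg N (data_size N)) a1" by (rule S1(2)) (simp_all add: bnds_pre)
 have v1': "10 <= seg_bits read_prg N (data_size N)" unfolding seg_bits_def using v0 by simp
 note S2 = reaches_in_seg[OF seg_pre(2)[OF order_refl] w1 _ v1', of N, folded a2_def]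
 have w2: "bounded_by (seg_bits scale_prg N (seg_bits read_prg N (data_size N))) a2" by (rule S2(2)) (simp_all add: bnds_pre nn)
 have v2'': "10 <= seg_bits scale_prg N (seg_bits read_prg N (data_size N))" unfolding seg_bits_def[of scale_prg] using v1' by simp
 note S3 = reaches_in_seg(1)[OF seg_stage2 w2 _ v2'', of N, folded a3_def]
 have B3: "nat (a2 x 0) <= N" if "x : bnds stage2_prg" for x
  using that nn by (auto simp: stage2_prg_def load2_prg_def prim_prg_def prim_scan_def prim_add_def)
 define T1 where "T1 = 1 + (seg_time read_prg N (data_size N) + (1 + (seg_time scale_prg N (seg_bits read_prg N (data_size N)) +
   seg_time stage2_prg N (seg_bits scale_prg N (seg_bits read_prg N (data_size N))))))"
 have "reaches_in D T1 ([completer], a0) ([], a3)" unfolding completer_def T1_def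
  apply (rule reaches_in_Seq, rule reaches_in_trans[OF S1(1)], simp, simp add: bnds_pre)
  apply (rule reaches_in_Seq, rule reaches_in_trans[OF S2(1)], simp, simp add: bnds_pre nn)
  apply (rule S3, simp, erule B3)
  done
 then obtain k t where kt: "k <= T1" "t <= T1" "reaches D ([completer], a0, 0) k ([], a3, 0 + t)" unfolding reaches_in_def fst_conv snd_conv by blast
 have T0: "T0 = T1 + (1 + 2 * N * N) + (1 + 4 * N * N)" unfolding T0_def completer_time_def T1_def by simp
 show thesis
 proof
  fix T assume "T0 <= T"
  hence "T = k + (T - k)" using kt unfolding T0 by simp
  hence "stepn D T ([completer], a0, 0) = bind_pmf (stepn D k ([completer], a0, 0)) (stepn D (T - k))" by (metis stepn_add)
  thus "run D completer [inp, fs, enc E, enc A] T = return_pmf ([], a3, t)"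
   unfolding run_eq_stepn a0_def [symmetric] using kt unfolding reaches_def by (simp add: bind_return_pmf stepn_idle)
 next
  show fl: "list_of (a3 0) = flat (prim E A)" by (rule list_of_out_list[OF ol])
  have "list_size (flat (prim E A)) <= 1 + 2 * length (prim E A) * n" using prim_edges[OF E A] by (intro list_size_flat) auto
  also have "... <= 1 + 2 * N * N" using length_prim[of E A] nn_le by (intro add_left_mono mult_le_mono) auto
  finally have "list_size (list_of (a3 0)) <= 1 + 2 * N * N" unfolding fl .
  moreover have "a3 1 = array_of fs"
  proof -
   have "a3 1 = a2 1" unfolding a3_def by (rule den_frame) (simp add: stage2_prg_def load2_prg_def wr_prim)
   thus ?thesis using i0 by (simp add: f1 f2 wr_pre)
  qed
  hence "list_of (a3 1) = fs" unfolding list_of_def array_of_def by (auto intro!: nth_equalityI)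
  ultimately show "t + list_size (list_of (a3 0)) + list_size (list_of (a3 1)) <= T0" using kt fs unfolding T0 by simp
 qed
qed

end

section \<open>Properties of the centres, completion costs and the first stage on good
  samples\<close>

lemma finite_arg_max:
 fixes f :: "'a => real"
 assumes "finite W" "W ~= {}"
 obtains u where "u : W" "!!w. w : W ==> f w <= f u"
proof -
 have "Max (f ` W) : f ` W" using assms by (intro Max_in) auto
 then obtain u where "u : W" "Max (f ` W) = f u" by (rule imageE)
 moreover have "f w <= Max (f ` W)" if "w : W" for w using assms that by (intro Max_ge) auto
 ultimately show thesis using that by simp
qed

context pmet
begin

lemma greedy_Diff: "greedy S T es ==> x : S ==> greedy S (T - {x}) es"
proof (induction S T es rule: greedy.induct)
 case (2 S T u v es)
 thus ?case by auto
qed auto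

end

context core
begin

lemma radius_upto_bounds: "0 <= radius_upto m As v u" "radius_upto m As v u <= d v s" by (induction u) auto

lemma radius_upto_le: "w < u ==> m <= hits As v (d v w) ==> radius_upto m As v u <= d v w" by (induction u) (auto simp: less_Suc_eq)

lemma radius_upto_attained:
 "radius_upto m As v u < d v s ==> EX w<u. radius_upto m As v u = d v w & m <= hits As v (d v w)"
 by (induction u) (auto simp: less_Suc_eq split: if_splits)

text \<open>Centres other than the root appear in order of increasing radius. A new centre
  \<open>v\<close> is farther than \<open>4 * R v\<close> from the old ones by choice, and
  \<open>R c <= R v\<close> gives the same for the radius of an old centre \<open>c\<close>. The
  second conjunct carries the order through the induction.\<close>

lemma centres_invariant:
 "(ALL c:centres R i - {s}. ALL c':centres R i. c ~= c' --> 4 * R c < d c c') &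
  (ALL c:centres R i - {s}. ALL v<n. ~ (EX c:centres R i. d v c <= 4 * R v) --> R c <= R v)"
proof (induction i)
 case (Suc i)
 show ?case
 proof (cases "first_min (%v. ~ (EX c:centres R i. d v c <= 4 * R v)) R n")
  case None
  thus ?thesis using Suc by simp
 next
  case (Some v)
  note v = first_min_Some[OF Some]
  have cs: "centres R (Suc i) = insert v (centres R i)" using Some by simp
  have far: "4 * R v < d v c" if "c : centres R i" for c using v that by (auto simp: not_le)
  have "4 * R c < d c v" if "c : centres R i - {s}" for c
  proof -
   have "R c <= R v" using conjunct2[OF Suc] that v by auto
   thus ?thesis using far[of c] that d_sym[of c v] by simp
  qed
  note far' = this
  have "4 * R c < d c c'" if "c : insert v (centres R i) - {s}" "c' : insert v (centres R i)" "c ~= c'" for c c'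
   using that far[of c'] far'[of c] conjunct1[OF Suc] by (cases "c = v"; cases "c' = v") auto
  moreover have "R c <= R w" if c: "c : insert v (centres R i) - {s}" and w: "w < n" "~ (EX c:insert v (centres R i). d w c <= 4 * R w)" for c w
  proof (cases "c = v")
   case True
   thus ?thesis using v w by auto
  next
   case False
   thus ?thesis using conjunct2[OF Suc] c w by auto
  qed
  ultimately show ?thesis unfolding cs by auto
 qed
qed simp

text \<open>A vertex uncovered at the end is uncovered in every round, so each of the
  \<open>n\<close> rounds adds a vertex to the root and there would be more than \<open>n\<close>
  centres.\<close>

lemma centres_cover:
 assumes R: "!!v. v < n ==> 0 <= R v" and v: "v < n"
 shows "EX c:centres R n. d v c <= 4 * R v"
proof (rule ccontr)
 assume un: "~ (EX c:centres R n. d v c <= 4 * R v)"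
 have mono: "centres R i <= centres R (i + j)" for i j by (induction j) (auto split: option.splits)
 have "i <= n ==> Suc i <= card (centres R i)" for i
 proof (induction i)
  case (Suc i)
  have "~ (EX c:centres R i. d v c <= 4 * R v)" using un mono[of i "n - i"] Suc.prems by auto
  then obtain w where w: "first_min (%v. ~ (EX c:centres R i. d v c <= 4 * R v)) R n = Some w"
   using v first_min_None[of "%v. ~ (EX c:centres R i. d v c <= 4 * R v)" R n]
   by (cases "first_min (%v. ~ (EX c:centres R i. d v c <= 4 * R v)) R n") auto
  note w' = first_min_Some[OF w]
  have "w ~: centres R i"
  proof
   assume "w : centres R i"
   moreover have "d w w <= 4 * R w" using R[of w] w' by simp
   ultimately show False using w' by blast
  qed
  moreover have "finite (centres R i)" using centres_sub(1)[of R i] finite_subset by blast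
  ultimately show ?case using Suc w by simp
 qed simp
 hence "Suc n <= card (centres R n)" by simp
 moreover have "card (centres R n) <= card V" by (intro card_mono centres_sub) simp
 ultimately show False by simp
qed

text \<open>To serve \<open>A'\<close> from \<open>D Un X\<close>, connect \<open>A\<close> to
  \<open>D\<close> and then grow the ball from \<open>A\<close>, \<open>X\<close> and the root. The
  comparison edge set also joins all sources to the root by a star. Its edges do not enter the
  bound, since both endpoints are sources and thus not near any terminal in the sense of
  \<open>greedy_connected_le\<close>.\<close>

lemma completion_cost_le:
 assumes D: "D <= V" "s : D" and X: "X <= V" and A: "A <= V" and A': "A' <= ball_of A ro"
 shows "tcost (prim (D Un X) A') <= 2 * (tcost (prim D A) + ext_cost X A ro)"
proof -
 define S where "S = D Un X"
 define E1 where "E1 = set (prim D A)"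
 define E2 where "E2 = set (prim (insert s (A Un X)) (ball_of A ro))"
 define E0 where "E0 = (%x. (x, s)) ` S"
 define E where "E = E1 Un E2 Un E0"
 have S: "S <= V" "s : S" unfolding S_def using D X by simp_all
 have fS: "finite S" by (rule finite_subset[OF S(1)]) simp
 have A'V: "A' <= V" by (rule order_trans[OF A' ball_of_sub])
 have fin: "finite E1" "finite E2" "finite E0" unfolding E1_def E2_def E0_def using fS by simp_all
 have g1: "greedy D A (prim D A)" using D A by (intro greedy_prim) auto
 have g2: "greedy (insert s (A Un X)) (ball_of A ro) (prim (insert s (A Un X)) (ball_of A ro))"
  using A X s_less ball_of_sub by (intro greedy_prim) auto
 have toS: "(u, s) : (E Un E^-1)\<^sup>*" if "u : S" for u by (rule r_into_rtrancl) (use that in "auto simp: E_def E0_def")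
 have m1: "(E1 Un E1^-1)\<^sup>* <= (E Un E^-1)\<^sup>*" "(E2 Un E2^-1)\<^sup>* <= (E Un E^-1)\<^sup>*"
  by (rule rtrancl_mono, simp add: E_def converse_Un sup.coboundedI1 le_supI1 le_supI2)+
 have conn: "(v, s) : (E Un E^-1)\<^sup>*" if vA: "v : A'" for v
 proof -
  obtain u where u: "u : insert s (A Un X)" "(v, u) : (E2 Un E2^-1)\<^sup>*"
   using greedy_connects[OF g2 subsetD[OF A' vA]] unfolding E2_def by (rule bexE)
  have "(u, s) : (E Un E^-1)\<^sup>*"
  proof (cases "u : A")
   case True
   obtain u' where "u' : D" "(u, u') : (E1 Un E1^-1)\<^sup>*" using greedy_connects[OF g1 True] unfolding E1_def by (rule bexE)
   thus ?thesis by (intro rtrancl_trans[OF subsetD[OF m1(1)] toS]) (auto simp: S_def)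
  next
   case False
   thus ?thesis using u(1) S(2) by (intro toS) (auto simp: S_def)
  qed
  thus ?thesis by (rule rtrancl_trans[OF subsetD[OF m1(2) u(2)]])
 qed
 have "tcost (prim S A') <= 2 * ecost {(a, b) : E. EX v:A' - S. 2 * d v a < sd v S \<or> 2 * d v b < sd v S}"
 proof (rule greedy_connected_le[OF greedy_prim])
  show "finite A'" using A'V finite_subset by blast
  show "finite E" unfolding E_def using fin by simp
 qed (use S fS A'V conn in auto)
 also have "ecost {(a, b) : E. EX v:A' - S. 2 * d v a < sd v S \<or> 2 * d v b < sd v S} <= ecost (E1 Un E2)"
 proof (rule ecost_mono)
  have no: "~ 2 * d v a < sd v S" if "a : S" for v a using sd_le[OF fS that, of v] d_nonneg[of v a] by linarith
  show "{(a, b) : E. EX v:A' - S. 2 * d v a < sd v S \<or> 2 * d v b < sd v S} <= E1 Un E2" using no S(2) unfolding E_def E0_def by auto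
 qed (use fin in simp)
 also have "ecost (E1 Un E2) <= ecost E1 + ecost E2" using fin by (intro ecost_Un_le)
 also have "... <= tcost (prim D A) + ext_cost X A ro" unfolding E1_def E2_def ext_cost_def by (intro add_mono ecost_set_le)
 finally show ?thesis unfolding S_def by simp
qed

lemma ecost_normalized_le: "ecost (normalized es) <= tcost es"
proof -
 let ?f = "%e. (min (fst e) (snd e), max (fst e) (snd e))"
 have "d (min u v) (max u v) = d u v" for u v using d_sym[of u v] by (cases "u <= v") auto
 hence "tcost (map ?f es) = tcost es" unfolding tcost_def by (induction es) auto
 moreover have "normalized es = set (map ?f es)" unfolding normalized_def by simp
 ultimately show ?thesis using ecost_set_le[of "map ?f es"] by simp
qed

lemma tcost_prim_subset: "A <= S ==> S <= V ==> S ~= {} ==> tcost (prim S A) = 0"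
 using greedy_Nil_if_subset[OF greedy_prim[of S A]] unfolding tcost_def by auto

end

lemma normalized_converse: "normalized es Un (normalized es)^-1 = set es Un (set es)^-1"
proof -
 have *: "(min u v, max u v) = (u, v) \<or> (min u v, max u v) = (v, u)" for u v :: nat by (auto simp: min_def max_def)
 have n: "normalized es = (\<Union>(u, v)\<in>set es. {(min u v, max u v)})" unfolding normalized_def by force
 show ?thesis
 proof (intro equalityI subsetI)
  fix x assume "x : normalized es Un (normalized es)^-1"
  then obtain u v where "(u, v) : set es" "x = (min u v, max u v) \<or> x = (max u v, min u v)" unfolding n by auto
  thus "x : set es Un (set es)^-1" using *[of u v] by auto
 next
  fix x assume "x : set es Un (set es)^-1"
  then obtain u v where uv: "(u, v) : set es" "x = (u, v) \<or> x = (v, u)" by (cases x) auto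
  hence "(min u v, max u v) : normalized es" unfolding n by auto
  thus "x : normalized es Un (normalized es)^-1" using *[of u v] uv(2) by auto
 qed
qed

context benchmark
begin

text \<open>So it suffices to control the hitting probabilities at the \<open>n * n\<close> values
  \<open>d v u\<close>.\<close>

lemma hit_grid:
 "(ALL A. A <= V --> ~ hit v t A) \<or> (EX u<n. d v u <= t & (ALL A. A <= V --> hit v t A = hit v (d v u) A))"
proof (cases "EX u<n. d v u <= t")
 case True
 define W where "W = {u. u < n & d v u <= t}"
 have W: "finite W" "W ~= {}" unfolding W_def using True by auto
 obtain u where u: "u : W" "!!w. w : W ==> d v w <= d v u" using finite_arg_max[OF W, of "d v"] by blast
 have "hit v t A = hit v (d v u) A" if "A <= V" for A
 proof
  assume "hit v t A"
  then obtain j where "j : A" "d v j <= t" unfolding hit_def by blast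
  thus "hit v (d v u) A" using u(2)[of j] \<open>A <= V\<close> unfolding hit_def W_def by auto
 qed (use u(1) in "auto simp: W_def intro: hit_mono")
 thus ?thesis using u(1) unfolding W_def by (intro disjI2 exI[of _ u]) auto
next
 case False
 thus ?thesis unfolding hit_def by (auto simp: not_le)
qed

text \<open>\<open>w = 4 / 5\<close> in \<open>centres_cost_le\<close> gives
  \<open>4 / w = 5\<close>, and \<open>w = 6 / 5\<close> in \<open>second_stage_cost_le\<close>
  gives \<open>16 * w = 96 / 5\<close>.\<close>

lemma first_stage_bounds:
 assumes m: "0 < m" and As: "set As <= Pow V"
  and lo: "!!v u. v < n ==> u < n ==> m <= hits As v (d v u) ==> 4 / 5 <= lam * mean (%A. of_bool (hit v (d v u) A))"
  and hi: "!!v u. v < n ==> u < n ==> hits As v (d v u) < m ==> lam * mean (%A. of_bool (hit v (d v u) A)) <= 6 / 5"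
 defines "C == centres (rad m As) n"
 shows "tcost (prim {s} C) <= 4 * cs + 5 * (lam * mean ca)"
  and "lam * mean (%A. tcost (prim C A)) <= 8 * (lam * mean ca) + 96 / 5 * cs"
proof -
 let ?R = "rad m As"
 have R0: "0 <= ?R v" for v unfolding rad_def by (rule radius_upto_bounds)
 have C: "C <= V" "s : C" unfolding C_def using centres_sub by auto
 have "tcost (prim {s} C) <= 4 * (cs + lam * mean ca / (4 / 5))"
 proof (rule centres_cost_le[where D = "C - {s}" and R = ?R])
  show "greedy {s} (C - {s}) (prim {s} C)" using C s_less by (intro greedy_Diff greedy_prim) auto
  show "4 * ?R c < d c c'" if "c : C - {s}" "c' : insert s (C - {s})" "c ~= c'" for c c'
   using conjunct1[OF centres_invariant[of ?R n]] that C unfolding C_def by blast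
  show "4 / 5 <= lam * mean (%A. of_bool (hit v (?R v) A))" if v: "v : V" "?R v < d v s" for v
  proof -
   obtain u where "u < n" "?R v = d v u" "m <= hits As v (d v u)" using radius_upto_attained[of m As v n] v unfolding rad_def by auto
   thus ?thesis using lo[of v u] v by simp
  qed
 qed (use C R0 in auto)
 thus "tcost (prim {s} C) <= 4 * cs + 5 * (lam * mean ca)" by simp
 have "lam * mean (%A. tcost (prim C A)) <= 8 * (lam * mean ca + 2 * (6 / 5) * cs)"
 proof (rule second_stage_cost_le[OF C, where R = ?R])
  show "EX c:C. d v c <= 4 * ?R v" if "v : V" for v unfolding C_def using that R0 by (intro centres_cover) auto
  show "greedy C A (prim C A)" if "A <= V" for A using C that by (intro greedy_prim) auto
  show "lam * mean (%A. of_bool (hit v t A)) <= 6 / 5" if v: "v : V" and t: "t < ?R v" for v t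
  proof (cases "ALL A. A <= V --> ~ hit v t A")
   case True
   hence "mean (%A. of_bool (hit v t A)) = 0" unfolding mean_def by (auto intro!: sum.neutral)
   thus ?thesis by simp
  next
   case False
   then obtain u where u: "u < n" "d v u <= t" "!!A. A <= V ==> hit v t A = hit v (d v u) A" using hit_grid by blast
   have "~ m <= hits As v (d v u)" using radius_upto_le[OF u(1), of m As v] t u(2) unfolding rad_def by force
   hence "lam * mean (%A. of_bool (hit v (d v u) A)) <= 6 / 5" using hi u(1) v by simp
   moreover have "mean (%A. of_bool (hit v t A)) = mean (%A. of_bool (hit v (d v u) A))" unfolding mean_def by (intro sum.cong) (use u(3) in auto)
   ultimately show ?thesis by simp
  qed
 qed simp
 thus "lam * mean (%A. tcost (prim C A)) <= 8 * (lam * mean ca) + 96 / 5 * cs" by simp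
qed

lemma steiner_cost_le:
 assumes "S <= V" "s : S" "A <= V"
 shows "tcost (prim S A) <= 2 * (cs + ca A)"
proof -
 let ?E = "Fo Un Go A"
 have fin: "finite ?E" using finite_Fo finite_Go[OF assms(3)] by simp
 have "tcost (prim S A) <= 2 * ecost {(a, b) : ?E. EX v:A - S. 2 * d v a < sd v S \<or> 2 * d v b < sd v S}"
 proof (rule greedy_connected_le[OF greedy_prim])
  show "finite S" "finite A" using assms finite_subset by blast+
  show "(v, s) : (?E Un ?E^-1)\<^sup>*" if "v : A" for v by (rule conn[OF assms(3) that])
 qed (use assms fin in auto)
 also have "... <= 2 * ecost ?E" using fin by (intro mult_left_mono ecost_mono) auto
 also have "... <= 2 * (cs + ca A)" using finite_Fo finite_Go[OF assms(3)] by (intro mult_left_mono ecost_Un_le) auto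
 finally show ?thesis .
qed

text \<open>\<open>excess\<close> looks only at radii that are distances from \<open>A\<close>. An
  arbitrary radius is rounded down to the largest of these, which leaves the ball unchanged and does
  not raise the price.\<close>

lemma ext_cost_le_excess:
 assumes A: "A <= V" "A ~= {}" and ro: "0 <= ro" and y: "0 <= y"
 shows "lam * ext_cost X A ro <= excess y X A + 4 * y * ro"
proof -
 define W where "W = {u : V. sd u A <= ro}"
 have fA: "finite A" using A finite_subset by blast
 obtain a where "a : A" using A by blast
 hence "a : W" unfolding W_def using A ro sd_le[OF fA, of a a] by auto
 hence W: "finite W" "W ~= {}" unfolding W_def by auto
 obtain u where u: "u : W" "!!w. w : W ==> sd w A <= sd u A" using finite_arg_max[OF W, of "%w. sd w A"] by blast
 have "ball_of A ro = ball_of A (sd u A)" unfolding ball_of_sd[OF A] using u unfolding W_def by force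
 hence "ext_cost X A ro = ext_cost X A (sd u A)" unfolding ext_cost_def by simp
 moreover have "lam * ext_cost X A (sd u A) - 4 * y * sd u A <= excess y X A"
  unfolding excess_def using A u(1) unfolding W_def by (auto intro!: Max_ge)
 moreover have "4 * y * sd u A <= 4 * y * ro" using u(1) y unfolding W_def by (intro mult_left_mono) auto
 ultimately show ?thesis by simp
qed

end

section \<open>From scaled costs back to the instance\<close>

context dr_input
begin

lemma edges_sub: "F <= edges I ==> F <= V \<times> V" unfolding edges_def verts_def by auto

lemma finite_edges: "finite (edges I)" using finite_subset[OF edges_sub[OF order_refl]] by simp

lemma ecost_eq: assumes "F <= edges I" shows "ecost F = ri DEN * edge_set_cost I F"
proof -
 have "(case e of (u, v) => d u v) = ri DEN * (case e of (u, v) => rq (dist_cost I u v))" if "e : F" for e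
  using edges_sub[OF assms] that unfolding d_def clip_def by (auto split: prod.splits)
 thus ?thesis unfolding ecost_def edge_set_cost_def sum_distrib_left by (intro sum.cong) auto
qed

lemma normalized_edges:
 assumes "!!u v. (u, v) : set es ==> u < n & v < n & u ~= v"
 shows "normalized es <= edges I" unfolding normalized_def edges_def verts_def using assms by (fastforce simp: min_def max_def)

lemma feasible_output:
 assumes D: "D <= V" "s : D" and X: "X <= V"
 shows "feasible I (normalized (prim {s} D @ prim {s} X)) (%A. normalized (prim (D Un X) A))"
proof -
 let ?F = "normalized (prim {s} D @ prim {s} X)"
 have e1: "?F <= edges I"
 proof (rule normalized_edges)
  fix u v assume "(u, v) : set (prim {s} D @ prim {s} X)"
  thus "u < n & v < n & u ~= v" using prim_edges[of "{s}" D u v] prim_edges[of "{s}" X u v] s_lt D X by auto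
 qed
 have F: "?F Un ?F^-1 = set (prim {s} D @ prim {s} X) Un (set (prim {s} D @ prim {s} X))^-1" by (rule normalized_converse)
 have root: "(u, s) : (?F Un ?F^-1)\<^sup>*" if "u : D Un X" for u
 proof -
  obtain Y where Y: "Y : {D, X}" "u : Y" "Y <= V" using \<open>u : D Un X\<close> D X by auto
  have "greedy {s} Y (prim {s} Y)" using Y s_lt by (intro greedy_prim) auto
  from greedy_connects[OF this Y(2)] have "(u, s) : (set (prim {s} Y) Un (set (prim {s} Y))^-1)\<^sup>*" by simp
  moreover have "(set (prim {s} Y) Un (set (prim {s} Y))^-1)\<^sup>* <= (?F Un ?F^-1)\<^sup>*"
   unfolding F using Y(1) by (intro rtrancl_mono) auto
  ultimately show ?thesis by blast
 qed
 have "normalized (prim (D Un X) A) <= edges I & connects_to_root I (?F Un normalized (prim (D Un X) A)) A" if A: "A <= V" for A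
 proof
  show "normalized (prim (D Un X) A) <= edges I"
  proof (rule normalized_edges)
   fix u v assume "(u, v) : set (prim (D Un X) A)"
   thus "u < n & v < n & u ~= v" using prim_edges[of "D Un X" A u v] D X A by auto
  qed
  let ?G = "normalized (prim (D Un X) A)"
  have g: "greedy (D Un X) A (prim (D Un X) A)" using D X A by (intro greedy_prim) auto
  have "(v, s) : ((?F Un ?G) Un (?F Un ?G)^-1)\<^sup>*" if vA: "v : A" for v
  proof -
   obtain u where u: "u : D Un X" "(v, u) : (?G Un ?G^-1)\<^sup>*"
    using greedy_connects[OF g vA] unfolding normalized_converse by (rule bexE)
   have "(?G Un ?G^-1)\<^sup>* <= ((?F Un ?G) Un (?F Un ?G)^-1)\<^sup>*" "(?F Un ?F^-1)\<^sup>* <= ((?F Un ?G) Un (?F Un ?G)^-1)\<^sup>*"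
    by (intro rtrancl_mono; auto)+
   thus ?thesis by (intro rtrancl_trans[OF subsetD[OF _ u(2)] subsetD[OF _ root[OF u(1)]]])
  qed
  thus "connects_to_root I (?F Un ?G) A" unfolding connects_to_root_def by blast
 qed
 thus ?thesis unfolding feasible_def using e1 by (simp add: verts_def)
qed

lemma finite_ball_supp: "q : dball kp ==> finite (set_pmf q)" "q : dball kp ==> set_pmf q <= Pow V"
 unfolding distribution_ball_def verts_def using finite_subset[of "set_pmf q" "Pow V"] by auto

lemma bdd_ball: "bdd_above ((%q. expect q (f :: nat set => real)) ` dball kp)"
proof (rule bdd_aboveI2)
 fix q assume q: "q : dball kp"
 have "expect q f <= expect q (%_. Max (f ` Pow V))" using finite_ball_supp[OF q] by (intro expectation_le_finite) (auto intro!: Max_ge)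
 thus "expect q f <= Max (f ` Pow V)" by simp
qed

lemma p_in_ball:
 assumes "!!A. A <= V ==> kp I A A = 0"
 shows "p : dball kp"
proof -
 let ?g = "map_pmf (%A. (A, A)) p"
 have "wasserstein (kp I) p p <= (\<integral>\<^sup>+ (A, A'). kp I A A' \<partial>measure_pmf ?g)"
  unfolding wasserstein_def by (intro INF_lower) (simp add: map_pmf_comp)
 also have "... = (\<integral>\<^sup>+ A. kp I A A \<partial>measure_pmf p)" by simp
 also have "... = (\<integral>\<^sup>+ A. 0 \<partial>measure_pmf p)"
  using assms p_subset by (intro nn_integral_cong_AE AE_pmfI) (auto simp: verts_def)
 finally show ?thesis unfolding distribution_ball_def using p_subset by simp
qed

text \<open>The second-stage map matters only on subsets of \<open>V\<close>, so finitely many pairs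
  realise all objective values and the infimum is a minimum.\<close>

lemma optimum_attained:
 obtains Fo Go where "feasible I Fo Go" "objective kp I p Fo Go = optimum kp I p"
  "!!F FA. feasible I F FA ==> optimum kp I p <= objective kp I p F FA"
proof -
 define Fs where "Fs = {(F, FA). feasible I F FA}"
 define ob where "ob = (%(F, FA). objective kp I p F FA)"
 define Q where "Q = Pow (edges I) \<times> (PiE (Pow V) (%_. Pow (edges I)))"
 have finQ: "finite Q" unfolding Q_def using finite_edges by (intro finite_cartesian_product finite_PiE) auto
 have "ob ` Fs <= ob ` Q"
 proof
  fix x assume "x : ob ` Fs"
  then obtain F FA where F: "feasible I F FA" and x: "x = objective kp I p F FA" unfolding Fs_def ob_def by auto
  let ?G = "restrict FA (Pow V)"
  have "(F, ?G) : Q" using F unfolding Q_def feasible_def verts_def by auto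
  moreover have "objective kp I p F ?G = x"
  proof -
   have "expect q (%A. rq (inflation I) * edge_set_cost I (?G A)) =
     expect q (%A. rq (inflation I) * edge_set_cost I (FA A))" if q: "q : dball kp" for q
   proof (rule integral_cong_AE)
    show "AE A in measure_pmf q. rq (inflation I) * edge_set_cost I (?G A) = rq (inflation I) * edge_set_cost I (FA A)"
    proof (rule AE_pmfI)
     fix A assume "A : set_pmf q"
     hence "A : Pow V" using finite_ball_supp(2)[OF q] by (rule rev_subsetD)
     thus "rq (inflation I) * edge_set_cost I (?G A) = rq (inflation I) * edge_set_cost I (FA A)" by simp
    qed
   qed simp_all
   thus ?thesis unfolding x objective_def by (intro arg_cong2[of _ _ _ _ "(+)"] SUP_cong refl)
  qed
  ultimately show "x : ob ` Q" unfolding ob_def by (metis (no_types, lifting) case_prod_conv image_eqI)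
 qed
 hence fin: "finite (ob ` Fs)" using finQ finite_subset by blast
 have ne: "ob ` Fs ~= {}" using feasible_output[of V V] s_lt unfolding Fs_def by auto
 have opt: "optimum kp I p = Min (ob ` Fs)" unfolding optimum_def Fs_def [symmetric] ob_def [symmetric] using cInf_eq_Min[OF fin ne] .
 hence "optimum kp I p : ob ` Fs" using Min_in[OF fin ne] by simp
 then obtain Fo Go where Fo: "feasible I Fo Go" "objective kp I p Fo Go = optimum kp I p" unfolding Fs_def ob_def by auto
 have "optimum kp I p <= objective kp I p F FA" if "feasible I F FA" for F FA
  unfolding opt by (rule Min_le[OF fin]) (use that in "force simp: Fs_def ob_def")
 with Fo show thesis by (rule that)
qed

end

section \<open>An optimal solution as benchmark\<close>

locale dr_opt = dr_input +
 fixes kp :: scenario_metric and Fo :: "(nat \<times> nat) set" and Go :: "nat set => (nat \<times> nat) set"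
 assumes Fo_feasible: "feasible I Fo Go" and Fo_opt: "objective kp I p Fo Go = optimum kp I p"
  and opt_le: "!!F FA. feasible I F FA ==> optimum kp I p <= objective kp I p F FA"
  and metric_refl: "!!A. A <= V ==> kp I A A = 0"
begin

sublocale benchmark d n s p lm Fo Go
proof
 show "set_pmf p <= Pow V" using p_subset unfolding verts_def .
 show "1 <= lm" by (rule lm_ge1)
 show "Fo <= V \<times> V" using Fo_feasible edges_sub unfolding feasible_def by blast
 show "Go A <= V \<times> V" if "A <= V" for A using Fo_feasible edges_sub that unfolding feasible_def verts_def by blast
 show "(v, s) : ((Fo Un Go A) Un (Fo Un Go A)^-1)\<^sup>*" if "A <= V" "v : A" for A v
  using Fo_feasible that unfolding feasible_def connects_to_root_def verts_def by blast
qed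

text \<open>Worst-case second-stage cost of the optimal solution, in scaled costs and with
  \<open>lm\<close> in place of the inflation.\<close>

definition WC :: real where
 "WC = (SUP q\<in>dball kp. expect q (%A. lm * ca A))"

lemma WC_ge: "q : dball kp ==> expect q (%A. lm * ca A) <= WC" unfolding WC_def by (rule cSUP_upper[OF _ bdd_ball])

lemma mean_le_WC: "lm * mean ca <= WC" using WC_ge[OF p_in_ball] metric_refl unfolding mean_eq mean_cmult by simp

lemma WC_nonneg: "0 <= WC" using mean_le_WC mean_nonneg[of ca] lm_ge1 by (smt (verit) ecost_nonneg mult_nonneg_nonneg)

lemma lm_le_inflation: "lm <= rq (inflation I)"
 and inflation_le: "rq (inflation I) <= lm * max 1 (rq eps)"
proof -
 have i1: "1 <= rq (inflation I)" using inflation_ge1 by (metis of_rat_1 of_rat_less_eq)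
 have "rq (inflation I) / max 1 (rq eps) <= rq (inflation I) / 1" using i1 by (intro divide_left_mono) auto
 thus "lm <= rq (inflation I)" unfolding lm_eq using i1 by simp
 have "rq (inflation I) / max 1 (rq eps) <= lm" unfolding lm_eq by simp
 thus "rq (inflation I) <= lm * max 1 (rq eps)" by (simp add: divide_le_eq)
qed

text \<open>Replacing the inflation by the smaller \<open>lm\<close> only lowers the cost of the
  optimal solution.\<close>

lemma optimum_ge: "cs + WC <= ri DEN * optimum kp I p"
proof -
 have DEN: "0 < ri DEN" using DEN_pos by simp
 have sub: "Fo <= edges I" "!!A. A <= V ==> Go A <= edges I" using Fo_feasible unfolding feasible_def verts_def by auto
 define S where "S = (SUP q\<in>dball kp. expect q (%A. rq (inflation I) * edge_set_cost I (Go A)))"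
 have "WC <= ri DEN * S" unfolding WC_def
 proof (rule cSUP_least)
  show "dball kp ~= {}" using p_in_ball metric_refl by blast
  fix q assume q: "q : dball kp"
  have "expect q (%A. lm * ca A) <=
    expect q (%A. ri DEN * (rq (inflation I) * edge_set_cost I (Go A)))"
  proof (rule expectation_le_finite[OF finite_ball_supp(1)[OF q]])
   fix A assume "A : set_pmf q"
   hence "Go A <= edges I" using finite_ball_supp(2)[OF q] sub by blast
   thus "lm * ca A <= ri DEN * (rq (inflation I) * edge_set_cost I (Go A))"
    using mult_right_mono[OF lm_le_inflation ecost_nonneg, of "Go A"] ecost_eq[of "Go A"] by (simp add: algebra_simps)
  qed
  also have "... = ri DEN * expect q (%A. rq (inflation I) * edge_set_cost I (Go A))" by simp
  also have "... <= ri DEN * S" unfolding S_def by (rule mult_left_mono[OF cSUP_upper[OF q bdd_ball]]) (use DEN in simp)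
  finally show "expect q (%A. lm * ca A) <= ri DEN * S" .
 qed
 moreover have "optimum kp I p = edge_set_cost I Fo + S" unfolding Fo_opt [symmetric] objective_def S_def ..
 ultimately show ?thesis using ecost_eq[OF sub(1)] by (simp add: algebra_simps)
qed

text \<open>Returning from \<open>lm\<close> to the inflation costs the factor
  \<open>max 1 eps\<close>, which is at most \<open>1 + eps\<close>; this is where
  \<open>160 * eps\<close> comes from.\<close>

lemma objective_le:
 assumes feas: "feasible I F FA" and B: "!!q. q : dball kp ==> expect q (%A. lm * ecost (FA A)) <= B"
  and tot: "ecost F + B <= 160 * (cs + WC)"
 shows "objective kp I p F FA <= (160 + 160 * rq eps) * optimum kp I p"
proof -
 define tht where "tht = max 1 (rq eps)"
 have th: "1 <= tht" "tht <= 1 + rq eps" unfolding tht_def using eps_pos by auto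
 have DEN: "0 < ri DEN" using DEN_pos by simp
 have sub: "F <= edges I" "!!A. A <= V ==> FA A <= edges I" using feas unfolding feasible_def verts_def by auto
 define S where "S = (SUP q\<in>dball kp. expect q (%A. rq (inflation I) * edge_set_cost I (FA A)))"
 have "S <= tht * B / ri DEN" unfolding S_def
 proof (rule cSUP_least)
  show "dball kp ~= {}" using p_in_ball metric_refl by blast
  fix q assume q: "q : dball kp"
  have "expect q (%A. rq (inflation I) * edge_set_cost I (FA A)) <=
    expect q (%A. tht / ri DEN * (lm * ecost (FA A)))"
  proof (rule expectation_le_finite[OF finite_ball_supp(1)[OF q]])
   fix A assume "A : set_pmf q"
   hence e: "FA A <= edges I" using finite_ball_supp(2)[OF q] sub by blast
   have eq: "edge_set_cost I (FA A) = ecost (FA A) / ri DEN" using ecost_eq[OF e] DEN by simp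
   have "rq (inflation I) * (ecost (FA A) / ri DEN) <= lm * tht * (ecost (FA A) / ri DEN)"
    using inflation_le DEN unfolding tht_def by (intro mult_right_mono) auto
   thus "rq (inflation I) * edge_set_cost I (FA A) <= tht / ri DEN * (lm * ecost (FA A))"
    unfolding eq by (simp add: algebra_simps)
  qed
  also have "... = tht / ri DEN * expect q (%A. lm * ecost (FA A))" by simp
  also have "... <= tht / ri DEN * B" using th DEN B[OF q] by (intro mult_left_mono) auto
  finally show "expect q (%A. rq (inflation I) * edge_set_cost I (FA A)) <= tht * B / ri DEN" by simp
 qed
 moreover have "edge_set_cost I F = ecost F / ri DEN" using ecost_eq[OF sub(1)] DEN by simp
 moreover have "ecost F / ri DEN <= tht * (ecost F / ri DEN)" using th DEN by (intro mult_right_mono[of 1 tht, simplified]) auto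
 ultimately have "objective kp I p F FA <= tht * ((ecost F + B) / ri DEN)"
  unfolding objective_def S_def [symmetric] by (simp add: algebra_simps add_divide_distrib)
 also have "... <= tht * (160 * optimum kp I p)"
 proof -
  have "(ecost F + B) / ri DEN <= 160 * optimum kp I p" using tot optimum_ge DEN by (simp add: divide_le_eq algebra_simps)
  thus ?thesis using th by (intro mult_left_mono) auto
 qed
 also have "... <= (1 + rq eps) * (160 * optimum kp I p)"
 proof (rule mult_right_mono[OF th(2)])
  have "0 <= ri DEN * optimum kp I p" using optimum_ge WC_nonneg ecost_nonneg[of Fo] by linarith
  thus "0 <= 160 * optimum kp I p" using DEN by (simp add: zero_le_mult_iff)
 qed
 finally show ?thesis by (simp add: algebra_simps)
qed

end

section \<open>Conditions for a good output, and the discrete metric\<close>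

context dr_opt
begin

abbreviation "rr == rq (radius I)"

definition good :: "nat set => nat set => bool" where
 "good C X = (objective kp I p (normalized (prim {s} C @ prim {s} X)) (%A. normalized (prim (C Un X) A)) <=
   (160 + 160 * rq eps) * optimum kp I p)"

lemma goodI:
 assumes C: "C <= V" "s : C" and X: "X <= V"
  and F1: "tcost (prim {s} C) <= 4 * cs + 5 * (lm * mean ca)" and BX: "tcost (prim {s} X) <= BX"
  and B: "!!q. q : dball kp ==> expect q (%A. lm * tcost (prim (C Un X) A)) <= B"
  and tot: "4 * cs + 5 * WC + BX + B <= 160 * (cs + WC)"
 shows "good C X" unfolding good_def
proof (rule objective_le[OF feasible_output[OF C X]])
 show "expect q (%A. lm * ecost (normalized (prim (C Un X) A))) <= B" if q: "q : dball kp" for q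
 proof -
  have "expect q (%A. lm * ecost (normalized (prim (C Un X) A))) <= expect q (%A. lm * tcost (prim (C Un X) A))"
   using lm_ge1 by (intro expectation_le_finite[OF finite_ball_supp(1)[OF q]] mult_left_mono ecost_normalized_le) auto
  thus ?thesis using B[OF q] by simp
 qed
 have "ecost (normalized (prim {s} C @ prim {s} X)) <= tcost (prim {s} C) + tcost (prim {s} X)"
  using ecost_normalized_le[of "prim {s} C @ prim {s} X"] unfolding tcost_def by simp
 thus "ecost (normalized (prim {s} C @ prim {s} X)) + B <= 160 * (cs + WC)" using F1 BX tot mean_le_WC by linarith
qed

lemma dual_solution:
 assumes "0 < radius I"
 obtains y H where "0 <= y" "!!A. A <= V ==> 0 <= H A"
  "!!A A'. A <= V ==> A' <= V ==> kp I A A' < \<top> ==> lm * ca A' <= H A + y * enn2real (kp I A A')"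
  "rr * y + mean H <= WC"
proof -
 have r: "0 < rr" using assms by simp
 have fin: "finite (Pow V)" by simp
 have ps: "set_pmf p <= Pow V" using p_subset unfolding verts_def .
 have refl: "kp I A A = 0" if "A : Pow V" for A using metric_refl that by simp
 obtain y H where y: "0 <= y"
  and H: "!!A A'. A : Pow V ==> A' : Pow V ==> kp I A A' < \<top> ==> lm * ca A' <= H A + y * enn2real (kp I A A')"
  and W: "rr * y + expect p H <=
    (SUP q\<in>{q. set_pmf q <= Pow V & wasserstein (kp I) p q <= ennreal rr}. expect q (%A. lm * ca A))"
  using transport_duality[where h = "%A. lm * ca A" and kp = "kp I", OF fin ps r refl] by blast
 have "rr * y + mean H <= WC" using W unfolding WC_def distribution_ball_def verts_def mean_eq .
 moreover have "0 <= H A" if "A <= V" for A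
 proof -
  have "lm * ca A <= H A" using H[of A A] metric_refl[OF that] that by simp
  moreover have "0 <= lm * ca A" using lm_ge1 by simp
  ultimately show ?thesis by linarith
 qed
 ultimately show thesis using that[of y H] y H by simp
qed

lemma transport_le:
 assumes q: "q : dball kp" and y: "0 <= y"
  and le: "!!A A'. A <= V ==> A' <= V ==> kp I A A' < \<top> ==> w A' <= G A + y * enn2real (kp I A A')"
 shows "expect q w <= mean G + y * rr" unfolding mean_eq [symmetric]
proof (rule transport_upper_bound[where P = "Pow V" and kp = "kp I"])
 show "wasserstein (kp I) p q <= ennreal rr" using q unfolding distribution_ball_def by simp
 show "set_pmf p <= Pow V" "set_pmf q <= Pow V" using p_subset finite_ball_supp(2)[OF q] unfolding verts_def by auto
qed (use y le radius_nonneg in auto)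

text \<open>Probability mass up to the radius can be moved anywhere. If \<open>1 <= rr * lm\<close>,
  moving it to the scenario \<open>V\<close> shows \<open>ca V <= WC\<close>, so a tree on all
  vertices is affordable. Otherwise moved mass pays at most \<open>2 * lm * (cs + ca A)\<close> per
  unit: the dual solution covers the second part, and \<open>rr * lm < 1\<close> makes the first at
  most \<open>2 * cs\<close>.\<close>

lemma discrete_good:
 assumes kp: "kp = discrete_metric" and C: "C <= V" "s : C"
  and F1: "tcost (prim {s} C) <= 4 * cs + 5 * (lm * mean ca)"
  and F2: "lm * mean (%A. tcost (prim C A)) <= 8 * (lm * mean ca) + 96 / 5 * cs"
 shows "good C (if 1 <= rr * lm then V else {})"
proof (cases "1 <= rr * lm")
 case True
 have r: "0 < rr" using True mult_nonpos_nonneg[of rr lm] lm_ge1 by linarith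
 hence "0 < radius I" by simp
 then obtain y H where y: "0 <= y" "!!A. A <= V ==> 0 <= H A"
  and H: "!!A A'. A <= V ==> A' <= V ==> kp I A A' < \<top> ==> lm * ca A' <= H A + y * enn2real (kp I A A')"
  and W: "rr * y + mean H <= WC" using dual_solution by blast
 have "lm * ca V <= H A + y" if "A <= V" for A using H[OF that, of V] y unfolding kp discrete_metric_def by (cases "A = V") auto
 hence "mean (%_. lm * ca V) <= mean (%A. H A + y)" by (intro mean_mono)
 hence b: "lm * ca V <= mean H + y" unfolding mean_add mean_const .
 have H0: "0 <= mean H" using y by (intro mean_nonneg) auto
 have "ca V <= WC"
 proof (cases "1 <= rr")
  case True
  have "ca V <= lm * ca V" using mult_right_mono[OF lm_ge1 ecost_nonneg] by simp
  moreover have "y <= rr * y" using mult_right_mono[OF True y(1)] by simp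
  ultimately show ?thesis using b W by linarith
 next
  case False
  have "ca V <= rr * lm * ca V" using mult_right_mono[OF True ecost_nonneg] by simp
  also have "... <= rr * (mean H + y)" using mult_left_mono[OF b, of rr] r by (simp add: mult.assoc)
  also have "... <= mean H + rr * y" using mult_right_mono[of rr 1 "mean H"] False H0 by (simp add: distrib_left)
  finally show ?thesis using W by linarith
 qed
 hence X: "tcost (prim {s} V) <= 2 * cs + 2 * WC" using steiner_cost_le[of "{s}" V] s_lt by simp
 have "good C V"
 proof (rule goodI[OF C order_refl F1 X])
  fix q assume q: "q : dball kp"
  have "expect q (%A. lm * tcost (prim (C Un V) A)) <= expect q (%A. 0)"
  proof (rule expectation_le_finite[OF finite_ball_supp(1)[OF q]])
   fix A assume "A : set_pmf q"
   hence "A <= V" using finite_ball_supp(2)[OF q] by auto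
   hence "tcost (prim (C Un V) A) = 0" using C by (intro tcost_prim_subset) auto
   thus "lm * tcost (prim (C Un V) A) <= 0" by simp
  qed
  thus "expect q (%A. lm * tcost (prim (C Un V) A)) <= 0" by simp
 qed (use WC_nonneg ecost_nonneg[of Fo] in "simp, linarith?")
 thus ?thesis using True by simp
next
 case False
 have main: "good C {}" if B: "!!q. q : dball kp ==>
   expect q (%A. lm * tcost (prim C A)) <= lm * mean (%A. tcost (prim C A)) + 2 * WC + 2 * cs"
 proof (rule goodI[OF C empty_subsetI F1])
  show "tcost (prim {s} {}) <= 0" using tcost_prim_subset[of "{}" "{s}"] s_lt by simp
  show "expect q (%A. lm * tcost (prim (C Un {}) A)) <= 10 * WC + 106 / 5 * cs" if "q : dball kp" for q
   using B[OF that] F2 mean_le_WC by simp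
 qed (use WC_nonneg ecost_nonneg[of Fo] in "simp, linarith?")
 have tm: "lm * tcost (prim C A) <= 2 * (lm * cs) + 2 * (lm * ca A)" if "A <= V" for A
  using mult_left_mono[OF steiner_cost_le[OF C that], of lm] lm_ge1 by (simp add: algebra_simps)
 have "good C {}"
 proof (cases "radius I = 0")
  case True
  \<comment> \<open>Duality was proved for positive radius only. For radius 0 the multiplier is
    free, because it is multiplied by the radius, so one that dominates every cost is taken.\<close>
  define Y where "Y = (SUM A:Pow V. lm * tcost (prim C A))"
  have Y: "lm * tcost (prim C A) <= Y" if "A <= V" for A unfolding Y_def using that lm_ge1 by (intro member_le_sum) auto
  have "0 <= Y" unfolding Y_def using lm_ge1 by (intro sum_nonneg) auto
  show ?thesis
  proof (rule main)
   fix q assume q: "q : dball kp"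
   have calc: "expect q (%A. lm * tcost (prim C A)) <= mean (%A. lm * tcost (prim C A)) + Y * rr"
   proof (rule transport_le[OF q \<open>0 <= Y\<close>])
    fix A A' assume "A <= V" "A' <= V"
    have n0: "0 <= lm * tcost (prim C A)" using lm_ge1 by simp
    show "lm * tcost (prim C A') <= lm * tcost (prim C A) + Y * enn2real (kp I A A')"
    proof (cases "A = A'")
     case True
     thus ?thesis unfolding kp discrete_metric_def by simp
    next
     case False
     hence e1: "enn2real (kp I A A') = 1" unfolding kp discrete_metric_def by simp
     show ?thesis unfolding e1 using Y[OF \<open>A' <= V\<close>] n0 by linarith
    qed
   qed
   show "expect q (%A. lm * tcost (prim C A)) <= lm * mean (%A. tcost (prim C A)) + 2 * WC + 2 * cs"
   proof -
    have "Y * rr = 0" using True by simp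
    with calc show ?thesis using WC_nonneg ecost_nonneg[of Fo] unfolding mean_cmult by linarith
   qed
  qed
 next
  case r0: False
  hence "0 < radius I" using radius_nonneg by simp
  then obtain y H where y: "0 <= y" "!!A. A <= V ==> 0 <= H A"
   and H: "!!A A'. A <= V ==> A' <= V ==> kp I A A' < \<top> ==> lm * ca A' <= H A + y * enn2real (kp I A A')"
   and W: "rr * y + mean H <= WC" using dual_solution by blast
  show ?thesis
  proof (rule main)
   fix q assume q: "q : dball kp"
   have y0: "0 <= 2 * (lm * cs) + 2 * y" using y(1) lm_ge1 by simp
   have "expect q (%A. lm * tcost (prim C A)) <= mean (%A. lm * tcost (prim C A) + 2 * H A) + (2 * (lm * cs) + 2 * y) * rr"
   proof (rule transport_le[OF q y0])
    fix A A' assume A: "A <= V" "A' <= V" and fin: "kp I A A' < \<top>"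
    show "lm * tcost (prim C A') <= lm * tcost (prim C A) + 2 * H A + (2 * (lm * cs) + 2 * y) * enn2real (kp I A A')"
    proof (cases "A = A'")
     case True
     thus ?thesis using y(2)[OF A(1)] unfolding kp discrete_metric_def by simp
    next
     case ne: False
     have "lm * ca A' <= H A + y" using H[OF A fin] ne unfolding kp discrete_metric_def by simp
     moreover have "0 <= lm * tcost (prim C A)" using lm_ge1 by simp
     moreover have e1: "enn2real (kp I A A') = 1" using ne unfolding kp discrete_metric_def by simp
     ultimately show ?thesis using tm[OF A(2)] unfolding e1 mult_1_right by argo
    qed
   qed
   moreover have "lm * cs * rr <= cs" using mult_right_mono[of "rr * lm" 1 cs] False by (simp add: algebra_simps)
   ultimately show "expect q (%A. lm * tcost (prim C A)) <= lm * mean (%A. tcost (prim C A)) + 2 * WC + 2 * cs"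
    using W unfolding mean_add mean_cmult by (simp add: algebra_simps)
  qed
 qed
 thus ?thesis using False by simp
qed

end

section \<open>The asymmetric metric: balls, integrality and the sets chosen by the program\<close>

context dr_input
begin

lemma asym_refl: "A <= V ==> asym_metric I A A = 0"
proof -
 assume A: "A <= V"
 have "asym_metric I A A <= 0" unfolding asym_metric_def
 proof (rule SUP_least)
  fix j assume j: "j : A"
  have "(INF j'\<in>A. ennreal (rq (dist_cost I j j'))) <= ennreal (rq (dist_cost I j j))" using j by (rule INF_lower)
  also have "... = 0" using cost_self[of j] j A by auto
  finally show "(INF j'\<in>A. ennreal (rq (dist_cost I j j'))) <= 0" .
 qed
 thus ?thesis by simp
qed

lemma d_cost: "u < n ==> v < n ==> d u v = ri DEN * rq (dist_cost I u v)" unfolding d_def clip_def by simp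

text \<open>Together with \<open>asym_ball_le\<close> this identifies the scenarios reachable from
  \<open>A\<close> at a finite cost with the subsets of a ball around \<open>A\<close>;
  \<open>DEN\<close> is the scale of \<open>d\<close>.\<close>

lemma asym_sub_ball:
 assumes A: "A <= V" "A' <= V" and fin: "asym_metric I A A' < \<top>"
 shows "A' <= ball_of A (ri DEN * enn2real (asym_metric I A A'))"
proof
 fix j assume j: "j : A'"
 let ?f = "%i. ennreal (rq (dist_cost I j i))" and ?k = "asym_metric I A A'"
 have le: "(INF i\<in>A. ?f i) <= ?k" unfolding asym_metric_def using j by (rule SUP_upper)
 have ne: "A ~= {}" using le fin by auto
 have fA: "finite A" using A finite_subset by blast
 have "Min (?f ` A) : ?f ` A" using ne fA by (intro Min_in) auto
 then obtain i where i: "i : A" "Min (?f ` A) = ?f i" by (rule imageE)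
 have "(INF i\<in>A. ?f i) = ?f i" using i(2) Min_Inf[of "?f ` A"] ne fA by simp
 hence "?f i <= ennreal (enn2real ?k)" using le fin by simp
 moreover have jn: "j < n" "i < n" using j i A by auto
 ultimately have "rq (dist_cost I j i) <= enn2real ?k" by (simp add: ennreal_le_iff)
 hence "d j i <= ri DEN * enn2real ?k" unfolding d_cost[OF jn] using DEN_pos by (intro mult_left_mono) auto
 thus "j : ball_of A (ri DEN * enn2real ?k)" unfolding ball_of_def using i jn by auto
qed

lemma asym_empty: "A' ~= {} ==> asym_metric I {} A' = \<top>" unfolding asym_metric_def by simp

lemma asym_ball_le:
 assumes A: "A <= V" and ro: "0 <= ro"
 shows "asym_metric I A (ball_of A ro) <= ennreal (ro / ri DEN)" unfolding asym_metric_def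
proof (rule SUP_least)
 fix j assume "j : ball_of A ro"
 then obtain i where i: "j < n" "i : A" "d j i <= ro" unfolding ball_of_def by auto
 hence "i < n" using A by auto
 have DEN: "0 < ri DEN" using DEN_pos by simp
 have "(INF i\<in>A. ennreal (rq (dist_cost I j i))) <= ennreal (rq (dist_cost I j i))" using i(2) by (rule INF_lower)
 also have "... <= ennreal (ro / ri DEN)"
  using i(3) d_cost[OF i(1) \<open>i < n\<close>] DEN by (intro ennreal_leI) (simp add: le_divide_eq mult.commute)
 finally show "(INF i\<in>A. ennreal (rq (dist_cost I j i))) <= ennreal (ro / ri DEN)" .
qed

definition rs :: real where "rs = ri DEN * rq (radius I)"
definition Zs :: "nat => real" where "Zs i = ri (zc i) / ri U"

lemma d_int: "u < n ==> v < n ==> d u v : \<int>" "d u v < ri CS"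
proof -
 have ex: "EX k<n * n. d u v = ri (Cc k)" if "u < n" "v < n" for u v
 proof -
  have "u * n + v < Suc u * n" using that by simp
  also have "... <= n * n" using that by (intro mult_le_mono1) simp
  finally have k: "u * n + v < n * n" .
  thus ?thesis using Cc_d[OF k] that by (intro exI[of _ "u * n + v"]) simp
 qed
 show "u < n ==> v < n ==> d u v : \<int>" using ex[of u v] by auto
 have "d u v = d (clip u) (clip v)" unfolding d_def clip_def using s_lt by simp
 moreover obtain k where k: "k < n * n" "d (clip u) (clip v) = ri (Cc k)" using ex[OF clip_lt clip_lt] by blast
 moreover have "Cc k < CS" unfolding CS_def using member_le_sum[of k "{..<n * n}" Cc] Cc_nonneg k(1) by force
 ultimately show "d u v < ri CS" by simp
qed

lemma tcost_int:
 assumes "S <= V" "S ~= {}" "T <= V"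
 shows "tcost (prim S T) : \<int>"
proof -
 have "ALL (u, v):set es. d u v : \<int> ==> tcost es : \<int>" for es unfolding tcost_def by (induction es) auto
 thus ?thesis using prim_edges[OF assms] d_int(1) by blast
qed

lemma ecost_int: "F <= V \<times> V ==> ecost F : \<int>" unfolding ecost_def by (intro Ints_sum) (use d_int(1) in auto)

lemma rs_ge: "0 < radius I ==> 1 / ri (dnm (radius I)) <= rs"
proof -
 assume "0 < radius I"
 hence "1 <= num (radius I)" using num_pos[of "radius I"] by simp
 hence "1 <= DEN * num (radius I)" using DEN_pos mult_mono[of 1 DEN 1 "num (radius I)"] by simp
 hence "1 <= ri (DEN * num (radius I))" by linarith
 thus ?thesis unfolding rs_def rat_eq using dnm_pos[of "radius I"] by (simp add: divide_right_mono)
qed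

lemma XS_discrete:
 assumes As: "As : set_pmf (smp k0)"
 shows "XS k0 discrete_prg As = (if 1 <= rq (radius I) * lm then V else {})"
proof -
 have e: "env (centres_state k0 As)" by (rule centres_state_values[OF As])
 have "aFL ~: {aTS, aBUF, aKK, aSA} Un wr radii_prg Un wr centres_prg" using wr_radii_centres by (auto dest!: subsetD)
 hence fl: "centres_state k0 As aFL 0 = num (radius I) * LN - dnm (radius I) * LD + 1" using centres_state_frame pre_values(5) by simp
 have "0 < num (radius I) * LN - dnm (radius I) * LD + 1 \<longleftrightarrow> ri (dnm (radius I) * LD) <= ri (num (radius I) * LN)" by linarith
 also have "... \<longleftrightarrow> 1 <= rq (radius I) * lm"
  unfolding rat_eq lm_def using dnm_pos[of "radius I"] LD_pos by (simp add: le_divide_eq mult.commute)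
 finally show ?thesis unfolding XS_def den_discrete[OF e] fl by simp
qed

lemma XS_asym:
 assumes As: "As : set_pmf (smp k0)" and m: "0 < mm k0"
  and i: "i < L + 2" "accepted (Zs i) (mm k0) (round_run lm rs (Zs i) (mm k0) As)"
 obtains j where "j <= i" "accepted (Zs j) (mm k0) (round_run lm rs (Zs j) (mm k0) As)"
  "XS k0 asym_prg As = bought (mm k0) (round_run lm rs (Zs j) (mm k0) As)"
proof -
 \<comment> \<open>A common denominator of \<open>lm * rs\<close> and of the guesses
   \<open>Zs i\<close>.\<close>
 define kp where "kp = ri (LD * dnm (radius I) * U)"
 note v = centres_state_values[OF As]
 have fr: "centres_state k0 As x = pre k0 x" if "x : {aMm, aK1, aUn, aI, aK2, aZ}" for x
 proof (rule centres_state_frame)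
  have "x ~: {aR, aV, aU, aCT, aT, aHIT, aJ, aD, aIT2, aB, aCOV, aCc, 99}" "x ~: {aTS, aBUF, aKK, aSA}" using that by (elim insertE emptyE; simp)+
  thus "x ~: {aTS, aBUF, aKK, aSA} Un wr radii_prg Un wr centres_prg" using wr_radii_centres by blast
 qed
 have k0': "0 < kp" unfolding kp_def using LD_pos dnm_pos[of "radius I"] U_pos by simp
 have "ri (LN * num (radius I) * DEN * U) = kp * (lm * rs)"
  unfolding kp_def lm_def rs_def rat_eq using LD_pos dnm_pos[of "radius I"] by simp
 hence par: "params (centres_state k0 As) kp lm rs (mm k0)" unfolding params_def using k0' pre_values(2,6,7)[of k0] U_pos by (simp add: fr)
 have "ri (centres_state k0 As aK2 i) = kp * (4 * Zs i) &
   ri (centres_state k0 As aZ i) = ri (centres_state k0 As aUn 0) * Zs i" if "i < L + 2" for i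
  using pre_values(9)[OF that, of k0] pre_values(7)[of k0] U_pos unfolding Zs_def kp_def by (simp add: fr)
 moreover have "centres_state k0 As aI 0 = int (L + 2)" using pre_values(4)[of k0] by (simp add: fr)
 ultimately show thesis using den_asym[OF v(1,2) par m, of "L + 2" Zs i] i that unfolding XS_def by blast
qed

end

context pmet
begin

lemma greedy_zero: "greedy S T es ==> (!!v. v : T ==> EX a:S. d a v = 0) ==> tcost es = 0"
proof (induction S T es rule: greedy.induct)
 case (2 S T u v es)
 have "v : T" using 2(2) by simp
 then obtain a where "a : S" "d a v = 0" using 2(3) by blast
 hence "d u v <= 0" using 2(2) by force
 hence "d u v = 0" using d_nonneg[of u v] by linarith
 moreover have "tcost es = 0" using 2 by (intro 2(1)) auto
 ultimately show ?case unfolding tcost_def by simp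
qed (simp add: tcost_def)

end

context core
begin

lemma round_run_zero: assumes "0 < m" shows "round_run lam 0 0 m As = (%_. 0, 0, 0)"
proof -
 have g: "gain lam 0 0 X A = (%u. 0)" for X A by (rule ext) (simp add: gain_def)
 have "first_max (gain lam 0 0 X A) n = None" for X A
  unfolding g using first_max_Some[of "%u. 0 :: real" n] by (cases "first_max (%u. 0 :: real) n") auto
 hence "round_step lam 0 0 m (%_. 0, 0, 0) A = (%_. 0, 0, 0)" for A unfolding round_step_def Let_def by simp
 thus ?thesis unfolding round_run_def by (induction As) simp_all
qed

end

lemma sum_list_nth: "sum_list (map f xs) = (SUM t<length xs. f (xs ! t))" for f :: "'a => 'b::comm_monoid_add"
 by (simp add: sum_list_sum_nth atLeast0LessThan)

lemma card_nth_filter: "real (card {t. t < length xs & P (xs ! t)}) = (SUM x<-xs. of_bool (P x))"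
proof -
 have "{t. t < length xs & P (xs ! t)} = {t : {..<length xs}. P (xs ! t)}" by auto
 hence "real (card {t. t < length xs & P (xs ! t)}) = (SUM t<length xs. of_bool (P (xs ! t)))"
  by (simp add: of_bool_def sum.inter_filter [symmetric])
 thus ?thesis unfolding sum_list_nth .
qed

section \<open>Good outputs for the asymmetric metric\<close>

context dr_opt
begin

text \<open>A scenario reached from \<open>A\<close> lies in a ball around \<open>A\<close>, so its
  completion is paid by the completion of \<open>A\<close> and by the extension to the ball. The
  latter is covered by \<open>G\<close> and a price of \<open>y\<close> per unit of radius, whose
  mean is controlled by the radius \<open>rs\<close> of the ball of distributions.\<close>

lemma asym_transport:
 assumes kp: "kp = asym_metric" and C: "C <= V" "s : C" and X: "X <= V" and y: "0 <= y"
  and G: "!!A ro. A <= V ==> A ~= {} ==> 0 <= ro ==> 2 * (lm * ext_cost X A ro) <= G A + y * ro" and G0: "0 <= G {}"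
  and q: "q : dball kp"
 shows "expect q (%A. lm * tcost (prim (C Un X) A)) <= 2 * (lm * mean (%A. tcost (prim C A))) + mean G + y * rs"
proof -
 have DEN: "0 < ri DEN" using DEN_pos by simp
 have y': "0 <= y * ri DEN" using y DEN by simp
 have "expect q (%A. lm * tcost (prim (C Un X) A)) <=
   mean (%A. 2 * (lm * tcost (prim C A)) + G A) + y * ri DEN * rr"
 proof (rule transport_le[OF q y'])
  fix A A' assume A: "A <= V" "A' <= V" and fin: "kp I A A' < \<top>"
  define ro where "ro = ri DEN * enn2real (kp I A A')"
  have r0: "0 <= ro" unfolding ro_def using DEN by simp
  have sub: "A' <= ball_of A ro" unfolding ro_def kp by (rule asym_sub_ball[OF A fin[unfolded kp]])
  have yr: "y * ri DEN * enn2real (kp I A A') = y * ro" unfolding ro_def by simp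
  show "lm * tcost (prim (C Un X) A') <= 2 * (lm * tcost (prim C A)) + G A + y * ri DEN * enn2real (kp I A A')"
  proof (cases "A = {}")
   case True
   have "A' = {}" by (rule ccontr) (use asym_empty[of A'] fin True in \<open>simp add: kp\<close>)
   hence "tcost (prim (C Un X) A') = 0" using C X by (intro tcost_prim_subset) auto
   moreover have "0 <= lm * tcost (prim C A)" using lm_ge1 by simp
   moreover have "0 <= y * ro" using y r0 by simp
   ultimately show ?thesis unfolding yr using G0 True by simp
  next
   case False
   have "lm * tcost (prim (C Un X) A') <= lm * (2 * (tcost (prim C A) + ext_cost X A ro))"
    using lm_ge1 by (intro mult_left_mono completion_cost_le[OF C X A(1) sub]) auto
   thus ?thesis unfolding yr using G[OF A(1) False r0] by (simp add: algebra_simps)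
  qed
 qed
 thus ?thesis unfolding mean_add mean_cmult rs_def by (simp add: algebra_simps)
qed

lemma tcost_empty: "tcost (prim {s} {}) = 0" using tcost_prim_subset[of "{}" "{s}"] s_lt by simp

text \<open>Scaled distances are integers, so a ball of radius below 1 contains only vertices at
  distance 0 from \<open>A\<close> and extends at no cost. For larger radii a huge multiplier
  \<open>Y\<close> pays, which is free because the radius is 0.\<close>

lemma asym_good_zero_radius:
 assumes kp: "kp = asym_metric" and r: "radius I = 0" and C: "C <= V" "s : C"
  and F1: "tcost (prim {s} C) <= 4 * cs + 5 * (lm * mean ca)"
  and F2: "lm * mean (%A. tcost (prim C A)) <= 8 * (lm * mean ca) + 96 / 5 * cs"
 shows "good C {}"
proof -
 define Y where "Y = (SUM S:Pow V. SUM T:Pow V. 2 * (lm * tcost (prim S T)))"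
 have l0: "0 <= 2 * (lm * tcost (prim S T))" for S T using lm_ge1 by simp
 have Y: "2 * (lm * tcost (prim S T)) <= Y" if "S <= V" "T <= V" for S T
 proof -
  have "2 * (lm * tcost (prim S T)) <= (SUM T:Pow V. 2 * (lm * tcost (prim S T)))" using that l0 by (intro member_le_sum) auto
  also have "... <= Y" unfolding Y_def using that l0 sum_nonneg by (intro member_le_sum[of S "Pow V"]) (auto intro!: sum_nonneg)
  finally show ?thesis .
 qed
 have Y0: "0 <= Y" unfolding Y_def by (intro sum_nonneg l0)
 have ext: "2 * (lm * ext_cost {} A ro) <= 0 + Y * ro" if A: "A <= V" "A ~= {}" and ro: "0 <= ro" for A ro
 proof (cases "ro < 1")
  case True
  have g: "greedy (insert s (A Un {})) (ball_of A ro) (prim (insert s (A Un {})) (ball_of A ro))"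
   using A s_lt ball_of_sub by (intro greedy_prim) auto
  have "ext_cost {} A ro = 0" unfolding ext_cost_def
  proof (rule greedy_zero[OF g])
   fix v assume "v : ball_of A ro"
   then obtain j where j: "v < n" "j : A" "d v j <= ro" unfolding ball_of_def by auto
   hence "d v j : \<int>" using A by (intro d_int(1)) auto
   then obtain z where "d v j = ri z" by (elim Ints_cases)
   hence "d v j = 0" using j(3) True d_nonneg[of v j] by simp
   thus "EX a:insert s (A Un {}). d a v = 0" using j(2) d_sym[of j v] by auto
  qed
  thus ?thesis using Y0 ro by simp
 next
  case False
  have "2 * (lm * ext_cost {} A ro) <= Y" unfolding ext_cost_def using A s_lt ball_of_sub by (intro Y) auto
  also have "... <= Y * ro" using mult_left_mono[of 1 ro Y] False Y0 by simp
  finally show ?thesis by simp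
 qed
 have X: "tcost (prim {s} {}) <= 0" using tcost_empty by simp
 show ?thesis
 proof (rule goodI[OF C empty_subsetI F1 X])
  fix q assume "q : dball kp"
  from asym_transport[OF kp C empty_subsetI Y0, where G = "%_. 0", OF ext _ this]
  have "expect q (%A. lm * tcost (prim (C Un {}) A)) <= 2 * (lm * mean (%A. tcost (prim C A))) + mean (%A. 0) + Y * rs" by simp
  thus "expect q (%A. lm * tcost (prim (C Un {}) A)) <= 16 * WC + 192 / 5 * cs" using F2 mean_le_WC r unfolding mean_const rs_def by simp
 qed (use WC_nonneg ecost_nonneg[of Fo] in "simp, linarith?")
qed

lemma scaled_dual:
 assumes kp: "kp = asym_metric" and r: "0 < radius I"
 obtains ys H where "0 <= ys" "!!A. A <= V ==> 0 <= H A"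
  "!!A ro. A <= V ==> A ~= {} ==> 0 <= ro ==> lm * ca (ball_of A ro) <= H A + ys * ro"
  "rs * ys + mean H <= WC"
proof -
 have DEN: "0 < ri DEN" using DEN_pos by simp
 obtain y H where y: "0 <= y" "!!A. A <= V ==> 0 <= H A"
  and H: "!!A A'. A <= V ==> A' <= V ==> kp I A A' < \<top> ==> lm * ca A' <= H A + y * enn2real (kp I A A')"
  and W: "rr * y + mean H <= WC" using dual_solution[OF r] by blast
 show thesis
 proof (rule that[of "y / ri DEN" H])
  fix A ro assume A: "A <= V" and ro: "(0::real) <= ro"
  have le: "kp I A (ball_of A ro) <= ennreal (ro / ri DEN)" unfolding kp by (rule asym_ball_le[OF A ro])
  hence fin: "kp I A (ball_of A ro) < \<top>" by (rule le_less_trans) simp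
  have "enn2real (kp I A (ball_of A ro)) <= ro / ri DEN" using le ro DEN by (intro enn2real_leI) auto
  hence "y * enn2real (kp I A (ball_of A ro)) <= y * (ro / ri DEN)" using y(1) by (rule mult_left_mono)
  thus "lm * ca (ball_of A ro) <= H A + y / ri DEN * ro" using H[OF A ball_of_sub fin] by simp
 qed (use y W DEN in "auto simp: rs_def")
qed

context
 fixes ys :: real and H :: "nat set => real" and C :: "nat set"
 assumes kp: "kp = asym_metric" and r: "0 < radius I" and ys: "0 <= ys" and H0: "!!A. A <= V ==> 0 <= H A"
  and dual: "!!A ro. A <= V ==> A ~= {} ==> 0 <= ro ==> lm * ca (ball_of A ro) <= H A + ys * ro"
  and W: "rs * ys + mean H <= WC"
begin

lemma rs_pos: "0 < rs" unfolding rs_def using r DEN_pos by simp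

lemma mean_H_nonneg: "0 <= mean H" using H0 by (rule mean_nonneg)

text \<open>Integrality: \<open>cs\<close> is an integer and here below 1.\<close>

lemma small_cs: assumes "ri U * (cs + WC) < 1" shows "cs = 0"
proof -
 have "1 <= ri U" using U_pos by linarith
 hence "1 * cs <= ri U * cs" by (intro mult_right_mono) auto
 moreover have "0 <= ri U * WC" using WC_nonneg U_pos by simp
 ultimately have "cs < 1" using assms by (simp add: distrib_left)
 moreover obtain z where "cs = ri z" using ecost_int[OF Fo_sub] by (elim Ints_cases)
 ultimately show ?thesis using ecost_nonneg[of Fo] by simp
qed

text \<open>With \<open>cs = 0\<close> the dual solution alone pays for all extensions, so the
  centres suffice as first stage.\<close>

lemma asym_good_small:
 assumes small: "ri U * (cs + WC) < 1" and C: "C <= V" "s : C"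
  and F1: "tcost (prim {s} C) <= 4 * cs + 5 * (lm * mean ca)"
  and F2: "lm * mean (%A. tcost (prim C A)) <= 8 * (lm * mean ca) + 96 / 5 * cs"
 shows "good C {}"
proof -
 have X: "tcost (prim {s} {}) <= 0" using tcost_empty by simp
 have y4: "0 <= 4 * ys" using ys by simp
 have ext: "2 * (lm * ext_cost {} A ro) <= 4 * H A + 4 * ys * ro" if A: "A <= V" "A ~= {}" and ro: "0 <= ro" for A ro
 proof -
  have "lm * ext_cost {} A ro <= lm * (2 * (ca (ball_of A ro) + cs))" using lm_ge1 A by (intro mult_left_mono ext_cost_le_simple) auto
  thus ?thesis using dual[OF A ro] small_cs[OF small] by simp
 qed
 show ?thesis
 proof (rule goodI[OF C empty_subsetI F1 X])
  fix q assume "q : dball kp"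
  from asym_transport[OF kp C empty_subsetI y4, where G = "%A. 4 * H A", OF ext _ this]
  have "expect q (%A. lm * tcost (prim (C Un {}) A)) <= 2 * (lm * mean (%A. tcost (prim C A))) + 4 * mean H + 4 * ys * rs"
   using H0[of "{}"] unfolding mean_cmult by simp
  thus "expect q (%A. lm * tcost (prim (C Un {}) A)) <= 20 * WC + 192 / 5 * cs" using F2 mean_le_WC W mult.commute[of rs ys] by linarith
 qed (use WC_nonneg ecost_nonneg[of Fo] in "simp, linarith?")
qed

text \<open>A positive extension cost is an integer, so at least 1, and hence
  \<open>lm <= 2 * (H A + ys * sd u A)\<close>. The choice of \<open>U\<close> keeps both
  \<open>ys * sd u A\<close> and the mean of \<open>H\<close> at most \<open>1 / 200\<close>. So
  \<open>H A\<close> is at least \<open>99 / 200 * lm\<close> on these scenarios, which makes them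
  rare.\<close>

lemma small_mean:
 assumes small: "ri U * (cs + WC) < 1"
 shows "99 * lm * mean (%A. of_bool (A ~= {} & (EX u<n. 0 < ext_cost {} A (sd u A)))) <= 1"
proof -
 have DR: "0 < ri (dnm (radius I))" "0 < ri CS" "0 < ri U" using dnm_pos[of "radius I"] CS_ge1 U_pos by auto
 have Ueq: "ri U = 200 * ri CS * ri (dnm (radius I))" unfolding U_def by simp
 have cs0: "cs = 0" by (rule small_cs[OF small])
 hence UW: "ri U * WC < 1" using small by simp
 have yC: "ys * ri CS <= 1 / 200"
 proof -
  have "1 / ri (dnm (radius I)) * ys <= rs * ys" using rs_ge[OF r] ys by (intro mult_right_mono)
  also have "... <= WC" using W mean_H_nonneg by linarith
  finally have "ri U * (1 / ri (dnm (radius I)) * ys) <= ri U * WC" using DR by (intro mult_left_mono) auto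
  moreover have "ri U * (1 / ri (dnm (radius I)) * ys) = 200 * (ys * ri CS)" unfolding Ueq using DR by simp
  ultimately show ?thesis using UW by linarith
 qed
 have mH: "mean H <= 1 / 200"
 proof -
  have "1 <= CS * dnm (radius I)" using mult_mono[of 1 CS 1 "dnm (radius I)"] CS_ge1 dnm_pos[of "radius I"] by simp
  hence "200 <= U" unfolding U_def by simp
  hence "200 * WC <= ri U * WC" using WC_nonneg by (intro mult_right_mono) auto
  moreover have "mean H <= WC" using W mult_nonneg_nonneg[OF rs_pos[THEN less_imp_le] ys] by linarith
  ultimately show ?thesis using UW by linarith
 qed
 have "of_bool (A ~= {} & (EX u<n. 0 < ext_cost {} A (sd u A))) * (99 / 200 * lm) <= H A" if A: "A <= V" for A
 proof (cases "A ~= {} & (EX u<n. 0 < ext_cost {} A (sd u A))")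
  case True
  then obtain u where u: "u < n" "0 < ext_cost {} A (sd u A)" by blast
  have fA: "finite A" using A finite_subset by blast
  have s0: "0 <= sd u A" using sd_nonneg[OF fA] True by simp
  have "ext_cost {} A (sd u A) : \<int>" unfolding ext_cost_def using A s_lt ball_of_sub by (intro tcost_int) auto
  then obtain z where z: "ext_cost {} A (sd u A) = ri z" by (elim Ints_cases)
  hence "1 <= z" using u(2) by simp
  hence e1: "1 <= ext_cost {} A (sd u A)" unfolding z by simp
  have "ext_cost {} A (sd u A) <= 2 * (ca (ball_of A (sd u A)) + cs)" using A True by (intro ext_cost_le_simple) auto
  hence "lm * 1 <= lm * (2 * ca (ball_of A (sd u A)))" using e1 cs0 lm_ge1 by (intro mult_left_mono) auto
  hence "lm <= 2 * (lm * ca (ball_of A (sd u A)))" by (metis mult.left_commute mult.right_neutral)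
  moreover have "lm * ca (ball_of A (sd u A)) <= H A + ys * sd u A" using dual[OF A _ s0] True by simp
  moreover have "ys * sd u A <= 1 / 200"
  proof -
   obtain a where "a : A" using True by blast
   hence "sd u A <= ri CS" using sd_le[OF fA, of a u] d_int(2)[of u a] by simp
   hence "ys * sd u A <= ys * ri CS" using ys by (rule mult_left_mono)
   thus ?thesis using yC by simp
  qed
  ultimately have "99 / 200 * lm <= H A" using lm_ge1 by linarith
  thus ?thesis using True by simp
 qed (use H0[OF A] in auto)
 hence "mean (%A. of_bool (A ~= {} & (EX u<n. 0 < ext_cost {} A (sd u A))) * (99 / 200 * lm)) <= mean H" by (intro mean_mono)
 hence "99 / 200 * lm * mean (%A. of_bool (A ~= {} & (EX u<n. 0 < ext_cost {} A (sd u A)))) <= mean H"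
  by (simp add: mean_cmult [symmetric] mult.commute)
 thus ?thesis using mH by simp
qed

text \<open>The most expensive case: with \<open>Z <= 2 * (cs + WC)\<close> the contributions sum to
  at most \<open>119 * cs + 101 * WC\<close>, inside the budget of
  \<open>160 * (cs + WC)\<close>.\<close>

lemma asym_good_large:
 assumes Z: "cs + WC <= Z" "Z <= 2 * (cs + WC)" and C: "C <= V" "s : C" and X: "X <= V"
  and F1: "tcost (prim {s} C) <= 4 * cs + 5 * (lm * mean ca)"
  and F2: "lm * mean (%A. tcost (prim C A)) <= 8 * (lm * mean ca) + 96 / 5 * cs"
  and FX: "tcost (prim {s} X) <= 10 * Z" and ex: "mean (excess (Z / rs) X) <= 2 * mean H + 10 * Z + 3 / 10 * cs"
 shows "good C X"
proof -
 have Z0: "0 <= Z" using Z WC_nonneg ecost_nonneg[of Fo] by linarith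
 have y8: "0 <= 8 * (Z / rs)" using Z0 rs_pos by simp
 have ext: "2 * (lm * ext_cost X A ro) <= 2 * excess (Z / rs) X A + 8 * (Z / rs) * ro" if A: "A <= V" "A ~= {}" and ro: "0 <= ro" for A ro
  using ext_cost_le_excess[OF A ro, of "Z / rs" X] Z0 rs_pos by simp
 have G0: "0 <= 2 * excess (Z / rs) X {}" unfolding excess_def by simp
 show ?thesis
 proof (rule goodI[OF C X F1 FX])
  fix q assume "q : dball kp"
  from asym_transport[OF kp C X y8, where G = "%A. 2 * excess (Z / rs) X A", OF ext G0 this]
  have "expect q (%A. lm * tcost (prim (C Un X) A)) <= 2 * (lm * mean (%A. tcost (prim C A))) + 2 * mean (excess (Z / rs) X) + 8 * Z"
   using rs_pos unfolding mean_cmult by simp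
  moreover have "mean H <= WC" using W mult_nonneg_nonneg[OF rs_pos[THEN less_imp_le] ys] by linarith
  ultimately show "expect q (%A. lm * tcost (prim (C Un X) A)) <= 20 * WC + 39 * cs + 28 * Z" using F2 mean_le_WC ex by linarith
 qed (use Z WC_nonneg ecost_nonneg[of Fo] in "simp, linarith?")
qed

end

text \<open>A tree on all vertices leaves nothing for the second stage and costs at most the sum of
  all distances. This bounds the range of the guesses from above.\<close>

lemma opt_le_CS: "cs + WC <= ri CS"
proof -
 let ?F = "normalized (prim {s} V @ prim {s} V)" and ?G = "%A. normalized (prim (V Un V) A)"
 have feas: "feasible I ?F ?G" using s_lt by (intro feasible_output) auto
 have DEN: "0 < ri DEN" using DEN_pos by simp
 have F: "?F <= edges I" using feas unfolding feasible_def by simp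
 have nil: "?G A = {}" if "A <= V" for A
 proof -
  have "greedy (V Un V) A (prim (V Un V) A)" using that s_lt by (intro greedy_prim) auto
  hence "prim (V Un V) A = []" using that by (intro greedy_Nil_if_subset) auto
  thus ?thesis unfolding normalized_def by simp
 qed
 have "expect q (%A. rq (inflation I) * edge_set_cost I (?G A)) <= 0" if q: "q : dball kp" for q
 proof -
  have "expect q (%A. rq (inflation I) * edge_set_cost I (?G A)) <= expect q (%A. 0)"
  proof (rule expectation_le_finite[OF finite_ball_supp(1)[OF q]])
   fix A assume "A : set_pmf q"
   hence "A <= V" using finite_ball_supp(2)[OF q] by auto
   thus "rq (inflation I) * edge_set_cost I (?G A) <= 0" unfolding edge_set_cost_def nil[OF \<open>A <= V\<close>] by simp
  qed
  thus ?thesis by simp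
 qed
 hence "objective kp I p ?F ?G <= edge_set_cost I ?F + 0"
  unfolding objective_def using p_in_ball metric_refl by (intro add_left_mono cSUP_least) auto
 hence "optimum kp I p <= edge_set_cost I ?F" using opt_le[OF feas] by linarith
 hence "ri DEN * optimum kp I p <= ecost ?F" unfolding ecost_eq[OF F] using DEN by (intro mult_left_mono) auto
 also have "ecost ?F <= ri (SUM k<n * n. Cc k)"
 proof -
  let ?h = "%e. fst e * n + snd e"
  have FV: "?F <= V \<times> V" by (rule edges_sub[OF F])
  have dm: "(u * n + v) div n = u" "(u * n + v) mod n = v" "u * n + v < n * n" if "u < n" "v < n" for u v
  proof -
   have "u * n + v < Suc u * n" using that by simp
   also have "... <= n * n" using that by (intro mult_le_mono1) simp
   finally show "u * n + v < n * n" .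
  qed (use that in simp_all)
  have inj: "inj_on ?h ?F"
  proof (rule inj_onI)
   fix e e' assume e: "e : ?F" "e' : ?F" "?h e = ?h e'"
   hence "fst e < n" "snd e < n" "fst e' < n" "snd e' < n" using FV by auto
   thus "e = e'" using dm(1,2)[of "fst e" "snd e"] dm(1,2)[of "fst e'" "snd e'"] e(3) by (metis prod.expand)
  qed
  have "ecost ?F = (SUM e:?F. ri (Cc (?h e)))" unfolding ecost_def
  proof (rule sum.cong[OF refl])
   fix e assume "e : ?F"
   hence "fst e < n" "snd e < n" using FV by auto
   thus "(case e of (u, v) => d u v) = ri (Cc (?h e))" using Cc_d[OF dm(3)] dm(1,2) by (simp add: case_prod_beta)
  qed
  also have "... = (SUM k:?h ` ?F. ri (Cc k))" by (rule sum.reindex[OF inj, unfolded comp_def, symmetric])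
  also have "... <= (SUM k<n * n. ri (Cc k))"
  proof (rule sum_mono2)
   show "?h ` ?F <= {..<n * n}" using FV dm(3) by auto
  qed (use Cc_nonneg in auto)
  finally show ?thesis by simp
 qed
 finally show ?thesis using optimum_ge unfolding CS_def by simp
qed

text \<open>The least power of two not below \<open>U * (cs + WC)\<close>; since that number is at
  least 1, the power is at most twice as large. The guess 0 occupies index 0, which shifts the
  powers by one and explains the bound \<open>L + 2\<close>.\<close>

lemma grid_value:
 assumes "1 <= ri U * (cs + WC)"
 obtains i where "i < L + 2" "cs + WC <= Zs i" "Zs i <= 2 * (cs + WC)"
proof -
 define x where "x = ri U * (cs + WC)"
 have U: "0 < ri U" using U_pos by simp
 have "x <= ri (U * CS)" unfolding x_def using opt_le_CS U by simp
 also have "... <= ri BIG"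
 proof -
  have "U * CS <= BIG" unfolding BIG_def using inp_sum_nonneg by linarith
  thus ?thesis by (simp only: of_int_le_iff)
 qed
 also have "... <= 2 ^ L"
 proof -
  have "nat BIG < 2 ^ L" unfolding L_def by (rule floorlog_leD) auto
  moreover have "0 <= BIG" unfolding BIG_def using inp_sum_nonneg U_pos CS_ge1 by simp
  ultimately have "BIG < 2 ^ L" by (simp add: nat_less_iff)
  hence "ri BIG < ri (2 ^ L)" by (simp only: of_int_less_iff)
  thus ?thesis by simp
 qed
 finally have xL: "x <= 2 ^ L" .
 define j where "j = (LEAST j. x <= 2 ^ j)"
 have xj: "x <= 2 ^ j" unfolding j_def by (rule LeastI[of "%j. x <= 2 ^ j", OF xL])
 have jL: "j <= L" unfolding j_def by (rule Least_le[of "%j. x <= 2 ^ j", OF xL])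
 have "(2::real) ^ j <= 2 * x"
 proof (cases j)
  case 0
  thus ?thesis using assms unfolding x_def by simp
 next
  case (Suc j')
  hence "~ x <= 2 ^ j'" using not_less_Least[of j' "%j. x <= 2 ^ j"] unfolding j_def [symmetric] by simp
  thus ?thesis using Suc by simp
 qed
 hence "cs + WC <= Zs (Suc j)" "Zs (Suc j) <= 2 * (cs + WC)"
  using xj U unfolding Zs_def zc_def x_def by (simp_all add: le_divide_eq divide_le_eq algebra_simps)
 thus thesis using jL that[of "Suc j"] by simp
qed

lemma Zs_mono: "j <= i ==> Zs j <= Zs i" "0 <= Zs j"
proof -
 have "zc j <= zc i" if "j <= i" for i j using that power_increasing[of "j - 1" "i - 1" "2::int"] unfolding zc_def by (auto simp: diff_le_mono)
 thus "j <= i ==> Zs j <= Zs i" unfolding Zs_def using U_pos by (intro divide_right_mono) auto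
 show "0 <= Zs j" unfolding Zs_def zc_def using U_pos by simp
qed

end

section \<open>High-probability bounds\<close>

context dr_input
begin

text \<open>\<open>K\<close> counts the elementary events of a union bound, each of which fails with
  probability at most \<open>exp (- mm k0 / 16800)\<close>.\<close>

definition whp :: "nat => nat => (nat set list => bool) => bool" where
 "whp k0 K P = (measure_pmf.prob (smp k0) {As. ~ P As} <= real K * exp (- real (mm k0) / 16800))"

lemma whp_mono:
 assumes "whp k0 K P" "K <= K'" "!!As. As : set_pmf (smp k0) ==> P As ==> Q As"
 shows "whp k0 K' Q"
proof -
 have "measure_pmf.prob (smp k0) {As. ~ Q As} <= measure_pmf.prob (smp k0) {As. ~ P As}"
  by (rule measure_pmf.finite_measure_mono_AE, rule AE_pmfI) (use assms(3) in auto)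
 also have "... <= real K * exp (- real (mm k0) / 16800)" using assms(1) unfolding whp_def .
 also have "... <= real K' * exp (- real (mm k0) / 16800)" using assms(2) by (intro mult_right_mono) auto
 finally show ?thesis unfolding whp_def .
qed

lemma whp_conj:
 assumes "whp k0 K P" "whp k0 K' Q"
 shows "whp k0 (K + K') (%As. P As & Q As)"
proof -
 have "{As. ~ (P As & Q As)} = {As. ~ P As} Un {As. ~ Q As}" by auto
 hence "measure_pmf.prob (smp k0) {As. ~ (P As & Q As)} <=
   measure_pmf.prob (smp k0) {As. ~ P As} + measure_pmf.prob (smp k0) {As. ~ Q As}"
  using measure_Un_le[of "{As. ~ P As}" "measure_pmf (smp k0)" "{As. ~ Q As}"] by simp
 thus ?thesis using assms unfolding whp_def by (simp add: distrib_right)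
qed

lemma whp_all:
 assumes "finite S" "!!x. x : S ==> whp k0 1 (P x)"
 shows "whp k0 (card S) (%As. ALL x:S. P x As)" using assms
proof (induction S rule: finite_induct)
 case empty
 thus ?case unfolding whp_def by simp
next
 case (insert x S)
 have "whp k0 (1 + card S) (%As. P x As & (ALL x:S. P x As))" using insert by (intro whp_conj) auto
 thus ?case by (rule whp_mono) (use insert in auto)
qed

lemma mm_ge: "k0 * input_size I eps <= mm k0"
proof -
 have "bit_size x <= 1 + L" if xi: "x : set inp" for x
 proof -
  obtain k where k: "k < length inp" "x = inp ! k" using xi by (auto simp: in_set_conv_nth)
  have "x <= (SUM k<length inp. inp ! k)" unfolding k(2) using k(1) inp_nonneg by (intro member_le_sum) auto
  also have "... <= BIG" unfolding BIG_def using U_pos CS_ge1 by simp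
  finally have "nat \<bar>x\<bar> <= nat BIG" using inp_nonneg[OF xi] by simp
  hence "floorlog 2 (nat \<bar>x\<bar>) <= L" unfolding L_def by (rule floorlog_mono)
  thus ?thesis unfolding bit_size_def by simp
 qed
 hence "input_size I eps <= 1 + length inp * (1 + L)" unfolding input_size_def by (rule list_size_bound)
 also have "... <= (9 + 2 * (n * n)) * L + (9 + 2 * (n * n))" unfolding length_inp by (simp add: algebra_simps)
 finally show ?thesis unfolding mm_def by (rule mult_le_mono2)
qed

text \<open>The number of events is at most \<open>exp\<close> of twice the input size. With this
  \<open>k0\<close> the exponent is at least \<open>k + 2\<close> times the input size: two of these
  parts absorb the union bound and \<open>k\<close> remain.\<close>

lemma failure_le:
 fixes k :: nat
 assumes "k0 = 16800 * (k + 2)"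
 shows "real (2 * (n * n) + 2 ^ n + 2) * exp (- real (mm k0) / 16800) <= 1 / real (input_size I eps) ^ k"
proof -
 define Ni where "Ni = input_size I eps"
 have N: "8 + 2 * (n * n) < Ni" "n < Ni" using nn_le unfolding Ni_def by auto
 have "2 * (n * n) + 2 <= Ni" using N by linarith
 also have "Ni <= 2 ^ Ni" using less_exp[of Ni] by simp
 finally have a: "2 * (n * n) + 2 <= 2 ^ Ni" .
 have "(2::nat) ^ n <= 2 ^ Ni" using N by (intro power_increasing) auto
 hence "2 * (n * n) + 2 ^ n + 2 <= 2 * 2 ^ Ni" using a by linarith
 also have "... <= 2 ^ Ni * 2 ^ Ni"
 proof (rule mult_le_mono1)
  show "(2::nat) <= 2 ^ Ni" using power_increasing[of 1 Ni "2::nat"] N by simp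
 qed
 also have "... = 2 ^ (2 * Ni)" by (simp add: mult_2 power_add)
 finally have "real (2 * (n * n) + 2 ^ n + 2) <= real (2 ^ (2 * Ni))" by (simp only: of_nat_le_iff)
 also have "... = 2 ^ (2 * Ni)" by simp
 also have "... <= exp 1 ^ (2 * Ni)" using exp_ge_add_one_self[of 1] by (intro power_mono) auto
 also have "... = exp (real (2 * Ni))" using exp_of_nat_mult[of "2 * Ni" "1::real"] by simp
 finally have c: "real (2 * (n * n) + 2 ^ n + 2) <= exp (real (2 * Ni))" .
 have "16800 * (k + 2) * Ni <= mm k0" using mm_ge[of k0] unfolding assms Ni_def .
 hence "real (16800 * (k + 2) * Ni) <= real (mm k0)" by (simp only: of_nat_le_iff)
 hence "real (mm k0) / 16800 \<ge> real ((k + 2) * Ni)" by (simp add: algebra_simps)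
 hence e: "exp (- real (mm k0) / 16800) <= exp (- real ((k + 2) * Ni))" by simp
 have "real (2 * (n * n) + 2 ^ n + 2) * exp (- real (mm k0) / 16800) <= exp (real (2 * Ni)) * exp (- real ((k + 2) * Ni))"
  by (intro mult_mono c e) auto
 also have "... = exp (- (real k * real Ni))" unfolding exp_add [symmetric] by (simp add: algebra_simps)
 also have "... = 1 / exp (real Ni) ^ k" using exp_of_nat_mult[of k "real Ni"] by (simp add: exp_minus inverse_eq_divide)
 also have "... <= 1 / real Ni ^ k"
 proof (rule divide_left_mono)
  have "real Ni <= exp (real Ni)" using exp_ge_add_one_self[of "real Ni"] by linarith
  thus "real Ni ^ k <= exp (real Ni) ^ k" by (intro power_mono) auto
  show "0 < exp (real Ni) ^ k * real Ni ^ k" using N by (intro mult_pos_pos zero_less_power) auto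
 qed simp
 finally show ?thesis unfolding Ni_def .
qed

end

context dr_opt
begin

lemma finite_p: "finite (set_pmf p)" using p_sub by (rule finite_subset) simp

text \<open>The requirement on \<open>eta\<close> comes from the widest range that occurs: with
  values up to \<open>84 * lm * Z\<close> and \<open>1680 = 84 * 20\<close>, the error in the sum is
  \<open>lm * Z * mm k0 / 20\<close>. The exponent of the tail is then
  \<open>mm k0 / 16800\<close>.\<close>

lemma whp_upper:
 assumes f: "!!A. A <= V ==> 0 <= f A & f A <= c" and c: "0 <= c" and eta: "real (mm k0) / 1680 <= eta"
 shows "whp k0 1 (%As. (SUM A<-As. f A) <= 11 / 10 * (real (MM k0) * mean f) + c * eta)"
proof -
 have "measure_pmf.prob (smp k0) {As. 11 / 10 * (real (MM k0) * expect p f) + c * eta < (SUM A<-As. f A)} <= exp (- eta / 10)"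
  using f p_sub by (intro chernoff_upper finite_p c) auto
 also have "... <= exp (- real (mm k0) / 16800)" using eta by simp
 finally show ?thesis unfolding whp_def mean_eq not_le by simp
qed

lemma whp_lower:
 assumes f: "!!A. A <= V ==> 0 <= f A & f A <= c" and c: "0 <= c" and eta: "real (mm k0) / 1680 <= eta"
 shows "whp k0 1 (%As. 95 / 100 * (real (MM k0) * mean f) <= (SUM A<-As. f A) + c * eta)"
proof -
 have "measure_pmf.prob (smp k0) {As. (SUM A<-As. f A) + c * eta < 95 / 100 * (real (MM k0) * expect p f)} <= exp (- eta / 10)"
  using f p_sub by (intro chernoff_lower finite_p c) auto
 also have "... <= exp (- real (mm k0) / 16800)" using eta by simp
 finally show ?thesis unfolding whp_def mean_eq not_le by simp
qed

lemma MM_mean_le: "0 <= x ==> real (MM k0) * x <= real (mm k0) * (lm * x)"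
 using mult_right_mono[OF MM_bounds(1)[of k0], of x] by (simp add: mult.assoc)

definition first_ok :: "nat set => bool" where
 "first_ok C = (tcost (prim {s} C) <= 4 * cs + 5 * (lm * mean ca) &
   lm * mean (%A. tcost (prim C A)) <= 8 * (lm * mean ca) + 96 / 5 * cs)"

text \<open>The window from \<open>4 / 5\<close> to \<open>6 / 5\<close> fits the deviations:
  \<open>11 / 10 * 4 / 5 + 1 / 10 < 1\<close> and \<open>95 / 100 * 6 / 5 - 1 / 10 > 1\<close>. The
  slack in the latter absorbs the rounding of the number of samples once
  \<open>100 <= mm k0\<close>.\<close>

lemma whp_first:
 assumes m: "100 <= mm k0"
 shows "whp k0 (2 * (n * n)) (%As. first_ok (CD k0 As))"
proof -
 define f where "f e A = (of_bool (hit (fst e) (d (fst e) (snd e)) A) :: real)" for e :: "nat \<times> nat" and A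
 define Pu where "Pu e As = ((SUM A<-As. f e A) <= 11 / 10 * (real (MM k0) * mean (f e)) + 1 * (real (mm k0) / 10))" for e As
 define Pl where "Pl e As = (95 / 100 * (real (MM k0) * mean (f e)) <= (SUM A<-As. f e A) + 1 * (real (mm k0) / 10))" for e As
 have u: "whp k0 (card (V \<times> V)) (%As. ALL e:V \<times> V. Pu e As)" unfolding Pu_def by (intro whp_all whp_upper) (auto simp: f_def)
 have l: "whp k0 (card (V \<times> V)) (%As. ALL e:V \<times> V. Pl e As)" unfolding Pl_def by (intro whp_all whp_lower) (auto simp: f_def)
 show ?thesis
 proof (rule whp_mono[OF whp_conj[OF u l]])
  show "card (V \<times> V) + card (V \<times> V) <= 2 * (n * n)" by simp
  fix As assume As: "As : set_pmf (smp k0)" and P: "(ALL e:V \<times> V. Pu e As) & (ALL e:V \<times> V. Pl e As)"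
  have sub: "set As <= Pow V" by (rule centres_state_values(5)[OF As])
  have hits: "(SUM A<-As. f (v, w) A) = real (hits As v (d v w))" for v w unfolding f_def hits_def hit_def by (induction As) auto
  have f01: "0 <= mean (f e)" "mean (f e) <= 1" for e
  proof -
   show "0 <= mean (f e)" by (intro mean_nonneg) (simp add: f_def)
   have "mean (f e) <= mean (%_. 1)" by (intro mean_mono) (simp add: f_def)
   thus "mean (f e) <= 1" unfolding mean_const .
  qed
  have m0: "0 < mm k0" "100 <= real (mm k0)" using m by auto
  have mf: "mean (%A. of_bool (hit v (d v w) A)) = mean (f (v, w))" for v w unfolding f_def by simp
  note fs = first_stage_bounds[OF m0(1) sub, folded CD_def]
  have lo: "4 / 5 <= lm * mean (%A. of_bool (hit v (d v w) A))" if vw: "v < n" "w < n" and h: "mm k0 <= hits As v (d v w)" for v w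
  proof (rule ccontr)
   assume "~ 4 / 5 <= lm * mean (%A. of_bool (hit v (d v w) A))"
   hence "lm * mean (f (v, w)) <= 4 / 5" unfolding mf by simp
   hence "real (mm k0) * (lm * mean (f (v, w))) <= real (mm k0) * (4 / 5)" by (intro mult_left_mono) auto
   hence "real (MM k0) * mean (f (v, w)) <= real (mm k0) * (4 / 5)" using MM_mean_le[OF f01(1), of k0 "(v, w)"] by linarith
   moreover have "real (hits As v (d v w)) <= 11 / 10 * (real (MM k0) * mean (f (v, w))) + 1 * (real (mm k0) / 10)"
    using conjunct1[OF P] vw unfolding Pu_def hits [symmetric] by auto
   moreover have "real (mm k0) <= real (hits As v (d v w))" using h by simp
   ultimately show False using m0 by linarith
  qed
  have hi: "lm * mean (%A. of_bool (hit v (d v w) A)) <= 6 / 5" if vw: "v < n" "w < n" and h: "hits As v (d v w) < mm k0" for v w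
  proof (rule ccontr)
   assume "~ lm * mean (%A. of_bool (hit v (d v w) A)) <= 6 / 5"
   hence "6 / 5 <= lm * mean (f (v, w))" unfolding mf by simp
   hence "real (mm k0) * (6 / 5) <= real (mm k0) * (lm * mean (f (v, w)))" by (intro mult_left_mono) auto
   moreover have "real (mm k0) * lm * mean (f (v, w)) <= (real (MM k0) + 1) * mean (f (v, w))"
    using MM_bounds(2)[of k0] f01(1) by (intro mult_right_mono) auto
   hence "real (mm k0) * (lm * mean (f (v, w))) <= real (MM k0) * mean (f (v, w)) + mean (f (v, w))" by (simp add: algebra_simps)
   moreover have "95 / 100 * (real (MM k0) * mean (f (v, w))) <= real (hits As v (d v w)) + 1 * (real (mm k0) / 10)"
    using conjunct2[OF P] vw unfolding Pl_def hits [symmetric] by auto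
   moreover have "real (hits As v (d v w)) <= real (mm k0)" using h by simp
   ultimately show False using m0 f01(2)[of "(v, w)"] by linarith
  qed
  show "first_ok (CD k0 As)" unfolding first_ok_def using fs[OF lo hi] by blast
 qed
qed

lemma discrete_whp:
 assumes kp: "kp = discrete_metric" and m: "100 <= mm k0"
 shows "whp k0 (2 * (n * n) + 2 ^ n + 2) (%As. good (CD k0 As) (XS k0 discrete_prg As))"
proof (rule whp_mono[OF whp_first[OF m]])
 fix As assume As: "As : set_pmf (smp k0)" and ok: "first_ok (CD k0 As)"
 show "good (CD k0 As) (XS k0 discrete_prg As)"
  unfolding XS_discrete[OF As] using ok unfolding first_ok_def by (intro discrete_good[OF kp CD_sub]) auto
qed simp

lemma excess_nonneg: "0 <= excess y X A" unfolding excess_def by (auto intro!: Max_ge)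

text \<open>Three regimes: radius 0; an optimum below the unit of the grid, where the guess 0 is
  accepted; and otherwise a guess within a factor 2 of the optimum. The union bound has
  \<open>2 * (n * n)\<close> events for the hits, \<open>2 ^ n\<close> for the excess of every
  possible bought set, and 2 for the sums over \<open>H\<close>.\<close>

lemma asym_whp:
 assumes kp: "kp = asym_metric" and m: "100 <= mm k0"
 shows "whp k0 (2 * (n * n) + 2 ^ n + 2) (%As. good (CD k0 As) (XS k0 asym_prg As))"
proof (cases "radius I = 0")
 case r: True
 have Z0: "Zs 0 = 0" and rs0: "rs = 0" unfolding Zs_def zc_def rs_def r by simp_all
 have m0: "0 < mm k0" using m by simp
 show ?thesis
 proof (rule whp_mono[OF whp_first[OF m]])
  fix As assume As: "As : set_pmf (smp k0)" and ok: "first_ok (CD k0 As)"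
  have b: "bought (mm k0) (%_. 0, 0, 0) = {}" unfolding bought_def using m0 by simp
  have "accepted (Zs 0) (mm k0) (round_run lm rs (Zs 0) (mm k0) As)" unfolding Z0 rs0 round_run_zero[OF m0] accepted_def b using tcost_empty by simp
  then obtain j where "j <= 0" "XS k0 asym_prg As = bought (mm k0) (round_run lm rs (Zs j) (mm k0) As)" using XS_asym[OF As m0, of 0] by auto
  hence "XS k0 asym_prg As = {}" using b round_run_zero[OF m0] Z0 rs0 by simp
  thus "good (CD k0 As) (XS k0 asym_prg As)" using ok asym_good_zero_radius[OF kp r CD_sub] unfolding first_ok_def by auto
 qed simp
next
 case False
 hence r: "0 < radius I" using radius_nonneg by simp
 obtain ys H where ys: "0 <= ys" and H0: "!!A. A <= V ==> 0 <= H A"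
  and dual: "!!A ro. A <= V ==> A ~= {} ==> 0 <= ro ==> lm * ca (ball_of A ro) <= H A + ys * ro"
  and W: "rs * ys + mean H <= WC" using scaled_dual[OF kp r] by blast
 have rsp: "0 < rs" by (rule rs_pos[OF kp r ys H0 dual W])
 have mH: "mean H <= WC" using W mult_nonneg_nonneg[OF rsp[THEN less_imp_le] ys] by linarith
 have m0: "0 < mm k0" "100 <= real (mm k0)" using m by auto
 have AsV: "As ! t <= V" if "As : set_pmf (smp k0)" "t < length As" for As t
  using centres_state_values(5)[OF that(1)] nth_mem[OF that(2)] by auto
 show ?thesis
 proof (cases "ri U * (cs + WC) < 1")
  case small: True
  define f where "f A = (of_bool (A ~= {} & (EX u<n. 0 < ext_cost {} A (sd u A))) :: real)" for A
  have f0: "0 <= mean f" by (intro mean_nonneg) (simp add: f_def)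
  have "99 * lm * mean f <= 1" unfolding f_def by (rule small_mean[OF kp r ys H0 dual W small])
  hence "real (mm k0) * (lm * mean f) <= real (mm k0) * (1 / 99)" by (intro mult_left_mono) auto
  hence Mf: "real (MM k0) * mean f <= real (mm k0) / 99" using MM_mean_le[OF f0, of k0] by simp
  have w: "whp k0 1 (%As. (SUM A<-As. f A) <= 11 / 10 * (real (MM k0) * mean f) + 1 * (real (mm k0) / 10))" by (rule whp_upper) (auto simp: f_def)
  show ?thesis
  proof (rule whp_mono[OF whp_conj[OF whp_first[OF m] w]])
   fix As assume As: "As : set_pmf (smp k0)"
    and ok: "first_ok (CD k0 As) & (SUM A<-As. f A) <= 11 / 10 * (real (MM k0) * mean f) + 1 * (real (mm k0) / 10)"
   let ?c = "card {t. t < length As & As ! t ~= {} & (EX u<n. 0 < ext_cost {} (As ! t) (sd u (As ! t)))}"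
   have "real ?c = (SUM A<-As. f A)" unfolding f_def by (rule card_nth_filter)
   hence "real (8 * ?c) <= real (mm k0)" using conjunct2[OF ok] Mf by simp
   hence S4: "8 * ?c <= mm k0" by (simp only: of_nat_le_iff)
   have Z0: "Zs 0 = 0" unfolding Zs_def zc_def by simp
   note za = zero_accepted[OF H0 ys rsp dual order_refl m0(1) AsV[OF As] S4]
   have "accepted (Zs 0) (mm k0) (round_run lm rs (Zs 0) (mm k0) As)" unfolding Z0 using za(1) .
   then obtain j where "j <= 0" "XS k0 asym_prg As = bought (mm k0) (round_run lm rs (Zs j) (mm k0) As)" using XS_asym[OF As m0(1), of 0] by auto
   hence "XS k0 asym_prg As = {}" using za(2) Z0 by simp
   thus "good (CD k0 As) (XS k0 asym_prg As)"
    using conjunct1[OF ok] asym_good_small[OF kp r ys H0 dual W small CD_sub] unfolding first_ok_def by auto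
  qed simp
 next
  case False
  hence "1 <= ri U * (cs + WC)" by simp
  then obtain i where i: "i < L + 2" "cs + WC <= Zs i" "Zs i <= 2 * (cs + WC)" by (rule grid_value)
  define Z where "Z = Zs i"
  have "0 < ri U * (cs + WC)" using False by linarith
  hence "0 < cs + WC" using U_pos by (simp add: zero_less_mult_iff)
  hence Zp: "0 < Z" using i(2) unfolding Z_def by linarith
  have ZW: "cs + rs * ys + mean H <= Z" using W i(2) unfolding Z_def by linarith
  have lZ: "0 <= 84 * lm * Z" "0 <= Z * lm" using Zp lm_ge1 by simp_all
  define f1 where "f1 A = min (H A) (84 * lm * Z)" for A
  define f2 where "f2 A = (of_bool (20 * lm * Z < H A) :: real)" for A
  define f3 where "f3 X A = min (excess (Z / rs) X A) (2 * lm * cs)" for X A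
  have w1: "whp k0 1 (%As. (SUM A<-As. f1 A) <= 11 / 10 * (real (MM k0) * mean f1) + (84 * lm * Z) * (real (mm k0) / 1680))"
   by (rule whp_upper) (use H0 lZ in "auto simp: f1_def")
  have w2: "whp k0 1 (%As. (SUM A<-As. f2 A) <= 11 / 10 * (real (MM k0) * mean f2) + 1 * (real (mm k0) / 20))"
   by (rule whp_upper) (auto simp: f2_def)
  have lc: "0 <= 2 * lm * cs" using lm_ge1 by simp
  have w3: "whp k0 (card (Pow V)) (%As. ALL X:Pow V. 95 / 100 * (real (MM k0) * mean (f3 X)) <= (SUM A<-As. f3 X A) + (2 * lm * cs) * (real (mm k0) / 100))"
   by (intro whp_all whp_lower) (use lc excess_nonneg in "auto simp: f3_def")
  show ?thesis
  proof (rule whp_mono[OF whp_conj[OF whp_first[OF m] whp_conj[OF w3 whp_conj[OF w1 w2]]]])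
   show "2 * (n * n) + (card (Pow V) + (1 + 1)) <= 2 * (n * n) + 2 ^ n + 2" by (simp add: card_Pow)
   fix As assume As: "As : set_pmf (smp k0)"
    and ok: "first_ok (CD k0 As) &
     (ALL X:Pow V. 95 / 100 * (real (MM k0) * mean (f3 X)) <= (SUM A<-As. f3 X A) + (2 * lm * cs) * (real (mm k0) / 100)) &
     (SUM A<-As. f1 A) <= 11 / 10 * (real (MM k0) * mean f1) + (84 * lm * Z) * (real (mm k0) / 1680) &
     (SUM A<-As. f2 A) <= 11 / 10 * (real (MM k0) * mean f2) + 1 * (real (mm k0) / 20)"
   have len: "length As = MM k0" by (rule centres_state_values(4)[OF As])
   have S1: "(SUM t<length As. min (H (As ! t)) (84 * lm * Z)) <= lm * real (mm k0) * (11 / 10 * mean H + 1 / 20 * Z)"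
   proof -
    have f1: "0 <= mean f1" using H0 lZ by (intro mean_nonneg) (auto simp: f1_def)
    have "mean f1 <= mean H" by (intro mean_mono) (simp add: f1_def)
    hence "real (mm k0) * (lm * mean f1) <= real (mm k0) * (lm * mean H)" using lm_ge1 by (intro mult_left_mono) auto
    hence "real (MM k0) * mean f1 <= real (mm k0) * (lm * mean H)" using MM_mean_le[OF f1, of k0] by linarith
    moreover have "(SUM t<length As. min (H (As ! t)) (84 * lm * Z)) = (SUM A<-As. f1 A)" unfolding sum_list_nth f1_def ..
    ultimately show ?thesis using ok by (simp add: algebra_simps)
   qed
   have S2: "8 * card {t. t < length As & 20 * lm * Z < H (As ! t)} <= mm k0"
   proof -
    have f2: "0 <= mean f2" by (intro mean_nonneg) (simp add: f2_def)
    have "mean (%A. 20 * lm * Z * f2 A) <= mean H" using H0 by (intro mean_mono) (auto simp: f2_def)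
    hence "20 * lm * Z * mean f2 <= mean H" unfolding mean_cmult .
    also have "... <= Z" using ZW mult_nonneg_nonneg[OF rsp[THEN less_imp_le] ys] ecost_nonneg[of Fo] by linarith
    finally have "Z * (20 * lm * mean f2) <= Z * 1" by (simp add: algebra_simps)
    hence "20 * lm * mean f2 <= 1" using Zp by (simp only: mult_le_cancel_left_pos)
    hence "real (mm k0) * (lm * mean f2) <= real (mm k0) * (1 / 20)" by (intro mult_left_mono) auto
    hence "real (MM k0) * mean f2 <= real (mm k0) / 20" using MM_mean_le[OF f2, of k0] by simp
    moreover have "real (card {t. t < length As & 20 * lm * Z < H (As ! t)}) = (SUM A<-As. f2 A)" unfolding f2_def by (rule card_nth_filter)
    ultimately have "real (8 * card {t. t < length As & 20 * lm * Z < H (As ! t)}) <= real (mm k0)" using ok by simp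
    thus ?thesis by (simp only: of_nat_le_iff)
   qed
   have S3: "95 / 100 * (real (length As) * mean (%A. min (excess (Z / rs) X A) (2 * lm * cs))) <=
     (SUM t<length As. min (excess (Z / rs) X (As ! t)) (2 * lm * cs)) + real (mm k0) / 50 * (lm * cs)" if "X <= V" for X
   proof -
    have "95 / 100 * (real (MM k0) * mean (f3 X)) <= (SUM A<-As. f3 X A) + (2 * lm * cs) * (real (mm k0) / 100)" using ok that by blast
    moreover have "(2 * lm * cs) * (real (mm k0) / 100) = real (mm k0) / 50 * (lm * cs)" by simp
    ultimately show ?thesis unfolding sum_list_nth f3_def len by linarith
   qed
   have "accepted Z (mm k0) (round_run lm rs Z (mm k0) As)" by (rule benchmark_accepted[OF H0 ys rsp dual ZW m0(1) AsV[OF As] S1 S2])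
   then obtain j where j: "j <= i" "accepted (Zs j) (mm k0) (round_run lm rs (Zs j) (mm k0) As)"
    and X: "XS k0 asym_prg As = bought (mm k0) (round_run lm rs (Zs j) (mm k0) As)" using XS_asym[OF As m0(1) i(1)] unfolding Z_def by blast
   have jZ: "Zs j <= Z" unfolding Z_def using j(1) by (rule Zs_mono)
   \<comment> \<open>Rounding the number of samples down loses less than one of at least
     100.\<close>
   have "real (mm k0) <= real (mm k0) * lm" using mult_left_mono[OF lm_ge1, of "real (mm k0)"] by simp
   hence Mb: "99 / 100 * (real (mm k0) * lm) <= real (length As)" unfolding len using MM_bounds(2)[of k0] m0 by linarith
   have ex: "mean (excess (Z / rs) (XS k0 asym_prg As)) <= 2 * mean H + 10 * Z + 3 / 10 * cs"
    unfolding X by (rule excess_mean_le[OF H0 ys rsp dual ZW m0(1) AsV[OF As] Zs_mono(2) jZ j(2) Mb S3])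
   have FX: "tcost (prim {s} (XS k0 asym_prg As)) <= 10 * Z" using j(2) jZ unfolding accepted_def X by simp
   show "good (CD k0 As) (XS k0 asym_prg As)"
    using conjunct1[OF ok] asym_good_large[OF kp r ys H0 dual W i(2)[folded Z_def] i(3)[folded Z_def] CD_sub XS_sub _ _ FX ex]
    unfolding first_ok_def by blast
  qed
 qed
qed

end

section \<open>Correctness and running time combined\<close>

context dr_input
begin

definition result :: "scenario_metric => prg => nat => nat set list => bool" where
 "result kp c k0 As \<longleftrightarrow> objective kp I p (normalized (prim {s} (CD k0 As) @ prim {s} (XS k0 c As)))
   (%A. normalized (prim (CD k0 As Un XS k0 c As) A)) <= (160 + 160 * rq eps) * optimum kp I p"

lemma result_whp:
 assumes c: "(kp, c) : {(discrete_metric, discrete_prg), (asym_metric, asym_prg)}" and m: "100 <= mm k0"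
 shows "whp k0 (2 * (n * n) + 2 ^ n + 2) (result kp c k0)"
proof -
 obtain Fo Go where Fo: "feasible I Fo Go" "objective kp I p Fo Go = optimum kp I p"
  "!!F FA. feasible I F FA ==> optimum kp I p <= objective kp I p F FA" using optimum_attained[of kp] by blast
 have "kp I A A = 0" if "A <= V" for A using c asym_refl[OF that] by (auto simp: discrete_metric_def)
 then interpret O: dr_opt I eps p kp Fo Go using Fo by unfold_locales auto
 have "whp k0 (2 * (n * n) + 2 ^ n + 2) (%As. O.good (CD k0 As) (XS k0 c As))" using c O.discrete_whp[OF _ m] O.asym_whp[OF _ m] by auto
 thus ?thesis unfolding O.good_def result_def .
qed

lemma approximation:
 fixes k :: nat
 assumes c: "(kp, c) : {(discrete_metric, discrete_prg), (asym_metric, asym_prg)}" and k0: "k0 = 16800 * (k + 2)"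
  and T1: "solver_time (10 + k0) k0 c N <= T" and T2: "completer_time N <= T"
 defines "D == map_pmf enc p"
 defines "R == output_pmf D (solver k0 c) [inp] T"
 shows "runs_in_time D (solver k0 c) [inp] T"
  and "out : set_pmf R ==> A : Pow (verts I) ==> runs_in_time (return_pmf []) completer (stage2_input I eps out A) T"
  and "1 - 1 / real (input_size I eps) ^ k <=
   measure_pmf.prob R {out. good_output kp (160 + 160 * rq eps) completer T I eps p out}"
proof -
 have c': "c : {asym_prg, discrete_prg}" using c by auto
 obtain tt where run': "!!T. solver_time (10 + k0) k0 c N <= T ==> run (map_pmf enc p) (solver k0 c) [inp] T =
    map_pmf (%As. ([], fin k0 c As, tt As)) (smp k0)"
  and tt': "!!As. As : set_pmf (smp k0) ==>
    tt As + list_size (list_of (fin k0 c As 0)) + list_size (list_of (fin k0 c As 1)) <= solver_time (10 + k0) k0 c N"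
  using run_solver[OF c', of k0] by blast
 have run: "run D (solver k0 c) [inp] T = map_pmf (%As. ([], fin k0 c As, tt As)) (smp k0)" unfolding D_def by (rule run'[OF T1])
 have tt: "tt As + list_size (list_of (fin k0 c As 0)) + list_size (list_of (fin k0 c As 1)) <= T"
  if "As : set_pmf (smp k0)" for As using tt'[OF that] T1 by (rule order_trans)
 show "runs_in_time D (solver k0 c) [inp] T" unfolding runs_in_time_def run using tt by auto
 define out_of where "out_of As = (flat (prim {s} (CD k0 As) @ prim {s} (XS k0 c As)), enc (CD k0 As Un XS k0 c As))" for As
 have R: "R = map_pmf out_of (smp k0)" unfolding R_def output_pmf_def run map_pmf_comp
 proof (rule map_pmf_cong[OF refl])
  fix As assume "As : set_pmf (smp k0)"
  from fin_output[OF this c'] show "output_of ([], fin k0 c As, tt As) = out_of As" unfolding output_of_def out_of_def encode_scenario_def by simp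
 qed
 have comp: "EX st t. run (return_pmf []) completer (stage2_input I eps (out_of As) A) T = return_pmf ([], st, t) &
   t + list_size (list_of (st 0)) + list_size (list_of (st 1)) <= T & list_of (st 0) = flat (prim (CD k0 As Un XS k0 c As) A)"
  if A: "A <= V" for As A
 proof -
  let ?es = "prim {s} (CD k0 As) @ prim {s} (XS k0 c As)"
  have "list_size (flat ?es) <= 1 + 2 * length ?es * n"
   using prim_edges[of "{s}" "CD k0 As"] prim_edges[of "{s}" "XS k0 c As"] s_lt CD_sub XS_sub by (intro list_size_flat) auto
  also have "... <= 1 + 2 * (2 * N) * N"
   using length_prim[of "{s}" "CD k0 As"] length_prim[of "{s}" "XS k0 c As"] nn_le by (intro add_left_mono mult_le_mono) auto
  finally have fs: "list_size (flat ?es) <= 1 + 4 * N * N" by simp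
  have E: "CD k0 As Un XS k0 c As <= V" "CD k0 As Un XS k0 c As ~= {}" using CD_sub[of k0 As] XS_sub[of k0 c As] by auto
  obtain st t where st: "!!T. completer_time N <= T ==>
     run (return_pmf []) completer [inp, flat ?es, enc (CD k0 As Un XS k0 c As), enc A] T = return_pmf ([], st, t)"
    "t + list_size (list_of (st 0)) + list_size (list_of (st 1)) <= completer_time N"
    "list_of (st 0) = flat (prim (CD k0 As Un XS k0 c As) A)" using run_completer[OF E A fs, of "return_pmf []"] by blast
  thus ?thesis using T2 unfolding stage2_input_def out_of_def by (intro exI[of _ st] exI[of _ t]) (auto intro: le_trans)
 qed
 show "runs_in_time (return_pmf []) completer (stage2_input I eps out A) T" if out: "out : set_pmf R" and A: "A : Pow (verts I)"
 proof -
  obtain As where As: "out = out_of As" using out unfolding R by auto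
  from comp[of A As] A show ?thesis unfolding runs_in_time_def As verts_def by auto
 qed
 have "100 <= mm k0"
 proof -
  have "100 <= k0" unfolding k0 by simp
  also have "k0 <= k0 * input_size I eps" using nn_le(2) by simp
  also have "... <= mm k0" by (rule mm_ge)
  finally show ?thesis .
 qed
 note w = result_whp[OF c this]
 have good: "good_output kp (160 + 160 * rq eps) completer T I eps p (out_of As)" if "result kp c k0 As" for As unfolding good_output_def
 proof (intro exI[of _ "%A. normalized (prim (CD k0 As Un XS k0 c As) A)"] conjI ballI)
  fix A out2 assume A: "A : Pow (verts I)" and o: "out2 : set_pmf (output_pmf (return_pmf []) completer (stage2_input I eps (out_of As) A) T)"
  obtain st t where "run (return_pmf []) completer (stage2_input I eps (out_of As) A) T = return_pmf ([], st, t)"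
   "list_of (st 0) = flat (prim (CD k0 As Un XS k0 c As) A)" using comp[of A As] A unfolding verts_def by auto
  thus "normalized (prim (CD k0 As Un XS k0 c As) A) = decode_edges (fst out2)"
   using o unfolding output_pmf_def output_of_def by (simp add: decode_flat)
 next
  show "feasible I (decode_edges (fst (out_of As))) (%A. normalized (prim (CD k0 As Un XS k0 c As) A))"
   unfolding out_of_def fst_conv decode_flat by (rule feasible_output[OF CD_sub XS_sub])
  show "objective kp I p (decode_edges (fst (out_of As))) (%A. normalized (prim (CD k0 As Un XS k0 c As) A)) <=
    (160 + 160 * rq eps) * optimum kp I p" using that unfolding out_of_def fst_conv decode_flat result_def .
 qed
 let ?G = "{As. good_output kp (160 + 160 * rq eps) completer T I eps p (out_of As)}"
 have "whp k0 (2 * (n * n) + 2 ^ n + 2) (%As. As : ?G)" using w by (rule whp_mono) (use good in auto)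
 hence "measure_pmf.prob (smp k0) {As. As ~: ?G} <= 1 / real (input_size I eps) ^ k"
  unfolding whp_def using failure_le[OF k0] by linarith
 moreover have "UNIV - ?G = {As. As ~: ?G}" by auto
 ultimately have "1 - 1 / real (input_size I eps) ^ k <= measure_pmf.prob (smp k0) ?G"
  using measure_pmf.prob_compl[of ?G "smp k0"] by simp
 also have "?G = out_of -` {out. good_output kp (160 + 160 * rq eps) completer T I eps p out}" by auto
 finally show "1 - 1 / real (input_size I eps) ^ k <=
   measure_pmf.prob R {out. good_output kp (160 + 160 * rq eps) completer T I eps p out}" unfolding R measure_map_pmf .
qed

end

text \<open>The solver depends, through \<open>k0\<close>, on the prescribed exponent
  \<open>k\<close> of the success probability; the completer is the same for all
  \<open>k\<close>.\<close>

lemma admits_approximation_160: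
 assumes c: "(kp, c) : {(discrete_metric, discrete_prg), (asym_metric, asym_prg)}"
 shows "admits_approximation kp (%eps. 160 + 160 * eps)" unfolding admits_approximation_def
proof
 fix k :: nat
 define k0 where "k0 = 16800 * (k + 2)"
 have "poly_bounded (%N. solver_time (10 + k0) k0 c N + completer_time N)"
  by (intro poly_bounded_add poly_bounded_solver_time poly_bounded_completer_time)
 then obtain K d where Kd: "!!N. 0 < N ==> solver_time (10 + k0) k0 c N + completer_time N <= K * N ^ d" unfolding poly_bounded_def by blast
 show "EX P Q K d. deterministic Q &
    (ALL I eps p. valid_instance I & 0 < eps & set_pmf p <= Pow (verts I) -->
      (let D = map_pmf (encode_scenario I) p;
        T = time_bound K d I eps;
        R = output_pmf D P [encode_input I eps] T
      in runs_in_time D P [encode_input I eps] T &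
        (ALL out:set_pmf R. ALL A:Pow (verts I).
         runs_in_time (return_pmf []) Q (stage2_input I eps out A) T) &
        measure_pmf.prob R {out. good_output kp (160 + 160 * rq eps) Q T I eps p out}
         \<ge> 1 - 1 / real (input_size I eps) ^ k))"
 proof (rule exI[of _ "solver k0 c"], rule exI[of _ completer], rule exI[of _ K], rule exI[of _ d], intro conjI allI impI)
  show "deterministic completer" by (rule deterministic_completer)
  fix I :: steiner and eps :: rat and p :: "nat set pmf" assume "valid_instance I & 0 < eps & set_pmf p <= Pow (verts I)"
  then interpret dr_input I eps p by unfold_locales auto
  have "0 < N" using nn_le(2) by simp
  hence "solver_time (10 + k0) k0 c N + completer_time N <= time_bound K d I eps" unfolding time_bound_def by (rule Kd)
  hence T: "solver_time (10 + k0) k0 c N <= time_bound K d I eps" "completer_time N <= time_bound K d I eps" by auto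
  note ap = approximation[OF c k0_def T]
  show "let D = map_pmf (encode_scenario I) p;
        T = time_bound K d I eps;
        R = output_pmf D (solver k0 c) [encode_input I eps] T
      in runs_in_time D (solver k0 c) [encode_input I eps] T &
        (ALL out:set_pmf R. ALL A:Pow (verts I).
         runs_in_time (return_pmf []) completer (stage2_input I eps out A) T) &
        measure_pmf.prob R {out. good_output kp (160 + 160 * rq eps) completer T I eps p out}
         \<ge> 1 - 1 / real (input_size I eps) ^ k" unfolding Let_def by (intro conjI ballI ap)
 qed
qed

theorem theorem3p22:
  shows "(\<exists>C>0. admits_approximation discrete_metric (\<lambda>\<epsilon>. 160 + C * \<epsilon>)) \<and>
         (\<exists>C>0. admits_approximation asym_metric (\<lambda>\<epsilon>. 160 + C * \<epsilon>))"
  using admits_approximation_160[of discrete_metric discrete_prg] admits_approximation_160[of asym_metric asym_prg]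
  by (intro conjI exI[of _ 160]) auto

end
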